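(* Let $\sigma=0$, $\lambda>0$, $r\in[1,\infty)$ and $\alpha:=(r-1)/r\in[0,1)$, and assume the density is bounded below by a positive constant $\rho_0$. Then the following three formulations are equivalent (all functions being $\lambda$-periodic in the horizontal variable): (i) the velocity formulation (V) for $u-c,\,v,\,P\in W^1_r(\Omega_\eta)\cap C^\alpha(\overline{\Omega}_\eta)$, $\eta\in C^{1+\alpha}(\mathbb{R})$ and $\rho\in W^1_r(\Omega_\eta)\cap C^\alpha(\overline{\Omega}_\eta)$; (ii) the stream function formulation (S) for $\psi\in W^2_r(\Omega_\eta)\cap C^{1+\alpha}(\overline{\Omega}_\eta)$, $\eta\in C^{1+\alpha}(\mathbb{R})$, $\overline\rho\in W^1_r((p_0,0))$ and $\beta\in L_r((p_0,0))$; (iii) the height function formulation (D) for $h\in W^2_r(\Omega)\cap C^{1+\alpha}(\overline\Omega)$, $\overline\rho\in W^1_r((p_0,0))$ and $\beta\in L_r((p_0,0))$. That is, each solution of (V) in the class (i) determines, through the correspondence (V)$\to$(S), a constant $p_0<0$ and a solution of (S) in the class (ii); each solution of (S) in the class (ii) determines, through the correspondence (S)$\to$(D), a solution of (D) in the class (iii); and each solution of (D) in the class (iii) arises through these correspondences from a solution of (V) in the class (i).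
   Context: Constants: $g>0$, $d>0$ are fixed; $\rho_0>0$; $p_0<0$. For $\eta:\mathbb{R}\to(-d,\infty)$ set $\Omega_\eta:=\{(x,y): x\in\mathbb{R},\ -d<y<\eta(x)\}$, and $\Omega:=\mathbb{R}\times(p_0,0)$. All function spaces consist of functions that are $\lambda$-periodic in $x$ (respectively $q$), with integrability understood over one period; equations hold in $L_r$, i.e. almost everywhere. $C^0$ and $C^1$ are meant when $\alpha=0$. (V) Velocity formulation (with $\sigma=0$), unknowns $(u-c,v,P,\rho,\eta)$: $$\rho(u-c)u_x+\rho v u_y=-P_x,\quad \rho(u-c)v_x+\rho v v_y=-P_y-g\rho,\quad (u-c)\rho_x+v\rho_y=0,\quad u_x+v_y=0\quad\text{in }\Omega_\eta,$$ $$P=0,\quad v=(u-c)\eta'\quad\text{on } y=\eta(x);\qquad v=0\ \text{on } y=-d;\qquad \int_0^\lambda\eta\,dx=0,$$ together with $\sup_{\Omega_\eta}(u-c)<0$; density bound: $\rho\ge\rho_0$. (S) Stream function formulation, unknowns $(\psi,\eta)$, with data $p_0,\overline\rho,\beta$: $$\Delta\psi=gy\,\overline\rho'(-\psi)+\beta(-\psi)\ \text{in }\Omega_\eta,\quad \psi=0\ \text{on }y=\eta(x),\quad \psi=-p_0\ \text{on }y=-d,$$ $$|\nabla\psi|^2+2g\overline\rho(0)y=Q\ \text{on }y=\eta(x),\qquad Q=\frac1\lambda\int_0^\lambda|\nabla\psi|^2(x,\eta(x))\,dx,$$ together with $\sup_{\Omega_\eta}\psi_y<0$; density bound: $\overline\rho\ge\rho_0$.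 (D) Height function formulation, unknown $h$, with data $p_0,\overline\rho,\beta$: $$(1+h_q^2)h_{pp}-2h_qh_ph_{pq}+h_p^2h_{qq}-[g\overline\rho'(h-d)+\beta]h_p^3=0\ \text{in }\Omega,\qquad h=0\ \text{on }p=p_0,$$ $$1+h_q^2+h_p^2\Big[2g\overline\rho(0)(h-d)-\frac1\lambda\int_0^\lambda\frac{1+h_q^2}{h_p^2}(q,0)\,dq\Big]=0\ \text{on }p=0,$$ together with $\inf_\Omega h_p>0$; density bound: $\overline\rho\ge\rho_0$. Correspondences. (V)$\to$(S): $\psi$ is determined by $\nabla\psi=(-\sqrt\rho\,v,\sqrt\rho\,(u-c))$ in $\Omega_\eta$ and $\psi=0$ on $y=\eta(x)$; $p_0:=-\psi|_{y=-d}$ (a negative constant); $\mathcal H(x,y):=(q,p):=(x,-\psi(x,y))$ is a bijection $\overline\Omega_\eta\to\overline\Omega$; with $E:=P+\rho\frac{(u-c)^2+v^2}{2}+g\rho y$, the functions $\overline\rho,\beta$ of $p$ alone are determined by $\rho\circ\mathcal H^{-1}=\overline\rho$ and $-\partial_p(E\circ\mathcal H^{-1})=\beta$. (S)$\to$(D): $h(q,p):=y+d$, where $(x,y)=\mathcal H^{-1}(q,p)$ and $\mathcal H(x,y)=(x,-\psi(x,y))$. *)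

theory Defs
  imports "HOL-Analysis.Analysis"
begin

section \<open>Function spaces\<close>

primrec C_k :: "nat \<Rightarrow> ('a::euclidean_space \<Rightarrow> real) \<Rightarrow> bool" where
  "C_k 0 f \<longleftrightarrow> continuous_on UNIV f"
| "C_k (Suc k) f \<longleftrightarrow> (\<forall>x. f differentiable (at x)) \<and>
     (\<forall>b\<in>Basis. C_k k (\<lambda>x. frechet_derivative f (at x) b))"

definition test_function :: "'a::euclidean_space set \<Rightarrow> ('a \<Rightarrow> real) \<Rightarrow> bool" where
  "test_function U \<phi> \<longleftrightarrow> (\<forall>k. C_k k \<phi>) \<and>
     compact (closure {x. \<phi> x \<noteq> 0}) \<and> closure {x. \<phi> x \<noteq> 0} \<subseteq> U"

definition locally_integrable_on :: "'a::euclidean_space set \<Rightarrow> ('a \<Rightarrow> real) \<Rightarrow> bool" where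
  "locally_integrable_on U f \<longleftrightarrow>
     (\<forall>K. compact K \<and> K \<subseteq> U \<longrightarrow> integrable (lebesgue_on K) f)"

text \<open>\<open>g\<close> is a weak partial derivative of \<open>f\<close> on the open set \<open>U\<close> in the direction \<open>b\<close>
  (a basis vector).\<close>

definition has_weak_deriv ::
    "'a::euclidean_space set \<Rightarrow> 'a \<Rightarrow> ('a \<Rightarrow> real) \<Rightarrow> ('a \<Rightarrow> real) \<Rightarrow> bool" where
  "has_weak_deriv U b f g \<longleftrightarrow> locally_integrable_on U f \<and> locally_integrable_on U g \<and>
     (\<forall>\<phi>. test_function U \<phi> \<longrightarrow>
        (LINT x|lebesgue_on U. f x * frechet_derivative \<phi> (at x) b) =
        - (LINT x|lebesgue_on U. g x * \<phi> x))"

text \<open>Some representative of the weak derivative. It is unique up to null sets and is used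
  only inside equations that are required almost everywhere.\<close>

definition weak_deriv ::
    "'a::euclidean_space set \<Rightarrow> 'a \<Rightarrow> ('a \<Rightarrow> real) \<Rightarrow> 'a \<Rightarrow> real" where
  "weak_deriv U b f = (SOME g. has_weak_deriv U b f g)"

abbreviation wd1 :: "(real \<times> real) set \<Rightarrow> (real \<times> real \<Rightarrow> real) \<Rightarrow> real \<times> real \<Rightarrow> real" where
  "wd1 U \<equiv> weak_deriv U (1, 0)"

abbreviation wd2 :: "(real \<times> real) set \<Rightarrow> (real \<times> real \<Rightarrow> real) \<Rightarrow> real \<times> real \<Rightarrow> real" where
  "wd2 U \<equiv> weak_deriv U (0, 1)"

definition Lr_on :: "real \<Rightarrow> 'a::euclidean_space set \<Rightarrow> ('a \<Rightarrow> real) \<Rightarrow> bool" where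
  "Lr_on r U f \<longleftrightarrow> f \<in> borel_measurable (lebesgue_on U) \<and>
     integrable (lebesgue_on U) (\<lambda>x. \<bar>f x\<bar> powr r)"

text \<open>\<open>W\<^sup>1\<^sub>r\<close> of a bounded open interval. The elements are represented by their continuous
  representatives on the closed interval, which always exist in one dimension; the value
  of the density function at the endpoint \<open>0\<close> refers to this representative.\<close>

definition W1_interval :: "real \<Rightarrow> real \<Rightarrow> real \<Rightarrow> (real \<Rightarrow> real) \<Rightarrow> bool" where
  "W1_interval r a b f \<longleftrightarrow> continuous_on {a..b} f \<and> Lr_on r {a<..<b} f \<and>
     (\<exists>f'. has_weak_deriv {a<..<b} 1 f f' \<and> Lr_on r {a<..<b} f')"

text \<open>Spaces of functions that are \<open>lam\<close>-periodic in the first variable, on open sets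
  \<open>U\<close> that are invariant under the shift by \<open>lam\<close>. Integrability is understood over one
  period, whereas weak derivatives are taken in all of \<open>U\<close>.\<close>

definition Lr_per :: "real \<Rightarrow> real \<Rightarrow> (real \<times> real) set \<Rightarrow> (real \<times> real \<Rightarrow> real) \<Rightarrow> bool" where
  "Lr_per lam r U f \<longleftrightarrow> f \<in> borel_measurable (lebesgue_on U) \<and>
     (AE z in lebesgue_on U. f (z + (lam, 0)) = f z) \<and>
     Lr_on r (U \<inter> {z. 0 < fst z \<and> fst z < lam}) f"

definition W1_per :: "real \<Rightarrow> real \<Rightarrow> (real \<times> real) set \<Rightarrow> (real \<times> real \<Rightarrow> real) \<Rightarrow> bool" where
  "W1_per lam r U f \<longleftrightarrow> Lr_per lam r U f \<and>
     (\<forall>b\<in>Basis. \<exists>g. has_weak_deriv U b f g \<and> Lr_per lam r U g)"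

definition W2_per :: "real \<Rightarrow> real \<Rightarrow> (real \<times> real) set \<Rightarrow> (real \<times> real \<Rightarrow> real) \<Rightarrow> bool" where
  "W2_per lam r U f \<longleftrightarrow> Lr_per lam r U f \<and>
     (\<forall>b\<in>Basis. \<exists>g. has_weak_deriv U b f g \<and> W1_per lam r U g)"

definition periodic_on :: "real \<Rightarrow> (real \<times> real) set \<Rightarrow> (real \<times> real \<Rightarrow> real) \<Rightarrow> bool" where
  "periodic_on lam S f \<longleftrightarrow> (\<forall>z\<in>S. f (z + (lam, 0)) = f z)"

text \<open>\<open>C\<^sup>a(S)\<close> for \<open>0 \<le> a < 1\<close>. For \<open>a = 0\<close> the last condition follows from boundedness
  (\<open>t powr 0 = 1\<close> for \<open>t > 0\<close>), so that this is the space of bounded continuous functions.\<close>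

definition holder_on :: "real \<Rightarrow> 'a::euclidean_space set \<Rightarrow> ('a \<Rightarrow> real) \<Rightarrow> bool" where
  "holder_on a S f \<longleftrightarrow> continuous_on S f \<and> bounded (f ` S) \<and>
     (\<exists>C. \<forall>x\<in>S. \<forall>y\<in>S. \<bar>f x - f y\<bar> \<le> C * dist x y powr a)"

text \<open>\<open>C\<^sup>1\<^sup>+\<^sup>a\<close> of the closure of the open set \<open>U\<close>: the partial derivatives on \<open>U\<close> extend to
  functions in \<open>C\<^sup>a\<close> of the closure.\<close>

definition C1_holder_closure :: "real \<Rightarrow> 'a::euclidean_space set \<Rightarrow> ('a \<Rightarrow> real) \<Rightarrow> bool" where
  "C1_holder_closure a U f \<longleftrightarrow> continuous_on (closure U) f \<and> bounded (f ` closure U) \<and>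
     (\<forall>z\<in>U. f differentiable (at z)) \<and>
     (\<forall>b\<in>Basis. \<exists>g. holder_on a (closure U) g \<and>
        (\<forall>z\<in>U. g z = frechet_derivative f (at z) b))"

text \<open>The continuous extension to the closure of \<open>U\<close> of the classical partial derivative in
  the direction \<open>b\<close>; in \<open>U\<close> itself it is the partial derivative.\<close>

definition ext_deriv ::
    "(real \<times> real) set \<Rightarrow> real \<times> real \<Rightarrow> (real \<times> real \<Rightarrow> real) \<Rightarrow> real \<times> real \<Rightarrow> real" where
  "ext_deriv U b f z = Lim (at z within U) (\<lambda>w. frechet_derivative f (at w) b)"

abbreviation cd1 :: "(real \<times> real) set \<Rightarrow> (real \<times> real \<Rightarrow> real) \<Rightarrow> real \<times> real \<Rightarrow> real" where
  "cd1 U \<equiv> ext_deriv U (1, 0)"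

abbreviation cd2 :: "(real \<times> real) set \<Rightarrow> (real \<times> real \<Rightarrow> real) \<Rightarrow> real \<times> real \<Rightarrow> real" where
  "cd2 U \<equiv> ext_deriv U (0, 1)"


section \<open>The three formulations\<close>

definition fluid_domain :: "real \<Rightarrow> (real \<Rightarrow> real) \<Rightarrow> (real \<times> real) set" where
  "fluid_domain d \<eta> = {(x, y). - d < y \<and> y < \<eta> x}"

definition strip :: "real \<Rightarrow> (real \<times> real) set" where
  "strip p0 = UNIV \<times> {p0<..<0}"

definition surface_profile :: "real \<Rightarrow> real \<Rightarrow> real \<Rightarrow> (real \<Rightarrow> real) \<Rightarrow> bool" where
  "surface_profile d lam a \<eta> \<longleftrightarrow> C1_holder_closure a UNIV \<eta> \<and>
     (\<forall>x. \<eta> (x + lam) = \<eta> x) \<and> (\<forall>x. - d < \<eta> x)"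

definition velocity_class ::
    "real \<Rightarrow> real \<Rightarrow> real \<Rightarrow> (real \<times> real) set \<Rightarrow> (real \<times> real \<Rightarrow> real) \<Rightarrow> bool" where
  "velocity_class lam r a U f \<longleftrightarrow>
     W1_per lam r U f \<and> holder_on a (closure U) f \<and> periodic_on lam (closure U) f"

definition potential_class ::
    "real \<Rightarrow> real \<Rightarrow> real \<Rightarrow> (real \<times> real) set \<Rightarrow> (real \<times> real \<Rightarrow> real) \<Rightarrow> bool" where
  "potential_class lam r a U f \<longleftrightarrow>
     W2_per lam r U f \<and> C1_holder_closure a U f \<and> periodic_on lam (closure U) f"

text \<open>The unknown \<open>w\<close> is the horizontal velocity in the moving frame, \<open>u - c\<close>; its weak
  derivatives are those of \<open>u\<close>.\<close>

definition velocity_solution ::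
    "real \<Rightarrow> real \<Rightarrow> real \<Rightarrow> real \<Rightarrow> real \<Rightarrow> real \<Rightarrow>
     (real \<times> real \<Rightarrow> real) \<Rightarrow> (real \<times> real \<Rightarrow> real) \<Rightarrow> (real \<times> real \<Rightarrow> real) \<Rightarrow>
     (real \<times> real \<Rightarrow> real) \<Rightarrow> (real \<Rightarrow> real) \<Rightarrow> bool" where
  "velocity_solution g d \<rho>0 lam r a w v P \<rho> \<eta> \<longleftrightarrow>
     (let U = fluid_domain d \<eta> in
      surface_profile d lam a \<eta> \<and>
      velocity_class lam r a U w \<and> velocity_class lam r a U v \<and>
      velocity_class lam r a U P \<and> velocity_class lam r a U \<rho> \<and>
      (AE z in lebesgue_on U.
         \<rho> z * w z * wd1 U w z + \<rho> z * v z * wd2 U w z = - wd1 U P z) \<and>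
      (AE z in lebesgue_on U.
         \<rho> z * w z * wd1 U v z + \<rho> z * v z * wd2 U v z = - wd2 U P z - g * \<rho> z) \<and>
      (AE z in lebesgue_on U. w z * wd1 U \<rho> z + v z * wd2 U \<rho> z = 0) \<and>
      (AE z in lebesgue_on U. wd1 U w z + wd2 U v z = 0) \<and>
      (\<forall>x. P (x, \<eta> x) = 0) \<and>
      (\<forall>x. v (x, \<eta> x) = w (x, \<eta> x) * deriv \<eta> x) \<and>
      (\<forall>x. v (x, - d) = 0) \<and>
      integral {0..lam} \<eta> = 0 \<and>
      (SUP z\<in>U. w z) < 0 \<and>
      (\<forall>z\<in>U. \<rho>0 \<le> \<rho> z))"

text \<open>In the following, \<open>R\<close> is the streamline density \<open>\<rho>\<close>-bar as a function of \<open>p\<close>.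
  Equations in the interior use weak derivatives (the first-order ones agree almost
  everywhere with the classical ones); boundary conditions and the sign conditions use the
  classical first derivatives, extended continuously to the closure.\<close>

definition data_class ::
    "real \<Rightarrow> real \<Rightarrow> real \<Rightarrow> (real \<Rightarrow> real) \<Rightarrow> (real \<Rightarrow> real) \<Rightarrow> bool" where
  "data_class \<rho>0 r p0 R \<beta> \<longleftrightarrow>
     W1_interval r p0 0 R \<and> Lr_on r {p0<..<0} \<beta> \<and> (\<forall>p\<in>{p0..0}. \<rho>0 \<le> R p)"

definition stream_solution ::
    "real \<Rightarrow> real \<Rightarrow> real \<Rightarrow> real \<Rightarrow> real \<Rightarrow> real \<Rightarrow>
     real \<Rightarrow> (real \<Rightarrow> real) \<Rightarrow> (real \<Rightarrow> real) \<Rightarrow>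
     (real \<times> real \<Rightarrow> real) \<Rightarrow> (real \<Rightarrow> real) \<Rightarrow> bool" where
  "stream_solution g d \<rho>0 lam r a p0 R \<beta> \<psi> \<eta> \<longleftrightarrow>
     (let U = fluid_domain d \<eta>;
          R' = weak_deriv {p0<..<0} 1 R;
          grad2 = (\<lambda>x. (cd1 U \<psi> (x, \<eta> x))\<^sup>2 + (cd2 U \<psi> (x, \<eta> x))\<^sup>2);
          Q = (1 / lam) * integral {0..lam} grad2 in
      data_class \<rho>0 r p0 R \<beta> \<and>
      surface_profile d lam a \<eta> \<and>
      potential_class lam r a U \<psi> \<and>
      (AE z in lebesgue_on U.
         wd1 U (wd1 U \<psi>) z + wd2 U (wd2 U \<psi>) z = g * snd z * R' (- \<psi> z) + \<beta> (- \<psi> z)) \<and>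
      (\<forall>x. \<psi> (x, \<eta> x) = 0) \<and>
      (\<forall>x. \<psi> (x, - d) = - p0) \<and>
      (\<forall>x. grad2 x + 2 * g * R 0 * \<eta> x = Q) \<and>
      (SUP z\<in>U. cd2 U \<psi> z) < 0)"

definition height_solution ::
    "real \<Rightarrow> real \<Rightarrow> real \<Rightarrow> real \<Rightarrow> real \<Rightarrow> real \<Rightarrow>
     real \<Rightarrow> (real \<Rightarrow> real) \<Rightarrow> (real \<Rightarrow> real) \<Rightarrow> (real \<times> real \<Rightarrow> real) \<Rightarrow> bool" where
  "height_solution g d \<rho>0 lam r a p0 R \<beta> h \<longleftrightarrow>
     (let U = strip p0;
          R' = weak_deriv {p0<..<0} 1 R;
          hq = wd1 U h; hp = wd2 U h in
      data_class \<rho>0 r p0 R \<beta> \<and>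
      potential_class lam r a U h \<and>
      (AE z in lebesgue_on U.
         (1 + (hq z)\<^sup>2) * wd2 U hp z - 2 * hq z * hp z * wd2 U hq z + (hp z)\<^sup>2 * wd1 U hq z
           - (g * R' (snd z) * (h z - d) + \<beta> (snd z)) * hp z ^ 3 = 0) \<and>
      (\<forall>q. h (q, p0) = 0) \<and>
      (\<forall>q. 1 + (cd1 U h (q, 0))\<^sup>2 + (cd2 U h (q, 0))\<^sup>2 *
         (2 * g * R 0 * (h (q, 0) - d)
          - (1 / lam) * integral {0..lam}
              (\<lambda>s. (1 + (cd1 U h (s, 0))\<^sup>2) / (cd2 U h (s, 0))\<^sup>2)) = 0) \<and>
      (INF z\<in>U. cd2 U h z) > 0)"


section \<open>The correspondences\<close>

definition hodograph :: "(real \<times> real \<Rightarrow> real) \<Rightarrow> real \<times> real \<Rightarrow> real \<times> real" where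
  "hodograph \<psi> = (\<lambda>z. (fst z, - \<psi> z))"

definition inv_hodograph ::
    "real \<Rightarrow> (real \<Rightarrow> real) \<Rightarrow> (real \<times> real \<Rightarrow> real) \<Rightarrow> real \<times> real \<Rightarrow> real \<times> real" where
  "inv_hodograph d \<eta> \<psi> = the_inv_into (closure (fluid_domain d \<eta>)) (hodograph \<psi>)"

definition head ::
    "real \<Rightarrow> (real \<times> real \<Rightarrow> real) \<Rightarrow> (real \<times> real \<Rightarrow> real) \<Rightarrow> (real \<times> real \<Rightarrow> real) \<Rightarrow>
     (real \<times> real \<Rightarrow> real) \<Rightarrow> real \<times> real \<Rightarrow> real" where
  "head g w v P \<rho> z = P z + \<rho> z * ((w z)\<^sup>2 + (v z)\<^sup>2) / 2 + g * \<rho> z * snd z"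

definition velocity_to_stream ::
    "real \<Rightarrow> real \<Rightarrow> (real \<times> real \<Rightarrow> real) \<Rightarrow> (real \<times> real \<Rightarrow> real) \<Rightarrow> (real \<times> real \<Rightarrow> real) \<Rightarrow>
     (real \<times> real \<Rightarrow> real) \<Rightarrow> (real \<Rightarrow> real) \<Rightarrow>
     real \<Rightarrow> (real \<Rightarrow> real) \<Rightarrow> (real \<Rightarrow> real) \<Rightarrow> (real \<times> real \<Rightarrow> real) \<Rightarrow> bool" where
  "velocity_to_stream g d w v P \<rho> \<eta> p0 R \<beta> \<psi> \<longleftrightarrow>
     (let U = fluid_domain d \<eta>; Hinv = inv_hodograph d \<eta> \<psi> in
      continuous_on (closure U) \<psi> \<and>
      (\<forall>z\<in>U. (\<psi> has_derivative
          (\<lambda>k. - sqrt (\<rho> z) * v z * fst k + sqrt (\<rho> z) * w z * snd k)) (at z)) \<and>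
      (\<forall>x. \<psi> (x, \<eta> x) = 0) \<and>
      (\<forall>x. p0 = - \<psi> (x, - d)) \<and>
      bij_betw (hodograph \<psi>) (closure U) (closure (strip p0)) \<and>
      (\<forall>q. \<forall>p\<in>{p0..0}. \<rho> (Hinv (q, p)) = R p) \<and>
      (\<exists>B. (\<forall>q. \<forall>p\<in>{p0..0}. head g w v P \<rho> (Hinv (q, p)) = B p) \<and>
           has_weak_deriv {p0<..<0} 1 B (\<lambda>p. - \<beta> p)))"

definition stream_to_height ::
    "real \<Rightarrow> real \<Rightarrow> (real \<times> real \<Rightarrow> real) \<Rightarrow> (real \<Rightarrow> real) \<Rightarrow> (real \<times> real \<Rightarrow> real) \<Rightarrow> bool" where
  "stream_to_height d p0 \<psi> \<eta> h \<longleftrightarrow>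
     bij_betw (hodograph \<psi>) (closure (fluid_domain d \<eta>)) (closure (strip p0)) \<and>
     (\<forall>z\<in>closure (strip p0). h z = snd (inv_hodograph d \<eta> \<psi> z) + d)"

end

theory Submission
 imports Defs
begin

text \<open>Writing \<open>k = - \<psi>\<close> (respectively \<open>k = h - d\<close>), the passage between the fluid domain and the
strip is the change of variables \<open>(x, y) \<mapsto> (x, k (x, y))\<close>, which preserves vertical fibres and is bi-Lipschitz
because the vertical derivative of \<open>k\<close> is bounded away from zero. Weak derivatives are handled through local
\<open>L\<^sup>1\<close>-approximation by \<open>C\<^sup>1\<close> functions: this gives the chain rules for such changes of variables, and
the divergence theorem on rectangles. The latter yields the stream function of a solution of the
Euler equations, and it shows that the density and the head, whose weak \<open>q\<close>-derivatives vanish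
in the strip, depend on \<open>p\<close> alone. All remaining assertions are pointwise algebraic identities between
weak derivatives.\<close>

text \<open>Since r = 1 is allowed, the first derivatives of \<psi> may be merely bounded and
  continuous and the second ones merely integrable. Products are therefore formed only between a
  bounded continuous factor and an L_r factor, and each class is carried with its weak derivatives
  named; the equations then become algebra in finitely many numbers at almost every point. The
  exponent (r-1)/r is that of the embedding of W^1_r of an interval: it makes density and head, as
  functions of \<psi>, Hoelder continuous again when the velocity is recovered. A second obstacle is
  the boundary: differentiability is given inside the domain, whereas the kinematic conditions live
  on bed and surface; they are reached as limits along curves interpolating between the two. Two
  normalisations match the formulations: the head at p = 0 equals Q/2, which is the condition P = 0,
  and that Q is the mean of |grad \<psi>|^2 corresponds, by averaging Bernoulli's law over the
  surface, to the zero mean of \<eta>.\<close>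

abbreviation "fd f z == frechet_derivative f (at z)"

section \<open>Bump functions\<close>

text \<open>The derivative is an existential witness here, unlike in \<open>C_k\<close>, so that
  closure under sums, products and affine substitutions is a plain induction. The two notions are
  linked by \<open>C_k_tensor\<close> and \<open>smooth_upto_of_C_k\<close>.\<close>

primrec smooth_upto :: "nat => (real => real) => bool" where
 "smooth_upto 0 f \<longleftrightarrow> continuous_on UNIV f"
| "smooth_upto (Suc k) f \<longleftrightarrow> (EX f'. (ALL x. (f has_real_derivative f' x) (at x)) & smooth_upto k f')"

lemma smooth_upto_Suc_D: "smooth_upto (Suc k) f ==> smooth_upto k f"
proof (induction k arbitrary: f)
 case 0
 then show ?case
  by (auto simp: continuous_on_eq_continuous_within intro: DERIV_isCont)
next
 case (Suc k)
 then show ?case by (metis smooth_upto.simps(2))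
qed

lemma smooth_upto_const: "smooth_upto k (%x. c)"
proof (induction k arbitrary: c)
 case (Suc k)
 show ?case using Suc[of 0] by (auto intro!: exI[of _ "%x. 0"])
qed auto

lemma smooth_upto_add: "smooth_upto k f ==> smooth_upto k g ==> smooth_upto k (%x. f x + g x)"
proof (induction k arbitrary: f g)
 case 0 then show ?case by (auto intro: continuous_intros)
next
 case (Suc k)
 then obtain f' g' where "ALL x. (f has_real_derivative f' x) (at x)" "smooth_upto k f'"
  "ALL x. (g has_real_derivative g' x) (at x)" "smooth_upto k g'" by auto
 then show ?case using Suc.IH[of f' g']
  by (auto intro!: exI[of _ "%x. f' x + g' x"] derivative_eq_intros)
qed

lemma smooth_upto_mult: "smooth_upto k f ==> smooth_upto k g ==> smooth_upto k (%x. f x * g x)"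
proof (induction k arbitrary: f g)
 case 0 then show ?case by (auto intro: continuous_intros)
next
 case (Suc k)
 then obtain f' g' where *: "ALL x. (f has_real_derivative f' x) (at x)" "smooth_upto k f'"
  "ALL x. (g has_real_derivative g' x) (at x)" "smooth_upto k g'" by auto
 have "smooth_upto k f" "smooth_upto k g" using Suc.prems[THEN smooth_upto_Suc_D] by auto
 then have "smooth_upto k (%x. f' x * g x + f x * g' x)"
  using * by (intro smooth_upto_add Suc.IH)
 then show ?case using *
  by (auto intro!: exI[of _ "%x. f' x * g x + f x * g' x"] derivative_eq_intros)
qed

lemma smooth_upto_affine: "smooth_upto k f ==> smooth_upto k (%x. f (c * x + b))"
proof (induction k arbitrary: f)
 case 0 then show ?case
  by (auto intro!: continuous_intros intro: continuous_on_compose2[where s=UNIV])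
next
 case (Suc k)
 then obtain f' where f': "!!x. (f has_real_derivative f' x) (at x)" "smooth_upto k f'" by auto
 have "((%x. f (c * x + b)) has_real_derivative f' (c * x + b) * c) (at x)" for x
  by (rule DERIV_chain2[OF f'(1)]) (auto intro!: derivative_eq_intros)
 moreover have "smooth_upto k (%x. f' (c * x + b) * c)"
  using Suc.IH[OF f'(2)] by (intro smooth_upto_mult smooth_upto_const)
 ultimately show ?case by (auto intro!: exI[of _ "%x. f' (c * x + b) * c"])
qed

text \<open>Differentiation stays inside this family of functions, so smoothness of the classical
  flat function exp(-1/x) is an induction in which the polynomial varies.\<close>

definition exp_inv :: "real poly => real => real" where
 "exp_inv p x = (if x > 0 then poly p (inverse x) * exp (- inverse x) else 0)"

lemma poly_exp_tendsto_0:
 fixes p :: "real poly"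
 shows "((%x. poly p x * exp (- x)) \<longlongrightarrow> 0) at_top"
proof (induction p)
 case (pCons c p)
 have mono: "((%x. x ^ k * exp (- x)) \<longlongrightarrow> (0::real)) at_top" for k
  using tendsto_power_div_exp_0[of k] by (simp add: exp_minus divide_inverse)
 have "((%x. poly p x * x * exp (- x)) \<longlongrightarrow> 0) at_top" for p :: "real poly"
 proof -
  have "((%x. (\<Sum>i\<le>degree p. coeff p i * (x ^ (i+1) * exp (- x)))) \<longlongrightarrow> (\<Sum>i\<le>degree p. coeff p i * 0)) at_top"
   by (intro tendsto_sum tendsto_mult tendsto_const mono)
  moreover have "(%x. poly p x * x * exp (- x)) = (%x. (\<Sum>i\<le>degree p. coeff p i * (x ^ (i+1) * exp (- x))))"
   by (rule ext) (simp add: poly_altdef sum_distrib_right sum_distrib_left mult_ac)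
  ultimately show ?thesis by simp
 qed
 note this[of p]
 moreover have "((%x. c * (x ^ 0 * exp (- x))) \<longlongrightarrow> c * 0) at_top"
  by (intro tendsto_mult tendsto_const mono)
 ultimately have "((%x. c * (x ^ 0 * exp (- x)) + poly p x * x * exp (- x)) \<longlongrightarrow> c * 0 + 0) at_top"
  by (intro tendsto_add)
 then show ?case by (simp add: algebra_simps)
qed simp

lemma exp_inv_tendsto_0: "(exp_inv p \<longlongrightarrow> 0) (at 0)"
proof -
 have "((%x. poly p (inverse x) * exp (- inverse x)) \<longlongrightarrow> 0) (at_right 0)"
  using filterlim_compose[OF poly_exp_tendsto_0 filterlim_inverse_at_top_right] by simp
 then have "(exp_inv p \<longlongrightarrow> 0) (at_right 0)"
  by (rule Lim_transform_eventually) (auto simp: exp_inv_def eventually_at_right[of 0 1] intro!: exI[of _ 1])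
 moreover have "(exp_inv p \<longlongrightarrow> 0) (at_left 0)"
  by (rule Lim_transform_eventually[OF tendsto_const])
   (auto simp: exp_inv_def eventually_at_left[of "-1"] intro!: exI[of _ "-1"])
 ultimately show ?thesis by (simp add: filterlim_split_at)
qed

text \<open>With t = 1/x one has d/dx = - t^2 d/dt, which turns p(t) exp(-t) into t^2 (p - p')(t)
  exp(-t). At 0 the difference quotient multiplies p by t, so it is again a member of the family and
  tends to 0.\<close>

lemma exp_inv_deriv:
 "(exp_inv p has_real_derivative exp_inv ([:0,0,1:] * (p - pderiv p)) x) (at x)"
proof -
 consider "x > 0" | "x < 0" | "x = 0" by linarith
 then show ?thesis
 proof cases
  case 1
  have "((%x. poly p (inverse x) * exp (- inverse x)) has_real_derivative exp_inv ([:0,0,1:] * (p - pderiv p)) x) (at x)"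
   using 1 unfolding exp_inv_def
   by (auto intro!: derivative_eq_intros simp: power2_eq_square field_simps)
  then show ?thesis
   by (rule has_field_derivative_transform_within_open[where S="{0<..}"]) (use 1 in \<open>auto simp: exp_inv_def\<close>)
 next
  case 2
  have "((%x. 0) has_real_derivative exp_inv ([:0,0,1:] * (p - pderiv p)) x) (at x)"
   using 2 unfolding exp_inv_def by auto
  then show ?thesis
   by (rule has_field_derivative_transform_within_open[where S="{..<0}"]) (use 2 in \<open>auto simp: exp_inv_def\<close>)
 next
  case 3
  have "(%h. (exp_inv p (0 + h) - exp_inv p 0) / h) = exp_inv ([:0,1:] * p)"
   by (auto simp: exp_inv_def fun_eq_iff field_simps)
  then show ?thesis
   using 3 exp_inv_tendsto_0[of "[:0,1:] * p"] by (simp add: DERIV_def exp_inv_def)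
 qed
qed

lemma smooth_exp_inv: "smooth_upto k (exp_inv p)"
proof (induction k arbitrary: p)
 case 0
 then show ?case
  using exp_inv_deriv by (auto simp: continuous_on_eq_continuous_within intro: DERIV_isCont)
next
 case (Suc k)
 then show ?case using exp_inv_deriv by auto
qed

lemma has_derivative_fst_snd:
 assumes "(f has_real_derivative f') (at (fst z))" "(g has_real_derivative g') (at (snd z))"
 shows "((%z::real\<times>real. f (fst z) * g (snd z)) has_derivative
  (%h. f' * g (snd z) * fst h + f (fst z) * g' * snd h)) (at z)"
proof -
 have f: "((%z::real\<times>real. f (fst z)) has_derivative (%h. f' * fst h)) (at z)"
  by (rule has_derivative_compose[of fst fst z UNIV f "(*) f'"])
   (use assms(1) in \<open>auto simp: has_field_derivative_def intro!: derivative_eq_intros\<close>)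
 have g: "((%z::real\<times>real. g (snd z)) has_derivative (%h. g' * snd h)) (at z)"
  by (rule has_derivative_compose[of snd snd z UNIV g "(*) g'"])
   (use assms(2) in \<open>auto simp: has_field_derivative_def intro!: derivative_eq_intros\<close>)
 show ?thesis
  using has_derivative_mult[OF f g] by (simp add: algebra_simps)
qed

text \<open>Both partial derivatives of a tensor product are tensor products with one factor
  differentiated, so the induction on the order closes. This produces the planar mollifiers and the
  test functions of product form.\<close>

lemma C_k_tensor:
 assumes "!!k. smooth_upto k f" "!!k. smooth_upto k g"
 shows "C_k k (%z::real\<times>real. f (fst z) * g (snd z))"
proof -
 have "smooth_upto k f ==> smooth_upto k g ==> C_k k (%z::real\<times>real. f (fst z) * g (snd z))" for k f g
 proof (induction k arbitrary: f g)
  case 0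
  then show ?case by (auto intro!: continuous_intros intro: continuous_on_compose2[where s=UNIV])
 next
  case (Suc k)
  then obtain f' g' where *: "!!x. (f has_real_derivative f' x) (at x)" "smooth_upto k f'"
   "!!x. (g has_real_derivative g' x) (at x)" "smooth_upto k g'" by auto
  note d = has_derivative_fst_snd[OF *(1,3)]
  have fd: "frechet_derivative (%z. f (fst z) * g (snd z)) (at z) = (%h. f' (fst z) * g (snd z) * fst h + f (fst z) * g' (snd z) * snd h)" for z
   using frechet_derivative_at[OF d] by simp
  have "smooth_upto k f" "smooth_upto k g" using Suc.prems[THEN smooth_upto_Suc_D] by auto
  moreover have "(%z. f (fst z) * g (snd z)) differentiable at z" for z :: "real \<times> real"
   using d[of z] by (rule differentiableI)
  ultimately show ?case using Suc.IH[of f' g] Suc.IH[of f g'] *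
   by (simp add: fd Basis_prod_def del: split_paired_All)
 qed
 then show ?thesis using assms by blast
qed

text \<open>Makes vertical slices of planar test functions admissible in the definition of a weak
  derivative on an interval.\<close>

lemma C_k_slice:
 fixes \<phi> :: "real \<times> real => real"
 shows "C_k k \<phi> ==> C_k k (%p. \<phi> (q, p))"
proof (induction k arbitrary: \<phi>)
 case 0
 then show ?case by (auto intro!: continuous_intros intro: continuous_on_compose2[where s=UNIV])
next
 case (Suc k)
 have "(\<phi> has_derivative fd \<phi> z) (at z)" for z
  using Suc.prems unfolding frechet_derivative_works[symmetric] by (simp del: split_paired_All)
 then have d: "((%p. \<phi> (q, p)) has_derivative (%h. fd \<phi> (q, p) (0, h))) (at p)" for p
  by (rule has_derivative_compose[of "Pair q" "Pair 0" p UNIV \<phi>, rotated]) (auto intro!: derivative_eq_intros)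
 have fd: "frechet_derivative (%p. \<phi> (q, p)) (at p) = (%h. fd \<phi> (q, p) (0, h))" for p
  using frechet_derivative_at[OF d] by simp
 have "(%p. \<phi> (q, p)) differentiable at p" for p
  using d by (rule differentiableI)
 then show ?case using Suc.prems Suc.IH[of "%x. fd \<phi> x (0, 1)"]
  by (simp add: fd Basis_prod_def del: split_paired_All)
qed

lemma frechet_slice:
 fixes \<phi> :: "real \<times> real => real"
 assumes "\<phi> differentiable at (q, p)"
 shows "((%p. \<phi> (q, p)) has_real_derivative fd \<phi> (q, p) (0, 1)) (at p)"
  "((%q. \<phi> (q, p)) has_real_derivative fd \<phi> (q, p) (1, 0)) (at q)"
proof -
 let ?D = "fd \<phi> (q, p)"
 have D: "(\<phi> has_derivative ?D) (at (q, p))"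
  using assms by (simp add: frechet_derivative_works[symmetric])
 then have lin: "linear ?D" by (rule has_derivative_linear)
 have "((%p. \<phi> (q, p)) has_derivative (%h. ?D (0, h))) (at p)"
  by (rule has_derivative_compose[of "Pair q" "Pair 0" p UNIV \<phi>, OF _ D]) (auto intro!: derivative_eq_intros)
 moreover have "(%h. ?D (0, h)) = (*) (?D (0, 1))"
  proof
  fix h show "?D (0, h) = ?D (0, 1) * h" using linear_cmul[OF lin, of h "(0, 1)"] by (simp add: mult.commute)
 qed
 ultimately show "((%p. \<phi> (q, p)) has_real_derivative ?D (0, 1)) (at p)"
  by (simp add: has_field_derivative_def)
 have "((%q. \<phi> (q, p)) has_derivative (%h. ?D (h, 0))) (at q)"
  by (rule has_derivative_compose[of "%q. (q, p)" "%h. (h, 0)" q UNIV \<phi>, OF _ D]) (auto intro!: derivative_eq_intros)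
 moreover have "(%h. ?D (h, 0)) = (*) (?D (1, 0))"
  proof
  fix h show "?D (h, 0) = ?D (1, 0) * h" using linear_cmul[OF lin, of h "(1, 0)"] by (simp add: mult.commute)
 qed
 ultimately show "((%q. \<phi> (q, p)) has_real_derivative ?D (1, 0)) (at q)"
  by (simp add: has_field_derivative_def)
qed

lemma smooth_upto_of_C_k: "C_k k \<phi> ==> smooth_upto k \<phi>"
proof (induction k arbitrary: \<phi>)
 case (Suc k)
 have "(\<phi> has_real_derivative fd \<phi> x 1) (at x)" for x
 proof -
  have D: "(\<phi> has_derivative fd \<phi> x) (at x)"
   using Suc.prems unfolding frechet_derivative_works[symmetric] by simp
  have "fd \<phi> x = (*) (fd \<phi> x 1)"
   proof
   fix h show "fd \<phi> x h = fd \<phi> x 1 * h"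
    using linear_cmul[OF has_derivative_linear[OF D], of h 1] by (simp add: mult.commute)
  qed
  then show ?thesis using D by (simp add: has_field_derivative_def)
 qed
 moreover have "smooth_upto k (%x. fd \<phi> x 1)"
  using Suc.prems by (intro Suc.IH) simp
 ultimately show ?case unfolding smooth_upto.simps by (intro exI[of _ "%x. fd \<phi> x 1"]) simp
qed simp

definition bump0 :: "real => real" where
 "bump0 t = exp_inv 1 (1 + t) * exp_inv 1 (1 - t)"

lemma smooth_bump0: "smooth_upto k bump0"
 using smooth_upto_mult[OF smooth_upto_affine[OF smooth_exp_inv, of k 1 1 1] smooth_upto_affine[OF smooth_exp_inv, of k 1 "-1" 1]]
 by (simp add: bump0_def[abs_def] algebra_simps)

lemma bump0_nonneg: "0 <= bump0 t" and bump0_pos: "\<bar>t\<bar> < 1 ==> 0 < bump0 t"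
 and bump0_eq_0: "1 <= \<bar>t\<bar> ==> bump0 t = 0"
 by (auto simp: bump0_def exp_inv_def)

lemma bump_exists:
 obtains b :: "real => real" where "!!k. smooth_upto k b" "!!t. 0 <= b t" "!!t. 1 <= \<bar>t\<bar> ==> b t = 0"
  "integrable lborel b" "integral\<^sup>L lborel b = 1"
proof -
 have c: "continuous_on UNIV bump0" using smooth_bump0[of 0] by simp
 have i: "integrable lborel bump0"
 proof -
  have "integrable lborel (%x. indicator {-1..1} x *\<^sub>R bump0 x)"
   by (rule borel_integrable_compact) (auto intro: continuous_on_subset[OF c])
  also have "(%x. indicator {-1..1} x *\<^sub>R bump0 x) = bump0"
  proof
   fix x show "indicator {-1..1} x *\<^sub>R bump0 x = bump0 x"
    using bump0_eq_0[of x] by (cases "\<bar>x\<bar> <= 1") (auto simp: indicator_def abs_le_iff)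
  qed
  finally show ?thesis .
 qed
 have "integral\<^sup>L lborel bump0 ~= 0"
 proof
  assume "integral\<^sup>L lborel bump0 = 0"
  then have "AE x in lborel. bump0 x = 0"
   using integral_nonneg_eq_0_iff_AE[OF i] bump0_nonneg by auto
  then have "AE x in lborel. x ~: {-1<..<1::real}"
   
  proof eventually_elim
   case (elim x)
   then show ?case using bump0_pos[of x] by (auto simp: abs_less_iff)
  qed
  then have "emeasure lborel {-1<..<1::real} = 0"
   by (subst (asm) AE_iff_null_sets[symmetric]) auto
  then show False by simp
 qed
 then have pos: "integral\<^sup>L lborel bump0 > 0"
  using integral_nonneg_AE[of bump0 lborel] bump0_nonneg by (simp add: order_less_le)
 let ?b = "%x. bump0 x * inverse (integral\<^sup>L lborel bump0)"
 show ?thesis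
  by (rule that[of ?b])
   (use pos i bump0_nonneg bump0_eq_0 in \<open>auto intro!: smooth_upto_mult smooth_bump0 smooth_upto_const\<close>)
qed

section \<open>Convolution and mollifiers\<close>

text \<open>Truncating height and support reduces to a bounded function with bounded support. That
  one is an almost everywhere limit of continuous functions; clipping these at the same height and
  multiplying by the cutoff \<open>chi\<close> supplies a dominating function without changing the
  limit.\<close>

lemma approx_continuous_L1:
 fixes g :: "'a::euclidean_space => real"
 assumes g: "integrable lborel g" and "e > 0"
 obtains c R where "continuous_on UNIV c" "!!z. z ~: cball 0 R ==> c z = 0"
  "(\<integral>\<^sup>+z. ennreal \<bar>g z - c z\<bar> \<partial>lborel) < ennreal e"
proof -
 have gm[measurable]: "g : borel_measurable borel" using g by auto
 define clip where "clip = (%(n::nat) t::real. max (- real n) (min (real n) t))"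
 have clip_le: "\<bar>clip n t\<bar> <= real n" "\<bar>clip n t\<bar> <= \<bar>t\<bar>" for n t by (auto simp: clip_def max_def min_def)
 have clip_cont: "continuous_on UNIV (clip n)" for n unfolding clip_def by (intro continuous_intros)
 have clip_lim: "(%n. clip n t) \<longlonglongrightarrow> t" for t
 proof (rule tendsto_eventually)
  obtain N where "\<bar>t\<bar> < real N" using reals_Archimedean2 by blast
  then show "\<forall>\<^sub>F n in sequentially. clip n t = t"
   by (auto simp: eventually_sequentially clip_def max_def min_def intro!: exI[of _ N])
 qed
 have clip_m[measurable]: "clip n : borel_measurable borel" for n
  by (rule borel_measurable_continuous_onI) (rule clip_cont)
 let ?s = "%n z. clip n (g z) * indicator (cball 0 (real n)) z"
 have sm[measurable]: "?s n : borel_measurable borel" for n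
  by (auto intro!: borel_measurable_times borel_measurable_indicator)
 have "(%n. \<integral>\<^sup>+z. norm (g z - ?s n z) \<partial>lborel) \<longlonglongrightarrow> 0"
 proof (rule nn_integral_dominated_convergence_norm[where w="%z. \<bar>g z\<bar>"])
  show "(\<integral>\<^sup>+ x. ennreal \<bar>g x\<bar> \<partial>lborel) < \<infinity>" using g by (simp add: integrable_iff_bounded)
  show "AE x in lborel. (%i. ?s i x) \<longlonglongrightarrow> g x"
  proof (rule AE_I2)
   fix x :: 'a
   obtain N where N: "norm x < real N" using reals_Archimedean2 by blast
   have "(%i. indicator (cball 0 (real i)) x :: real) \<longlonglongrightarrow> 1"
    by (rule tendsto_eventually) (use N in \<open>auto simp: eventually_sequentially intro!: exI[of _ N]\<close>)
   then show "(%i. ?s i x) \<longlonglongrightarrow> g x" using tendsto_mult[OF clip_lim] by fastforce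
  qed
  show "?s n : borel_measurable lborel" for n using sm by simp
 qed (use clip_le in \<open>auto split: split_indicator\<close>)
 then have "\<forall>\<^sub>F n in sequentially. (\<integral>\<^sup>+z. norm (g z - ?s n z) \<partial>lborel) < ennreal (e/2)"
  by (rule order_tendstoD) (use \<open>e > 0\<close> in \<open>auto simp: ennreal_zero_less_divide\<close>)
 then obtain n where n: "(\<integral>\<^sup>+z. norm (g z - ?s n z) \<partial>lborel) < ennreal (e/2)"
  by (auto simp: eventually_sequentially)
 define chi where "chi = (%z::'a. max 0 (min 1 (real n + 1 - norm z)))"
 have chi_cont: "continuous_on UNIV chi" unfolding chi_def by (intro continuous_intros)
 have chi0: "chi z = 0" if "z ~: cball 0 (real n + 1)" for z using that by (auto simp: chi_def)
 have chi1: "chi z = 1" if "z : cball 0 (real n)" for z using that by (auto simp: chi_def)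
 have chi_b: "0 <= chi z" "chi z <= 1" for z by (auto simp: chi_def)
 obtain c0 where c0: "continuous_on UNIV c0" "(\<integral>\<^sup>+z. norm (?s n z - clip n (c0 z) * chi z) \<partial>lborel) < ennreal (e/2)"
 proof -
  have chim[measurable]: "chi : borel_measurable borel" by (rule borel_measurable_continuous_onI) (rule chi_cont)
  have "EX c0. continuous_on UNIV c0 & (\<integral>\<^sup>+z. norm (?s n z - clip n (c0 z) * chi z) \<partial>lborel) < ennreal (e/2)"
  proof -
   have "(%z. g z * indicator (cball 0 (real n)) z) : borel_measurable lborel"
    by (auto intro!: borel_measurable_times borel_measurable_indicator)
   then have "(%z. g z * indicator (cball 0 (real n)) z) measurable_on UNIV"
    by (intro lebesgue_measurable_imp_measurable_on_real measurable_completion) auto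
   then obtain N f where N: "negligible N" "!!k. continuous_on UNIV (f k)"
    "!!x. x ~: N ==> (%k. f k x) \<longlonglongrightarrow> g x * indicator (cball 0 (real n)) x"
    unfolding measurable_on_def by auto
   have fm[measurable]: "f k : borel_measurable borel" for k by (rule borel_measurable_continuous_onI) (rule N)
   have "(%k. \<integral>\<^sup>+z. norm (?s n z - clip n (f k z) * chi z) \<partial>lborel) \<longlonglongrightarrow> 0"
   proof (rule nn_integral_dominated_convergence_norm[where w="%z. real n * indicator (cball 0 (real n + 1)) z"])
    show "AE x in lborel. norm (clip n (f j x) * chi x) <= real n * indicator (cball 0 (real n + 1)) x" for j
    proof (rule AE_I2)
     fix x
     have "\<bar>clip n (f j x)\<bar> * \<bar>chi x\<bar> <= real n * 1"
      using chi_b[of x] clip_le(1)[of n] by (intro mult_mono) auto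
     then show "norm (clip n (f j x) * chi x) <= real n * indicator (cball 0 (real n + 1)) x"
      using chi0[of x] by (auto simp: abs_mult split: split_indicator)
    qed
    have "emeasure lborel (cball (0::'a) (real n + 1)) < \<infinity>" by (rule emeasure_bounded_finite) simp
    then show "(\<integral>\<^sup>+ x. ennreal (real n * indicator (cball 0 (real n + 1)) x) \<partial>(lborel::'a measure)) < \<infinity>"
     by (simp add: ennreal_mult nn_integral_cmult_indicator ennreal_indicator ennreal_mult_less_top)
    have "AE x in lebesgue. x ~: N"
     using N(1) by (intro AE_not_in) (simp add: negligible_iff_null_sets)
    then have "AE x in lborel. x ~: N" by (simp only: AE_completion_iff)
    then show "AE x in lborel. (%i. clip n (f i x) * chi x) \<longlonglongrightarrow> ?s n x"
    proof eventually_elim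
     case (elim x)
     have ct: "isCont (clip n) t" for t using clip_cont[of n] by (auto simp: continuous_on_eq_continuous_within)
     have "(%i. clip n (f i x) * chi x) \<longlonglongrightarrow> clip n (g x * indicator (cball 0 (real n)) x) * chi x"
      by (intro tendsto_mult isCont_tendsto_compose[OF ct] N(3) elim tendsto_const)
     moreover have "clip n (g x * indicator (cball 0 (real n)) x) * chi x = ?s n x"
      using chi1[of x] by (auto split: split_indicator simp: clip_def)
     ultimately show ?case by simp
    qed
   qed (auto intro!: borel_measurable_times borel_measurable_indicator)
   then have "\<forall>\<^sub>F k in sequentially. (\<integral>\<^sup>+z. norm (?s n z - clip n (f k z) * chi z) \<partial>lborel) < ennreal (e/2)"
    by (rule order_tendstoD) (use \<open>e > 0\<close> in \<open>auto simp: ennreal_zero_less_divide\<close>)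
   then show ?thesis using N(2) by (auto simp: eventually_sequentially)
  qed
  then show ?thesis using that by blast
 qed
 have c: "continuous_on UNIV (%z. clip n (c0 z) * chi z)"
  by (intro continuous_intros chi_cont continuous_on_compose2[OF clip_cont c0(1)]) auto
 note [measurable] = borel_measurable_continuous_onI[OF c]
 show ?thesis
 proof (rule that[OF c, of "real n + 1"])
  show "z ~: cball 0 (real n + 1) ==> clip n (c0 z) * chi z = 0" for z using chi0[of z] by simp
  have "(\<integral>\<^sup>+z. ennreal \<bar>g z - clip n (c0 z) * chi z\<bar> \<partial>lborel) <=
   (\<integral>\<^sup>+z. ennreal (norm (g z - ?s n z)) + ennreal (norm (?s n z - clip n (c0 z) * chi z)) \<partial>lborel)"
   by (intro nn_integral_mono) (auto simp: ennreal_plus[symmetric] simp del: ennreal_plus)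
  also have "... = (\<integral>\<^sup>+z. ennreal (norm (g z - ?s n z)) \<partial>lborel) + (\<integral>\<^sup>+z. ennreal (norm (?s n z - clip n (c0 z) * chi z)) \<partial>lborel)"
  proof (rule nn_integral_add)
   have "(%z. norm (g z - ?s n z)) : borel_measurable borel" "(%z. norm (?s n z - clip n (c0 z) * chi z)) : borel_measurable borel"
    using measurable_compose[OF borel_measurable_diff[OF gm sm[of n]] borel_measurable_norm]
     measurable_compose[OF borel_measurable_diff[OF sm[of n] borel_measurable_continuous_onI[OF c]] borel_measurable_norm] by simp_all
   then show "(%z. ennreal (norm (g z - ?s n z))) : borel_measurable lborel"
    "(%z. ennreal (norm (?s n z - clip n (c0 z) * chi z))) : borel_measurable lborel" by auto
  qed
  also have "... < ennreal (e/2) + ennreal (e/2)"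
   using n c0(2) by (rule add_strict_mono)
  also have "... = ennreal e" using \<open>e > 0\<close> by (simp add: ennreal_plus[symmetric] del: ennreal_plus)
  finally show "(\<integral>\<^sup>+z. ennreal \<bar>g z - clip n (c0 z) * chi z\<bar> \<partial>lborel) < ennreal e" .
 qed
qed

lemma uniformly_continuous_compact_support:
 fixes f :: "'a::euclidean_space => real"
 assumes c: "continuous_on UNIV f" and z: "!!x. x ~: cball 0 R ==> f x = 0" and "e > 0"
 obtains d where "d > 0" "!!x y. dist x y < d ==> \<bar>f x - f y\<bar> < e"
proof -
 \<comment> \<open>The radius is enlarged by 1 because a point outside the support may be compared
   with one inside; for the same reason distances are kept below 1.\<close>
 have "uniformly_continuous_on (cball 0 (R+1)) f"
  by (intro compact_uniformly_continuous continuous_on_subset[OF c]) auto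
 then obtain d where d: "d > 0" "!!x y. x : cball 0 (R+1) ==> y : cball 0 (R+1) ==> dist x y < d ==> dist (f x) (f y) < e"
  using \<open>e > 0\<close> unfolding uniformly_continuous_on_def by (metis dist_commute)
 show ?thesis
 proof (rule that[of "min d 1"])
  fix x y :: 'a assume xy: "dist x y < min d 1"
  show "\<bar>f x - f y\<bar> < e"
  proof (cases "x : cball 0 R \<or> y : cball 0 R")
   case True
   then have "x : cball 0 (R+1)" "y : cball 0 (R+1)"
    using xy norm_triangle_sub[of x y] norm_triangle_sub[of y x] by (auto simp: dist_norm norm_minus_commute)
   then show ?thesis using d(2)[of x y] xy by (auto simp: dist_real_def)
  next
   case False then show ?thesis using z \<open>e > 0\<close> by simp
  qed
 qed (use d in auto)
qed

definition conv :: "('a::euclidean_space => real) => ('a => real) => 'a => real" where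
 "conv g ker z = (LINT w|lborel. g w * ker (z - w))"

text \<open>Only size, mass and support are recorded; smoothness is supplied separately by
  \<open>C1_on\<close>, so that the L1 estimates hold for arbitrary bounded kernels.\<close>

definition mollifier :: "real => ('a::euclidean_space => real) => bool" where
 "mollifier \<delta> ker \<longleftrightarrow> ker : borel_measurable borel & (ALL z. 0 <= ker z) & (EX B. ALL z. ker z <= B) \<and>
  (\<integral>\<^sup>+z. ennreal (ker z) \<partial>lborel) = 1 & (ALL z. norm z > \<delta> --> ker z = 0)"

lemma nn_integral_shift:
 assumes [measurable]: "f : borel_measurable borel"
 shows "(\<integral>\<^sup>+z. f (c + z) \<partial>lborel) = (\<integral>\<^sup>+z. f z \<partial>(lborel::'a::euclidean_space measure))"
 by (subst lborel_distr_plus[of c, symmetric], subst nn_integral_distr) (auto simp: comp_def)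

lemma nn_integral_reflect:
 assumes [measurable]: "f : borel_measurable borel"
 shows "(\<integral>\<^sup>+z. f (c - z) \<partial>lborel) = (\<integral>\<^sup>+z. f z \<partial>(lborel::'a::euclidean_space measure))"
proof -
 have "distr lborel borel (%z. c - z) = (lborel::'a measure)"
  using lborel_affine[of "-1" c] by (simp add: density_1)
 then have "(\<integral>\<^sup>+z. f z \<partial>(lborel::'a measure)) = (\<integral>\<^sup>+z. f z \<partial>distr lborel borel (%z. c - z))" by simp
 also have "... = (\<integral>\<^sup>+z. f (c - z) \<partial>lborel)" by (subst nn_integral_distr) auto
 finally show ?thesis by simp
qed

lemma conv_integrable:
 fixes g :: "'a::euclidean_space => real"
 assumes "integrable lborel g" "ker : borel_measurable borel" "!!z. \<bar>ker z\<bar> <= B"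
 shows "integrable lborel (%w. g w * ker (z - w))"
proof (rule Bochner_Integration.integrable_bound[where f="%w. g w * B"])
 show "integrable lborel (%w. g w * B)" using assms by simp
 have [measurable]: "g : borel_measurable borel" "ker : borel_measurable borel" using assms by auto
 show "(%w. g w * ker (z - w)) : borel_measurable lborel" by measurable
 have "\<bar>g w * ker (z - w)\<bar> <= \<bar>g w * B\<bar>" for w
  using assms(3)[of "z - w"] by (auto simp: abs_mult intro!: mult_left_mono)
 then show "AE w in lborel. norm (g w * ker (z - w)) <= norm (g w * B)" by auto
qed

lemma mollifier_integrable:
 assumes "mollifier \<delta> ker"
 shows "integrable lborel (%w. ker (z - w))" "(LINT w|lborel. ker (z - w)) = 1"
proof -
 have m[measurable]: "ker : borel_measurable borel" using assms by (auto simp: mollifier_def)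
 have i: "(\<integral>\<^sup>+w. ennreal (ker (z - w)) \<partial>lborel) = ennreal 1"
  using assms nn_integral_reflect[of "%w. ennreal (ker w)" z] by (simp add: mollifier_def)
 have "has_bochner_integral lborel (%w. ker (z - w)) 1"
  by (rule has_bochner_integral_nn_integral) (use i assms in \<open>auto simp: mollifier_def\<close>)
 then show "integrable lborel (%w. ker (z - w))" "(LINT w|lborel. ker (z - w)) = 1"
  by (auto simp: has_bochner_integral_iff)
qed

lemma conv_mollifier_integrable:
 assumes "integrable lborel g" "mollifier \<delta> ker"
 shows "integrable lborel (%w. g w * ker (z - w))"
proof -
 obtain B where "ALL z. ker z <= B" using assms(2) by (auto simp: mollifier_def)
 then show ?thesis using assms by (intro conv_integrable[of g ker B]) (auto simp: mollifier_def)
qed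

lemma conv_borel[measurable]:
 assumes [measurable]: "g : borel_measurable borel" "ker : borel_measurable borel"
 shows "conv g ker : borel_measurable borel"
 unfolding conv_def by measurable

lemma conv_close:
 assumes g: "integrable lborel g" and ker: "mollifier \<delta> ker"
  and *: "!!w. dist z w <= \<delta> ==> \<bar>g w - b\<bar> <= e"
 shows "\<bar>conv g ker z - b\<bar> <= e"
proof -
 note i = conv_mollifier_integrable[OF g ker] and k = mollifier_integrable[OF ker]
 have "conv g ker z - b = (LINT w|lborel. g w * ker (z - w)) - (LINT w|lborel. b * ker (z - w))"
  by (simp add: conv_def k)
 also have "... = (LINT w|lborel. (g w - b) * ker (z - w))"
  by (subst Bochner_Integration.integral_diff[symmetric]) (auto simp: i k algebra_simps)
 finally have "\<bar>conv g ker z - b\<bar> = \<bar>LINT w|lborel. (g w - b) * ker (z - w)\<bar>" by simp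
 also have "... <= (LINT w|lborel. \<bar>(g w - b) * ker (z - w)\<bar>)" by (rule integral_abs_bound)
 also have "... <= (LINT w|lborel. e * ker (z - w))"
 proof (rule integral_mono)
  have "integrable lborel (%w. (g w - b) * ker (z - w))"
   using Bochner_Integration.integrable_diff[OF i integrable_mult_right[OF k(1)[of z], of b]] by (simp add: algebra_simps)
  then show "integrable lborel (%w. \<bar>(g w - b) * ker (z - w)\<bar>)" by auto
  show "integrable lborel (%w. e * ker (z - w))" using k by auto
  fix w
  show "\<bar>(g w - b) * ker (z - w)\<bar> <= e * ker (z - w)"
   using * [of w] ker by (cases "dist z w <= \<delta>") (auto simp: mollifier_def abs_mult dist_norm intro!: mult_right_mono)
 qed
 also have "... = e" using k by simp
 finally show ?thesis .
qed

text \<open>Tonelli moves the integration in z onto the kernel, whose translates have mass one: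
  convolution is a contraction of L1.\<close>

lemma conv_L1_le:
 fixes g :: "'a::euclidean_space => real"
 assumes g: "integrable lborel g" and ker: "mollifier \<delta> ker"
 shows "(\<integral>\<^sup>+z. ennreal \<bar>conv g ker z\<bar> \<partial>lborel) <= (\<integral>\<^sup>+z. ennreal \<bar>g z\<bar> \<partial>lborel)"
proof -
 have [measurable]: "g : borel_measurable borel" "ker : borel_measurable borel" using g ker by (auto simp: mollifier_def)
 have k1: "(\<integral>\<^sup>+z. ennreal (ker (z - w)) \<partial>lborel) = 1" for w
  using ker nn_integral_shift[of "%w. ennreal (ker w)" "-w"] by (simp add: mollifier_def)
 have "(\<integral>\<^sup>+z. ennreal \<bar>conv g ker z\<bar> \<partial>lborel) <= (\<integral>\<^sup>+z. (\<integral>\<^sup>+w. ennreal (\<bar>g w\<bar> * ker (z - w)) \<partial>lborel) \<partial>lborel)"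
 proof (rule nn_integral_mono)
  fix z
  have "ennreal (norm (conv g ker z)) <= (\<integral>\<^sup>+w. ennreal (norm (g w * ker (z - w))) \<partial>lborel)"
   unfolding conv_def by (rule integral_norm_bound_ennreal[OF conv_mollifier_integrable[OF g ker]])
  then show "ennreal \<bar>conv g ker z\<bar> <= (\<integral>\<^sup>+w. ennreal (\<bar>g w\<bar> * ker (z - w)) \<partial>lborel)"
   using ker by (simp add: mollifier_def abs_mult)
 qed
 also have "... = (\<integral>\<^sup>+w. (\<integral>\<^sup>+z. ennreal (\<bar>g w\<bar> * ker (z - w)) \<partial>lborel) \<partial>lborel)"
  by (rule lborel_pair.Fubini') measurable
 also have "... = (\<integral>\<^sup>+w. ennreal \<bar>g w\<bar> * (\<integral>\<^sup>+z. ennreal (ker (z - w)) \<partial>lborel) \<partial>lborel)"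
  using ker by (auto simp: ennreal_mult nn_integral_cmult mollifier_def intro!: nn_integral_cong)
 finally show ?thesis by (simp add: k1)
qed

lemma conv_diff:
 assumes "integrable lborel g" "integrable lborel h" "mollifier \<delta> ker"
 shows "conv (%z. g z - h z) ker z = conv g ker z - conv h ker z"
 unfolding conv_def
 by (subst Bochner_Integration.integral_diff[symmetric])
  (auto simp: conv_mollifier_integrable[OF assms(1,3)] conv_mollifier_integrable[OF assms(2,3)] algebra_simps)

lemma ennreal_tendsto_0I:
 assumes "!!e. e > 0 ==> \<forall>\<^sub>F n in F. f n < ennreal e"
 shows "(f \<longlongrightarrow> 0) F"
proof (rule order_tendstoI)
 fix a :: ennreal assume "0 < a"
 then obtain b where b: "0 < b" "b < a" using dense by blast
 then have "b = ennreal (enn2real b)" "enn2real b > 0"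
  by (auto simp: enn2real_positive_iff less_top intro!: ennreal_enn2real[symmetric] elim: order_less_trans less_le_trans)
 then have "\<forall>\<^sub>F n in F. f n < b" using assms[of "enn2real b"] by simp
 then show "\<forall>\<^sub>F n in F. f n < a" by eventually_elim (use b in simp)
qed simp

text \<open>Density argument: for continuous c with compact support the convergence is uniform on a
  fixed ball, and the contraction property controls the convolution of g - c.\<close>

lemma conv_L1_tendsto:
 fixes g :: "'a::euclidean_space => real"
 assumes g: "integrable lborel g" and ker: "!!n. mollifier (\<delta> n) (ker n)" and \<delta>: "\<delta> \<longlonglongrightarrow> 0"
 shows "(%n. \<integral>\<^sup>+z. ennreal \<bar>conv g (ker n) z - g z\<bar> \<partial>lborel) \<longlonglongrightarrow> 0"
proof -
 have [measurable]: "g : borel_measurable borel" "!!n. ker n : borel_measurable borel" using g ker by (auto simp: mollifier_def)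
 have "\<forall>\<^sub>F n in sequentially. (\<integral>\<^sup>+z. ennreal \<bar>conv g (ker n) z - g z\<bar> \<partial>lborel) < ennreal e" if "e > 0" for e
 proof -
  obtain c R where c: "continuous_on UNIV c" "!!z. z ~: cball 0 R ==> c z = 0"
   "(\<integral>\<^sup>+z. ennreal \<bar>g z - c z\<bar> \<partial>lborel) < ennreal (e/4)"
   using approx_continuous_L1[OF g, of "e/4"] \<open>e > 0\<close> by auto
  note [measurable] = borel_measurable_continuous_onI[OF c(1)]
  have ci: "integrable lborel c"
  proof -
   have "integrable lborel (%x. indicator (cball 0 R) x *\<^sub>R c x)"
    by (rule borel_integrable_compact) (auto intro: continuous_on_subset[OF c(1)])
   also have "(%x. indicator (cball 0 R) x *\<^sub>R c x) = c"
    using c(2) by (auto simp: fun_eq_iff indicator_def)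
   finally show ?thesis .
  qed
  \<comment> \<open>For radii below 1 the convolution of c lives in this larger ball. A uniform
    error e / (4 (V + 1)) on it costs at most e/4 in L1; the other two terms cost another e/4
    each.\<close>
  define V where "V = measure lborel (cball (0::'a) (R + 1))"
  have V: "emeasure lborel (cball (0::'a) (R + 1)) = ennreal V" "V \<ge> 0"
   unfolding V_def by (use emeasure_bounded_finite[of "cball (0::'a) (R + 1)"] in \<open>auto intro!: emeasure_eq_ennreal_measure\<close>)
  obtain d where d: "d > 0" "!!x y. dist x y < d ==> \<bar>c x - c y\<bar> < e / (4 * (V + 1))"
  proof (rule uniformly_continuous_compact_support[OF c(1,2)])
   show "e / (4 * (V + 1)) > 0" using \<open>e > 0\<close> V by simp
  qed auto
  have "\<forall>\<^sub>F n in sequentially. \<delta> n < min d 1" using \<delta> d by (intro order_tendstoD) auto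
  then show ?thesis
  proof eventually_elim
   case (elim n)
   have close: "\<bar>conv c (ker n) z - c z\<bar> <= e / (4 * (V + 1)) * indicator (cball 0 (R + 1)) z" for z
   proof (cases "z : cball 0 (R + 1)")
    case True
    then show ?thesis
     using conv_close[OF ci ker[of n], of z "c z" "e / (4 * (V + 1))"] d(2) elim
     by (simp add: less_imp_le dist_commute order_le_less_trans)
   next
    case False
    have "\<bar>conv c (ker n) z - 0\<bar> <= 0"
    proof (rule conv_close[OF ci ker[of n]])
     fix w assume "dist z w <= \<delta> n"
     then have "w ~: cball 0 R" using False elim norm_triangle_sub[of z w] by (auto simp: dist_norm)
     then show "\<bar>c w - 0\<bar> <= 0" using c(2) by simp
    qed
    moreover have "c z = 0" using c(2)[of z] False by auto
    ultimately show ?thesis using False by simp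
   qed
   have diff: "conv (%z. g z - c z) (ker n) z = conv g (ker n) z - conv c (ker n) z" for z
    by (rule conv_diff[OF g ci ker])
   have "(\<integral>\<^sup>+z. ennreal \<bar>conv g (ker n) z - g z\<bar> \<partial>lborel) <=
    (\<integral>\<^sup>+z. ennreal \<bar>conv (%z. g z - c z) (ker n) z\<bar> + (ennreal \<bar>conv c (ker n) z - c z\<bar> + ennreal \<bar>g z - c z\<bar>) \<partial>lborel)"
    by (intro nn_integral_mono) (auto simp: diff ennreal_plus[symmetric] simp del: ennreal_plus)
   also have "... = (\<integral>\<^sup>+z. ennreal \<bar>conv (%z. g z - c z) (ker n) z\<bar> \<partial>lborel) +
    ((\<integral>\<^sup>+z. ennreal \<bar>conv c (ker n) z - c z\<bar> \<partial>lborel) + (\<integral>\<^sup>+z. ennreal \<bar>g z - c z\<bar> \<partial>lborel))"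
    by (simp add: nn_integral_add)
   also have "... <= (\<integral>\<^sup>+z. ennreal \<bar>g z - c z\<bar> \<partial>lborel) + (ennreal (e/4) + (\<integral>\<^sup>+z. ennreal \<bar>g z - c z\<bar> \<partial>lborel))"
   proof (intro add_mono conv_L1_le[OF _ ker] order_refl)
    show "integrable lborel (%z. g z - c z)" using g ci by simp
    have "(\<integral>\<^sup>+z. ennreal \<bar>conv c (ker n) z - c z\<bar> \<partial>lborel) <= (\<integral>\<^sup>+z. ennreal (e / (4 * (V + 1))) * indicator (cball 0 (R + 1)) z \<partial>(lborel::'a measure))"
    proof (rule nn_integral_mono)
     fix z
     show "ennreal \<bar>conv c (ker n) z - c z\<bar> <= ennreal (e / (4 * (V + 1))) * indicator (cball 0 (R + 1)) z"
      using ennreal_leI[OF close[of z]] by (cases "z : cball 0 (R + 1)") (simp_all del: mem_cball)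
    qed
    also have "... = ennreal (e / (4 * (V + 1)) * V)"
     using V \<open>e > 0\<close> by (simp add: nn_integral_cmult_indicator ennreal_mult[symmetric])
    also have "... <= ennreal (e/4)"
     using V \<open>e > 0\<close> by (intro ennreal_leI) (auto simp: field_simps)
    finally show "(\<integral>\<^sup>+z. ennreal \<bar>conv c (ker n) z - c z\<bar> \<partial>lborel) <= ennreal (e/4)" .
   qed
   also have "... <= ennreal (e/4) + (ennreal (e/4) + ennreal (e/4))"
    using c(3) by (intro add_mono) (auto intro: less_imp_le)
   also have "... < ennreal e" using \<open>e > 0\<close>
    by (simp add: ennreal_plus[symmetric] ennreal_less_iff del: ennreal_plus)
   finally show ?case .
  qed
 qed
 then show ?thesis by (rule ennreal_tendsto_0I)
qed

text \<open>The partial derivatives are part of the data, so that sums, products and chain rules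
  give explicit formulas and convergence of derivatives can be stated for sequences.\<close>

definition C1_on :: "(real * real) set => (real * real => real) => (real * real => real) => (real * real => real) => bool" where
 "C1_on V F F1 F2 \<longleftrightarrow> open V & continuous_on V F1 & continuous_on V F2 \<and>
  (ALL z:V. (F has_derivative (%h. F1 z * fst h + F2 z * snd h)) (at z))"

lemma C1_on_continuous: "C1_on V F F1 F2 ==> continuous_on V F"
 unfolding C1_on_def
 by (intro has_derivative_continuous_on[of V F "%z h. F1 z * fst h + F2 z * snd h"]) (auto intro: has_derivative_at_withinI)

lemma conv_continuous:
 fixes g :: "'a::euclidean_space => real"
 assumes g: "integrable lborel g" and c: "continuous_on UNIV ker" and z: "!!z. z ~: cball 0 R ==> ker z = 0"
 shows "integrable lborel (%w. g w * ker (z - w))" "continuous_on UNIV (conv g ker)"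
proof -
 have "compact (ker ` cball 0 R)" by (intro compact_continuous_image continuous_on_subset[OF c]) auto
 then obtain B where "!!x. x : cball 0 R ==> \<bar>ker x\<bar> <= B" by (force dest!: compact_imp_bounded simp: bounded_iff)
 then have B: "\<bar>ker x\<bar> <= max B 0" for x using z[of x] by (cases "x : cball 0 R") (auto intro: max.coboundedI1)
 have [measurable]: "ker : borel_measurable borel" by (rule borel_measurable_continuous_onI[OF c])
 show i: "integrable lborel (%w. g w * ker (z - w))" for z by (rule conv_integrable[OF g _ B]) simp
 define N where "N = (LINT w|lborel. \<bar>g w\<bar>)"
 have N: "N \<ge> 0" by (simp add: N_def)
 show "continuous_on UNIV (conv g ker)"
  unfolding continuous_on_iff
 proof (intro ballI allI impI)
  fix x and e :: real assume e: "e > 0"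
  obtain d where d: "d > 0" "!!x y. dist x y < d ==> \<bar>ker x - ker y\<bar> < e / (N + 1)"
  proof (rule uniformly_continuous_compact_support[OF c z])
   show "e / (N + 1) > 0" using e N by simp
  qed auto
  show "\<exists>d>0. ALL x':UNIV. dist x' x < d --> dist (conv g ker x') (conv g ker x) < e"
  proof (intro exI conjI ballI impI)
   fix y assume y: "dist y x < d"
   have "conv g ker y - conv g ker x = (LINT w|lborel. g w * ker (y - w) - g w * ker (x - w))"
    unfolding conv_def by (rule Bochner_Integration.integral_diff[symmetric]) (rule i)+
   then have "\<bar>conv g ker y - conv g ker x\<bar> <= (LINT w|lborel. \<bar>g w * ker (y - w) - g w * ker (x - w)\<bar>)"
    by (simp add: integral_abs_bound)
   also have "... <= (LINT w|lborel. e / (N + 1) * \<bar>g w\<bar>)"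
   proof (rule integral_mono)
    show "integrable lborel (%w. \<bar>g w * ker (y - w) - g w * ker (x - w)\<bar>)" using i by simp
    show "integrable lborel (%w. e / (N + 1) * \<bar>g w\<bar>)" using g by simp
    fix w
    have "\<bar>ker (y - w) - ker (x - w)\<bar> <= e / (N + 1)" using d(2)[of "y - w" "x - w"] y by (simp add: dist_norm)
    then have "\<bar>g w\<bar> * \<bar>ker (y - w) - ker (x - w)\<bar> <= \<bar>g w\<bar> * (e / (N + 1))" by (intro mult_left_mono) auto
    then show "\<bar>g w * ker (y - w) - g w * ker (x - w)\<bar> <= e / (N + 1) * \<bar>g w\<bar>"
     by (simp add: abs_mult[symmetric] right_diff_distrib mult.commute)
   qed
   also have "... = e / (N + 1) * N" by (simp add: N_def)
   also have "... < e" using e N by (simp add: field_simps)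
   finally show "dist (conv g ker y) (conv g ker x) < e" by (simp add: dist_real_def)
  qed fact
 qed
qed

text \<open>The linearisation error of the kernel is uniform in the base point because its partial
  derivatives are uniformly continuous; it can therefore be integrated against g.\<close>

lemma conv_C1:
 fixes g ker ker1 ker2 :: "real \<times> real => real"
 assumes g: "integrable lborel g" and D: "C1_on UNIV ker ker1 ker2"
  and z: "!!z. z ~: cball 0 R ==> ker z = 0" "!!z. z ~: cball 0 R ==> ker1 z = 0" "!!z. z ~: cball 0 R ==> ker2 z = 0"
 shows "C1_on UNIV (conv g ker) (conv g ker1) (conv g ker2)"
proof -
 have c: "continuous_on UNIV ker1" "continuous_on UNIV ker2" "continuous_on UNIV ker"
  and d: "!!z. (ker has_derivative (%h. ker1 z * fst h + ker2 z * snd h)) (at z)"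
  using D C1_on_continuous[OF D] by (auto simp: C1_on_def)
 note i = conv_continuous(1)[OF g c(3) z(1)] conv_continuous(1)[OF g c(1) z(2)] conv_continuous(1)[OF g c(2) z(3)]
 define N where "N = (LINT w|lborel. \<bar>g w\<bar>)"
 have N: "N \<ge> 0" by (simp add: N_def)
 have "(conv g ker has_derivative (%h. conv g ker1 z * fst h + conv g ker2 z * snd h)) (at z)" for z
  unfolding has_derivative_at_alt
 proof (intro conjI allI impI)
  show "bounded_linear (%h. conv g ker1 z * fst h + conv g ker2 z * snd h)"
   by (intro bounded_linear_add bounded_linear_const_mult bounded_linear_fst bounded_linear_snd)
  fix e :: real assume e: "e > 0"
  \<comment> \<open>N is the L1 norm of g and may be 0, hence N + 1.\<close>
  define e' where "e' = e / (N + 1)"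
  have e': "e' > 0" using e N by (simp add: e'_def)
  have "e' * N <= e' * (N + 1)" using e' by simp
  then have e'N: "e' * N <= e" using N by (simp add: e'_def)
  obtain d1 where d1: "d1 > 0" "!!x y. dist x y < d1 ==> \<bar>ker1 x - ker1 y\<bar> < e' / 2"
  proof (rule uniformly_continuous_compact_support[OF c(1) z(2)])
   show "e' / 2 > 0" using e' by simp
  qed auto
  obtain d2 where d2: "d2 > 0" "!!x y. dist x y < d2 ==> \<bar>ker2 x - ker2 y\<bar> < e' / 2"
  proof (rule uniformly_continuous_compact_support[OF c(2) z(3)])
   show "e' / 2 > 0" using e' by simp
  qed auto
  have lin: "\<bar>ker y - ker x - (ker1 x * fst (y - x) + ker2 x * snd (y - x))\<bar> <= norm (y - x) * e'"
   if xy: "norm (y - x) < min d1 d2" for x y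
  proof -
   have "norm (ker y - ker x - (%h. ker1 x * fst h + ker2 x * snd h) (y - x)) <= norm (y - x) * e'"
   proof (rule differentiable_bound_linearization[where S="ball x (min d1 d2)" and f'="%x h. ker1 x * fst h + ker2 x * snd h"])
    fix t :: real assume "t : {0..1}"
    then have "norm (t *\<^sub>R (y - x)) <= norm (y - x)" by (auto simp: mult_left_le_one_le)
    then show "x + t *\<^sub>R (y - x) : ball x (min d1 d2)" using xy by (simp add: dist_norm)
   next
    fix w assume w: "w : ball x (min d1 d2)"
    show "onorm ((%h. ker1 w * fst h + ker2 w * snd h) - (%h. ker1 x * fst h + ker2 x * snd h)) <= e'"
    proof (rule onorm_le)
     fix h :: "real \<times> real"
     have k: "\<bar>ker1 w - ker1 x\<bar> <= e'/2" "\<bar>ker2 w - ker2 x\<bar> <= e'/2"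
      using d1(2)[of w x] d2(2)[of w x] w by (auto simp: dist_commute)
     have h: "\<bar>fst h\<bar> <= norm h" "\<bar>snd h\<bar> <= norm h" using norm_fst_le[of "fst h" "snd h"] norm_snd_le[of "snd h" "fst h"] by auto
     have "\<bar>(ker1 w - ker1 x) * fst h + (ker2 w - ker2 x) * snd h\<bar> <= e'/2 * norm h + e'/2 * norm h"
     proof (intro order_trans[OF abs_triangle_ineq] add_mono)
      show "\<bar>(ker1 w - ker1 x) * fst h\<bar> <= e'/2 * norm h" unfolding abs_mult
       by (rule mult_mono) (use e' k h in auto)
      show "\<bar>(ker2 w - ker2 x) * snd h\<bar> <= e'/2 * norm h" unfolding abs_mult
       by (rule mult_mono) (use e' k h in auto)
     qed
     then show "norm (((%h. ker1 w * fst h + ker2 w * snd h) - (%h. ker1 x * fst h + ker2 x * snd h)) h) <= e' * norm h"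
      by (simp add: algebra_simps)
    qed
   qed (use d d1 d2 in \<open>auto intro: has_derivative_at_withinI\<close>)
   then show ?thesis by simp
  qed
  show "\<exists>d>0. ALL y. norm (y - z) < d -->
   norm (conv g ker y - conv g ker z - (conv g ker1 z * fst (y - z) + conv g ker2 z * snd (y - z))) <= e * norm (y - z)"
  proof (intro exI conjI allI impI)
   show "min d1 d2 > 0" using d1 d2 by simp
   fix y assume y: "norm (y - z) < min d1 d2"
   let ?r = "%w. g w * (ker (y - w) - ker (z - w) - (ker1 (z - w) * fst (y - z) + ker2 (z - w) * snd (y - z)))"
   have r: "?r = (%w. g w * ker (y - w) - g w * ker (z - w) - (g w * ker1 (z - w) * fst (y - z) + g w * ker2 (z - w) * snd (y - z)))"
    by (auto simp: algebra_simps)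
   have ri: "integrable lborel ?r" unfolding r by (intro Bochner_Integration.integrable_diff Bochner_Integration.integrable_add integrable_mult_left i)
   have eq: "conv g ker y - conv g ker z - (conv g ker1 z * fst (y - z) + conv g ker2 z * snd (y - z)) = (LINT w|lborel. ?r w)"
   proof -
    have "has_bochner_integral lborel ?r (conv g ker y - conv g ker z - (conv g ker1 z * fst (y - z) + conv g ker2 z * snd (y - z)))"
     unfolding r conv_def
     by (rule has_bochner_integral_diff[OF has_bochner_integral_diff[OF
       has_bochner_integral_integrable[OF i(1)] has_bochner_integral_integrable[OF i(1)]]
       has_bochner_integral_add[OF has_bochner_integral_mult_left[OF has_bochner_integral_integrable[OF i(2)]]
        has_bochner_integral_mult_left[OF has_bochner_integral_integrable[OF i(3)]]]])
    then show ?thesis by (simp add: has_bochner_integral_integral_eq)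
   qed
   have "norm (LINT w|lborel. ?r w) <= (LINT w|lborel. \<bar>?r w\<bar>)"
    unfolding real_norm_def by (rule integral_abs_bound)
   also have "... <= (LINT w|lborel. norm (y - z) * e' * \<bar>g w\<bar>)"
   proof (rule integral_mono)
    show "integrable lborel (%w. \<bar>?r w\<bar>)" using ri by (rule integrable_abs)
    show "integrable lborel (%w. norm (y - z) * e' * \<bar>g w\<bar>)" using g by simp
    fix w
    have "\<bar>ker (y - w) - ker (z - w) - (ker1 (z - w) * fst (y - z) + ker2 (z - w) * snd (y - z))\<bar> <= norm (y - z) * e'"
     using lin[of "y - w" "z - w"] y by simp
    then show "\<bar>?r w\<bar> <= norm (y - z) * e' * \<bar>g w\<bar>"
     unfolding abs_mult by (subst mult.commute) (rule mult_right_mono, auto)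
   qed
   also have "... = e' * N * norm (y - z)" by (simp add: N_def)
   also have "... <= e * norm (y - z)" using e'N by (intro mult_right_mono) auto
   finally show "norm (conv g ker y - conv g ker z - (conv g ker1 z * fst (y - z) + conv g ker2 z * snd (y - z))) <= e * norm (y - z)"
    unfolding eq .
  qed
 qed
 then show ?thesis
  using conv_continuous(2)[OF g c(1) z(2)] conv_continuous(2)[OF g c(2) z(3)] by (simp add: C1_on_def)
qed

text \<open>Provides room for mollification: at points of V, kernels of radius at most \<delta> see
  only values on the compact set K', where local integrability applies.\<close>

lemma compact_nbhd:
 fixes K :: "'a::euclidean_space set"
 assumes "compact K" "open U" "K \<subseteq> U"
 obtains \<delta> K' V where "\<delta> > 0" "compact K'" "K' \<subseteq> U" "open V" "K \<subseteq> V" "!!z. z : V ==> cball z \<delta> \<subseteq> K'"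
proof -
 obtain e where e: "e > 0" "(\<Union>x\<in>K. cball x e) \<subseteq> U"
  using compact_subset_open_imp_cball_epsilon_subset[OF assms] by blast
 have "{x + y | x y. x : K & y : cball 0 e} = (\<Union>x\<in>K. cball x e)"
 proof safe
  fix x y :: 'a assume "x : K" "y : cball 0 e"
  then show "x + y : (\<Union>x\<in>K. cball x e)" by (intro UN_I[of x]) (auto simp: dist_norm)
 next
  fix x z assume "x : K" "z : cball x e"
  then show "EX x y. z = x + y & x : K & y : cball 0 e"
   by (intro exI[of _ x] exI[of _ "z - x"]) (auto simp: dist_norm norm_minus_commute)
 qed
 then have "compact (\<Union>x\<in>K. cball x e)"
  using compact_sums[OF \<open>compact K\<close> compact_cball[of 0 e]] by simp
 moreover have "cball z (e/2) \<subseteq> (\<Union>x\<in>K. cball x e)" if z: "z : (\<Union>x\<in>K. ball x (e/2))" for z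
 proof
  fix w assume w: "w : cball z (e/2)"
  from z obtain x where x: "x : K" "dist x z < e/2" by auto
  have "dist x w <= e" using x w dist_triangle[of x w z] by auto
  then show "w : (\<Union>x\<in>K. cball x e)" using x by auto
 qed
 ultimately show ?thesis
  using e by (intro that[of "e/2" "\<Union>x\<in>K. cball x e" "\<Union>x\<in>K. ball x (e/2)"]) auto
qed

lemma nn_integral_lborel_fst:
 fixes f :: "'a::euclidean_space \<times> 'b::euclidean_space => ennreal"
 assumes "f : borel_measurable borel"
 shows "(\<integral>\<^sup>+z. f z \<partial>lborel) = (\<integral>\<^sup>+x. \<integral>\<^sup>+y. f (x, y) \<partial>lborel \<partial>lborel)"
proof -
 have "f : borel_measurable (lborel \<Otimes>\<^sub>M lborel)" using assms by (simp add: lborel_prod)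
 from lborel.nn_integral_fst[OF this] show ?thesis by (simp add: lborel_prod)
qed

text \<open>Tensor products of rescaled bumps: the support is a square of half side 1/s, contained
  in the disc of radius 2/s. The last clause, smoothness of reflected translates, is what turns them
  into test functions.\<close>

lemma moll_seq_exists:
 obtains ker ker1 ker2 :: "nat => real \<times> real => real" and \<delta> :: "nat => real"
 where "\<delta> \<longlonglongrightarrow> 0" "!!n. mollifier (\<delta> n) (ker n)" "!!n. C1_on UNIV (ker n) (ker1 n) (ker2 n)"
  "!!n z. z ~: cball 0 (\<delta> n) ==> ker n z = 0" "!!n z. z ~: cball 0 (\<delta> n) ==> ker1 n z = 0" "!!n z. z ~: cball 0 (\<delta> n) ==> ker2 n z = 0"
  "!!n z k. C_k k (%w. ker n (z - w))"
proof -
 obtain b where b: "!!k. smooth_upto k b" "!!t. 0 <= b t" "!!t. 1 <= \<bar>t\<bar> ==> b t = 0"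
  "integrable lborel b" "integral\<^sup>L lborel b = 1" using bump_exists by blast
 have [measurable]: "b : borel_measurable borel" using b(4) by auto
 obtain b' where b': "!!t. (b has_real_derivative b' t) (at t)" "continuous_on UNIV b'"
  using b(1)[of 1] by auto
 have bc: "continuous_on UNIV b" using b(1)[of 0] by simp
 define s where "s = (%n. real (Suc n))"
 have s: "s n > 0" for n by (simp add: s_def)
 have b'0: "b' t = 0" if "\<bar>t\<bar> > 1" for t
 proof -
  have "((%_. 0) has_real_derivative b' t) (at t)"
   by (rule has_field_derivative_transform_within_open[OF b'(1), of "{t. \<bar>t\<bar> > 1}"])
    (use that b(3) in \<open>auto intro!: open_Collect_less continuous_intros\<close>)
  then show ?thesis using DERIV_unique[OF _ DERIV_const] by blast
 qed
 let ?ker = "%n z::real\<times>real. (s n * b (s n * fst z)) * (s n * b (s n * snd z))"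
 let ?ker1 = "%n z::real\<times>real. (s n * (b' (s n * fst z) * s n)) * (s n * b (s n * snd z))"
 let ?ker2 = "%n z::real\<times>real. (s n * b (s n * fst z)) * (s n * (b' (s n * snd z) * s n))"
 let ?\<delta> = "%n. 2 / s n"
 \<comment> \<open>The strict inequality is what \<open>b'0\<close> requires: b' is shown to vanish
   for |t| > 1, where b is locally zero.\<close>
 have out: "\<bar>s n * fst z\<bar> > 1 \<or> \<bar>s n * snd z\<bar> > 1" if "z ~: cball 0 (?\<delta> n)" for n and z :: "real\<times>real"
 proof (rule ccontr)
  assume "\<not> ?thesis"
  then have "\<bar>fst z\<bar> <= 1 / s n" "\<bar>snd z\<bar> <= 1 / s n" using s[of n] by (auto simp: abs_mult field_simps)
  then have "norm z <= ?\<delta> n" using norm_Pair_le[of "fst z" "snd z"] by simp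
  then show False using that by simp
 qed
 have bn: "smooth_upto k (%x. s n * b (c * x + t))" for k n c t
  by (intro smooth_upto_mult smooth_upto_const smooth_upto_affine b)
 have dn: "((%x. s n * b (s n * x)) has_real_derivative s n * (b' (s n * x) * s n)) (at x)" for n x
  using s[of n] by (auto intro!: derivative_eq_intros DERIV_chain2[OF b'(1)])
 show ?thesis
 proof (rule that[of ?\<delta> ?ker ?ker1 ?ker2])
  show "?\<delta> \<longlonglongrightarrow> 0" using tendsto_mult[OF tendsto_const[of 2] LIMSEQ_inverse_real_of_nat] by (simp add: s_def divide_inverse)
  fix n
  show "z ~: cball 0 (?\<delta> n) ==> ?ker n z = 0" "z ~: cball 0 (?\<delta> n) ==> ?ker1 n z = 0" "z ~: cball 0 (?\<delta> n) ==> ?ker2 n z = 0" for z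
   using out[of z n] b(3) b'0 by (force simp: less_imp_le)+
  show "C_k k (%w. ?ker n (z - w))" for z k
  proof -
   have "C_k k (%w::real\<times>real. s n * b ((- s n) * fst w + s n * fst z) * (s n * b ((- s n) * snd w + s n * snd z)))"
    by (rule C_k_tensor; rule bn)
   moreover have "(- s n) * x + s n * y = s n * (y - x)" for x y by (simp add: algebra_simps)
   ultimately show ?thesis by simp
  qed
  show "C1_on UNIV (?ker n) (?ker1 n) (?ker2 n)"
   unfolding C1_on_def
  proof (intro conjI ballI)
   show "continuous_on UNIV (?ker1 n)" "continuous_on UNIV (?ker2 n)"
    by (intro continuous_intros continuous_on_compose2[OF bc] continuous_on_compose2[OF b'(2)]; simp)+
   show "(?ker n has_derivative (%h. ?ker1 n z * fst h + ?ker2 n z * snd h)) (at z)" for z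
    using has_derivative_fst_snd[OF dn dn] by simp
  qed simp
  show "mollifier (?\<delta> n) (?ker n)"
   unfolding mollifier_def
  proof (intro conjI allI impI)
   show km: "?ker n : borel_measurable borel"
    by (intro borel_measurable_continuous_onI continuous_intros continuous_on_compose2[OF bc]) auto
   show "0 <= ?ker n z" for z using b s[of n] by simp
   show "?\<delta> n < norm z ==> ?ker n z = 0" for z
    using out[of z n] b(3) by (force simp: less_imp_le)
   have "compact (b ` {-1..1})" by (intro compact_continuous_image continuous_on_subset[OF bc]) auto
   from compact_imp_bounded[OF this] obtain B where Bb: "ALL y:b ` {-1..1}. norm y <= B"
    unfolding bounded_iff ..
   have B0: "b x <= B" if "x : {-1..1}" for x
    using bspec[OF Bb imageI[OF that]] by simp
   have B: "b x <= max B 0" for x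
   proof (cases "x : {-1..1}")
    case False
    then have "b x = 0" by (intro b(3)) auto
    then show ?thesis by simp
   next
    case True
    then show ?thesis using B0[of x] by (simp add: le_max_iff_disj)
   qed
   show "EX B. ALL z. ?ker n z <= B"
   proof (intro exI allI)
    fix z
    have "s n * b x <= s n * max B 0" "0 <= s n * b x" for x
     using B[of x] b(2)[of x] s[of n] by (auto intro: mult_left_mono)
    then show "?ker n z <= (s n * max B 0) * (s n * max B 0)"
     by (intro mult_mono) (use B b(2) s[of n] in \<open>auto intro: less_imp_le\<close>)
   qed
   have one: "(\<integral>\<^sup>+x. ennreal (s n * b (s n * x)) \<partial>lborel) = 1"
   proof -
    have "(\<integral>\<^sup>+x. ennreal (b x) \<partial>lborel) = ennreal 1"
     using b by (subst nn_integral_eq_integral) auto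
    moreover have "(\<integral>\<^sup>+x. ennreal (b x) \<partial>lborel) = ennreal \<bar>s n\<bar> * (\<integral>\<^sup>+x. ennreal (b (0 + s n * x)) \<partial>lborel)"
     using s[of n] by (intro nn_integral_real_affine) auto
    ultimately show ?thesis
     using s[of n] b(2) by (simp add: ennreal_mult nn_integral_cmult)
   qed
   have "(\<integral>\<^sup>+z. ennreal (?ker n z) \<partial>lborel) = (\<integral>\<^sup>+x. \<integral>\<^sup>+y. ennreal (?ker n (x, y)) \<partial>lborel \<partial>lborel)"
    by (rule nn_integral_lborel_fst) (use km in simp)
   also have "... = (\<integral>\<^sup>+x. ennreal (s n * b (s n * x)) * (\<integral>\<^sup>+y. ennreal (s n * b (s n * y)) \<partial>lborel) \<partial>lborel)"
    using b(2) s[of n] by (subst nn_integral_cmult[symmetric]) (auto simp: ennreal_mult)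
   finally show "(\<integral>\<^sup>+z. ennreal (?ker n z) \<partial>lborel) = 1" using one by simp
  qed
 qed
qed

section \<open>Borel representatives and local integrability\<close>

lemma AE_lebesgue_on_iff:
 assumes "U : sets borel"
 shows "(AE z in lebesgue_on U. P z) \<longleftrightarrow> (AE z\<in>U in lborel. P z)"
 using assms by (subst AE_restrict_space_iff) (auto simp: AE_completion_iff)

lemma borel_measurable_lebesgue_onI:
 assumes "g : borel_measurable borel"
 shows "g : borel_measurable (lebesgue_on U)"
 by (rule measurable_restrict_space1[OF measurable_completion]) (use assms in simp)

lemma lebesgue_on_borel:
 fixes g :: "'a::euclidean_space => real"
 assumes g: "g : borel_measurable borel" and S: "S : sets borel"
 shows "integrable (lebesgue_on S) g \<longleftrightarrow> integrable lborel (%x. indicator S x * g x)"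
  "integral\<^sup>L (lebesgue_on S) g = (LINT x|lborel. indicator S x * g x)"
proof -
 have S': "S \<inter> space lebesgue : sets lebesgue" using S by simp
 have m: "(%x. indicator S x * g x) : borel_measurable lborel" using g S by simp
 show "integrable (lebesgue_on S) g \<longleftrightarrow> integrable lborel (%x. indicator S x * g x)"
  using integrable_restrict_space[OF S', of g] integrable_completion[OF m] by simp
 show "integral\<^sup>L (lebesgue_on S) g = (LINT x|lborel. indicator S x * g x)"
  using integral_restrict_space[OF S', of g] integral_completion[OF m] by simp
qed

text \<open>Bridge between two measure settings: the formulations speak of
  \<open>lebesgue_on\<close>, whereas Fubini, convolution and change of variables are carried out
  with Borel functions for \<open>lborel\<close>.\<close>

lemma lebesgue_on_rep:
 fixes f g :: "'a::euclidean_space => real"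
 assumes g: "g : borel_measurable borel" and S: "S : sets borel"
  and f: "f : borel_measurable (lebesgue_on S)" and eq: "AE z\<in>S in lborel. f z = g z"
 shows "integrable (lebesgue_on S) f \<longleftrightarrow> integrable lborel (%x. indicator S x * g x)"
  "integral\<^sup>L (lebesgue_on S) f = (LINT x|lborel. indicator S x * g x)"
proof -
 have g': "g : borel_measurable (lebesgue_on S)" by (rule borel_measurable_lebesgue_onI[OF g])
 have eq': "AE z in lebesgue_on S. f z = g z" using eq by (simp add: AE_lebesgue_on_iff S)
 show "integrable (lebesgue_on S) f \<longleftrightarrow> integrable lborel (%x. indicator S x * g x)"
  using integrable_cong_AE[OF f g' eq'] lebesgue_on_borel(1)[OF g S] by simp
 show "integral\<^sup>L (lebesgue_on S) f = (LINT x|lborel. indicator S x * g x)"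
  using integral_cong_AE[OF f g' eq'] lebesgue_on_borel(2)[OF g S] by simp
qed

lemma borel_rep_exists:
 fixes f :: "'a::euclidean_space => real"
 assumes S: "S : sets borel" and f: "f : borel_measurable (lebesgue_on S)"
 obtains g where "g : borel_measurable borel" "AE z\<in>S in lborel. f z = g z"
proof -
 have "(%x. if x : S then f x else 0) : borel_measurable lebesgue"
  using f S by (subst borel_measurable_if) auto
 from completion_ex_borel_measurable_real[OF this] obtain g where
  g: "g : borel_measurable lborel" "AE x in lborel. (if x : S then f x else 0) = g x" by auto
 show ?thesis
 proof (rule that[of g])
  show "AE z\<in>S in lborel. f z = g z" using g(2) by eventually_elim auto
 qed (use g in simp)
qed

text \<open>Borel on the whole space although integrability is asked only on compact subsets of U:
  such representatives can be convolved and multiplied directly.\<close>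

definition L1loc :: "'a::euclidean_space set => ('a => real) => bool" where
 "L1loc U g \<longleftrightarrow> g : borel_measurable borel \<and>
  (ALL K. compact K & K \<subseteq> U --> integrable lborel (%z. indicator K z * g z))"

lemma locally_integrable_of_L1loc: "L1loc U g ==> locally_integrable_on U g"
 by (auto simp: L1loc_def locally_integrable_on_def lebesgue_on_borel(1) borel_compact)

text \<open>Measurability is given on compact subsets; an exhaustion of U by compact sets writes f,
  extended by 0, as a pointwise limit.\<close>

lemma locally_integrable_measurable:
 fixes f :: "'a::euclidean_space => real"
 assumes "open U" "locally_integrable_on U f"
 shows "f : borel_measurable (lebesgue_on U)"
proof -
 obtain C :: "nat => 'a set" where C: "!!n. compact (C n)" "!!n. C n \<subseteq> U"
  "!!n. C n \<subseteq> interior (C (Suc n))" "\<Union>(range C) = U"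
  "!!K. [|compact K; K \<subseteq> U|] ==> EX N. \<forall>n\<ge>N. K \<subseteq> C n"
  using open_Union_compact_subsets[OF assms(1)] by metis
 have U: "U : sets lebesgue" using assms(1) by simp
 have "(%x. if x : U then f x else 0) : borel_measurable lebesgue"
 proof (rule borel_measurable_LIMSEQ_real)
  fix n
  have "f : borel_measurable (lebesgue_on (C n))"
   using assms(2) C(1,2) by (auto simp: locally_integrable_on_def)
  then show "(%x. if x : C n then f x else 0) : borel_measurable lebesgue"
   by (subst borel_measurable_if) (use C in \<open>auto simp: borel_compact\<close>)
 next
  fix x
  show "(%n. if x : C n then f x else 0) \<longlonglongrightarrow> (if x : U then f x else 0)"
  proof (rule tendsto_eventually, cases "x : U")
   case True
   then obtain N where "\<forall>n\<ge>N. {x} \<subseteq> C n" using C(5)[of "{x}"] by auto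
   then show "\<forall>\<^sub>F n in sequentially. (if x : C n then f x else 0) = (if x : U then f x else 0)"
    using True by (auto simp: eventually_sequentially)
  next
   case False
   then show "\<forall>\<^sub>F n in sequentially. (if x : C n then f x else 0) = (if x : U then f x else 0)"
    using C(2) by (intro always_eventually) auto
  qed
 qed
 then show ?thesis using U by (subst (asm) borel_measurable_if) auto
qed

lemma L1loc_rep_exists:
 fixes f :: "'a::euclidean_space => real"
 assumes "open U" "locally_integrable_on U f"
 obtains g where "L1loc U g" "AE z\<in>U in lborel. f z = g z"
proof -
 obtain g where g: "g : borel_measurable borel" "AE z\<in>U in lborel. f z = g z"
  using borel_rep_exists[OF _ locally_integrable_measurable[OF assms]] assms by auto
 have "integrable lborel (%z. indicator K z * g z)" if K: "compact K" "K \<subseteq> U" for K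
 proof -
  have "integrable (lebesgue_on K) f" using assms K by (auto simp: locally_integrable_on_def)
  then show ?thesis
   by (subst (asm) lebesgue_on_rep(1)[OF g(1)])
    (use K g(2) assms(2) in \<open>auto simp: borel_compact locally_integrable_on_def elim: eventually_mono\<close>)
 qed
 then show ?thesis using g by (intro that[of g]) (auto simp: L1loc_def)
qed

section \<open>Test functions and uniqueness of weak derivatives\<close>

lemma test_functionD:
 fixes \<phi> :: "'a::euclidean_space => real"
 assumes "test_function U \<phi>"
 obtains S where "compact S" "S \<subseteq> U" "!!z. z ~: S ==> \<phi> z = 0" "!!z b. z ~: S ==> fd \<phi> z b = 0"
  "continuous_on UNIV \<phi>" "!!z. (\<phi> has_derivative fd \<phi> z) (at z)"
  "!!b. b : Basis ==> continuous_on UNIV (%z. fd \<phi> z b)"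
proof -
 define S where "S = closure {z. \<phi> z ~= 0}"
 have C: "C_k 0 \<phi>" "C_k (Suc 0) \<phi>" using assms unfolding test_function_def by blast+
 have d: "(\<phi> has_derivative fd \<phi> z) (at z)" for z
 proof -
  have "\<phi> differentiable (at z)" using C(2) unfolding C_k.simps by (rule conjunct1[THEN spec])
  then show ?thesis by (rule frechet_derivative_works[THEN iffD1])
 qed
 have z: "\<phi> z = 0" if "z ~: S" for z using that closure_subset[of "{z. \<phi> z ~= 0}"] unfolding S_def by blast
 have opn: "open (- S)" unfolding S_def by (intro open_Compl closed_closure)
 have fz: "fd \<phi> z b = 0" if "z ~: S" for z b
 proof -
  have "((%_. 0) has_derivative fd \<phi> z) (at z)"
   by (rule has_derivative_transform_within_open[OF d opn]) (simp_all add: that z)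
  then have "fd \<phi> z = (%_. 0)"
   by (rule has_derivative_unique[OF _ has_derivative_const])
  then show ?thesis by simp
 qed
 have fc: "continuous_on UNIV (%z. fd \<phi> z b)" if "b : Basis" for b
  using C(2) that unfolding C_k.simps by (blast dest: conjunct2)
 have S: "compact S" "S \<subseteq> U" using assms by (simp_all add: test_function_def S_def)
 show ?thesis
  by (rule that[OF S z fz _ d fc]) (use C(1) in simp_all)
qed

lemma pairing_rep:
 fixes F F' c :: "'a::euclidean_space => real"
 assumes U: "open U" and F: "locally_integrable_on U F" "F' : borel_measurable borel" "AE z\<in>U in lborel. F z = F' z"
  and c: "continuous_on UNIV c" "!!z. z ~: S ==> c z = 0" and S: "S \<subseteq> U"
 shows "(LINT z|lebesgue_on U. F z * c z) = (LINT z|lborel. F' z * c z)"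
proof -
 have [measurable]: "c : borel_measurable borel" by (rule borel_measurable_continuous_onI[OF c(1)])
 have "(LINT z|lebesgue_on U. F z * c z) = (LINT z|lborel. indicator U z * (F' z * c z))"
 proof (rule lebesgue_on_rep(2))
  show "(%z. F' z * c z) : borel_measurable borel" using F(2) by simp
  show "(%z. F z * c z) : borel_measurable (lebesgue_on U)"
   by (intro borel_measurable_times locally_integrable_measurable[OF U F(1)] borel_measurable_lebesgue_onI) simp
  show "AE z\<in>U in lborel. F z * c z = F' z * c z" using F(3) by eventually_elim simp
 qed (use U in simp)
 also have "(%z. indicator U z * (F' z * c z)) = (%z. F' z * c z)"
  using c(2) S by (force simp: indicator_def)
 finally show ?thesis .
qed

text \<open>Both integrals see only the support of the test function, a compact subset of U, so the
  functions may be replaced by globally defined Borel representatives.\<close>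

lemma weak_deriv_borel_iff:
 fixes f g f' g' :: "'a::euclidean_space => real"
 assumes U: "open U" and b: "b : Basis" and loc: "locally_integrable_on U f" "locally_integrable_on U g"
  and f': "f' : borel_measurable borel" "AE z\<in>U in lborel. f z = f' z"
  and g': "g' : borel_measurable borel" "AE z\<in>U in lborel. g z = g' z"
 shows "has_weak_deriv U b f g \<longleftrightarrow> (ALL \<phi>. test_function U \<phi> -->
  (LINT z|lborel. f' z * fd \<phi> z b) = - (LINT z|lborel. g' z * \<phi> z))"
proof -
 have "(LINT z|lebesgue_on U. f z * fd \<phi> z b) = (LINT z|lborel. f' z * fd \<phi> z b) \<and>
  (LINT z|lebesgue_on U. g z * \<phi> z) = (LINT z|lborel. g' z * \<phi> z)" if \<phi>: "test_function U \<phi>" for \<phi>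
 proof -
  obtain S where S: "S \<subseteq> U" "!!z. z ~: S ==> \<phi> z = 0" "!!z b. z ~: S ==> fd \<phi> z b = 0"
   "continuous_on UNIV \<phi>" "!!b. b : Basis ==> continuous_on UNIV (%z. fd \<phi> z b)"
   using test_functionD[OF \<phi>] by metis
  show ?thesis
   using pairing_rep[OF U loc(1) f' S(5)[OF b] S(3,1)] pairing_rep[OF U loc(2) g' S(4,2,1)] by simp
 qed
 then show ?thesis using loc by (auto simp: has_weak_deriv_def)
qed

lemma weak_deriv_borel:
 fixes f g f' g' :: "'a::euclidean_space => real"
 assumes w: "has_weak_deriv U b f g" and U: "open U" and b: "b : Basis"
  and f': "f' : borel_measurable borel" "AE z\<in>U in lborel. f z = f' z"
  and g': "g' : borel_measurable borel" "AE z\<in>U in lborel. g z = g' z"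
  and \<phi>: "test_function U \<phi>"
 shows "(LINT z|lborel. f' z * fd \<phi> z b) = - (LINT z|lborel. g' z * \<phi> z)"
proof -
 have "locally_integrable_on U f" "locally_integrable_on U g" using w by (auto simp: has_weak_deriv_def)
 from weak_deriv_borel_iff[OF U b this f' g'] w \<phi> show ?thesis by blast
qed

lemma mollifier_test_function:
 assumes "!!k. C_k k (%w. ker (z - w))" "!!z. z ~: cball 0 \<delta> ==> ker z = 0" "cball z \<delta> \<subseteq> U"
 shows "test_function U (%w. ker (z - w))"
proof -
 have b: "{w. ker (z - w) ~= 0} \<subseteq> cball z \<delta>"
 proof
  fix w assume "w : {w. ker (z - w) ~= 0}"
  then show "w : cball z \<delta>" using assms(2)[of "z - w"] by (auto simp: dist_norm norm_minus_commute)
 qed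
 from b have sub: "closure {w. ker (z - w) ~= 0} \<subseteq> cball z \<delta>" by (rule closure_minimal) simp
 then have "compact (closure {w. ker (z - w) ~= 0})"
  unfolding compact_closure by (intro bounded_subset[OF bounded_cball b])
 then show ?thesis using assms sub by (auto simp: test_function_def)
qed

lemma AE_zero_if_zero_on_compacts:
 fixes h :: "'a::euclidean_space => real"
 assumes "open U" "!!K. compact K ==> K \<subseteq> U ==> AE z\<in>K in lborel. h z = 0"
 shows "AE z\<in>U in lborel. h z = 0"
proof -
 obtain C :: "nat => 'a set" where C: "!!n. compact (C n)" "!!n. C n \<subseteq> U"
  "!!n. C n \<subseteq> interior (C (Suc n))" "\<Union>(range C) = U"
  using open_Union_compact_subsets[OF assms(1)] by metis
 have "AE z in lborel. ALL n. z : C n --> h z = 0"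
  unfolding AE_all_countable using assms(2) C by blast
 then show ?thesis by eventually_elim (use C(4) in blast)
qed

lemma AE_zero_if_conv_zero:
 fixes h :: "'a::euclidean_space => real"
 assumes h: "integrable lborel h" and ker: "!!n. mollifier (\<delta> n) (ker n)" and \<delta>: "\<delta> \<longlonglongrightarrow> 0"
  and ev: "\<forall>\<^sub>F n in sequentially. ALL z:K. conv h (ker n) z = 0" and K: "K : sets borel"
 shows "AE z\<in>K in lborel. h z = 0"
proof -
 have [measurable]: "h : borel_measurable borel" "K : sets borel" using h K by auto
 have "(\<integral>\<^sup>+z. ennreal \<bar>h z\<bar> * indicator K z \<partial>lborel) <= 0"
 proof (rule tendsto_lowerbound[OF conv_L1_tendsto[OF h ker \<delta>]])
  show "\<forall>\<^sub>F n in sequentially. (\<integral>\<^sup>+z. ennreal \<bar>h z\<bar> * indicator K z \<partial>lborel) <= (\<integral>\<^sup>+z. ennreal \<bar>conv h (ker n) z - h z\<bar> \<partial>lborel)"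
   using ev by eventually_elim (auto intro!: nn_integral_mono split: split_indicator)
 qed simp
 then have "(\<integral>\<^sup>+z. ennreal \<bar>h z\<bar> * indicator K z \<partial>lborel) = 0" by simp
 then have "AE z in lborel. ennreal \<bar>h z\<bar> * indicator K z = 0"
  by (subst (asm) nn_integral_0_iff_AE) auto
 then show ?thesis by eventually_elim (auto simp: indicator_def split: if_splits)
qed

text \<open>The fundamental lemma of the calculus of variations: reflected translates of the
  mollifier are test functions, so the convolutions with small radius vanish on K while they
  converge to h in L1.\<close>

lemma AE_zero_if_tested_zero:
 fixes h :: "real \<times> real => real"
 assumes U: "open U" and h: "L1loc U h"
  and z: "!!\<phi>. test_function U \<phi> ==> (LINT z|lborel. h z * \<phi> z) = 0"
 shows "AE z\<in>U in lborel. h z = 0"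
proof (rule AE_zero_if_zero_on_compacts[OF U])
 fix K assume K: "compact K" "K \<subseteq> U"
 obtain \<delta>0 K' V where K': "\<delta>0 > 0" "compact K'" "K' \<subseteq> U" "open V" "K \<subseteq> V" "!!z. z : V ==> cball z \<delta>0 \<subseteq> K'"
  using compact_nbhd[OF K(1) U K(2)] by metis
 obtain ker :: "nat => real \<times> real => real" and \<delta> where
  ker: "\<delta> \<longlonglongrightarrow> 0" "!!n. mollifier (\<delta> n) (ker n)" "!!n z. z ~: cball 0 (\<delta> n) ==> ker n z = 0" "!!n z k. C_k k (%w. ker n (z - w))"
  by (rule moll_seq_exists) blast
 have hi: "integrable lborel (%z. indicator K' z * h z)" using h K' by (auto simp: L1loc_def)
 have "\<forall>\<^sub>F n in sequentially. \<delta> n < \<delta>0" using ker(1) K'(1) by (rule order_tendstoD)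
 then have "\<forall>\<^sub>F n in sequentially. ALL z:K. conv (%z. indicator K' z * h z) (ker n) z = 0"
 proof eventually_elim
  case (elim n)
  show ?case
  proof
   fix z assume "z : K"
   then have "cball z \<delta>0 \<subseteq> K'" using K'(5) by (intro K'(6)) auto
   then have zK: "cball z (\<delta> n) \<subseteq> K'" using elim by (meson subset_cball less_imp_le order_trans)
   have "test_function U (%w. ker n (z - w))"
    by (rule mollifier_test_function[where \<delta>="\<delta> n"]) (use ker zK K'(3) in auto)
   from z[OF this] have "(LINT w|lborel. h w * ker n (z - w)) = 0" .
   moreover have "(%w. indicator K' w * h w * ker n (z - w)) = (%w. h w * ker n (z - w))"
   proof
    fix w
    show "indicator K' w * h w * ker n (z - w) = h w * ker n (z - w)"
    proof (cases "w : cball z (\<delta> n)")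
     case True
     then show ?thesis using subsetD[OF zK True] by simp
    next
     case False
     then have "ker n (z - w) = 0" by (intro ker(3)) (simp add: dist_norm norm_minus_commute)
     then show ?thesis by simp
    qed
   qed
   ultimately show "conv (%z. indicator K' z * h z) (ker n) z = 0" unfolding conv_def by simp
  qed
 qed
 from AE_zero_if_conv_zero[OF hi ker(2,1) this borel_compact[OF K(1)]]
 show "AE z\<in>K in lborel. h z = 0"
 proof eventually_elim
  case (elim z)
  have "z : K'" if "z : K"
  proof -
   have "cball z \<delta>0 \<subseteq> K'" using K'(5) that by (intro K'(6)) auto
   then show ?thesis using K'(1) by auto
  qed
  then show ?case using elim by auto
 qed
qed

lemma L1loc_diff: "L1loc U f ==> L1loc U g ==> L1loc U (%z. f z - g z)"
 unfolding L1loc_def by (auto simp: right_diff_distrib)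

lemma L1loc_times_integrable:
 assumes "L1loc U g" "compact S" "S \<subseteq> U" "continuous_on UNIV c" "!!z. z ~: S ==> c z = 0"
 shows "integrable lborel (%z. g z * c z)"
proof -
 have "bounded (c ` S)" by (intro compact_imp_bounded compact_continuous_image continuous_on_subset[OF assms(4)] assms) simp
 then obtain B where B: "ALL y:c ` S. norm y <= B" unfolding bounded_iff ..
 have m[measurable]: "g : borel_measurable borel" "c : borel_measurable borel"
  using assms(1) borel_measurable_continuous_onI[OF assms(4)] by (auto simp: L1loc_def)
 have "integrable lborel (%z. indicator S z * g z * B)" using assms by (auto simp: L1loc_def)
 then show ?thesis
 proof (rule Bochner_Integration.integrable_bound)
  show "AE z in lborel. norm (g z * c z) <= norm (indicator S z * g z * B)"
  proof (rule AE_I2)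
   fix z
   show "norm (g z * c z) <= norm (indicator S z * g z * B)"
   proof (cases "z : S")
    case True
    then have "\<bar>c z\<bar> <= \<bar>B\<bar>" using bspec[OF B imageI[OF True]] by simp
    then show ?thesis using True by (auto simp: abs_mult intro: mult_left_mono)
   qed (use assms(5) in simp)
  qed
 qed simp
qed

text \<open>The difference of the two derivatives integrates to 0 against every test function. Thus
  the choice made by \<open>weak_deriv\<close> is determined up to null sets.\<close>

lemma has_weak_deriv_unique:
 fixes f g g' :: "real \<times> real => real"
 assumes U: "open U" and b: "b : Basis" and w: "has_weak_deriv U b f g" "has_weak_deriv U b f' g'"
  and ff: "AE z in lebesgue_on U. f z = f' z"
 shows "AE z in lebesgue_on U. g z = g' z"
proof -
 obtain F where F: "L1loc U F" "AE z\<in>U in lborel. f z = F z"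
  using L1loc_rep_exists[OF U] w by (auto simp: has_weak_deriv_def)
 obtain G where G: "L1loc U G" "AE z\<in>U in lborel. g z = G z"
  using L1loc_rep_exists[OF U] w by (auto simp: has_weak_deriv_def)
 obtain G' where G': "L1loc U G'" "AE z\<in>U in lborel. g' z = G' z"
  using L1loc_rep_exists[OF U] w by (auto simp: has_weak_deriv_def)
 have F': "AE z\<in>U in lborel. f' z = F z"
  using ff[unfolded AE_lebesgue_on_iff[OF borel_open[OF U]]] F(2) by eventually_elim auto
 have "AE z\<in>U in lborel. G z - G' z = 0"
 proof (rule AE_zero_if_tested_zero[OF U L1loc_diff[OF G(1) G'(1)]])
  fix \<phi> :: "real \<times> real => real" assume \<phi>: "test_function U \<phi>"
  obtain S where S: "compact S" "S \<subseteq> U" "!!z. z ~: S ==> \<phi> z = 0" "continuous_on UNIV \<phi>"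
   using test_functionD[OF \<phi>] by metis
  have "(LINT z|lborel. G z * \<phi> z) = (LINT z|lborel. G' z * \<phi> z)"
   using weak_deriv_borel[OF w(1) U b _ F(2) _ G(2) \<phi>] weak_deriv_borel[OF w(2) U b _ F' _ G'(2) \<phi>] F(1) G(1) G'(1)
   by (simp add: L1loc_def)
  then show "(LINT z|lborel. (G z - G' z) * \<phi> z) = 0"
   using L1loc_times_integrable[OF G(1) S(1,2,4,3)] L1loc_times_integrable[OF G'(1) S(1,2,4,3)]
   by (simp add: left_diff_distrib)
 qed
 then have "AE z\<in>U in lborel. g z = g' z" using G(2) G'(2) by eventually_elim auto
 then show ?thesis using U by (simp add: AE_lebesgue_on_iff)
qed

section \<open>Local approximation by continuously differentiable functions\<close>

declare split_paired_All [simp del] split_paired_Ex [simp del]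

definition dL1 :: "(real * real) set => (real * real => real) => (real * real => real) => ennreal" where
 "dL1 K f g = (\<integral>\<^sup>+z. ennreal \<bar>f z - g z\<bar> * indicator K z \<partial>lborel)"

text \<open>Uniform convergence of values together with L1 convergence of derivatives passes to
  products. The domains depend on n because an approximant can be composed with a function of one
  variable only where its values allow it.\<close>

definition C1_approx :: "(real * real) set => (real * real => real) => (real * real => real) => (real * real => real) =>
 (nat => (real * real) set) => (nat => real * real => real) => (nat => real * real => real) => (nat => real * real => real) => bool" where
 "C1_approx K f g1 g2 V F F1 F2 \<longleftrightarrow> (ALL n. K \<subseteq> V n & C1_on (V n) (F n) (F1 n) (F2 n)) \<and>
  uniform_limit K F f sequentially & (%n. dL1 K (F1 n) g1) \<longlonglongrightarrow> 0 & (%n. dL1 K (F2 n) g2) \<longlonglongrightarrow> 0"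

text \<open>Meyers-Serrin type description of continuous functions with locally integrable weak
  gradient. The approximating sequence may depend on K, which keeps all arguments local.\<close>

definition sob :: "(real * real) set => (real * real => real) => (real * real => real) => (real * real => real) => bool" where
 "sob U f g1 g2 \<longleftrightarrow> open U & continuous_on U f & L1loc U g1 & L1loc U g2 \<and>
  (ALL K. compact K --> K \<subseteq> U --> (EX V F F1 F2. C1_approx K f g1 g2 V F F1 F2))"

lemma L1loc_indicator_continuous:
 assumes "open U" "continuous_on U f"
 shows "L1loc U (%z. indicator U z * f z)"
 unfolding L1loc_def
proof (intro conjI allI impI)
 show "(%z. indicator U z * f z) : borel_measurable borel"
  using borel_measurable_continuous_on_indicator[OF _ assms(2)] assms(1) by simp
 fix K assume K: "compact K & K \<subseteq> U"
 then have "integrable lborel (%z. indicator K z *\<^sub>R f z)"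
  by (intro borel_integrable_compact continuous_on_subset[OF assms(2)]) auto
 also have "(%z. indicator K z *\<^sub>R f z) = (%z. indicator K z * (indicator U z * f z))"
  using K by (auto simp: indicator_def fun_eq_iff)
 finally show "integrable lborel (%z. indicator K z * (indicator U z * f z))" .
qed

lemma locally_integrable_continuous:
 assumes "open U" "continuous_on U f"
 shows "locally_integrable_on U f"
 unfolding locally_integrable_on_def
proof (intro allI impI)
 fix K assume K: "compact K & K \<subseteq> U"
 have "integrable (lebesgue_on K) (%z. indicator U z * f z)"
  using locally_integrable_of_L1loc[OF L1loc_indicator_continuous[OF assms]] K by (simp add: locally_integrable_on_def)
 also have "integrable (lebesgue_on K) (%z. indicator U z * f z) \<longleftrightarrow> integrable (lebesgue_on K) f"
  using K by (intro Bochner_Integration.integrable_cong) auto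
 finally show "integrable (lebesgue_on K) f" .
qed

lemma conv_cong_on_support:
 fixes ker f g :: "'a::euclidean_space => real"
 assumes "!!w. w ~: cball 0 \<delta> ==> ker w = 0" "cball z \<delta> \<subseteq> K" "!!w. w : K ==> f w = g w"
 shows "f w * ker (z - w) = g w * ker (z - w)"
proof (cases "norm (z - w) <= \<delta>")
 case True
 then have "w : cball z \<delta>" by (simp add: dist_norm)
 then show ?thesis using assms(2,3) by auto
next
 case False
 then have "ker (z - w) = 0" by (intro assms(1)) simp
 then show ?thesis by simp
qed

text \<open>For radii below the room around K the derivative of the mollified function falls on the
  kernel, which is a test function in U, and the weak derivative takes it over: differentiation
  commutes with mollification near K.\<close>

lemma weak_imp_sob:
 assumes U: "open U" and f: "continuous_on U f"
  and w1: "has_weak_deriv U (1, 0) f g1" and w2: "has_weak_deriv U (0, 1) f g2"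
  and g1': "L1loc U g1'" "AE z\<in>U in lborel. g1 z = g1' z"
  and g2': "L1loc U g2'" "AE z\<in>U in lborel. g2 z = g2' z"
 shows "sob U f g1' g2'"
 unfolding sob_def
proof (intro conjI allI impI)
 fix K assume K: "compact K" "K \<subseteq> U"
 obtain \<delta>0 K' V where K': "\<delta>0 > 0" "compact K'" "K' \<subseteq> U" "open V" "K \<subseteq> V" "!!z. z : V ==> cball z \<delta>0 \<subseteq> K'"
  using compact_nbhd[OF K(1) U K(2)] by metis
 obtain ker ker1 ker2 :: "nat => real \<times> real => real" and \<delta> where
  \<delta>: "\<delta> \<longlonglongrightarrow> 0" and ker: "!!n. mollifier (\<delta> n) (ker n)" "!!n. C1_on UNIV (ker n) (ker1 n) (ker2 n)"
  and ker0: "!!n z. z ~: cball 0 (\<delta> n) ==> ker n z = 0" "!!n z. z ~: cball 0 (\<delta> n) ==> ker1 n z = 0" "!!n z. z ~: cball 0 (\<delta> n) ==> ker2 n z = 0"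
  and kerC: "!!n z k. C_k k (%w. ker n (z - w))"
  by (rule moll_seq_exists) blast
 have "\<forall>\<^sub>F n in sequentially. \<delta> n < \<delta>0" using \<delta> K'(1) by (rule order_tendstoD)
 \<comment> \<open>The index is shifted by N so that every member of the sequence is usable, as
   \<open>C1_approx\<close> demands.\<close>
 then obtain N where N: "!!n. \<delta> (n + N) < \<delta>0"
  by (auto simp: eventually_sequentially) (metis le_add2)
 define f' where "f' = (%z. indicator U z * f z)"
 have f': "L1loc U f'" unfolding f'_def by (rule L1loc_indicator_continuous[OF U f])
 have ff': "AE z\<in>U in lborel. f z = f' z" by (simp add: f'_def)
 define f0 where "f0 = (%z. indicator K' z * f' z)"
 define h1 where "h1 = (%z. indicator K' z * g1' z)"
 define h2 where "h2 = (%z. indicator K' z * g2' z)"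
 have i0: "integrable lborel f0" "integrable lborel h1" "integrable lborel h2"
  using f' g1' g2' K' unfolding f0_def h1_def h2_def L1loc_def by blast+
 have f0f: "f0 w = f w" if "w : K'" for w using that K'(3) by (auto simp: f0_def f'_def)
 have C1: "C1_on V (conv f0 (ker n)) (conv f0 (ker1 n)) (conv f0 (ker2 n))" for n
  using conv_C1[OF i0(1) ker(2) ker0] K'(4) by (auto simp: C1_on_def intro: continuous_on_subset)
 have ball: "cball z (\<delta> (n + N)) \<subseteq> K'" if "z : V" for z n
 proof -
  have "cball z \<delta>0 \<subseteq> K'" using that by (rule K'(6))
  then show ?thesis using N[of n] by (meson subset_cball less_imp_le order_trans)
 qed
 have eq: "conv f0 (ker1 (n + N)) z = conv h1 (ker (n + N)) z" "conv f0 (ker2 (n + N)) z = conv h2 (ker (n + N)) z" if z: "z : V" for n z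
 proof -
  let ?m = "n + N" and ?\<phi> = "%w. ker (n + N) (z - w)"
  note b = ball[OF z, of n]
  have t: "test_function U ?\<phi>"
   by (rule mollifier_test_function[where \<delta>="\<delta> ?m"]) (use kerC ker0 b K'(3) in auto)
  have "(ker ?m has_derivative (%h. ker1 ?m (z - w) * fst h + ker2 ?m (z - w) * snd h)) (at (z - w))" for w
   using ker(2)[of ?m] by (simp add: C1_on_def)
  \<comment> \<open>Differentiating in w brings a minus sign, which cancels the one in the
    definition of the weak derivative.\<close>
  then have d\<phi>: "(?\<phi> has_derivative (%h. ker1 ?m (z - w) * fst (- h) + ker2 ?m (z - w) * snd (- h))) (at w)" for w
   by (rule has_derivative_compose[of "%w. z - w" "%h. - h", rotated]) (auto intro!: derivative_eq_intros)
  have fd: "frechet_derivative ?\<phi> (at w) = (%h. ker1 ?m (z - w) * fst (- h) + ker2 ?m (z - w) * snd (- h))" for w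
   by (rule frechet_derivative_at[OF d\<phi>, symmetric])
  have c: "f0 w * ker1 ?m (z - w) = f' w * ker1 ?m (z - w)" "f0 w * ker2 ?m (z - w) = f' w * ker2 ?m (z - w)"
   "h1 w * ?\<phi> w = g1' w * ?\<phi> w" "h2 w * ?\<phi> w = g2' w * ?\<phi> w" for w
  proof -
   have s: "f w * k (z - w) = g w * k (z - w)"
    if "!!w. w ~: cball 0 (\<delta> ?m) ==> k w = 0" "!!w. w : K' ==> f w = g w" for k f g :: "real \<times> real => real"
    using that(1) b that(2) by (rule conv_cong_on_support)
   show "f0 w * ker1 ?m (z - w) = f' w * ker1 ?m (z - w)" by (rule s) (simp_all add: ker0 f0_def)
   show "f0 w * ker2 ?m (z - w) = f' w * ker2 ?m (z - w)" by (rule s) (simp_all add: ker0 f0_def)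
   show "h1 w * ?\<phi> w = g1' w * ?\<phi> w" by (rule s) (simp_all add: ker0 h1_def)
   show "h2 w * ?\<phi> w = g2' w * ?\<phi> w" by (rule s) (simp_all add: ker0 h2_def)
  qed
  have Bs: "(1, 0) : (Basis :: (real\<times>real) set)" "(0, 1) : (Basis :: (real\<times>real) set)"
   by (auto simp: Basis_prod_def)
  show "conv f0 (ker1 ?m) z = conv h1 (ker ?m) z"
   using weak_deriv_borel[OF w1 U Bs(1) _ ff' _ g1'(2) t] f' g1' unfolding conv_def fd c
   by (simp add: L1loc_def)
  show "conv f0 (ker2 ?m) z = conv h2 (ker ?m) z"
   using weak_deriv_borel[OF w2 U Bs(2) _ ff' _ g2'(2) t] f' g2' unfolding conv_def fd c
   by (simp add: L1loc_def)
 qed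
 have \<delta>N: "(%n. \<delta> (n + N)) \<longlonglongrightarrow> 0" using \<delta> by (rule LIMSEQ_ignore_initial_segment)
 have lim: "(%n. dL1 K (conv f0 (k (n + N))) g) \<longlonglongrightarrow> 0"
  if eq: "!!n z. z : V ==> conv f0 (k (n + N)) z = conv h (ker (n + N)) z" and h: "integrable lborel h" "h = (%z. indicator K' z * g z)" for k h g
 proof (rule tendsto_sandwich[OF _ _ tendsto_const conv_L1_tendsto[OF h(1) ker(1) \<delta>N]])
  have "dL1 K (conv f0 (k (n + N))) g <= (\<integral>\<^sup>+ z. ennreal \<bar>conv h (ker (n + N)) z - h z\<bar> \<partial>lborel)" for n
   unfolding dL1_def
  proof (rule nn_integral_mono)
   fix z
   show "ennreal \<bar>conv f0 (k (n + N)) z - g z\<bar> * indicator K z <= ennreal \<bar>conv h (ker (n + N)) z - h z\<bar>"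
   proof (cases "z : K")
    case True
    then have z: "z : V" using K'(5) by auto
    have "z : cball z \<delta>0" using K'(1) by simp
    then have "z : K'" using K'(6)[OF z] by blast
    then show ?thesis using True by (simp add: eq[OF z] h(2))
   qed simp
  qed
  then show "\<forall>\<^sub>F n in sequentially. dL1 K (conv f0 (k (n + N))) g <= (\<integral>\<^sup>+ z. ennreal \<bar>conv h (ker (n + N)) z - h z\<bar> \<partial>lborel)"
   by (intro always_eventually allI)
 qed simp
 have "uniform_limit K (%n. conv f0 (ker (n + N))) f sequentially"
  unfolding uniform_limit_iff
 proof (intro allI impI)
  fix e :: real assume e: "e > 0"
  have "uniformly_continuous_on K' f"
   by (intro compact_uniformly_continuous continuous_on_subset[OF f] K')
  then obtain d where d: "d > 0" "!!x y. x : K' ==> y : K' ==> dist y x < d ==> dist (f y) (f x) < e/2"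
   unfolding uniformly_continuous_on_def using e by (metis half_gt_zero)
  have "\<forall>\<^sub>F n in sequentially. \<delta> (n + N) < d" using \<delta>N d(1) by (rule order_tendstoD)
  then show "\<forall>\<^sub>F n in sequentially. ALL z:K. dist (conv f0 (ker (n + N)) z) (f z) < e"
  proof eventually_elim
   case (elim n)
   show ?case
   proof
    fix z assume z: "z : K"
    then have zV: "z : V" using K'(5) by auto
    have "z : cball z \<delta>0" using K'(1) by simp
    then have zK: "z : K'" using K'(6)[OF zV] by blast
    have "\<bar>conv f0 (ker (n + N)) z - f z\<bar> <= e/2"
    proof (rule conv_close[OF i0(1) ker(1)])
     fix w assume w: "dist z w <= \<delta> (n + N)"
     then have wK: "w : K'" using ball[OF zV, of n] by auto
     have "dist (f w) (f z) < e/2" using w elim by (intro d(2)[OF zK wK]) (simp add: dist_commute)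
     then show "\<bar>f0 w - f z\<bar> <= e/2" by (simp add: f0f[OF wK] dist_real_def)
    qed
    then show "dist (conv f0 (ker (n + N)) z) (f z) < e" using e by (simp add: dist_real_def)
   qed
  qed
 qed
 then have "C1_approx K f g1' g2' (%_. V) (%n. conv f0 (ker (n + N))) (%n. conv f0 (ker1 (n + N))) (%n. conv f0 (ker2 (n + N)))"
  unfolding C1_approx_def
  using lim[OF eq(1) i0(2) h1_def] lim[OF eq(2) i0(3) h2_def] C1 K'(5) by blast
 then show "EX V F F1 F2. C1_approx K f g1' g2' V F F1 F2" by blast
qed (use U f g1' g2' in auto)

section \<open>Integration by parts and the divergence theorem on rectangles\<close>

lemma integrable_compact_support:
 fixes f :: "'a::euclidean_space => real"
 assumes "continuous_on UNIV f" "!!z. z ~: cball 0 R ==> f z = 0"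
 shows "integrable lborel f"
proof -
 have "integrable lborel (%x. indicator (cball 0 R) x *\<^sub>R f x)"
  by (rule borel_integrable_compact) (auto intro: continuous_on_subset[OF assms(1)])
 also have "(%x. indicator (cball 0 R) x *\<^sub>R f x) = f"
  using assms(2) by (auto simp: fun_eq_iff indicator_def)
 finally show ?thesis .
qed

lemma integral_deriv_zero_1d:
 fixes G G' :: "real => real"
 assumes D: "!!x. (G has_real_derivative G' x) (at x)" and c: "continuous_on UNIV G'"
  and z: "!!x. \<bar>x\<bar> > R ==> G x = 0" "!!x. \<bar>x\<bar> > R ==> G' x = 0"
 shows "(LINT x|lborel. G' x) = 0"
proof -
 let ?S = "\<bar>R\<bar> + 1"
 have "(LINT x|lborel. indicator {-?S..?S} x *\<^sub>R G' x) = G ?S - G (- ?S)"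
  by (rule integral_FTC_Icc)
   (auto intro!: continuous_on_subset[OF c] has_field_derivative_at_within[OF D] simp: has_real_derivative_iff_has_vector_derivative[symmetric])
 also have "(%x. indicator {-?S..?S} x *\<^sub>R G' x) = G'"
 proof
  fix x show "indicator {-?S..?S} x *\<^sub>R G' x = G' x"
   using z(2)[of x] by (cases "x : {-?S..?S}") auto
 qed
 also have "G ?S - G (- ?S) = 0" using z(1)[of ?S] z(1)[of "-?S"] by simp
 finally show ?thesis .
qed

lemma C1_on_slices:
 assumes "C1_on V F F1 F2"
 shows "(x, y) : V ==> ((%x. F (x, y)) has_real_derivative F1 (x, y)) (at x)"
  "(x, y) : V ==> ((%y. F (x, y)) has_real_derivative F2 (x, y)) (at y)"
proof -
 assume "(x, y) : V"
 then have D: "(F has_derivative (%h. F1 (x, y) * fst h + F2 (x, y) * snd h)) (at (x, y))"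
  using assms by (simp add: C1_on_def)
 have "((%x. F (x, y)) has_derivative (%h. F1 (x, y) * fst (h, 0::real) + F2 (x, y) * snd (h, 0::real))) (at x)"
  by (rule has_derivative_compose[of "%x. (x, y)" "%h. (h, 0)" x UNIV F, OF _ D]) (auto intro!: derivative_eq_intros)
 then show "((%x. F (x, y)) has_real_derivative F1 (x, y)) (at x)"
  by (simp add: has_field_derivative_def)
 have "((%y. F (x, y)) has_derivative (%h. F1 (x, y) * fst (0::real, h) + F2 (x, y) * snd (0::real, h))) (at y)"
  by (rule has_derivative_compose[of "%y. (x, y)" "%h. (0, h)" y UNIV F, OF _ D]) (auto intro!: derivative_eq_intros)
 then show "((%y. F (x, y)) has_real_derivative F2 (x, y)) (at y)"
  by (simp add: has_field_derivative_def)
qed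

lemma integral_partial_zero:
 assumes G: "C1_on UNIV G G1 G2"
  and z: "!!z. z ~: cball 0 R ==> G z = 0" "!!z. z ~: cball 0 R ==> G1 z = 0" "!!z. z ~: cball 0 R ==> G2 z = 0"
 shows "(LINT z|lborel. G1 z) = 0" "(LINT z|lborel. G2 z) = 0"
proof -
 have c: "continuous_on UNIV G1" "continuous_on UNIV G2" using G by (auto simp: C1_on_def)
 have i: "integrable (lborel \<Otimes>\<^sub>M lborel) (%(x, y). G1 (x, y))" "integrable (lborel \<Otimes>\<^sub>M lborel) (%(x, y). G2 (x, y))"
  using integrable_compact_support[OF c(1) z(2)] integrable_compact_support[OF c(2) z(3)] by (simp_all add: lborel_prod)
 have out: "(x, y) ~: cball 0 R" if "\<bar>x\<bar> > R \<or> \<bar>y\<bar> > R" for x y :: real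
  using that norm_fst_le[of x y] norm_snd_le[of y x] by auto
 have "(LINT y|lborel. (LINT x|lborel. G1 (x, y))) = (LINT y|(lborel::real measure). 0)"
 proof (rule arg_cong[where f="%f. integral\<^sup>L lborel f"], rule ext)
  fix y show "(LINT x|lborel. G1 (x, y)) = 0"
   by (rule integral_deriv_zero_1d[OF C1_on_slices(1)[OF G], where R=R])
    (auto intro!: continuous_on_compose2[OF c(1)] continuous_intros z out)
 qed
 then show "(LINT z|lborel. G1 z) = 0" using lborel_pair.integral_snd[OF i(1)] by (simp add: lborel_prod)
 have "(LINT x|lborel. (LINT y|lborel. G2 (x, y))) = (LINT x|(lborel::real measure). 0)"
 proof (rule arg_cong[where f="%f. integral\<^sup>L lborel f"], rule ext)
  fix x show "(LINT y|lborel. G2 (x, y)) = 0"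
   by (rule integral_deriv_zero_1d[OF C1_on_slices(2)[OF G], where R=R])
    (auto intro!: continuous_on_compose2[OF c(2)] continuous_intros z out)
 qed
 then show "(LINT z|lborel. G2 z) = 0" using lborel_pair.integral_fst[OF i(2)] by (simp add: lborel_prod)
qed

lemma L1loc_AE_cong:
 assumes "L1loc U g" "g' : borel_measurable borel" "AE z\<in>U in lborel. g z = g' z"
 shows "L1loc U g'"
 unfolding L1loc_def
proof (intro conjI allI impI)
 fix K assume K: "compact K & K \<subseteq> U"
 have [measurable]: "g : borel_measurable borel" "K : sets borel" using assms K by (auto simp: L1loc_def borel_compact)
 have "integrable lborel (%z. indicator K z * g z)" using assms K by (auto simp: L1loc_def)
 also have "integrable lborel (%z. indicator K z * g z) \<longleftrightarrow> integrable lborel (%z. indicator K z * g' z)"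
 proof (rule integrable_cong_AE)
  show "AE z in lborel. indicator K z * g z = indicator K z * g' z"
   using assms(3) by eventually_elim (use K in \<open>auto simp: indicator_def\<close>)
 qed (use assms(2) in simp_all)
 finally show "integrable lborel (%z. indicator K z * g' z)" .
qed (use assms in simp)

lemma has_weak_deriv_cong:
 assumes w: "has_weak_deriv U b f g" and U: "open U" and b: "b : Basis"
  and f': "locally_integrable_on U f'" "AE z\<in>U in lborel. f z = f' z"
  and g': "locally_integrable_on U g'" "AE z\<in>U in lborel. g z = g' z"
 shows "has_weak_deriv U b f' g'"
proof -
 have loc: "locally_integrable_on U f" "locally_integrable_on U g" using w by (auto simp: has_weak_deriv_def)
 obtain F where F: "L1loc U F" "AE z\<in>U in lborel. f z = F z" using L1loc_rep_exists[OF U loc(1)] .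
 obtain G where G: "L1loc U G" "AE z\<in>U in lborel. g z = G z" using L1loc_rep_exists[OF U loc(2)] .
 have F': "AE z\<in>U in lborel. f' z = F z" using F(2) f'(2) by eventually_elim auto
 have G': "AE z\<in>U in lborel. g' z = G z" using G(2) g'(2) by eventually_elim auto
 have B: "F : borel_measurable borel" "G : borel_measurable borel" using F G by (auto simp: L1loc_def)
 show ?thesis
  using w weak_deriv_borel_iff[OF U b loc B(1) F(2) B(2) G(2)] weak_deriv_borel_iff[OF U b f'(1) g'(1) B(1) F' B(2) G']
  by simp
qed

text \<open>F is controlled only on V. Since \<phi> and its derivatives vanish off the compact set
  S, the product glued with 0 outside S is C1 on the whole plane.\<close>

lemma C1_on_cutoff:
 assumes F: "C1_on V F F1 F2" and \<phi>: "C1_on UNIV \<phi> \<phi>1 \<phi>2" and S: "compact S" "S \<subseteq> V"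
  and z: "!!z. z ~: S ==> \<phi> z = 0" "!!z. z ~: S ==> \<phi>1 z = 0" "!!z. z ~: S ==> \<phi>2 z = 0"
 shows "C1_on UNIV (%z. indicator S z * (F z * \<phi> z)) (%z. indicator S z * (F1 z * \<phi> z + F z * \<phi>1 z))
  (%z. indicator S z * (F2 z * \<phi> z + F z * \<phi>2 z))"
proof -
 have oS: "open (- S)" using S by (simp add: compact_imp_closed open_Compl)
 have V: "open V" "continuous_on V F" "continuous_on V F1" "continuous_on V F2"
  using F C1_on_continuous[OF F] by (auto simp: C1_on_def)
 have \<phi>c: "continuous_on V \<phi>" "continuous_on V \<phi>1" "continuous_on V \<phi>2"
  using C1_on_continuous[OF \<phi>] \<phi> by (auto simp: C1_on_def intro: continuous_on_subset)
 have cont: "continuous_on UNIV (%z. indicator S z * c z)"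
  if c: "continuous_on V c" "!!z. z ~: S ==> c z = 0" for c :: "real \<times> real => real"
 proof -
  have "continuous_on V (%z. indicator S z * c z)"
   by (rule continuous_on_eq[OF c(1)]) (use c(2) in \<open>auto simp: indicator_def\<close>)
  moreover have "continuous_on (- S) (%z. indicator S z * c z)"
   by (rule continuous_on_eq[of _ "%_. 0"]) auto
  ultimately have "continuous_on (V \<union> - S) (%z. indicator S z * c z)"
   by (intro continuous_on_open_Un V oS)
  moreover have "V \<union> - S = UNIV" using S by auto
  ultimately show ?thesis by simp
 qed
 show ?thesis
  unfolding C1_on_def
 proof (intro conjI ballI)
  show "continuous_on UNIV (%z. indicator S z * (F1 z * \<phi> z + F z * \<phi>1 z))"
   "continuous_on UNIV (%z. indicator S z * (F2 z * \<phi> z + F z * \<phi>2 z))"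
   by (rule cont, intro continuous_intros V \<phi>c, simp add: z)+
  fix w
  let ?D = "%h. indicator S w * (F1 w * \<phi> w + F w * \<phi>1 w) * fst h + indicator S w * (F2 w * \<phi> w + F w * \<phi>2 w) * snd h"
  show "((%z. indicator S z * (F z * \<phi> z)) has_derivative ?D) (at w)"
  proof (cases "w : V")
   case True
   have "(F has_derivative (%h. F1 w * fst h + F2 w * snd h)) (at w)" "(\<phi> has_derivative (%h. \<phi>1 w * fst h + \<phi>2 w * snd h)) (at w)"
    using F \<phi> True by (auto simp: C1_on_def)
   from has_derivative_mult[OF this]
   have "((%z. F z * \<phi> z) has_derivative ?D) (at w)"
    by (rule has_derivative_eq_rhs) (use z[of w] in \<open>auto simp: fun_eq_iff algebra_simps indicator_def\<close>)
   then show ?thesis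
    by (rule has_derivative_transform_within_open[OF _ V(1) True]) (use z(1) in \<open>auto simp: indicator_def\<close>)
  next
   case False
   then have w: "w : - S" using S by auto
   have "((%z. 0) has_derivative ?D) (at w)" using w by simp
   then show ?thesis
    by (rule has_derivative_transform_within_open[OF _ oS w]) auto
  qed
 qed simp
qed

lemma integrable_ind_continuous:
 fixes f :: "'a::euclidean_space => real"
 assumes "compact K" "continuous_on K f"
 shows "integrable lborel (%z. indicator K z * f z)"
 using borel_integrable_compact[OF assms] by simp

lemma dL1_integral_tendsto:
 assumes K: "compact K" and G: "!!n. continuous_on K (G n)" and g: "integrable lborel (%z. indicator K z * g z)"
  and c: "continuous_on UNIV c" and lim: "(%n. dL1 K (G n) g) \<longlonglongrightarrow> 0"
 shows "(%n. LINT z|lborel. indicator K z * (G n z * c z)) \<longlonglongrightarrow> (LINT z|lborel. indicator K z * (g z * c z))"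
proof -
 have [measurable]: "K : sets borel" "c : borel_measurable borel" "(%z. indicator K z * g z) : borel_measurable borel"
  using K g borel_measurable_continuous_onI[OF c] by (auto simp: borel_compact)
 have "bounded (c ` K)" using K by (intro compact_imp_bounded compact_continuous_image continuous_on_subset[OF c]) auto
 then obtain B0 where B0: "ALL y:c ` K. norm y <= B0" unfolding bounded_iff ..
 define B where "B = \<bar>B0\<bar>"
 have B: "\<bar>c z\<bar> <= B" "B \<ge> 0" if "z : K" for z using bspec[OF B0 imageI[OF that]] by (auto simp: B_def)
 have iG: "integrable lborel (%z. indicator K z * (G n z * c z))" for n
  by (intro integrable_ind_continuous K continuous_intros G continuous_on_subset[OF c]) auto
 have ig: "integrable lborel (%z. indicator K z * (g z * c z))"
 proof (rule Bochner_Integration.integrable_bound)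
  show "integrable lborel (%z. indicator K z * g z * B)" using g by simp
  show "(%z. indicator K z * (g z * c z)) : borel_measurable lborel"
   by (subst mult.assoc[symmetric]) measurable
  show "AE z in lborel. norm (indicator K z * (g z * c z)) <= norm (indicator K z * g z * B)"
   using B by (auto simp: abs_mult indicator_def intro!: mult_left_mono)
 qed
 have "(%n. ennreal (norm ((LINT z|lborel. indicator K z * (G n z * c z)) - (LINT z|lborel. indicator K z * (g z * c z))))) \<longlonglongrightarrow> ennreal 0"
 proof (rule tendsto_sandwich[OF _ _ tendsto_const])
  have "(%n. ennreal B * dL1 K (G n) g) \<longlonglongrightarrow> ennreal B * 0"
   by (intro ennreal_tendsto_cmult lim) simp
  then show "(%n. ennreal B * dL1 K (G n) g) \<longlonglongrightarrow> ennreal 0" by simp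
  have "ennreal (norm ((LINT z|lborel. indicator K z * (G n z * c z)) - (LINT z|lborel. indicator K z * (g z * c z)))) <= ennreal B * dL1 K (G n) g" for n
  proof -
   have Gm[measurable]: "(%z. indicator K z * G n z) : borel_measurable borel"
    using integrable_ind_continuous[OF K G] by auto
   have eq: "(%z. \<bar>G n z - g z\<bar> * indicator K z) = (%z. \<bar>indicator K z * G n z - indicator K z * g z\<bar>)"
    by (auto simp: indicator_def)
   have "(%z. \<bar>G n z - g z\<bar> * indicator K z) : borel_measurable lborel"
    unfolding eq by measurable
   then have m: "(%z. ennreal (\<bar>G n z - g z\<bar> * indicator K z)) : borel_measurable lborel"
    by (rule measurable_compose) simp
   have "ennreal (norm (LINT z|lborel. indicator K z * (G n z * c z) - indicator K z * (g z * c z)))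
    <= (\<integral>\<^sup>+z. ennreal (norm (indicator K z * (G n z * c z) - indicator K z * (g z * c z))) \<partial>lborel)"
    by (rule integral_norm_bound_ennreal) (intro Bochner_Integration.integrable_diff iG ig)
   also have "... <= (\<integral>\<^sup>+z. ennreal B * ennreal (\<bar>G n z - g z\<bar> * indicator K z) \<partial>lborel)"
   proof (rule nn_integral_mono)
    fix z
    show "ennreal (norm (indicator K z * (G n z * c z) - indicator K z * (g z * c z))) <= ennreal B * ennreal (\<bar>G n z - g z\<bar> * indicator K z)"
    proof (cases "z : K")
     case True
     have "\<bar>G n z - g z\<bar> * \<bar>c z\<bar> <= \<bar>G n z - g z\<bar> * B" using B(1)[OF True] by (intro mult_left_mono) auto
     then have "norm (indicator K z * (G n z * c z) - indicator K z * (g z * c z)) <= B * \<bar>G n z - g z\<bar>"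
      using True by (simp only: indicator_simps mult_1 left_diff_distrib[symmetric] real_norm_def abs_mult mult.commute[of B])
     then show ?thesis using True B(2)[OF True] by (simp add: ennreal_mult[symmetric] ennreal_leI)
    qed simp
   qed
   also have "... = ennreal B * dL1 K (G n) g"
    unfolding dL1_def using m by (subst nn_integral_cmult) (auto simp: ennreal_mult ennreal_indicator)
   finally show ?thesis by (subst (asm) Bochner_Integration.integral_diff[OF iG ig])
  qed
  then show "\<forall>\<^sub>F n in sequentially. ennreal (norm ((LINT z|lborel. indicator K z * (G n z * c z)) - (LINT z|lborel. indicator K z * (g z * c z)))) <= ennreal B * dL1 K (G n) g"
   by (intro always_eventually allI)
 qed simp
 then have "(%n. norm ((LINT z|lborel. indicator K z * (G n z * c z)) - (LINT z|lborel. indicator K z * (g z * c z)))) \<longlonglongrightarrow> 0"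
  by (rule tendsto_ennrealD) auto
 then show ?thesis by (subst (asm) tendsto_norm_zero_iff) (simp add: LIM_zero_iff)
qed

lemma uniform_limit_imp_dL1:
 assumes K: "compact K" and u: "uniform_limit K F f sequentially"
 shows "(%n. dL1 K (F n) f) \<longlonglongrightarrow> 0"
proof (rule ennreal_tendsto_0I)
 fix e :: real assume e: "e > 0"
 have fin: "emeasure lborel K < \<infinity>" using K by (intro emeasure_bounded_finite compact_imp_bounded)
 define M where "M = measure lborel K"
 have M: "emeasure lborel K = ennreal M" "M \<ge> 0"
  using fin by (auto simp: M_def emeasure_eq_ennreal_measure)
 have "\<forall>\<^sub>F n in sequentially. ALL z:K. dist (F n z) (f z) < e / (2 * (M + 1))"
  using u e M unfolding uniform_limit_iff by simp
 then show "\<forall>\<^sub>F n in sequentially. dL1 K (F n) f < ennreal e"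
 proof eventually_elim
  case (elim n)
  have "dL1 K (F n) f <= (\<integral>\<^sup>+z. ennreal (e / (2 * (M + 1))) * indicator K z \<partial>lborel)"
   unfolding dL1_def
  proof (rule nn_integral_mono)
   fix z show "ennreal \<bar>F n z - f z\<bar> * indicator K z <= ennreal (e / (2 * (M + 1))) * indicator K z"
    using elim by (cases "z : K") (auto simp: dist_real_def less_imp_le intro!: ennreal_leI)
  qed
  also have "... = ennreal (e / (2 * (M + 1)) * M)"
   using K M e by (simp add: nn_integral_cmult_indicator borel_compact ennreal_mult[symmetric])
  also have "... < ennreal e"
  proof -
   have "e * M < e * (2 * (M + 1))" using e M by (intro mult_strict_left_mono) auto
   then show ?thesis using M e by (simp add: ennreal_less_iff field_simps)
  qed
  finally show ?case .
 qed
qed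

lemma test_function_C1_on:
 fixes \<phi> :: "real \<times> real => real"
 assumes "test_function U \<phi>"
 shows "C1_on UNIV \<phi> (%z. fd \<phi> z (1, 0)) (%z. fd \<phi> z (0, 1))"
proof -
 obtain S where S: "!!z. (\<phi> has_derivative fd \<phi> z) (at z)"
  "!!b. b : Basis ==> continuous_on UNIV (%z. fd \<phi> z b)"
  using test_functionD[OF assms] by metis
 have "fd \<phi> z = (%h. fd \<phi> z (1, 0) * fst h + fd \<phi> z (0, 1) * snd h)" for z
 proof
  fix h :: "real \<times> real"
  have lin: "linear (fd \<phi> z)" using S(1) by (rule has_derivative_linear)
  have h: "h = fst h *\<^sub>R (1, 0) + snd h *\<^sub>R (0, 1)" by (cases h) simp
  show "fd \<phi> z h = fd \<phi> z (1, 0) * fst h + fd \<phi> z (0, 1) * snd h"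
   by (subst h) (simp only: linear_add[OF lin] linear_cmul[OF lin] real_scaleR_def mult.commute)
 qed
 then show ?thesis using S by (simp add: C1_on_def Basis_prod_def)
qed

text \<open>For an approximant times the test function the integral of a partial derivative is 0;
  the resulting identity passes to the limit because values converge uniformly and derivatives in
  L1.\<close>

lemma sob_tested:
 assumes s: "sob U f g1 g2" and \<phi>: "test_function U \<phi>"
 shows "(LINT z|lborel. (indicator U z * f z) * fd \<phi> z (1, 0)) = - (LINT z|lborel. g1 z * \<phi> z)"
  "(LINT z|lborel. (indicator U z * f z) * fd \<phi> z (0, 1)) = - (LINT z|lborel. g2 z * \<phi> z)"
proof -
 define \<phi>1 where "\<phi>1 = (%z. fd \<phi> z (1, 0))"
 define \<phi>2 where "\<phi>2 = (%z. fd \<phi> z (0, 1))"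
 obtain S where S: "compact S" "S \<subseteq> U" "!!z. z ~: S ==> \<phi> z = 0" "!!z b. z ~: S ==> fd \<phi> z b = 0"
  using test_functionD[OF \<phi>] by metis
 have S': "!!z. z ~: S ==> \<phi>1 z = 0" "!!z. z ~: S ==> \<phi>2 z = 0" by (auto simp: \<phi>1_def \<phi>2_def S)
 have C: "C1_on UNIV \<phi> \<phi>1 \<phi>2" unfolding \<phi>1_def \<phi>2_def by (rule test_function_C1_on[OF \<phi>])
 have cc: "continuous_on UNIV \<phi>" "continuous_on UNIV \<phi>1" "continuous_on UNIV \<phi>2"
  using C C1_on_continuous[OF C] by (auto simp: C1_on_def)
 obtain V F F1 F2 where A: "C1_approx S f g1 g2 V F F1 F2" using s S by (auto simp: sob_def)
 have Vn: "S \<subseteq> V n" "C1_on (V n) (F n) (F1 n) (F2 n)" for n using A by (auto simp: C1_approx_def)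
 have cF: "continuous_on S (F n)" "continuous_on S (F1 n)" "continuous_on S (F2 n)" for n
  using C1_on_continuous[OF Vn(2)] Vn[of n] by (auto simp: C1_on_def intro: continuous_on_subset)
 from compact_imp_bounded[OF S(1)] obtain R where "ALL x:S. norm x <= R" unfolding bounded_iff ..
 then have R: "S \<subseteq> cball 0 R" by auto
 have zero: "(LINT z|lborel. indicator S z * (F1 n z * \<phi> z + F n z * \<phi>1 z)) = 0"
  "(LINT z|lborel. indicator S z * (F2 n z * \<phi> z + F n z * \<phi>2 z)) = 0" for n
 proof -
  have R': "indicator S z * c = (0::real)" if "z ~: cball 0 R" for z c using R that by (auto simp: indicator_def)
  note C1_on_cutoff[OF Vn(2) C S(1) Vn(1) S(3) S']
  from integral_partial_zero[OF this R' R' R']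
  show "(LINT z|lborel. indicator S z * (F1 n z * \<phi> z + F n z * \<phi>1 z)) = 0"
   "(LINT z|lborel. indicator S z * (F2 n z * \<phi> z + F n z * \<phi>2 z)) = 0" by simp_all
 qed
 have i: "integrable lborel (%z. indicator S z * (F n z * \<phi>1 z))" "integrable lborel (%z. indicator S z * (F n z * \<phi>2 z))"
  "integrable lborel (%z. indicator S z * (F1 n z * \<phi> z))" "integrable lborel (%z. indicator S z * (F2 n z * \<phi> z))" for n
  by (intro integrable_ind_continuous S continuous_intros cF continuous_on_subset[OF cc(1)] continuous_on_subset[OF cc(2)] continuous_on_subset[OF cc(3)] subset_UNIV)+
 have e1: "(LINT z|lborel. indicator S z * (F n z * \<phi>1 z)) = - (LINT z|lborel. indicator S z * (F1 n z * \<phi> z))" for n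
  using zero(1)[of n] Bochner_Integration.integral_add[OF i(3) i(1), of n n] by (simp add: distrib_left)
 have e2: "(LINT z|lborel. indicator S z * (F n z * \<phi>2 z)) = - (LINT z|lborel. indicator S z * (F2 n z * \<phi> z))" for n
  using zero(2)[of n] Bochner_Integration.integral_add[OF i(4) i(2), of n n] by (simp add: distrib_left)
 have g: "integrable lborel (%z. indicator S z * g1 z)" "integrable lborel (%z. indicator S z * g2 z)"
  using s S by (auto simp: sob_def L1loc_def)
 have fi: "integrable lborel (%z. indicator S z * f z)"
  by (intro integrable_ind_continuous S continuous_on_subset[OF _ S(2)]) (use s in \<open>simp add: sob_def\<close>)
 have u: "uniform_limit S F f sequentially" and d: "(%n. dL1 S (F1 n) g1) \<longlonglongrightarrow> 0" "(%n. dL1 S (F2 n) g2) \<longlonglongrightarrow> 0"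
  using A by (auto simp: C1_approx_def)
 note l = dL1_integral_tendsto[OF S(1) cF(1) fi _ uniform_limit_imp_dL1[OF S(1) u]]
 note r1 = dL1_integral_tendsto[OF S(1) cF(2) g(1) cc(1) d(1)]
 note r2 = dL1_integral_tendsto[OF S(1) cF(3) g(2) cc(1) d(2)]
 have E: "(LINT z|lborel. indicator S z * (f z * \<phi>1 z)) = - (LINT z|lborel. indicator S z * (g1 z * \<phi> z))"
  "(LINT z|lborel. indicator S z * (f z * \<phi>2 z)) = - (LINT z|lborel. indicator S z * (g2 z * \<phi> z))"
  using LIMSEQ_unique[OF l[OF cc(2)]] tendsto_minus[OF r1] LIMSEQ_unique[OF l[OF cc(3)]] tendsto_minus[OF r2]
  by (simp_all add: e1 e2)
 have I: "(%z. indicator S z * (f z * \<phi>1 z)) = (%z. indicator U z * f z * \<phi>1 z)" "(%z. indicator S z * (f z * \<phi>2 z)) = (%z. indicator U z * f z * \<phi>2 z)"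
  "(%z. indicator S z * (g1 z * \<phi> z)) = (%z. g1 z * \<phi> z)" "(%z. indicator S z * (g2 z * \<phi> z)) = (%z. g2 z * \<phi> z)"
  using S(2,3) S' by (auto simp: fun_eq_iff indicator_def)
 show "(LINT z|lborel. (indicator U z * f z) * fd \<phi> z (1, 0)) = - (LINT z|lborel. g1 z * \<phi> z)"
  "(LINT z|lborel. (indicator U z * f z) * fd \<phi> z (0, 1)) = - (LINT z|lborel. g2 z * \<phi> z)"
  using E[unfolded I] unfolding \<phi>1_def \<phi>2_def by simp_all
qed

lemma Basis_plane: "(1, 0) : (Basis :: (real * real) set)" "(0, 1) : (Basis :: (real * real) set)"
 "b : (Basis :: (real * real) set) \<longleftrightarrow> b = (1, 0) \<or> b = (0, 1)"
 by (auto simp: Basis_prod_def)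

lemma sob_imp_weak:
 assumes s: "sob U f g1 g2"
 shows "has_weak_deriv U (1, 0) f g1" "has_weak_deriv U (0, 1) f g2"
proof -
 have U: "open U" "continuous_on U f" and g: "L1loc U g1" "L1loc U g2" using s by (auto simp: sob_def)
 note lf = locally_integrable_continuous[OF U]
 have f': "(%z. indicator U z * f z) : borel_measurable borel"
  using L1loc_indicator_continuous[OF U] by (simp add: L1loc_def)
 have ae: "AE z\<in>U in lborel. f z = indicator U z * f z" by simp
 show "has_weak_deriv U (1, 0) f g1"
  using weak_deriv_borel_iff[OF U(1) Basis_plane(1) lf locally_integrable_of_L1loc[OF g(1)] f' ae, of g1] g(1) sob_tested(1)[OF s]
  by (simp add: L1loc_def)
 show "has_weak_deriv U (0, 1) f g2"
  using weak_deriv_borel_iff[OF U(1) Basis_plane(2) lf locally_integrable_of_L1loc[OF g(2)] f' ae, of g2] g(2) sob_tested(2)[OF s]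
  by (simp add: L1loc_def)
qed

lemma integral_ind_continuous:
 fixes f :: "'a::euclidean_space => real"
 assumes "compact K" "continuous_on K f"
 shows "(LINT z|lborel. indicator K z * f z) = integral K f"
proof -
 have "set_integrable lborel K f" unfolding set_integrable_def using borel_integrable_compact[OF assms] .
 from set_borel_integral_eq_integral(2)[OF this] show ?thesis by (simp add: set_lebesgue_integral_def)
qed

lemma C1_on_rect:
 assumes F: "C1_on V F F1 F2" and V: "cbox (a, c) (b, d) \<subseteq> V" and ab: "a <= b" "c <= (d::real)"
 shows "integral (cbox (a, c) (b, d)) F1 = integral {c..d} (%y. F (b, y) - F (a, y))"
  "integral (cbox (a, c) (b, d)) F2 = integral {a..b} (%x. F (x, d) - F (x, c))"
proof -
 have c1: "continuous_on (cbox (a, c) (b, d)) F1" "continuous_on (cbox (a, c) (b, d)) F2"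
  using F V by (auto simp: C1_on_def intro: continuous_on_subset)
 have mem: "(x, y) : V" if "x : {a..b}" "y : {c..d}" for x y using V that by auto
 have "integral (cbox (a, c) (b, d)) F1 = integral (cbox a b) (%x. integral (cbox c d) (%y. F1 (x, y)))"
  by (rule integral_prod_continuous[OF c1(1)])
 also have "... = integral (cbox c d) (%y. integral (cbox a b) (%x. F1 (x, y)))"
  using integral_swap_continuous[of a c b d "%x y. F1 (x, y)"] c1(1) by simp
 also have "... = integral (cbox c d) (%y. F (b, y) - F (a, y))"
 proof (rule integral_cong)
  fix y assume y: "y : cbox c d"
  have "((%x. F1 (x, y)) has_integral F (b, y) - F (a, y)) {a..b}"
  proof (rule fundamental_theorem_of_calculus[OF ab(1)])
   fix x assume "x : {a..b}"
   then have "((%x. F (x, y)) has_real_derivative F1 (x, y)) (at x)"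
    using y by (intro C1_on_slices(1)[OF F] mem) auto
   then show "((%x. F (x, y)) has_vector_derivative F1 (x, y)) (at x within {a..b})"
    by (simp add: has_real_derivative_iff_has_vector_derivative has_vector_derivative_at_within)
  qed
  then show "integral (cbox a b) (%x. F1 (x, y)) = F (b, y) - F (a, y)" by (simp add: integral_unique)
 qed
 finally show "integral (cbox (a, c) (b, d)) F1 = integral {c..d} (%y. F (b, y) - F (a, y))" by simp
 have "integral (cbox (a, c) (b, d)) F2 = integral (cbox a b) (%x. integral (cbox c d) (%y. F2 (x, y)))"
  by (rule integral_prod_continuous[OF c1(2)])
 also have "... = integral (cbox a b) (%x. F (x, d) - F (x, c))"
 proof (rule integral_cong)
  fix x assume x: "x : cbox a b"
  have "((%y. F2 (x, y)) has_integral F (x, d) - F (x, c)) {c..d}"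
  proof (rule fundamental_theorem_of_calculus[OF ab(2)])
   fix y assume "y : {c..d}"
   then have "((%y. F (x, y)) has_real_derivative F2 (x, y)) (at y)"
    using x by (intro C1_on_slices(2)[OF F] mem) auto
   then show "((%y. F (x, y)) has_vector_derivative F2 (x, y)) (at y within {c..d})"
    by (simp add: has_real_derivative_iff_has_vector_derivative has_vector_derivative_at_within)
  qed
  then show "integral (cbox c d) (%y. F2 (x, y)) = F (x, d) - F (x, c)" by (simp add: integral_unique)
 qed
 finally show "integral (cbox (a, c) (b, d)) F2 = integral {a..b} (%x. F (x, d) - F (x, c))" by simp
qed

lemma uniform_limit_integral_tendsto:
 fixes f :: "nat => real => real"
 assumes "uniform_limit {a..b} f g sequentially" "!!n. continuous_on {a..b} (f n)"
 shows "(%n. integral {a..b} (f n)) \<longlonglongrightarrow> integral {a..b} g"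
proof -
 obtain I J where IJ: "!!n. (f n has_integral I n) {a..b}" "(g has_integral J) {a..b}" "I \<longlonglongrightarrow> J"
  using uniform_limit_integral[OF assms] by auto
 have "integral {a..b} (f n) = I n" for n using IJ(1) by (rule integral_unique)
 moreover have "integral {a..b} g = J" using IJ(2) by (rule integral_unique)
 ultimately show ?thesis using IJ(3) by simp
qed

text \<open>The edge integrals involve pointwise values, so it matters that the approximants
  converge uniformly on the closed rectangle and not merely in L1.\<close>

lemma sob_rect:
 assumes s: "sob U f g1 g2" and K: "cbox (a, c) (b, d) \<subseteq> U" and ab: "a <= b" "c <= (d::real)"
 shows "(LINT z|lborel. indicator (cbox (a, c) (b, d)) z * g1 z) = integral {c..d} (%y. f (b, y) - f (a, y))"
  "(LINT z|lborel. indicator (cbox (a, c) (b, d)) z * g2 z) = integral {a..b} (%x. f (x, d) - f (x, c))"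
proof -
 let ?K = "cbox (a, c) (b, d)"
 have cK: "compact ?K" by simp
 obtain V F F1 F2 where A: "C1_approx ?K f g1 g2 V F F1 F2" using s K cK by (force simp: sob_def)
 have Vn: "?K \<subseteq> V n" "C1_on (V n) (F n) (F1 n) (F2 n)" for n using A by (auto simp: C1_approx_def)
 have cF: "continuous_on ?K (F n)" "continuous_on ?K (F1 n)" "continuous_on ?K (F2 n)" for n
  using C1_on_continuous[OF Vn(2)] Vn[of n] by (auto simp: C1_on_def intro: continuous_on_subset)
 have g: "integrable lborel (%z. indicator ?K z * g1 z)" "integrable lborel (%z. indicator ?K z * g2 z)"
  using s K cK by (auto simp: sob_def L1loc_def)
 have u: "uniform_limit ?K F f sequentially" and d: "(%n. dL1 ?K (F1 n) g1) \<longlonglongrightarrow> 0" "(%n. dL1 ?K (F2 n) g2) \<longlonglongrightarrow> 0"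
  using A by (auto simp: C1_approx_def)
 have mem: "(x, y) : ?K" if "x : {a..b}" "y : {c..d}" for x y using that by auto
 have uy: "uniform_limit {c..d} (%n y. F n (x, y)) (%y. f (x, y)) sequentially" if "x : {a..b}" for x
  by (rule uniform_limit_compose'[OF u]) (use mem that in auto)
 have ux: "uniform_limit {a..b} (%n x. F n (x, y)) (%x. f (x, y)) sequentially" if "y : {c..d}" for y
  by (rule uniform_limit_compose'[OF u]) (use mem that in auto)
 have cy: "continuous_on {c..d} (%y. F n (x, y))" if "x : {a..b}" for n x
  by (rule continuous_on_compose2[OF cF(1)]) (use mem that in \<open>auto intro!: continuous_intros\<close>)
 have cx: "continuous_on {a..b} (%x. F n (x, y))" if "y : {c..d}" for n y
  by (rule continuous_on_compose2[OF cF(1)]) (use mem that in \<open>auto intro!: continuous_intros\<close>)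
 have "(%n. LINT z|lborel. indicator ?K z * F1 n z) \<longlonglongrightarrow> (LINT z|lborel. indicator ?K z * g1 z)"
  using dL1_integral_tendsto[OF cK cF(2) g(1) continuous_on_const[of UNIV 1] d(1)] by simp
 moreover have "(LINT z|lborel. indicator ?K z * F1 n z) = integral {c..d} (%y. F n (b, y) - F n (a, y))" for n
  using C1_on_rect(1)[OF Vn(2) Vn(1) ab] by (simp add: integral_ind_continuous[OF cK cF(2)])
 moreover have "(%n. integral {c..d} (%y. F n (b, y) - F n (a, y))) \<longlonglongrightarrow> integral {c..d} (%y. f (b, y) - f (a, y))"
  by (intro uniform_limit_integral_tendsto uniform_limit_minus continuous_intros uy cy) (use ab in auto)
 ultimately show "(LINT z|lborel. indicator ?K z * g1 z) = integral {c..d} (%y. f (b, y) - f (a, y))"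
  by (simp add: LIMSEQ_unique)
 have "(%n. LINT z|lborel. indicator ?K z * F2 n z) \<longlonglongrightarrow> (LINT z|lborel. indicator ?K z * g2 z)"
  using dL1_integral_tendsto[OF cK cF(3) g(2) continuous_on_const[of UNIV 1] d(2)] by simp
 moreover have "(LINT z|lborel. indicator ?K z * F2 n z) = integral {a..b} (%x. F n (x, d) - F n (x, c))" for n
  using C1_on_rect(2)[OF Vn(2) Vn(1) ab] by (simp add: integral_ind_continuous[OF cK cF(3)])
 moreover have "(%n. integral {a..b} (%x. F n (x, d) - F n (x, c))) \<longlonglongrightarrow> integral {a..b} (%x. f (x, d) - f (x, c))"
  by (intro uniform_limit_integral_tendsto uniform_limit_minus continuous_intros ux cx) (use ab in auto)
 ultimately show "(LINT z|lborel. indicator ?K z * g2 z) = integral {a..b} (%x. f (x, d) - f (x, c))"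
  by (simp add: LIMSEQ_unique)
qed

section \<open>Sums, products and compositions\<close>

lemma dL1_measurable:
 assumes "(%z. indicator K z * f z) : borel_measurable borel" "(%z. indicator K z * g z) : borel_measurable borel"
 shows "(%z. ennreal \<bar>f z - g z\<bar> * indicator K z) : borel_measurable lborel"
proof -
 have eq: "(%z. ennreal \<bar>f z - g z\<bar> * indicator K z) = (%z. ennreal \<bar>indicator K z * f z - indicator K z * g z\<bar>)"
  by (auto simp: indicator_def)
 have "(%z. indicator K z * f z - indicator K z * g z) : borel_measurable lborel" using assms by simp
 then have "(%z. \<bar>indicator K z * f z - indicator K z * g z\<bar>) : borel_measurable lborel" by (rule borel_measurable_abs)
 then show ?thesis unfolding eq by (rule measurable_compose) simp
qed

lemma dL1_add_tendsto:
 assumes m: "!!n. (%z. indicator K z * F n z) : borel_measurable borel" "(%z. indicator K z * f z) : borel_measurable borel"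
   "!!n. (%z. indicator K z * G n z) : borel_measurable borel" "(%z. indicator K z * g z) : borel_measurable borel"
  and lim: "(%n. dL1 K (F n) f) \<longlonglongrightarrow> 0" "(%n. dL1 K (G n) g) \<longlonglongrightarrow> 0"
 shows "(%n. dL1 K (%z. F n z + G n z) (%z. f z + g z)) \<longlonglongrightarrow> 0"
proof (rule tendsto_sandwich[OF _ _ tendsto_const])
 have "(%n. dL1 K (F n) f + dL1 K (G n) g) \<longlonglongrightarrow> 0 + 0" by (intro tendsto_add lim)
 then show "(%n. dL1 K (F n) f + dL1 K (G n) g) \<longlonglongrightarrow> 0" by simp
 have "dL1 K (%z. F n z + G n z) (%z. f z + g z) <= dL1 K (F n) f + dL1 K (G n) g" for n
 proof -
  have "dL1 K (%z. F n z + G n z) (%z. f z + g z)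
   <= (\<integral>\<^sup>+z. ennreal \<bar>F n z - f z\<bar> * indicator K z + ennreal \<bar>G n z - g z\<bar> * indicator K z \<partial>lborel)"
   unfolding dL1_def
  proof (rule nn_integral_mono)
   fix z
   have "\<bar>F n z + G n z - (f z + g z)\<bar> <= \<bar>F n z - f z\<bar> + \<bar>G n z - g z\<bar>" by linarith
   then have "ennreal \<bar>F n z + G n z - (f z + g z)\<bar> <= ennreal \<bar>F n z - f z\<bar> + ennreal \<bar>G n z - g z\<bar>"
    by (simp add: ennreal_plus[symmetric] ennreal_leI del: ennreal_plus)
   then show "ennreal \<bar>F n z + G n z - (f z + g z)\<bar> * indicator K z <= ennreal \<bar>F n z - f z\<bar> * indicator K z + ennreal \<bar>G n z - g z\<bar> * indicator K z"
    by (cases "z : K") auto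
  qed
  also have "... = dL1 K (F n) f + dL1 K (G n) g"
   unfolding dL1_def by (rule nn_integral_add) (intro dL1_measurable m)+
  finally show ?thesis .
 qed
 then show "\<forall>\<^sub>F n in sequentially. dL1 K (%z. F n z + G n z) (%z. f z + g z) <= dL1 K (F n) f + dL1 K (G n) g"
  by (intro always_eventually allI)
qed simp

lemma dL1_mult_tendsto:
 assumes K: "compact K" and c: "!!n. continuous_on K (c n)" "uniform_limit K c c' sequentially"
  and G: "!!n. continuous_on K (G n)" and g: "integrable lborel (%z. indicator K z * g z)"
  and lim: "(%n. dL1 K (G n) g) \<longlonglongrightarrow> 0"
 shows "(%n. dL1 K (%z. c n z * G n z) (%z. c' z * g z)) \<longlonglongrightarrow> 0"
proof (rule ennreal_tendsto_0I)
 fix e :: real assume e: "e > 0"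
 have c': "continuous_on K c'" by (rule uniform_limit_theorem[OF _ c(2)]) (auto intro: always_eventually c(1))
 have "bounded (c' ` K)" using K by (intro compact_imp_bounded compact_continuous_image c') auto
 then obtain B0 where B0: "ALL y:c' ` K. norm y <= B0" unfolding bounded_iff ..
 define B where "B = \<bar>B0\<bar> + 1"
 have B: "\<bar>c' z\<bar> <= B - 1" if "z : K" for z using bspec[OF B0 imageI[OF that]] by (auto simp: B_def)
 have B1: "B > 0" by (simp add: B_def)
 define M where "M = (LINT z|lborel. \<bar>indicator K z * g z\<bar>)"
 have M: "(\<integral>\<^sup>+z. ennreal \<bar>indicator K z * g z\<bar> \<partial>lborel) = ennreal M" "M \<ge> 0"
  using g by (auto simp: M_def intro!: nn_integral_eq_integral)
 \<comment> \<open>The difference splits as c n (G n - g) + (c n - c') g: e' <= 1 bounds |c n| by B,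
   and e' M < e/2 controls the second term.\<close>
 define e' where "e' = min 1 (e / (2 * (M + 1)))"
 have e': "e' > 0" "e' <= 1" "e' * M < e / 2"
 proof -
  show "e' > 0" "e' <= 1" using e M by (auto simp: e'_def)
  have "e' * M <= e / (2 * (M + 1)) * M" using M by (intro mult_right_mono) (auto simp: e'_def)
  also have "... < e / 2" using e M by (simp add: field_simps)
  finally show "e' * M < e / 2" .
 qed
 have "\<forall>\<^sub>F n in sequentially. ALL z:K. dist (c n z) (c' z) < e'" using c(2) e' unfolding uniform_limit_iff by blast
 moreover have "\<forall>\<^sub>F n in sequentially. dL1 K (G n) g < ennreal (e / (2 * B))"
  using lim by (rule order_tendstoD) (use e B1 in simp)
 ultimately show "\<forall>\<^sub>F n in sequentially. dL1 K (%z. c n z * G n z) (%z. c' z * g z) < ennreal e"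
 proof eventually_elim
  case (elim n)
  have gm: "(%z. indicator K z * g z) : borel_measurable borel" using g by auto
  have Gm: "(%z. indicator K z * G n z) : borel_measurable borel" using integrable_ind_continuous[OF K G] by auto
  have m1: "(%z. ennreal \<bar>G n z - g z\<bar> * indicator K z) : borel_measurable lborel" by (rule dL1_measurable[OF Gm gm])
  have m2: "(%z. ennreal \<bar>indicator K z * g z\<bar>) : borel_measurable lborel" using gm by simp
  have "dL1 K (%z. c n z * G n z) (%z. c' z * g z) <=
   (\<integral>\<^sup>+z. ennreal B * (ennreal \<bar>G n z - g z\<bar> * indicator K z) + ennreal e' * ennreal \<bar>indicator K z * g z\<bar> \<partial>lborel)"
   unfolding dL1_def
  proof (rule nn_integral_mono)
   fix z
   show "ennreal \<bar>c n z * G n z - c' z * g z\<bar> * indicator K z <= ennreal B * (ennreal \<bar>G n z - g z\<bar> * indicator K z) + ennreal e' * ennreal \<bar>indicator K z * g z\<bar>"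
   proof (cases "z : K")
    case True
    have cc: "\<bar>c n z - c' z\<bar> <= e'" using elim True by (force simp: dist_real_def)
    then have cB: "\<bar>c n z\<bar> <= B" using B[OF True] e' by linarith
    have "c n z * G n z - c' z * g z = c n z * (G n z - g z) + (c n z - c' z) * g z" by (simp add: algebra_simps)
    then have "\<bar>c n z * G n z - c' z * g z\<bar> <= \<bar>c n z\<bar> * \<bar>G n z - g z\<bar> + \<bar>c n z - c' z\<bar> * \<bar>g z\<bar>"
     by (metis abs_mult abs_triangle_ineq)
    also have "... <= B * \<bar>G n z - g z\<bar> + e' * \<bar>g z\<bar>" using cc cB by (intro add_mono mult_right_mono) auto
    finally have "ennreal \<bar>c n z * G n z - c' z * g z\<bar> <= ennreal (B * \<bar>G n z - g z\<bar> + e' * \<bar>g z\<bar>)" by (rule ennreal_leI)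
    also have "... = ennreal B * ennreal \<bar>G n z - g z\<bar> + ennreal e' * ennreal \<bar>g z\<bar>"
     using B1 e' by (simp add: ennreal_plus ennreal_mult)
    finally show ?thesis using True by simp
   qed simp
  qed
  also have "... = ennreal B * dL1 K (G n) g + ennreal e' * ennreal M"
   unfolding dL1_def M(1)[symmetric]
   using m1 m2 by (simp add: nn_integral_add nn_integral_cmult)
  also have "... <= ennreal B * ennreal (e / (2 * B)) + ennreal e' * ennreal M"
   using elim by (intro add_right_mono mult_left_mono) (auto intro: less_imp_le)
  also have "... = ennreal (e / 2 + e' * M)"
   using B1 e e' M by (simp add: ennreal_mult[symmetric] ennreal_plus[symmetric] del: ennreal_plus)
  also have "... < ennreal e" using e' e M by (intro ennreal_lessI) auto
  finally show ?case .
 qed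
qed

lemma C1_on_compose_real:
 assumes F: "C1_on V F F1 F2" and I: "open I" "!!t. t : I ==> (\<theta> has_real_derivative \<theta>' t) (at t)" "continuous_on I \<theta>'"
 shows "C1_on {z\<in>V. F z : I} (%z. \<theta> (F z)) (%z. \<theta>' (F z) * F1 z) (%z. \<theta>' (F z) * F2 z)"
 unfolding C1_on_def
proof (intro conjI ballI)
 have V: "open V" "continuous_on V F" "continuous_on V F1" "continuous_on V F2"
  using F C1_on_continuous[OF F] by (auto simp: C1_on_def)
 have "{z\<in>V. F z : I} = V \<inter> F -` I" by auto
 then show "open {z\<in>V. F z : I}" using continuous_open_preimage[OF V(2,1) I(1)] by simp
 have c: "continuous_on {z\<in>V. F z : I} (%z. \<theta>' (F z))"
  by (rule continuous_on_compose2[OF I(3)]) (auto intro: continuous_on_subset[OF V(2)])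
 show "continuous_on {z\<in>V. F z : I} (%z. \<theta>' (F z) * F1 z)" "continuous_on {z\<in>V. F z : I} (%z. \<theta>' (F z) * F2 z)"
  using c V(3,4) by (auto intro!: continuous_on_mult intro: continuous_on_subset)
 fix z assume z: "z : {z\<in>V. F z : I}"
 have "((%z. \<theta> (F z)) has_derivative (%h. \<theta>' (F z) * (F1 z * fst h + F2 z * snd h))) (at z)"
  by (rule has_derivative_compose[of F "%h. F1 z * fst h + F2 z * snd h" z UNIV \<theta>])
   (use F z I(2)[of "F z"] in \<open>auto simp: C1_on_def has_field_derivative_def\<close>)
 then show "((%z. \<theta> (F z)) has_derivative (%h. \<theta>' (F z) * F1 z * fst h + \<theta>' (F z) * F2 z * snd h)) (at z)"
  by (simp add: algebra_simps)
qed

lemma L1loc_mult_continuous: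
 assumes g: "L1loc U g" and c: "continuous_on U c" and U: "open U"
 shows "L1loc U (%z. indicator U z * (c z * g z))"
 unfolding L1loc_def
proof (intro conjI allI impI)
 have m[measurable]: "(%z. indicator U z * c z) : borel_measurable borel" "g : borel_measurable borel"
  using g L1loc_indicator_continuous[OF U c] by (auto simp: L1loc_def)
 have "(%z. (indicator U z * c z) * g z) : borel_measurable borel" by measurable
 then show bm: "(%z. indicator U z * (c z * g z)) : borel_measurable borel" by (simp add: mult.assoc)
 fix K assume K: "compact K & K \<subseteq> U"
 then have [measurable]: "K : sets borel" by (simp add: borel_compact)
 have "bounded (c ` K)" using K by (intro compact_imp_bounded compact_continuous_image continuous_on_subset[OF c]) auto
 then obtain B where B: "ALL y:c ` K. norm y <= B" unfolding bounded_iff ..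
 have "integrable lborel (%z. (indicator K z * g z) * B)" using g K by (auto simp: L1loc_def)
 then show "integrable lborel (%z. indicator K z * (indicator U z * (c z * g z)))"
 proof (rule Bochner_Integration.integrable_bound)
  show "(%z. indicator K z * (indicator U z * (c z * g z))) : borel_measurable lborel" using bm by simp
  show "AE z in lborel. norm (indicator K z * (indicator U z * (c z * g z))) <= norm ((indicator K z * g z) * B)"
  proof (rule AE_I2)
   fix z
   show "norm (indicator K z * (indicator U z * (c z * g z))) <= norm ((indicator K z * g z) * B)"
   proof (cases "z : K")
    case True
    then have "\<bar>c z\<bar> <= \<bar>B\<bar>" using bspec[OF B imageI[OF True]] by simp
    then have "\<bar>c z\<bar> * \<bar>g z\<bar> <= \<bar>B\<bar> * \<bar>g z\<bar>" by (rule mult_right_mono) simp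
    then show ?thesis using True K by (auto simp: abs_mult mult.commute)
   qed simp
  qed
 qed
qed

lemma dL1_cong: "(!!z. z : K ==> g z = g' z) ==> dL1 K f g = dL1 K f g'"
 unfolding dL1_def by (intro nn_integral_cong) (auto simp: indicator_def)

text \<open>\<theta> is given only on I. A compact neighbourhood J of f(K) inside I contains the
  values on K of all late approximants, and on J both \<theta> and its derivative are uniformly
  continuous.\<close>

lemma sob_compose_real:
 assumes s: "sob U f g1 g2" and I: "open I" "!!t. t : I ==> (\<theta> has_real_derivative \<theta>' t) (at t)" "continuous_on I \<theta>'"
  and fI: "f ` U \<subseteq> I"
 shows "sob U (%z. \<theta> (f z)) (%z. indicator U z * (\<theta>' (f z) * g1 z)) (%z. indicator U z * (\<theta>' (f z) * g2 z))"
 unfolding sob_def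
proof (intro conjI allI impI)
 have U: "open U" "continuous_on U f" and g: "L1loc U g1" "L1loc U g2" using s by (auto simp: sob_def)
 then show "open U" by simp
 have c\<theta>: "continuous_on I \<theta>" using I(2) by (auto intro!: continuous_at_imp_continuous_on DERIV_isCont)
 show "continuous_on U (%z. \<theta> (f z))" by (rule continuous_on_compose2[OF c\<theta> U(2) fI])
 have c': "continuous_on U (%z. \<theta>' (f z))" by (rule continuous_on_compose2[OF I(3) U(2) fI])
 show "L1loc U (%z. indicator U z * (\<theta>' (f z) * g1 z))" "L1loc U (%z. indicator U z * (\<theta>' (f z) * g2 z))"
  by (rule L1loc_mult_continuous[OF _ c' U(1)], fact)+
 fix K assume K: "compact K" "K \<subseteq> U"
 obtain V F F1 F2 where A: "C1_approx K f g1 g2 V F F1 F2" using s K by (auto simp: sob_def)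
 have Vn: "K \<subseteq> V n" "C1_on (V n) (F n) (F1 n) (F2 n)" for n using A by (auto simp: C1_approx_def)
 have u: "uniform_limit K F f sequentially" and d: "(%n. dL1 K (F1 n) g1) \<longlonglongrightarrow> 0" "(%n. dL1 K (F2 n) g2) \<longlonglongrightarrow> 0"
  using A by (auto simp: C1_approx_def)
 have cfK: "compact (f ` K)" by (intro compact_continuous_image continuous_on_subset[OF U(2)] K)
 obtain \<delta> J W where J: "\<delta> > 0" "compact J" "J \<subseteq> I" "open W" "f ` K \<subseteq> W" "!!t. t : W ==> cball t \<delta> \<subseteq> J"
  by (rule compact_nbhd[OF cfK I(1)]) (use fI K in blast)+
 have "\<forall>\<^sub>F n in sequentially. ALL z:K. dist (F n z) (f z) < \<delta>" using u J(1) unfolding uniform_limit_iff by blast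
 then obtain N where N: "!!n z. n \<ge> N ==> z : K ==> dist (F n z) (f z) < \<delta>"
  unfolding eventually_sequentially by blast
 have FJ: "F (n + N) z : J" if "z : K" for n z
 proof -
  have "cball (f z) \<delta> \<subseteq> J" using that J(5) by (intro J(6)) auto
  moreover have "F (n + N) z : cball (f z) \<delta>" using N[of "n + N" z] that by (simp add: dist_commute)
  ultimately show ?thesis by blast
 qed
 have uN: "uniform_limit K (%n. F (n + N)) f sequentially"
  using u unfolding uniform_limit_iff by (auto intro: eventually_all_ge_at_top sequentially_offset)
 have clJ: "closed J" using J(2) by (rule compact_imp_closed)
 have uc: "uniformly_continuous_on J \<theta>" "uniformly_continuous_on J \<theta>'"
  by (intro compact_uniformly_continuous J continuous_on_subset[OF c\<theta>] continuous_on_subset[OF I(3)])+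
 have ev: "\<forall>\<^sub>F n in sequentially. ALL z:K. F (n + N) z : J" using FJ by (intro always_eventually) auto
 have u\<theta>: "uniform_limit K (%n z. \<theta> (F (n + N) z)) (%z. \<theta> (f z)) sequentially"
  by (rule uniform_limit_compose_uniformly_continuous_on[OF uN uc(1) ev clJ])
 have u\<theta>': "uniform_limit K (%n z. \<theta>' (F (n + N) z)) (%z. \<theta>' (f z)) sequentially"
  by (rule uniform_limit_compose_uniformly_continuous_on[OF uN uc(2) ev clJ])
 let ?V = "%n. {z\<in>V (n + N). F (n + N) z : I}"
 have C: "C1_on (?V n) (%z. \<theta> (F (n + N) z)) (%z. \<theta>' (F (n + N) z) * F1 (n + N) z) (%z. \<theta>' (F (n + N) z) * F2 (n + N) z)" for n
  by (rule C1_on_compose_real[OF Vn(2) I])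
 have KV: "K \<subseteq> ?V n" for n using Vn(1) FJ J(3) by auto
 have cF: "continuous_on K (F1 n)" "continuous_on K (F2 n)" "continuous_on K (F n)" for n
  using Vn(1)[of n] Vn(2)[of n] C1_on_continuous[OF Vn(2)[of n]] by (auto simp: C1_on_def intro: continuous_on_subset)
 have c\<theta>F: "continuous_on K (%z. \<theta>' (F (n + N) z))" for n
  by (rule continuous_on_compose2[OF I(3) cF(3)]) (use FJ J(3) in auto)
 have gi: "integrable lborel (%z. indicator K z * g1 z)" "integrable lborel (%z. indicator K z * g2 z)"
  using g K by (auto simp: L1loc_def)
 have ind: "indicator U z * x = (x::real)" if "z : K" for z x using that K by auto
 have "(%n. dL1 K (%z. \<theta>' (F (n + N) z) * F1 (n + N) z) (%z. \<theta>' (f z) * g1 z)) \<longlonglongrightarrow> 0"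
  by (rule dL1_mult_tendsto[OF K(1) c\<theta>F u\<theta>' cF(1) gi(1) LIMSEQ_ignore_initial_segment[OF d(1)]])
 then have d1: "(%n. dL1 K (%z. \<theta>' (F (n + N) z) * F1 (n + N) z) (%z. indicator U z * (\<theta>' (f z) * g1 z))) \<longlonglongrightarrow> 0"
  by (simp add: ind cong: dL1_cong)
 have "(%n. dL1 K (%z. \<theta>' (F (n + N) z) * F2 (n + N) z) (%z. \<theta>' (f z) * g2 z)) \<longlonglongrightarrow> 0"
  by (rule dL1_mult_tendsto[OF K(1) c\<theta>F u\<theta>' cF(2) gi(2) LIMSEQ_ignore_initial_segment[OF d(2)]])
 then have d2: "(%n. dL1 K (%z. \<theta>' (F (n + N) z) * F2 (n + N) z) (%z. indicator U z * (\<theta>' (f z) * g2 z))) \<longlonglongrightarrow> 0"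
  by (simp add: ind cong: dL1_cong)
 show "EX V F F1 F2. C1_approx K (%z. \<theta> (f z)) (%z. indicator U z * (\<theta>' (f z) * g1 z)) (%z. indicator U z * (\<theta>' (f z) * g2 z)) V F F1 F2"
  by (rule exI[of _ ?V], intro exI[of _ "%n z. \<theta> (F (n + N) z)"] exI[of _ "%n z. \<theta>' (F (n + N) z) * F1 (n + N) z"] exI[of _ "%n z. \<theta>' (F (n + N) z) * F2 (n + N) z"])
   (unfold C1_approx_def, use C KV u\<theta> d1 d2 in blast)
qed

section \<open>Sobolev functions in the plane\<close>

lemma dL1_cong_AE:
 assumes "AE z\<in>K in lborel. g z = g' z"
 shows "dL1 K f g = dL1 K f g'"
 unfolding dL1_def by (intro nn_integral_cong_AE) (use assms in eventually_elim, auto simp: indicator_def)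

lemma sob_cong:
 assumes s: "sob U f g1 g2" and f: "!!z. z : U ==> f z = f' z"
  and g1: "g1' : borel_measurable borel" "AE z\<in>U in lborel. g1 z = g1' z"
  and g2: "g2' : borel_measurable borel" "AE z\<in>U in lborel. g2 z = g2' z"
 shows "sob U f' g1' g2'"
 unfolding sob_def
proof (intro conjI allI impI)
 show "open U" using s by (simp add: sob_def)
 show "continuous_on U f'" using s f by (auto simp: sob_def cong: continuous_on_cong)
 show "L1loc U g1'" "L1loc U g2'" using s L1loc_AE_cong[OF _ g1] L1loc_AE_cong[OF _ g2] by (auto simp: sob_def)
 fix K assume K: "compact K" "K \<subseteq> U"
 obtain V F F1 F2 where A: "C1_approx K f g1 g2 V F F1 F2" using s K by (auto simp: sob_def)
 have e1: "dL1 K (F1 n) g1' = dL1 K (F1 n) g1" for n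
  by (rule dL1_cong_AE) (use g1(2) K in \<open>auto elim: eventually_mono\<close>)
 have e2: "dL1 K (F2 n) g2' = dL1 K (F2 n) g2" for n
  by (rule dL1_cong_AE) (use g2(2) K in \<open>auto elim: eventually_mono\<close>)
 have u: "uniform_limit K F f' sequentially"
  unfolding uniform_limit_iff
 proof (intro allI impI)
  fix e :: real assume "e > 0"
  then have "\<forall>\<^sub>F n in sequentially. ALL z:K. dist (F n z) (f z) < e"
   using A unfolding C1_approx_def uniform_limit_iff by blast
  then show "\<forall>\<^sub>F n in sequentially. ALL z:K. dist (F n z) (f' z) < e"
  proof eventually_elim
   case (elim n)
   have "f z = f' z" if "z : K" for z using that K by (intro f) auto
   then show ?case using elim by simp
  qed
 qed
 have "C1_approx K f' g1' g2' V F F1 F2" using A u by (simp add: C1_approx_def e1 e2)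
 then show "EX V F F1 F2. C1_approx K f' g1' g2' V F F1 F2" by blast
qed

lemma C1_on_add:
 assumes "C1_on V F F1 F2" "C1_on W G G1 G2"
 shows "C1_on (V \<inter> W) (%z. F z + G z) (%z. F1 z + G1 z) (%z. F2 z + G2 z)"
 unfolding C1_on_def
proof (intro conjI ballI)
 show "open (V \<inter> W)" using assms by (auto simp: C1_on_def)
 show "continuous_on (V \<inter> W) (%z. F1 z + G1 z)" "continuous_on (V \<inter> W) (%z. F2 z + G2 z)"
  using assms by (auto simp: C1_on_def intro!: continuous_on_add intro: continuous_on_subset)
 fix z assume "z : V \<inter> W"
 then have "(F has_derivative (%h. F1 z * fst h + F2 z * snd h)) (at z)" "(G has_derivative (%h. G1 z * fst h + G2 z * snd h)) (at z)"
  using assms by (auto simp: C1_on_def)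
 from has_derivative_add[OF this]
 show "((%z. F z + G z) has_derivative (%h. (F1 z + G1 z) * fst h + (F2 z + G2 z) * snd h)) (at z)"
  by (simp add: algebra_simps)
qed

lemma sob_add:
 assumes sf: "sob U f f1 f2" and sg: "sob U g g1 g2"
 shows "sob U (%z. f z + g z) (%z. f1 z + g1 z) (%z. f2 z + g2 z)"
 unfolding sob_def
proof (intro conjI allI impI)
 show "open U" "continuous_on U (%z. f z + g z)" using sf sg by (auto simp: sob_def intro: continuous_on_add)
 show "L1loc U (%z. f1 z + g1 z)" "L1loc U (%z. f2 z + g2 z)"
  using sf sg by (auto simp: sob_def L1loc_def distrib_left)
 fix K assume K: "compact K" "K \<subseteq> U"
 obtain V F F1 F2 where A: "C1_approx K f f1 f2 V F F1 F2" using sf K by (auto simp: sob_def)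
 obtain W G G1 G2 where B: "C1_approx K g g1 g2 W G G1 G2" using sg K by (auto simp: sob_def)
 have m: "(%z. indicator K z * f1 z) : borel_measurable borel" "(%z. indicator K z * g1 z) : borel_measurable borel"
  "(%z. indicator K z * f2 z) : borel_measurable borel" "(%z. indicator K z * g2 z) : borel_measurable borel"
  using sf sg K unfolding sob_def L1loc_def by (auto intro!: borel_measurable_times borel_measurable_indicator simp: borel_compact)
 have mF: "(%z. indicator K z * F1 n z) : borel_measurable borel" "(%z. indicator K z * F2 n z) : borel_measurable borel" for n
 proof -
  have "continuous_on K (F1 n)" "continuous_on K (F2 n)"
   using A unfolding C1_approx_def C1_on_def by (meson continuous_on_subset)+
  from integrable_ind_continuous[OF K(1) this(1)] integrable_ind_continuous[OF K(1) this(2)]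
  show "(%z. indicator K z * F1 n z) : borel_measurable borel" "(%z. indicator K z * F2 n z) : borel_measurable borel" by auto
 qed
 have mG: "(%z. indicator K z * G1 n z) : borel_measurable borel" "(%z. indicator K z * G2 n z) : borel_measurable borel" for n
 proof -
  have "continuous_on K (G1 n)" "continuous_on K (G2 n)"
   using B unfolding C1_approx_def C1_on_def by (meson continuous_on_subset)+
  from integrable_ind_continuous[OF K(1) this(1)] integrable_ind_continuous[OF K(1) this(2)]
  show "(%z. indicator K z * G1 n z) : borel_measurable borel" "(%z. indicator K z * G2 n z) : borel_measurable borel" by auto
 qed
 have d: "(%n. dL1 K (%z. F1 n z + G1 n z) (%z. f1 z + g1 z)) \<longlonglongrightarrow> 0" "(%n. dL1 K (%z. F2 n z + G2 n z) (%z. f2 z + g2 z)) \<longlonglongrightarrow> 0"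
  using A B unfolding C1_approx_def
  by (auto intro: dL1_add_tendsto[OF mF(1) m(1) mG(1) m(2)] dL1_add_tendsto[OF mF(2) m(3) mG(2) m(4)])
 have u: "uniform_limit K (%n z. F n z + G n z) (%z. f z + g z) sequentially"
  using A B unfolding C1_approx_def by (auto intro: uniform_limit_add)
 have KV: "K \<subseteq> V n \<inter> W n" "C1_on (V n \<inter> W n) (%z. F n z + G n z) (%z. F1 n z + G1 n z) (%z. F2 n z + G2 n z)" for n
  using A B unfolding C1_approx_def by (auto intro: C1_on_add)
 show "EX V F F1 F2. C1_approx K (%z. f z + g z) (%z. f1 z + g1 z) (%z. f2 z + g2 z) V F F1 F2"
  by (rule exI[of _ "%n. V n \<inter> W n"], rule exI[of _ "%n z. F n z + G n z"], rule exI[of _ "%n z. F1 n z + G1 n z"], rule exI[of _ "%n z. F2 n z + G2 n z"])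
   (unfold C1_approx_def, use KV d u in blast)
qed

lemma sob_C1:
 assumes C: "C1_on U f f1 f2"
 shows "sob U f (%z. indicator U z * f1 z) (%z. indicator U z * f2 z)"
 unfolding sob_def
proof (intro conjI allI impI)
 show "open U" "continuous_on U f" using C C1_on_continuous[OF C] by (simp_all add: C1_on_def)
 show "L1loc U (%z. indicator U z * f1 z)" "L1loc U (%z. indicator U z * f2 z)"
  using C by (auto simp: C1_on_def intro: L1loc_indicator_continuous)
 fix K assume K: "compact K" "K \<subseteq> U"
 have "dL1 K f1 (%z. indicator U z * f1 z) = dL1 K f1 f1" "dL1 K f2 (%z. indicator U z * f2 z) = dL1 K f2 f2"
  using K by (auto intro!: dL1_cong)
 then have "C1_approx K f (%z. indicator U z * f1 z) (%z. indicator U z * f2 z) (%_. U) (%_. f) (%_. f1) (%_. f2)"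
  using C K by (simp add: C1_approx_def dL1_def uniform_limit_const)
 then show "EX V F F1 F2. C1_approx K f (%z. indicator U z * f1 z) (%z. indicator U z * f2 z) V F F1 F2" by blast
qed

text \<open>Derivatives are prescribed only almost everywhere, so that calculus rules can be stated
  with the natural formulas, without indicators or Borel representatives.\<close>

definition sobolev :: "(real * real) set => (real * real => real) => (real * real => real) => (real * real => real) => bool" where
 "sobolev U f g1 g2 \<longleftrightarrow> (EX g1' g2'. sob U f g1' g2' & (AE z\<in>U in lborel. g1 z = g1' z) & (AE z\<in>U in lborel. g2 z = g2' z))"

lemma sobolev_open: "sobolev U f g1 g2 ==> open U" and sobolev_continuous: "sobolev U f g1 g2 ==> continuous_on U f"
 by (auto simp: sobolev_def sob_def)

lemma sobolev_cong:
 assumes "sobolev U f g1 g2" "!!z. z : U ==> f z = f' z"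
  "AE z\<in>U in lborel. g1 z = g1' z" "AE z\<in>U in lborel. g2 z = g2' z"
 shows "sobolev U f' g1' g2'"
proof -
 obtain G1 G2 where G: "sob U f G1 G2" "AE z\<in>U in lborel. g1 z = G1 z" "AE z\<in>U in lborel. g2 z = G2 z"
  using assms(1) by (auto simp: sobolev_def)
 have "sob U f' G1 G2" by (rule sob_cong[OF G(1) assms(2)]) (use G(1) in \<open>auto simp: sob_def L1loc_def\<close>)
 moreover have "AE z\<in>U in lborel. g1' z = G1 z" using G(2) assms(3) by eventually_elim auto
 moreover have "AE z\<in>U in lborel. g2' z = G2 z" using G(3) assms(4) by eventually_elim auto
 ultimately show ?thesis by (auto simp: sobolev_def)
qed

lemma sobolev_cong':
 assumes "sobolev U f g1 g2" "!!z. z : U ==> f z = f' z" "!!z. z : U ==> g1 z = g1' z" "!!z. z : U ==> g2 z = g2' z"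
 shows "sobolev U f' g1' g2'"
 using assms(1,2) by (rule sobolev_cong) (use assms(3,4) in auto)

lemma sobolev_C1: "C1_on U f f1 f2 ==> sobolev U f f1 f2"
 unfolding sobolev_def by (intro exI conjI, rule sob_C1) auto

lemma sobolev_const: "open U ==> sobolev U (%_. c) (%_. 0) (%_. 0)"
 by (rule sobolev_C1) (auto simp: C1_on_def)

lemma sobolev_add:
 assumes "sobolev U f f1 f2" "sobolev U g g1 g2"
 shows "sobolev U (%z. f z + g z) (%z. f1 z + g1 z) (%z. f2 z + g2 z)"
proof -
 obtain F1 F2 where F: "sob U f F1 F2" "AE z\<in>U in lborel. f1 z = F1 z" "AE z\<in>U in lborel. f2 z = F2 z"
  using assms(1) by (auto simp: sobolev_def)
 obtain G1 G2 where G: "sob U g G1 G2" "AE z\<in>U in lborel. g1 z = G1 z" "AE z\<in>U in lborel. g2 z = G2 z"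
  using assms(2) by (auto simp: sobolev_def)
 have "AE z\<in>U in lborel. f1 z + g1 z = F1 z + G1 z" using F(2) G(2) by eventually_elim auto
 moreover have "AE z\<in>U in lborel. f2 z + g2 z = F2 z + G2 z" using F(3) G(3) by eventually_elim auto
 ultimately show ?thesis using sob_add[OF F(1) G(1)] unfolding sobolev_def by blast
qed

lemma sobolev_compose_real:
 assumes s: "sobolev U f g1 g2" and I: "open I" "!!t. t : I ==> (\<theta> has_real_derivative \<theta>' t) (at t)" "continuous_on I \<theta>'"
  and fI: "!!z. z : U ==> f z : I"
 shows "sobolev U (%z. \<theta> (f z)) (%z. \<theta>' (f z) * g1 z) (%z. \<theta>' (f z) * g2 z)"
proof -
 obtain G1 G2 where G: "sob U f G1 G2" "AE z\<in>U in lborel. g1 z = G1 z" "AE z\<in>U in lborel. g2 z = G2 z"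
  using s by (auto simp: sobolev_def)
 have "AE z\<in>U in lborel. \<theta>' (f z) * g1 z = indicator U z * (\<theta>' (f z) * G1 z)" using G(2) by eventually_elim auto
 moreover have "AE z\<in>U in lborel. \<theta>' (f z) * g2 z = indicator U z * (\<theta>' (f z) * G2 z)" using G(3) by eventually_elim auto
 ultimately show ?thesis using sob_compose_real[OF G(1) I] fI unfolding sobolev_def by blast
qed

lemma sobolev_cmult:
 assumes "sobolev U f g1 g2"
 shows "sobolev U (%z. c * f z) (%z. c * g1 z) (%z. c * g2 z)"
 by (rule sobolev_compose_real[OF assms, of UNIV "%t. c * t" "%_. c"]) (auto intro!: derivative_eq_intros)

lemma sobolev_minus: "sobolev U f g1 g2 ==> sobolev U (%z. - f z) (%z. - g1 z) (%z. - g2 z)"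
 using sobolev_cmult[of U f g1 g2 "-1"] by simp

lemma sobolev_diff:
 assumes "sobolev U f f1 f2" "sobolev U g g1 g2"
 shows "sobolev U (%z. f z - g z) (%z. f1 z - g1 z) (%z. f2 z - g2 z)"
 using sobolev_add[OF assms(1) sobolev_minus[OF assms(2)]] by simp

lemma sobolev_square:
 assumes "sobolev U f g1 g2"
 shows "sobolev U (%z. (f z)\<^sup>2) (%z. 2 * f z * g1 z) (%z. 2 * f z * g2 z)"
 by (rule sobolev_compose_real[OF assms, of UNIV "%t. t\<^sup>2" "%t. 2 * t"]) (auto intro!: derivative_eq_intros continuous_intros)

text \<open>Polarisation reduces products to squares, so that only compositions with functions of
 one real variable are needed.\<close>

lemma sobolev_mult:
 assumes "sobolev U f f1 f2" "sobolev U g g1 g2"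
 shows "sobolev U (%z. f z * g z) (%z. f1 z * g z + f z * g1 z) (%z. f2 z * g z + f z * g2 z)"
proof -
 have "sobolev U (%z. (1/4) * ((f z + g z)\<^sup>2 - (f z - g z)\<^sup>2))
  (%z. (1/4) * (2 * (f z + g z) * (f1 z + g1 z) - 2 * (f z - g z) * (f1 z - g1 z)))
  (%z. (1/4) * (2 * (f z + g z) * (f2 z + g2 z) - 2 * (f z - g z) * (f2 z - g2 z)))"
  by (intro sobolev_cmult sobolev_diff sobolev_square sobolev_add assms)
 then show ?thesis by (rule sobolev_cong') (simp_all add: power2_eq_square algebra_simps)
qed

lemma sobolev_inverse:
 assumes "sobolev U f g1 g2" "!!z. z : U ==> f z ~= 0"
 shows "sobolev U (%z. inverse (f z)) (%z. - g1 z / (f z)\<^sup>2) (%z. - g2 z / (f z)\<^sup>2)"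
proof -
 have "sobolev U (%z. inverse (f z)) (%z. - ((inverse (f z))\<^sup>2) * g1 z) (%z. - ((inverse (f z))\<^sup>2) * g2 z)"
  by (rule sobolev_compose_real[OF assms(1), of "- {0}" inverse "%t. - ((inverse t)\<^sup>2)"])
   (use assms(2) in \<open>auto intro!: derivative_eq_intros continuous_intros simp: power2_eq_square\<close>)
 then show ?thesis by (rule sobolev_cong') (auto simp: power_inverse divide_inverse)
qed

lemma sobolev_sqrt:
 assumes "sobolev U f g1 g2" "!!z. z : U ==> f z > 0"
 shows "sobolev U (%z. sqrt (f z)) (%z. g1 z / (2 * sqrt (f z))) (%z. g2 z / (2 * sqrt (f z)))"
proof -
 have "sobolev U (%z. sqrt (f z)) (%z. (inverse (sqrt (f z)) / 2) * g1 z) (%z. (inverse (sqrt (f z)) / 2) * g2 z)"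
  by (rule sobolev_compose_real[OF assms(1), of "{0<..}" sqrt "%t. inverse (sqrt t) / 2"])
   (use assms(2) in \<open>auto intro!: DERIV_real_sqrt continuous_intros\<close>)
 then show ?thesis by (rule sobolev_cong') (simp_all add: field_simps)
qed

lemma sobolev_of_weak:
 assumes U: "open U" and f: "continuous_on U f"
  and w: "has_weak_deriv U (1, 0) f g1" "has_weak_deriv U (0, 1) f g2"
 shows "sobolev U f g1 g2"
proof -
 have l: "locally_integrable_on U g1" "locally_integrable_on U g2" using w by (auto simp: has_weak_deriv_def)
 obtain G1 where G1: "L1loc U G1" "AE z\<in>U in lborel. g1 z = G1 z" using L1loc_rep_exists[OF U l(1)] .
 obtain G2 where G2: "L1loc U G2" "AE z\<in>U in lborel. g2 z = G2 z" using L1loc_rep_exists[OF U l(2)] .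
 show ?thesis using weak_imp_sob[OF U f w G1 G2] G1(2) G2(2) unfolding sobolev_def by blast
qed

lemma weak_deriv_works: "has_weak_deriv U b f g ==> has_weak_deriv U b f (weak_deriv U b f)"
 unfolding weak_deriv_def by (rule someI[of "has_weak_deriv U b f" g])

text \<open>The representative f' may differ from f on a null set. This is what evaluates
  \<open>wd1 U (wd1 U f)\<close>, whose inner function is a mere choice and need not be
  continuous.\<close>

lemma sobolev_weak_deriv:
 assumes s: "sobolev U f g1 g2" and f': "locally_integrable_on U f'" "AE z\<in>U in lborel. f z = f' z"
 shows "has_weak_deriv U (1, 0) f' (wd1 U f')" "has_weak_deriv U (0, 1) f' (wd2 U f')"
  "AE z\<in>U in lborel. wd1 U f' z = g1 z" "AE z\<in>U in lborel. wd2 U f' z = g2 z"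
proof -
 have U: "open U" using s by (rule sobolev_open)
 obtain G1 G2 where G: "sob U f G1 G2" "AE z\<in>U in lborel. g1 z = G1 z" "AE z\<in>U in lborel. g2 z = G2 z"
  using s by (auto simp: sobolev_def)
 have l: "locally_integrable_on U G1" "locally_integrable_on U G2" using G(1) by (auto simp: sob_def intro: locally_integrable_of_L1loc)
 have w1: "has_weak_deriv U (1, 0) f' G1"
  by (rule has_weak_deriv_cong[OF sob_imp_weak(1)[OF G(1)] U Basis_plane(1) f' l(1)]) simp
 have w2: "has_weak_deriv U (0, 1) f' G2"
  by (rule has_weak_deriv_cong[OF sob_imp_weak(2)[OF G(1)] U Basis_plane(2) f' l(2)]) simp
 show wd: "has_weak_deriv U (1, 0) f' (wd1 U f')" "has_weak_deriv U (0, 1) f' (wd2 U f')"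
  using w1 w2 by (auto intro: weak_deriv_works)
 have "AE z in lebesgue_on U. wd1 U f' z = G1 z"
  by (rule has_weak_deriv_unique[OF U Basis_plane(1) wd(1) w1]) simp
 then have "AE z\<in>U in lborel. wd1 U f' z = G1 z" using U by (simp add: AE_lebesgue_on_iff)
 then show "AE z\<in>U in lborel. wd1 U f' z = g1 z" using G(2) by eventually_elim auto
 have "AE z in lebesgue_on U. wd2 U f' z = G2 z"
  by (rule has_weak_deriv_unique[OF U Basis_plane(2) wd(2) w2]) simp
 then have "AE z\<in>U in lborel. wd2 U f' z = G2 z" using U by (simp add: AE_lebesgue_on_iff)
 then show "AE z\<in>U in lborel. wd2 U f' z = g2 z" using G(3) by eventually_elim auto
qed

lemma sobolev_wd:
 assumes s: "sobolev U f g1 g2"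
 shows "has_weak_deriv U (1, 0) f (wd1 U f)" "has_weak_deriv U (0, 1) f (wd2 U f)"
  "AE z\<in>U in lborel. wd1 U f z = g1 z" "AE z\<in>U in lborel. wd2 U f z = g2 z"
 by (rule sobolev_weak_deriv[OF s locally_integrable_continuous[OF sobolev_open[OF s] sobolev_continuous[OF s]]]; simp)+

section \<open>Fibre-preserving changes of variables\<close>

text \<open>Fluid domain and strip are both of this form, with bottom -d or p0 and top \<eta> or 0;
  one theory then serves both directions of the hodograph transform.\<close>

definition subgraph :: "real => (real => real) => (real * real) set" where
 "subgraph l u = {(x, y). l < y & y < u x}"

lemma mem_subgraph [simp]: "(x, y) : subgraph l u \<longleftrightarrow> l < y & y < u x"
 by (simp add: subgraph_def)

text \<open>The substitution rule gives equality with the factor k', and k' >= m costs the factor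
  1/m. Compact subintervals come first because k' is continuous only inside; monotone convergence
  does the rest.\<close>

lemma nn_integral_substitution_le:
 fixes F :: "real => ennreal"
 assumes F[measurable]: "F : borel_measurable borel" and m: "m > 0"
  and d: "!!y. l < y ==> y < u ==> (k has_real_derivative k' y) (at y)"
  and c: "continuous_on {l<..<u} k'" and k': "!!y. l < y ==> y < u ==> m <= k' y"
 shows "(\<integral>\<^sup>+y. F (k y) * indicator {l<..<u} y \<partial>lborel) <= ennreal (1 / m) * (\<integral>\<^sup>+t. F t \<partial>lborel)"
proof (cases "l < u")
 case True
 have ck: "continuous_on {l<..<u} k" using d by (auto intro!: continuous_at_imp_continuous_on DERIV_isCont)
 have Fk: "(%y. F (k y) * indicator A y) : borel_measurable borel" if "A : sets borel" "A \<subseteq> {l<..<u}" for A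
 proof -
  have "(%y. indicator {l<..<u} y *\<^sub>R k y) : borel_measurable borel"
   by (rule borel_measurable_continuous_on_indicator[OF _ ck]) simp
  then have "(%y. F (indicator {l<..<u} y *\<^sub>R k y) * indicator A y) : borel_measurable borel" using that by measurable
  also have "(%y. F (indicator {l<..<u} y *\<^sub>R k y) * indicator A y) = (%y. F (k y) * indicator A y)"
   using that(2) by (auto simp: indicator_def fun_eq_iff)
  finally show ?thesis .
 qed
 have compact_case: "(\<integral>\<^sup>+y. F (k y) * indicator {a..b} y \<partial>lborel) <= ennreal (1 / m) * (\<integral>\<^sup>+t. F t \<partial>lborel)"
  if ab: "l < a" "a < b" "b < u" for a b
 proof -
  have sub: "{a..b} \<subseteq> {l<..<u}" using ab by auto
  have "ennreal m * (\<integral>\<^sup>+y. F (k y) * indicator {a..b} y \<partial>lborel) = (\<integral>\<^sup>+y. ennreal m * (F (k y) * indicator {a..b} y) \<partial>lborel)"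
   by (rule nn_integral_cmult[symmetric]) (use Fk[OF _ sub] in simp)
  also have "... <= (\<integral>\<^sup>+y. F (k y) * ennreal (k' y) * indicator {a..b} y \<partial>lborel)"
  proof (rule nn_integral_mono)
   fix y
   show "ennreal m * (F (k y) * indicator {a..b} y) <= F (k y) * ennreal (k' y) * indicator {a..b} y"
   proof (cases "y : {a..b}")
    case True
    then have "ennreal m <= ennreal (k' y)" using ab by (intro ennreal_leI k') auto
    then have "ennreal m * F (k y) <= ennreal (k' y) * F (k y)" by (rule mult_right_mono) simp
    then show ?thesis using True by (simp add: mult.commute)
   qed simp
  qed
  also have "... = (\<integral>\<^sup>+t. F t * indicator {k a..k b} t \<partial>lborel)"
  proof (rule nn_integral_substitution_aux[symmetric, OF F _ _ _ _ ab(2)])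
   show "continuous_on {a..b} k'" by (rule continuous_on_subset[OF c sub])
   fix y assume "y : {a..b}"
   then show "(k has_real_derivative k' y) (at y)" "0 <= k' y" using ab d[of y] k'[of y] m by auto
  qed simp
  also have "... <= (\<integral>\<^sup>+t. F t \<partial>lborel)" by (intro nn_integral_mono) (auto simp: indicator_def)
  finally have le: "ennreal m * (\<integral>\<^sup>+y. F (k y) * indicator {a..b} y \<partial>lborel) <= (\<integral>\<^sup>+t. F t \<partial>lborel)" .
  have "(\<integral>\<^sup>+y. F (k y) * indicator {a..b} y \<partial>lborel) = ennreal (1 / m) * (ennreal m * (\<integral>\<^sup>+y. F (k y) * indicator {a..b} y \<partial>lborel))"
   using m by (simp add: mult.assoc[symmetric] ennreal_mult[symmetric])
  also have "... <= ennreal (1 / m) * (\<integral>\<^sup>+t. F t \<partial>lborel)" by (rule mult_left_mono[OF le]) simp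
  finally show ?thesis .
 qed
 \<comment> \<open>The offset 3 keeps a n < b n from the start.\<close>
 define a where "a = (%n::nat. l + (u - l) / real (n + 3))"
 define b where "b = (%n::nat. u - (u - l) / real (n + 3))"
 have ab: "l < a n" "a n < b n" "b n < u" for n
 proof -
  define q where "q = (u - l) / real (n + 3)"
  have "q <= (u - l) / 3" unfolding q_def using True by (intro divide_left_mono) auto
  moreover have "0 < q" unfolding q_def using True by simp
  ultimately have q: "0 < q" "3 * q <= u - l" by auto
  have "l + q < u - q" using q by linarith
  with q show "l < a n" "a n < b n" "b n < u" unfolding a_def b_def q_def by auto
 qed
 have step: "(u - l) / real (Suc n + 3) <= (u - l) / real (n + 3)" for n
  using True by (intro divide_left_mono) auto
 then have mono: "a (Suc n) <= a n" "b n <= b (Suc n)" for n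
  using step[of n] by (simp_all add: a_def b_def)
 have lim0: "(%n. (u - l) / real (n + 3)) \<longlonglongrightarrow> 0"
  by (rule LIMSEQ_ignore_initial_segment[OF lim_const_over_n])
 have la: "a \<longlonglongrightarrow> l" using tendsto_add[OF tendsto_const[of l] lim0] by (simp add: a_def)
 have lb: "b \<longlonglongrightarrow> u" using tendsto_diff[OF tendsto_const[of u] lim0] by (simp add: b_def)
 have "(%n. \<integral>\<^sup>+y. F (k y) * indicator {a n..b n} y \<partial>lborel) \<longlonglongrightarrow> (\<integral>\<^sup>+y. F (k y) * indicator {l<..<u} y \<partial>lborel)"
 proof (rule nn_integral_LIMSEQ)
  show "incseq (%n y. F (k y) * indicator {a n..b n} y)"
  proof (rule incseq_SucI, rule le_funI)
   fix n y
   have "{a n..b n} \<subseteq> {a (Suc n)..b (Suc n)}" using mono[of n] by auto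
   then show "F (k y) * indicator {a n..b n} y <= F (k y) * indicator {a (Suc n)..b (Suc n)} y"
    by (auto simp: indicator_def)
  qed
  show "(%y. F (k y) * indicator {a n..b n} y) : borel_measurable lborel" for n
  proof -
   have "{a n..b n} \<subseteq> {l<..<u}" using ab[of n] by auto
   then show ?thesis using Fk[of "{a n..b n}"] by simp
  qed
  fix y
  show "(%n. F (k y) * indicator {a n..b n} y) \<longlonglongrightarrow> F (k y) * indicator {l<..<u} y"
  proof (cases "l < y & y < u")
   case True
   have "\<forall>\<^sub>F n in sequentially. a n < y" "\<forall>\<^sub>F n in sequentially. y < b n"
    using True order_tendstoD(2)[OF la] order_tendstoD(1)[OF lb] by auto
   then have "\<forall>\<^sub>F n in sequentially. F (k y) * indicator {a n..b n} y = F (k y) * indicator {l<..<u} y"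
    by eventually_elim (use True in simp)
   then show ?thesis by (rule tendsto_eventually)
  next
   case False
   have "y ~: {a n..b n}" for n using ab[of n] False by auto
   then show ?thesis using False by simp
  qed
 qed
 then show ?thesis
  by (rule LIMSEQ_le_const2) (use compact_case ab in blast)
qed simp

definition fibre_map :: "(real * real => real) => real \<times> real => real \<times> real" where
 "fibre_map k z = (fst z, k z)"

text \<open>The map preserves vertical fibres, so its Jacobian is k2 and Tonelli reduces the
  estimate to one dimension.\<close>

lemma nn_integral_fibre_map_le:
 fixes F :: "real \<times> real => ennreal"
 assumes F[measurable]: "F : borel_measurable borel" and m: "m > 0" and C: "C1_on (subgraph l u) k k1 k2"
  and k2: "!!z. z : subgraph l u ==> m <= k2 z"
 shows "(%z. F (fibre_map k z) * indicator (subgraph l u) z) : borel_measurable borel"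
  "(\<integral>\<^sup>+z. F (fibre_map k z) * indicator (subgraph l u) z \<partial>lborel) <= ennreal (1 / m) * (\<integral>\<^sup>+w. F w \<partial>lborel)"
proof -
 let ?U = "subgraph l u"
 have U: "open ?U" using C by (simp add: C1_on_def)
 have ck: "continuous_on ?U k" by (rule C1_on_continuous[OF C])
 have "(%z. indicator ?U z *\<^sub>R fibre_map k z) : borel_measurable borel"
  by (rule borel_measurable_continuous_on_indicator) (use U ck in \<open>auto simp: fibre_map_def intro!: continuous_intros\<close>)
 then have "(%z. F (indicator ?U z *\<^sub>R fibre_map k z)) : borel_measurable borel" by (rule measurable_compose) simp
 then have "(%z. F (indicator ?U z *\<^sub>R fibre_map k z) * indicator ?U z) : borel_measurable borel"
  using U by (intro borel_measurable_times_ennreal borel_measurable_indicator) auto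
 also have "(%z. F (indicator ?U z *\<^sub>R fibre_map k z) * indicator ?U z) = (%z. F (fibre_map k z) * indicator ?U z)"
  by (auto simp: indicator_def fun_eq_iff)
 finally show M: "(%z. F (fibre_map k z) * indicator ?U z) : borel_measurable borel" .
 have fib: "(\<integral>\<^sup>+y. F (x, k (x, y)) * indicator ?U (x, y) \<partial>lborel) <= ennreal (1 / m) * (\<integral>\<^sup>+t. F (x, t) \<partial>lborel)" for x
 proof -
  have ind: "indicator ?U (x, y) = (indicator {l<..<u x} y :: ennreal)" for y by (simp add: indicator_def)
  show ?thesis unfolding ind
  proof (rule nn_integral_substitution_le[OF _ m])
   show "(%t. F (x, t)) : borel_measurable borel" by (rule measurable_compose[OF _ F]) simp
   show "continuous_on {l<..<u x} (%y. k2 (x, y))"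
    by (rule continuous_on_compose2[of ?U k2]) (use C in \<open>auto simp: C1_on_def intro!: continuous_intros\<close>)
   fix y assume "l < y" "y < u x"
   then have "(x, y) : ?U" by simp
   then show "((%y. k (x, y)) has_real_derivative k2 (x, y)) (at y)" "m <= k2 (x, y)"
    using C1_on_slices(2)[OF C] k2 by auto
  qed
 qed
 have "(\<integral>\<^sup>+z. F (fibre_map k z) * indicator ?U z \<partial>lborel) = (\<integral>\<^sup>+x. \<integral>\<^sup>+y. F (x, k (x, y)) * indicator ?U (x, y) \<partial>lborel \<partial>lborel)"
  using nn_integral_lborel_fst[OF M] by (simp add: fibre_map_def)
 also have "... <= (\<integral>\<^sup>+x. ennreal (1 / m) * (\<integral>\<^sup>+t. F (x, t) \<partial>lborel) \<partial>lborel)"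
  by (intro nn_integral_mono fib)
 also have "... = ennreal (1 / m) * (\<integral>\<^sup>+x. \<integral>\<^sup>+t. F (x, t) \<partial>lborel \<partial>lborel)"
 proof (rule nn_integral_cmult)
  have "F : borel_measurable (lborel \<Otimes>\<^sub>M lborel)" using F by (simp add: lborel_prod)
  from lborel.borel_measurable_nn_integral_fst[OF this]
  show "(%x. \<integral>\<^sup>+t. F (x, t) \<partial>lborel) : borel_measurable lborel" .
 qed
 also have "... = ennreal (1 / m) * (\<integral>\<^sup>+w. F w \<partial>lborel)" by (simp add: nn_integral_lborel_fst[OF F])
 finally show "(\<integral>\<^sup>+z. F (fibre_map k z) * indicator ?U z \<partial>lborel) <= ennreal (1 / m) * (\<integral>\<^sup>+w. F w \<partial>lborel)" .
qed

text \<open>The integral estimate, applied to the indicator of a null set containing the exceptional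
  points, shows that its preimage is null. Almost everywhere equations can thus be transported
  between the domains.\<close>

lemma AE_fibre_map:
 assumes m: "m > 0" and C: "C1_on (subgraph l u) k k1 k2"
  and k2: "!!z. z : subgraph l u ==> m <= k2 z"
  and maps: "!!z. z : subgraph l u ==> fibre_map k z : V"
  and P: "AE w\<in>V in lborel. P w"
 shows "AE z in lborel. z : subgraph l u --> P (fibre_map k z)"
proof -
 obtain N where N: "{w. \<not> (w : V --> P w)} \<subseteq> N" "emeasure lborel N = 0" "N : sets lborel"
  using P by (rule AE_E) auto
 have Nb: "(indicator N :: _ => ennreal) : borel_measurable borel" using N(3) by simp
 note le = nn_integral_fibre_map_le[OF Nb m C k2]
 have "(\<integral>\<^sup>+z. indicator N (fibre_map k z) * indicator (subgraph l u) z \<partial>lborel) = 0"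
  using le(2) N by simp
 then have "AE z in lborel. indicator N (fibre_map k z) * indicator (subgraph l u) z = (0::ennreal)"
  by (subst (asm) nn_integral_0_iff_AE) (use le(1) in auto)
 then show ?thesis
 proof eventually_elim
  case (elim z)
  show ?case
  proof
   assume z: "z : subgraph l u"
   then have "fibre_map k z ~: N" using elim by (auto simp: indicator_def split: if_splits)
   then show "P (fibre_map k z)" using N(1) maps[OF z] by auto
  qed
 qed
qed

lemma C1_on_fibre_compose:
 assumes F: "C1_on V F F1 F2" and C: "C1_on U k k1 k2"
 shows "C1_on {z\<in>U. fibre_map k z : V} (%z. F (fibre_map k z))
  (%z. F1 (fibre_map k z) + k1 z * F2 (fibre_map k z)) (%z. k2 z * F2 (fibre_map k z))"
 unfolding C1_on_def
proof (intro conjI ballI)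
 let ?W = "{z\<in>U. fibre_map k z : V}"
 have ck: "continuous_on U k" by (rule C1_on_continuous[OF C])
 then have cT: "continuous_on U (fibre_map k)" by (auto simp: fibre_map_def[abs_def] intro!: continuous_intros)
 have "?W = U \<inter> fibre_map k -` V" by auto
 then show "open ?W" using continuous_open_preimage[OF cT] C F by (auto simp: C1_on_def)
 have c: "continuous_on ?W (%z. F1 (fibre_map k z))" "continuous_on ?W (%z. F2 (fibre_map k z))"
  by (rule continuous_on_compose2[of V]; use F in \<open>auto simp: C1_on_def intro: continuous_on_subset[OF cT]\<close>)+
 have k: "continuous_on ?W k1" "continuous_on ?W k2" using C by (auto simp: C1_on_def intro: continuous_on_subset)
 show "continuous_on ?W (%z. F1 (fibre_map k z) + k1 z * F2 (fibre_map k z))" "continuous_on ?W (%z. k2 z * F2 (fibre_map k z))"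
  by (auto intro!: continuous_on_add continuous_on_mult c k)
 fix z assume z: "z : ?W"
 let ?w = "fibre_map k z"
 have dk: "(k has_derivative (%h. k1 z * fst h + k2 z * snd h)) (at z)" using C z by (simp add: C1_on_def)
 have dT: "(fibre_map k has_derivative (%h. (fst h, k1 z * fst h + k2 z * snd h))) (at z)"
  unfolding fibre_map_def[abs_def] by (intro has_derivative_Pair dk) (auto intro!: derivative_eq_intros)
 have dF: "(F has_derivative (%h. F1 ?w * fst h + F2 ?w * snd h)) (at ?w)" using F z by (simp add: C1_on_def)
 show "((%z. F (fibre_map k z)) has_derivative (%h. (F1 ?w + k1 z * F2 ?w) * fst h + k2 z * F2 ?w * snd h)) (at z)"
  by (rule has_derivative_eq_rhs[OF has_derivative_compose[OF dT dF]]) (simp add: algebra_simps)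
qed

text \<open>Composing C1 approximants with the map gives C1 approximants; the substitution
  inequality transfers their L1 convergence from the image of K to K.\<close>

lemma sobolev_fibre_compose:
 assumes s: "sobolev V f g1 g2" and m: "m > 0" and C: "C1_on (subgraph l u) k k1 k2"
  and k2: "!!z. z : subgraph l u ==> m <= k2 z"
  and maps: "!!z. z : subgraph l u ==> fibre_map k z : V"
 shows "sobolev (subgraph l u) (%z. f (fibre_map k z)) (%z. g1 (fibre_map k z) + k1 z * g2 (fibre_map k z))
  (%z. k2 z * g2 (fibre_map k z))"
proof -
 let ?U = "subgraph l u" and ?T = "fibre_map k"
 obtain G1 G2 where G: "sob V f G1 G2" "AE z\<in>V in lborel. g1 z = G1 z" "AE z\<in>V in lborel. g2 z = G2 z"
  using s by (auto simp: sobolev_def)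
 have U: "open ?U" using C by (simp add: C1_on_def)
 have ck: "continuous_on ?U k" by (rule C1_on_continuous[OF C])
 have cT: "continuous_on ?U ?T" unfolding fibre_map_def[abs_def] by (intro continuous_intros ck)
 have V: "open V" "continuous_on V f" and Gl: "L1loc V G1" "L1loc V G2" using G(1) by (auto simp: sob_def)
 have ckk: "continuous_on ?U k1" "continuous_on ?U k2" using C by (auto simp: C1_on_def)
 have L: "L1loc ?U (%z. indicator ?U z * g (?T z))" if g: "L1loc V g" for g
  unfolding L1loc_def
 proof (intro conjI allI impI)
  have gm: "g : borel_measurable borel" using g by (simp add: L1loc_def)
  have "(%z. indicator ?U z *\<^sub>R ?T z) : borel_measurable borel"
   by (rule borel_measurable_continuous_on_indicator) (use U cT in auto)
  then have "(%z. g (indicator ?U z *\<^sub>R ?T z)) : borel_measurable borel" by (rule measurable_compose[OF _ gm])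
  then have "(%z. indicator ?U z * g (indicator ?U z *\<^sub>R ?T z)) : borel_measurable borel"
   using U by (intro borel_measurable_times borel_measurable_indicator) auto
  also have "(%z. indicator ?U z * g (indicator ?U z *\<^sub>R ?T z)) = (%z. indicator ?U z * g (?T z))"
   by (auto simp: indicator_def fun_eq_iff)
  finally show bm: "(%z. indicator ?U z * g (?T z)) : borel_measurable borel" .
  fix K assume K: "compact K & K \<subseteq> ?U"
  have TK: "compact (?T ` K)" "?T ` K \<subseteq> V" using K maps by (auto intro!: compact_continuous_image intro: continuous_on_subset[OF cT])
  have gi: "integrable lborel (%z. indicator (?T ` K) z * g z)" using g TK by (auto simp: L1loc_def)
  let ?F = "%w. ennreal \<bar>indicator (?T ` K) w * g w\<bar>"
  have Fm: "?F : borel_measurable borel" using gi by auto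
  show "integrable lborel (%z. indicator K z * (indicator ?U z * g (?T z)))"
   unfolding integrable_iff_bounded
  proof
   show "(%z. indicator K z * (indicator ?U z * g (?T z))) : borel_measurable lborel"
    using borel_measurable_times[OF borel_measurable_indicator bm, of K] K by (simp add: borel_compact)
   have "(\<integral>\<^sup>+z. ennreal (norm (indicator K z * (indicator ?U z * g (?T z)))) \<partial>lborel) <= (\<integral>\<^sup>+z. ?F (?T z) * indicator ?U z \<partial>lborel)"
    by (intro nn_integral_mono) (auto simp: indicator_def)
   also have "... <= ennreal (1 / m) * (\<integral>\<^sup>+w. ?F w \<partial>lborel)" by (rule nn_integral_fibre_map_le(2)[OF Fm m C k2])
   also have "... < \<infinity>" using gi by (simp add: integrable_iff_bounded ennreal_mult_less_top)
   finally show "(\<integral>\<^sup>+z. ennreal (norm (indicator K z * (indicator ?U z * g (?T z)))) \<partial>lborel) < \<infinity>" .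
  qed
 qed
 have LU: "L1loc ?U (%z. indicator ?U z * (c z * g (?T z)))" if g: "L1loc V g" and c: "continuous_on ?U c" for g c
 proof -
  have "(%z. indicator ?U z * (c z * (indicator ?U z * g (?T z)))) = (%z. indicator ?U z * (c z * g (?T z)))"
   by (auto simp: indicator_def)
  then show ?thesis using L1loc_mult_continuous[OF L[OF g] c U] by simp
 qed
 have add: "L1loc ?U (%z. f z + g z)" if "L1loc ?U f" "L1loc ?U g" for f g
  using that by (auto simp: L1loc_def distrib_left)
 let ?G1 = "%z. indicator ?U z * G1 (?T z) + indicator ?U z * (k1 z * G2 (?T z))"
 let ?G2 = "%z. indicator ?U z * (k2 z * G2 (?T z))"
 have S: "sob ?U (%z. f (?T z)) ?G1 ?G2"
  unfolding sob_def
 proof (intro conjI allI impI)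
  show "continuous_on ?U (%z. f (?T z))" by (rule continuous_on_compose2[OF V(2) cT]) (use maps in auto)
  show "L1loc ?U ?G1" "L1loc ?U ?G2" by (intro add L LU Gl ckk)+
  fix K assume K: "compact K" "K \<subseteq> ?U"
  have TK: "compact (?T ` K)" "?T ` K \<subseteq> V" using K maps by (auto intro!: compact_continuous_image intro: continuous_on_subset[OF cT])
  obtain W F F1 F2 where A: "C1_approx (?T ` K) f G1 G2 W F F1 F2" using G(1) TK by (auto simp: sob_def)
  have Wn: "?T ` K \<subseteq> W n" "C1_on (W n) (F n) (F1 n) (F2 n)" for n using A by (auto simp: C1_approx_def)
  have u: "uniform_limit (?T ` K) F f sequentially" and d: "(%n. dL1 (?T ` K) (F1 n) G1) \<longlonglongrightarrow> 0" "(%n. dL1 (?T ` K) (F2 n) G2) \<longlonglongrightarrow> 0"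
   using A by (auto simp: C1_approx_def)
  let ?W = "%n. {z\<in>?U. ?T z : W n}"
  have C': "C1_on (?W n) (%z. F n (?T z)) (%z. F1 n (?T z) + k1 z * F2 n (?T z)) (%z. k2 z * F2 n (?T z))" for n
   by (rule C1_on_fibre_compose[OF Wn(2) C])
  have KW: "K \<subseteq> ?W n" for n using K Wn(1)[of n] by auto
  have uT: "uniform_limit K (%n z. F n (?T z)) (%z. f (?T z)) sequentially"
   by (rule uniform_limit_compose'[OF u]) auto
  have cF: "continuous_on K (%z. F1 n (?T z))" "continuous_on K (%z. F2 n (?T z))" for n
   by (rule continuous_on_compose2[of "W n"]; use Wn[of n] K in \<open>auto simp: C1_on_def intro: continuous_on_subset[OF cT]\<close>)+
  have TKb: "?T ` K : sets borel" using TK by (simp add: borel_compact)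
  have pull: "(%n. dL1 K (%z. h n (?T z)) (%z. g (?T z))) \<longlonglongrightarrow> 0"
   if lim: "(%n. dL1 (?T ` K) (h n) g) \<longlonglongrightarrow> 0" and h: "!!n. continuous_on (?T ` K) (h n)" and g: "L1loc V g" for h g
  proof (rule tendsto_sandwich[OF _ _ tendsto_const])
   have "(%n. ennreal (1 / m) * dL1 (?T ` K) (h n) g) \<longlonglongrightarrow> ennreal (1 / m) * 0"
    by (intro ennreal_tendsto_cmult lim) simp
   then show "(%n. ennreal (1 / m) * dL1 (?T ` K) (h n) g) \<longlonglongrightarrow> 0" by simp
   have "dL1 K (%z. h n (?T z)) (%z. g (?T z)) <= ennreal (1 / m) * dL1 (?T ` K) (h n) g" for n
   proof -
    let ?F = "%w. ennreal \<bar>h n w - g w\<bar> * indicator (?T ` K) w"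
    have "(%w. indicator (?T ` K) w * g w) : borel_measurable borel"
     using g TKb unfolding L1loc_def by (intro borel_measurable_times borel_measurable_indicator) auto
    moreover have "(%w. indicator (?T ` K) w * h n w) : borel_measurable borel"
     using integrable_ind_continuous[OF TK(1) h] by auto
    ultimately have "?F : borel_measurable lborel" by (intro dL1_measurable)
    then have Fm: "?F : borel_measurable borel" by simp
    have "dL1 K (%z. h n (?T z)) (%z. g (?T z)) <= (\<integral>\<^sup>+z. ?F (?T z) * indicator ?U z \<partial>lborel)"
     unfolding dL1_def using K by (intro nn_integral_mono) (auto simp: indicator_def)
    also have "... <= ennreal (1 / m) * dL1 (?T ` K) (h n) g"
     unfolding dL1_def by (rule nn_integral_fibre_map_le(2)[OF Fm m C k2])
    finally show ?thesis .
   qed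
   then show "\<forall>\<^sub>F n in sequentially. dL1 K (%z. h n (?T z)) (%z. g (?T z)) <= ennreal (1 / m) * dL1 (?T ` K) (h n) g"
    by (intro always_eventually allI)
  qed simp
  have hc: "continuous_on (?T ` K) (F1 n)" "continuous_on (?T ` K) (F2 n)" for n
   using Wn[of n] by (auto simp: C1_on_def intro: continuous_on_subset)
  have p1: "(%n. dL1 K (%z. F1 n (?T z)) (%z. G1 (?T z))) \<longlonglongrightarrow> 0" by (rule pull[OF d(1) hc(1) Gl(1)])
  have p2: "(%n. dL1 K (%z. F2 n (?T z)) (%z. G2 (?T z))) \<longlonglongrightarrow> 0" by (rule pull[OF d(2) hc(2) Gl(2)])
  have indU: "indicator ?U z * x = (x::real)" if "z : K" for z x using that K by auto
  have gi: "integrable lborel (%z. indicator K z * g (?T z))" if "L1loc V g" for g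
  proof -
   have "(%z. indicator K z * (indicator ?U z * g (?T z))) = (%z. indicator K z * g (?T z))"
    by (rule ext) (use K in \<open>auto simp: indicator_def\<close>)
   moreover have "integrable lborel (%z. indicator K z * (indicator ?U z * g (?T z)))"
    using L[OF that] K by (simp add: L1loc_def)
   ultimately show ?thesis by simp
  qed
  have mult: "(%n. dL1 K (%z. c z * F2 n (?T z)) (%z. c z * G2 (?T z))) \<longlonglongrightarrow> 0" if c: "continuous_on ?U c" for c
   by (rule dL1_mult_tendsto[OF K(1) _ uniform_limit_const cF(2) gi[OF Gl(2)] p2])
    (rule continuous_on_subset[OF c K(2)])
  have cKm: "(%z. indicator K z * h z) : borel_measurable borel" if "continuous_on K h" for h :: "real \<times> real => real"
   using integrable_ind_continuous[OF K(1) that] by auto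
  have k1K: "continuous_on K k1" by (rule continuous_on_subset[OF ckk(1) K(2)])
  have k1m: "(%z. indicator K z * (k1 z * G2 (?T z))) : borel_measurable borel"
  proof -
   have "(%z. (indicator K z * k1 z) * (indicator K z * G2 (?T z))) : borel_measurable borel"
    using borel_measurable_times[OF cKm[OF k1K] borel_measurable_integrable[OF gi[OF Gl(2)], simplified]] .
   also have "(%z. (indicator K z * k1 z) * (indicator K z * G2 (?T z))) = (%z. indicator K z * (k1 z * G2 (?T z)))"
    by (auto simp: indicator_def)
   finally show ?thesis .
  qed
  have G1m: "(%z. indicator K z * G1 (?T z)) : borel_measurable borel" using gi[OF Gl(1)] by auto
  have "(%n. dL1 K (%z. F1 n (?T z) + k1 z * F2 n (?T z)) (%z. G1 (?T z) + k1 z * G2 (?T z))) \<longlonglongrightarrow> 0"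
   by (rule dL1_add_tendsto[OF cKm[OF cF(1)] G1m cKm[OF continuous_on_mult[OF k1K cF(2)]] k1m p1 mult[OF ckk(1)]])
  then have d1: "(%n. dL1 K (%z. F1 n (?T z) + k1 z * F2 n (?T z)) ?G1) \<longlonglongrightarrow> 0"
   by (simp add: indU cong: dL1_cong)
  have d2: "(%n. dL1 K (%z. k2 z * F2 n (?T z)) ?G2) \<longlonglongrightarrow> 0"
   using mult[OF ckk(2)] by (simp add: indU cong: dL1_cong)
  show "EX V F F1 F2. C1_approx K (%z. f (?T z)) ?G1 ?G2 V F F1 F2"
   by (rule exI[of _ ?W], rule exI[of _ "%n z. F n (?T z)"], rule exI[of _ "%n z. F1 n (?T z) + k1 z * F2 n (?T z)"], rule exI[of _ "%n z. k2 z * F2 n (?T z)"])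
    (unfold C1_approx_def, use C' KW uT d1 d2 in blast)
 qed (rule U)
 have A1: "AE z\<in>?U in lborel. g1 (?T z) = G1 (?T z)" by (rule AE_fibre_map[OF m C k2 maps G(2)])
 have A2: "AE z\<in>?U in lborel. g2 (?T z) = G2 (?T z)" by (rule AE_fibre_map[OF m C k2 maps G(3)])
 have "AE z\<in>?U in lborel. g1 (?T z) + k1 z * g2 (?T z) = ?G1 z" using A1 A2 by eventually_elim auto
 moreover have "AE z\<in>?U in lborel. k2 z * g2 (?T z) = ?G2 z" using A2 by eventually_elim auto
 ultimately show ?thesis using S unfolding sobolev_def by blast
qed

section \<open>Hoelder classes\<close>

text \<open>At distances t up to 1 one has t <= t^a; at larger distances the bound on f is
  enough.\<close>

lemma holder_onI_lipschitz:
 fixes f :: "'a::euclidean_space => real"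
 assumes a: "0 <= a" "a <= 1" and b: "bounded (f ` S)"
  and L: "!!x y. x : S ==> y : S ==> \<bar>f x - f y\<bar> <= L * dist x y"
 shows "holder_on a S f"
proof -
 obtain B where B: "ALL y:f ` S. norm y <= B" using b unfolding bounded_iff ..
 have B': "\<bar>f x\<bar> <= B" if "x : S" for x using bspec[OF B imageI[OF that]] by simp
 have "continuous_on S f"
  unfolding continuous_on_iff
 proof (intro ballI allI impI)
  fix x and e :: real assume x: "x : S" and e: "e > 0"
  show "\<exists>d>0. ALL y:S. dist y x < d --> dist (f y) (f x) < e"
  proof (intro exI conjI ballI impI)
   show "e / (\<bar>L\<bar> + 1) > 0" using e by simp
   fix y assume y: "y : S" "dist y x < e / (\<bar>L\<bar> + 1)"
   have "\<bar>f y - f x\<bar> <= L * dist y x" using L x y by simp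
   also have "... <= (\<bar>L\<bar> + 1) * dist y x" by (intro mult_right_mono) auto
   also have "... < e" using y(2) by (simp add: field_simps)
   finally show "dist (f y) (f x) < e" by (simp add: dist_real_def)
  qed
 qed
 moreover have "\<bar>f x - f y\<bar> <= (\<bar>L\<bar> + 2 * \<bar>B\<bar>) * dist x y powr a" if xy: "x : S" "y : S" for x y
 proof (cases "dist x y <= 1")
  case True
  have "dist x y <= dist x y powr a"
  proof (cases "x = y")
   case False
   then have "dist x y powr 1 <= dist x y powr a" using True a by (intro powr_mono') auto
   then show ?thesis using False by simp
  qed simp
  then have "\<bar>L\<bar> * dist x y <= (\<bar>L\<bar> + 2 * \<bar>B\<bar>) * dist x y powr a" by (intro mult_mono) auto
  moreover have "L * dist x y <= \<bar>L\<bar> * dist x y" by (intro mult_right_mono) auto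
  ultimately show ?thesis using L[OF xy] by linarith
 next
  case False
  then have "1 <= dist x y powr a" using a by (intro ge_one_powr_ge_zero) auto
  then have "(\<bar>L\<bar> + 2 * \<bar>B\<bar>) * 1 <= (\<bar>L\<bar> + 2 * \<bar>B\<bar>) * dist x y powr a" by (intro mult_left_mono) auto
  then have "\<bar>L\<bar> + 2 * \<bar>B\<bar> <= (\<bar>L\<bar> + 2 * \<bar>B\<bar>) * dist x y powr a" by simp
  moreover have "\<bar>f x - f y\<bar> <= \<bar>L\<bar> + 2 * \<bar>B\<bar>" using B'[OF xy(1)] B'[OF xy(2)] by linarith
  ultimately show ?thesis by (rule order_trans[rotated])
 qed
 ultimately show ?thesis using b unfolding holder_on_def by blast
qed

lemma holder_on_obtain:
 assumes "holder_on a S f"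
 obtains C B where "C \<ge> 0" "B \<ge> 0" "!!x y. x : S ==> y : S ==> \<bar>f x - f y\<bar> <= C * dist x y powr a" "!!x. x : S ==> \<bar>f x\<bar> <= B"
proof -
 obtain C where C: "!!x y. x : S ==> y : S ==> \<bar>f x - f y\<bar> <= C * dist x y powr a" using assms by (auto simp: holder_on_def)
 have "bounded (f ` S)" using assms by (simp add: holder_on_def)
 then obtain B where B: "ALL y:f ` S. norm y <= B" unfolding bounded_iff ..
 show ?thesis
 proof (rule that[of "\<bar>C\<bar>" "\<bar>B\<bar>"])
  fix x y assume xy: "x : S" "y : S"
  have "C * dist x y powr a <= \<bar>C\<bar> * dist x y powr a" by (intro mult_right_mono) auto
  then show "\<bar>f x - f y\<bar> <= \<bar>C\<bar> * dist x y powr a" using C[OF xy] by linarith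
 next
  fix x assume "x : S" then show "\<bar>f x\<bar> <= \<bar>B\<bar>" using bspec[OF B imageI] by fastforce
 qed auto
qed

lemma holder_on_E:
 assumes "holder_on a S f"
 shows "EX C B. C \<ge> 0 & B \<ge> 0 & (ALL x:S. ALL y:S. \<bar>f x - f y\<bar> <= C * dist x y powr a) & (ALL x:S. \<bar>f x\<bar> <= B)"
proof (rule holder_on_obtain[OF assms])
 fix C B assume "C \<ge> 0" "B \<ge> 0" "!!x y. x : S ==> y : S ==> \<bar>f x - f y\<bar> <= C * dist x y powr a" "!!x. x : S ==> \<bar>f x\<bar> <= B"
 then show ?thesis by (intro exI[of _ C] exI[of _ B]) simp
qed

lemma holder_onI:
 assumes "continuous_on S f" "!!x. x : S ==> \<bar>f x\<bar> <= B" "!!x y. x : S ==> y : S ==> \<bar>f x - f y\<bar> <= C * dist x y powr a"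
 shows "holder_on a S f"
 using assms unfolding holder_on_def bounded_iff by fastforce

lemma holder_on_continuous: "holder_on a S f ==> continuous_on S f" by (simp add: holder_on_def)

lemma holder_on_cong: "holder_on a S f ==> (!!x. x : S ==> f x = g x) ==> holder_on a S g"
 unfolding holder_on_def by (simp cong: continuous_on_cong image_cong)

lemma holder_on_add:
 assumes "holder_on a S f" "holder_on a S g"
 shows "holder_on a S (%x. f x + g x)"
proof -
 obtain C B where f: "C \<ge> 0" "B \<ge> 0" "!!x y. x : S ==> y : S ==> \<bar>f x - f y\<bar> <= C * dist x y powr a" "!!x. x : S ==> \<bar>f x\<bar> <= B"
  using holder_on_E[OF assms(1)] by blast
 obtain C' B' where g: "C' \<ge> 0" "B' \<ge> 0" "!!x y. x : S ==> y : S ==> \<bar>g x - g y\<bar> <= C' * dist x y powr a" "!!x. x : S ==> \<bar>g x\<bar> <= B'"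
  using holder_on_E[OF assms(2)] by blast
 show ?thesis
 proof (rule holder_onI[where B="B + B'" and C="C + C'"])
  show "continuous_on S (%x. f x + g x)" using assms by (auto intro: continuous_on_add holder_on_continuous)
  fix x assume x: "x : S"
  then show "\<bar>f x + g x\<bar> <= B + B'" using f(4)[OF x] g(4)[OF x] by linarith
  fix y assume y: "y : S"
  show "\<bar>f x + g x - (f y + g y)\<bar> <= (C + C') * dist x y powr a"
   using f(3)[OF x y] g(3)[OF x y] unfolding distrib_right by linarith
 qed
qed

lemma holder_on_compose_real:
 assumes f: "holder_on a S f" and \<theta>: "!!s t. s : I ==> t : I ==> \<bar>\<theta> s - \<theta> t\<bar> <= L * \<bar>s - t\<bar>" and fI: "!!x. x : S ==> f x : I" and b: "!!t. t : I ==> \<bar>\<theta> t\<bar> <= M"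
 shows "holder_on a S (%x. \<theta> (f x))"
proof -
 obtain C B where "C \<ge> 0" "B \<ge> 0" and C: "!!x y. x : S ==> y : S ==> \<bar>f x - f y\<bar> <= C * dist x y powr a" and "!!x. x : S ==> \<bar>f x\<bar> <= B"
  using holder_on_E[OF f] by blast
 have "holder_on 1 I \<theta>"
  by (rule holder_onI_lipschitz[where L=L]) (use \<theta> b in \<open>auto simp: bounded_iff dist_real_def\<close>)
 then have "continuous_on I \<theta>" by (rule holder_on_continuous)
 show ?thesis
 proof (rule holder_onI[where B=M and C="\<bar>L\<bar> * C"])
  show "continuous_on S (%x. \<theta> (f x))"
   by (rule continuous_on_compose2[OF \<open>continuous_on I \<theta>\<close> holder_on_continuous[OF f]]) (use fI in auto)
  fix x assume x: "x : S"
  show "\<bar>\<theta> (f x)\<bar> <= M" using b fI x by auto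
  fix y assume y: "y : S"
  have "\<bar>\<theta> (f x) - \<theta> (f y)\<bar> <= L * \<bar>f x - f y\<bar>" by (intro \<theta> fI x y)
  also have "... <= \<bar>L\<bar> * \<bar>f x - f y\<bar>" by (intro mult_right_mono) auto
  also have "... <= \<bar>L\<bar> * (C * dist x y powr a)" by (intro mult_left_mono C x y) auto
  finally show "\<bar>\<theta> (f x) - \<theta> (f y)\<bar> <= \<bar>L\<bar> * C * dist x y powr a" by simp
 qed
qed

lemma holder_on_const: "holder_on a S (%_. c)"
 by (rule holder_onI[where B="\<bar>c\<bar>" and C=0]) auto

lemma holder_on_mult:
 assumes "holder_on a S f" "holder_on a S g"
 shows "holder_on a S (%x. f x * g x)"
proof -
 obtain C B where f: "C \<ge> 0" "B \<ge> 0" "!!x y. x : S ==> y : S ==> \<bar>f x - f y\<bar> <= C * dist x y powr a" "!!x. x : S ==> \<bar>f x\<bar> <= B"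
  using holder_on_E[OF assms(1)] by blast
 obtain C' B' where g: "C' \<ge> 0" "B' \<ge> 0" "!!x y. x : S ==> y : S ==> \<bar>g x - g y\<bar> <= C' * dist x y powr a" "!!x. x : S ==> \<bar>g x\<bar> <= B'"
  using holder_on_E[OF assms(2)] by blast
 show ?thesis
 proof (rule holder_onI[where B="B * B'" and C="B * C' + C * B'"])
  show "continuous_on S (%x. f x * g x)" using assms by (auto intro: continuous_on_mult holder_on_continuous)
  fix x assume x: "x : S"
  show "\<bar>f x * g x\<bar> <= B * B'" unfolding abs_mult by (intro mult_mono f(4) g(4) x f(2)) auto
  fix y assume y: "y : S"
  have "f x * g x - f y * g y = f x * (g x - g y) + (f x - f y) * g y" by (simp add: algebra_simps)
  then have "\<bar>f x * g x - f y * g y\<bar> <= \<bar>f x\<bar> * \<bar>g x - g y\<bar> + \<bar>f x - f y\<bar> * \<bar>g y\<bar>"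
   using abs_triangle_ineq[of "f x * (g x - g y)" "(f x - f y) * g y"] by (simp add: abs_mult)
  also have "... <= B * (C' * dist x y powr a) + (C * dist x y powr a) * B'"
   using f(1,2) g(1,2) by (intro add_mono mult_mono f(4) g(4) f(3) g(3) x y) auto
  finally show "\<bar>f x * g x - f y * g y\<bar> <= (B * C' + C * B') * dist x y powr a" by (simp add: algebra_simps)
 qed
qed

lemma holder_on_inverse:
 assumes f: "holder_on a S f" and m: "m > 0" "!!x. x : S ==> m <= \<bar>f x\<bar>"
 shows "holder_on a S (%x. inverse (f x))"
proof (rule holder_on_compose_real[OF f, where I="{t. m <= \<bar>t\<bar>}" and L="1 / m\<^sup>2" and M="1 / m"])
 fix s t assume "s : {t. m <= \<bar>t\<bar>}" "t : {t. m <= \<bar>t\<bar>}"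
 then have st: "m <= \<bar>s\<bar>" "m <= \<bar>t\<bar>" by auto
 then have nz: "s ~= 0" "t ~= 0" using m by auto
 have "m\<^sup>2 <= \<bar>s\<bar> * \<bar>t\<bar>" unfolding power2_eq_square using st m by (intro mult_mono) auto
 then have "\<bar>s - t\<bar> / (\<bar>s\<bar> * \<bar>t\<bar>) <= \<bar>s - t\<bar> / m\<^sup>2" using m nz by (intro divide_left_mono) auto
 moreover have "\<bar>inverse s - inverse t\<bar> = \<bar>s - t\<bar> / (\<bar>s\<bar> * \<bar>t\<bar>)"
  using nz by (simp add: inverse_diff_inverse abs_mult divide_inverse abs_minus_commute mult.commute mult.left_commute)
 ultimately show "\<bar>inverse s - inverse t\<bar> <= 1 / m\<^sup>2 * \<bar>s - t\<bar>" by simp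
 show "\<bar>inverse t\<bar> <= 1 / m" using st m by (simp add: divide_inverse le_imp_inverse_le)
qed (use m in auto)

lemma holder_on_sqrt:
 assumes f: "holder_on a S f" and m: "m > 0" "!!x. x : S ==> m <= f x"
 shows "holder_on a S (%x. sqrt (f x))"
proof -
 obtain C B where "C \<ge> 0" "B \<ge> 0" and "!!x y. x : S ==> y : S ==> \<bar>f x - f y\<bar> <= C * dist x y powr a" and B: "!!x. x : S ==> \<bar>f x\<bar> <= B"
  using holder_on_E[OF f] by blast
 show ?thesis
 proof (rule holder_on_compose_real[OF f, where I="{m..B}" and L="1 / sqrt m" and M="sqrt B"])
  fix s t assume st: "s : {m..B}" "t : {m..B}"
  have pos: "0 < sqrt m" "sqrt m <= sqrt s" "sqrt m <= sqrt t" using st m by auto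
  have "(sqrt s - sqrt t) * (sqrt s + sqrt t) = s - t"
   using st m by (simp add: algebra_simps)
  then have "\<bar>sqrt s - sqrt t\<bar> * \<bar>sqrt s + sqrt t\<bar> = \<bar>s - t\<bar>" by (simp add: abs_mult[symmetric])
  then have "\<bar>sqrt s - sqrt t\<bar> * (sqrt s + sqrt t) = \<bar>s - t\<bar>" using pos by simp
  moreover have "\<bar>sqrt s - sqrt t\<bar> * sqrt m <= \<bar>sqrt s - sqrt t\<bar> * (sqrt s + sqrt t)" using pos by (intro mult_left_mono) linarith+
  ultimately show "\<bar>sqrt s - sqrt t\<bar> <= 1 / sqrt m * \<bar>s - t\<bar>" using pos(1) by (simp add: field_simps)
  show "\<bar>sqrt t\<bar> <= sqrt B" using st m by auto
 next
  fix x assume "x : S" then show "f x : {m..B}" using m(2) B by fastforce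
 qed
qed

lemma holder_on_lipschitz_compose:
 assumes f: "holder_on a S f" and a: "a \<ge> 0" and T: "!!x y. x : S' ==> y : S' ==> dist (T x) (T y) <= L * dist x y" and L: "L \<ge> 0" and maps: "!!x. x : S' ==> T x : S"
  and cT: "continuous_on S' T"
 shows "holder_on a S' (%x. f (T x))"
proof -
 obtain C B where f': "C \<ge> 0" "B \<ge> 0" "!!x y. x : S ==> y : S ==> \<bar>f x - f y\<bar> <= C * dist x y powr a" "!!x. x : S ==> \<bar>f x\<bar> <= B"
  using holder_on_E[OF f] by blast
 show ?thesis
 proof (rule holder_onI[where B=B and C="C * L powr a"])
  show "continuous_on S' (%x. f (T x))"
   by (rule continuous_on_compose2[OF holder_on_continuous[OF f] cT]) (use maps in auto)
  fix x assume x: "x : S'"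
  show "\<bar>f (T x)\<bar> <= B" using f'(4) maps x by auto
  fix y assume y: "y : S'"
  have "\<bar>f (T x) - f (T y)\<bar> <= C * dist (T x) (T y) powr a" by (intro f'(3) maps x y)
  also have "... <= C * (L * dist x y) powr a" using T[OF x y] a f'(1) by (intro mult_left_mono powr_mono2) auto
  also have "... = C * L powr a * dist x y powr a" using L by (simp add: powr_mult)
  finally show "\<bar>f (T x) - f (T y)\<bar> <= C * L powr a * dist x y powr a" .
 qed
qed

section \<open>Closures of subgraphs and boundary values of derivatives\<close>

lemma open_subgraph: "continuous_on UNIV u ==> open (subgraph l u)"
proof -
 assume u: "continuous_on UNIV u"
 have "subgraph l u = {z. l < snd z} \<inter> {z. snd z < u (fst z)}" by (auto simp: subgraph_def)
 moreover have "continuous_on UNIV (%z::real\<times>real. u (fst z))" by (rule continuous_on_compose2[OF u]) (auto intro: continuous_intros)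
 ultimately show ?thesis by (auto intro!: open_Int open_Collect_less continuous_intros)
qed

lemma closure_subgraph:
 assumes u: "continuous_on UNIV u" and lu: "!!x. l < u x"
 shows "closure (subgraph l u) = {(x, y). l <= y & y <= u x}"
proof
 have cu: "continuous_on UNIV (%z::real\<times>real. u (fst z))" by (rule continuous_on_compose2[OF u]) (auto intro: continuous_intros)
 have "{(x, y). l <= y & y <= u x} = {z. l <= snd z} \<inter> {z. snd z <= u (fst z)}" by auto
 then have "closed {(x, y). l <= y & y <= u x}"
  by (auto intro!: closed_Int closed_Collect_le continuous_intros cu)
 then show "closure (subgraph l u) \<subseteq> {(x, y). l <= y & y <= u x}"
  by (rule closure_minimal[rotated]) (auto simp: subgraph_def)
 show "{(x, y). l <= y & y <= u x} \<subseteq> closure (subgraph l u)"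
 proof clarify
  fix x y assume y: "l <= y" "y <= u x"
  define t where "t = (%n. inverse (real (Suc n)))"
  have t: "0 < t n" "t n <= 1" for n by (auto simp: t_def field_simps)
  \<comment> \<open>Moving towards the midpoint of the fibre leads from any boundary point into the
    open set.\<close>
  define z where "z = (%n. (x, (1 - t n) * y + t n * ((l + u x) / 2)))"
  have "z n : subgraph l u" for n
  proof -
   have "l < (1 - t n) * y + t n * ((l + u x) / 2)"
   proof -
    have "(1 - t n) * l <= (1 - t n) * y" using t[of n] y by (intro mult_left_mono) auto
    moreover have "t n * l < t n * ((l + u x) / 2)" using t[of n] lu[of x] by (intro mult_strict_left_mono) auto
    moreover have "l = (1 - t n) * l + t n * l" by (simp add: algebra_simps)
    ultimately show ?thesis by linarith
   qed
   moreover have "(1 - t n) * y + t n * ((l + u x) / 2) < u x"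
   proof -
    have "(1 - t n) * y <= (1 - t n) * u x" using t[of n] y by (intro mult_left_mono) auto
    moreover have "t n * ((l + u x) / 2) < t n * u x" using t[of n] lu[of x] by (intro mult_strict_left_mono) auto
    moreover have "u x = (1 - t n) * u x + t n * u x" by (simp add: algebra_simps)
    ultimately show ?thesis by linarith
   qed
   ultimately show ?thesis by (simp add: z_def)
  qed
  moreover have "z \<longlonglongrightarrow> (x, y)"
  proof -
   have "t \<longlonglongrightarrow> 0" unfolding t_def by (rule LIMSEQ_inverse_real_of_nat)
   then have "z \<longlonglongrightarrow> (x, (1 - 0) * y + 0 * ((l + u x) / 2))"
    unfolding z_def by (intro tendsto_intros)
   then show ?thesis by simp
  qed
  ultimately show "(x, y) : closure (subgraph l u)" unfolding closure_sequential by blast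
 qed
qed

text \<open>Working form of \<open>C1_holder_closure\<close> in which f1 and f2 name the continuous
  extensions of the partial derivatives.\<close>

definition c1h :: "real => (real * real) set => (real * real => real) => (real * real => real) => (real * real => real) => bool" where
 "c1h a U f f1 f2 \<longleftrightarrow> continuous_on (closure U) f & bounded (f ` closure U) & C1_on U f f1 f2 \<and>
  holder_on a (closure U) f1 & holder_on a (closure U) f2"

lemma C1_on_frechet:
 assumes "C1_on U f f1 f2" "z : U"
 shows "fd f z = (%h. f1 z * fst h + f2 z * snd h)"
 using assms frechet_derivative_at[of f "%h. f1 z * fst h + f2 z * snd h" z] by (simp add: C1_on_def)

lemma C1_holder_closure_iff:
 assumes U: "open U"
 shows "C1_holder_closure a U f \<longleftrightarrow> (EX f1 f2. c1h a U f f1 f2)"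
proof
 assume A: "C1_holder_closure a U f"
 then obtain f1 f2 where f1: "holder_on a (closure U) f1" "!!z. z : U ==> f1 z = fd f z (1, 0)"
  and f2: "holder_on a (closure U) f2" "!!z. z : U ==> f2 z = fd f z (0, 1)"
  unfolding C1_holder_closure_def using Basis_plane(1,2) by metis
 have "C1_on U f f1 f2"
  unfolding C1_on_def
 proof (intro conjI ballI U)
  show "continuous_on U f1" "continuous_on U f2"
   using holder_on_continuous[OF f1(1)] holder_on_continuous[OF f2(1)] closure_subset by (auto intro: continuous_on_subset)
  fix z assume z: "z : U"
  then have D: "(f has_derivative fd f z) (at z)"
   using A by (simp add: C1_holder_closure_def frechet_derivative_works[symmetric])
  have lin: "linear (fd f z)" using D by (rule has_derivative_linear)
  have "fd f z h = f1 z * fst h + f2 z * snd h" for h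
  proof -
   have h: "h = fst h *\<^sub>R (1, 0) + snd h *\<^sub>R (0, 1)" by (cases h) simp
   show ?thesis
    by (subst h) (simp only: linear_add[OF lin] linear_cmul[OF lin] real_scaleR_def mult.commute f1(2)[OF z] f2(2)[OF z])
  qed
  then have "fd f z = (%h. f1 z * fst h + f2 z * snd h)" by (rule ext)
  then show "(f has_derivative (%h. f1 z * fst h + f2 z * snd h)) (at z)" using D by simp
 qed
 then show "EX f1 f2. c1h a U f f1 f2" using A f1(1) f2(1) unfolding c1h_def C1_holder_closure_def by blast
next
 assume "EX f1 f2. c1h a U f f1 f2"
 then obtain f1 f2 where c: "c1h a U f f1 f2" by blast
 then have C: "C1_on U f f1 f2" by (simp add: c1h_def)
 have "EX g. holder_on a (closure U) g & (ALL z:U. g z = fd f z b)" if "b : Basis" for b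
  using that c C1_on_frechet[OF C] unfolding Basis_plane(3) c1h_def by (auto intro: exI[of _ f1] exI[of _ f2])
 then show "C1_holder_closure a U f"
  using c C unfolding C1_holder_closure_def c1h_def C1_on_def differentiable_def by blast
qed

lemma at_within_open_nontrivial:
 fixes U :: "(real * real) set"
 assumes "open U" "z : closure U"
 shows "at z within U ~= bot"
proof -
 have "z islimpt U"
 proof (cases "z : U")
  case True then show ?thesis using assms(1) by (intro interior_limit_point) (simp add: interior_open)
 next
  case False then show ?thesis using assms(2) by (simp add: closure_def)
 qed
 then show ?thesis by (simp add: trivial_limit_within)
qed

text \<open>\<open>ext_deriv\<close> is a limit along U, and U clusters at each point of its
  closure, so any continuous extension of the partial derivative computes it.\<close>

lemma ext_deriv_eq:
 assumes C: "C1_on U f f1 f2" and z: "z : closure U"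
 shows "continuous_on (closure U) f1 ==> ext_deriv U (1, 0) f z = f1 z"
  "continuous_on (closure U) f2 ==> ext_deriv U (0, 1) f z = f2 z"
proof -
 have U: "open U" using C by (simp add: C1_on_def)
 note nb = at_within_open_nontrivial[OF U z]
 have lim: "Lim (at z within U) (%w. fd f w b) = g z"
  if g: "continuous_on (closure U) g" "!!w. w : U ==> fd f w b = g w" for g b
 proof (rule tendsto_Lim[OF nb])
  have "(g \<longlongrightarrow> g z) (at z within U)"
   using g(1) z by (meson closure_subset continuous_on_def tendsto_within_subset)
  then show "((%w. fd f w b) \<longlongrightarrow> g z) (at z within U)"
   by (rule Lim_transform_eventually) (use g(2) in \<open>auto simp: eventually_at_filter\<close>)
 qed
 show "continuous_on (closure U) f1 ==> ext_deriv U (1, 0) f z = f1 z"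
  unfolding ext_deriv_def by (rule lim) (simp_all add: C1_on_frechet[OF C])
 show "continuous_on (closure U) f2 ==> ext_deriv U (0, 1) f z = f2 z"
  unfolding ext_deriv_def by (rule lim) (simp_all add: C1_on_frechet[OF C])
qed

lemma AE_lborel_shift:
 fixes c :: "'a::euclidean_space"
 assumes "AE z in lborel. P z"
 shows "AE z in lborel. P (z + c)"
proof -
 obtain N where N: "{z. \<not> P z} \<subseteq> N" "emeasure lborel N = 0" "N : sets lborel" using assms by (rule AE_E) auto
 have "(\<integral>\<^sup>+z. indicator N (c + z) \<partial>lborel) = (\<integral>\<^sup>+z. indicator N z \<partial>lborel)"
  by (rule nn_integral_shift) (use N in simp)
 also have "... = 0" using N by simp
 finally have "AE z in lborel. indicator N (c + z) = (0::ennreal)"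
 proof (subst (asm) nn_integral_0_iff_AE)
  have [measurable]: "N : sets borel" using N by simp
  show "(%z. indicator N (c + z)) : borel_measurable lborel" by measurable
 qed
 then show ?thesis
 proof eventually_elim
  case (elim z)
  then have "z + c ~: N" by (auto simp: indicator_def add.commute split: if_splits)
  then show ?case using N(1) by auto
 qed
qed

section \<open>Periodic function classes\<close>

lemma ball_Basis_plane: "(ALL b:(Basis :: (real * real) set). P b) \<longleftrightarrow> P (1, 0) & P (0, 1)"
 by (auto simp: Basis_prod_def)

definition cell :: "real => (real * real) set => (real * real) set" where
 "cell lam U = U \<inter> {z. 0 < fst z & fst z < lam}"

text \<open>\<open>Lr_per\<close> freed from measurability of g itself: everything is said about a
  Borel representative or almost everywhere, hence the notion is stable under modification on null
  sets and under changes of variables.\<close>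

definition Lrq :: "real => real => (real * real) set => (real * real => real) => bool" where
 "Lrq lam r U g \<longleftrightarrow> (EX G. G : borel_measurable borel & (AE z\<in>U in lborel. g z = G z) \<and>
  (\<integral>\<^sup>+z. ennreal (\<bar>G z\<bar> powr r) * indicator (cell lam U) z \<partial>lborel) < \<infinity>) \<and>
  (AE z\<in>U in lborel. g (z + (lam, 0)) = g z)"

text \<open>Finite measure of one period cell is what puts bounded periodic functions into
  L_r.\<close>

locale periodic_domain =
 fixes lam r a :: real and U :: "(real * real) set"
 assumes lam: "lam > 0" and r: "r \<ge> 1" and a: "a = (r - 1) / r" and U: "open U"
  and shift: "!!z. z + (lam, 0) : U \<longleftrightarrow> z : U" and cell_finite: "emeasure lborel (cell lam U) < \<infinity>"
begin

lemma a_bounds: "0 <= a" "a <= 1" using r by (auto simp: a field_simps)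

lemma open_cell: "open (cell lam U)"
 using U by (auto simp: cell_def intro!: open_Int open_Collect_conj open_Collect_less continuous_intros)

lemma cell_sets [measurable]: "cell lam U : sets borel" using open_cell by simp

lemma AE_shift: "AE z\<in>U in lborel. P z ==> AE z\<in>U in lborel. P (z + (lam, 0))"
 using AE_lborel_shift[of "%z. z : U --> P z" "(lam, 0)"] shift by simp

lemma Lrq_cong:
 assumes "Lrq lam r U g" "AE z\<in>U in lborel. g z = g' z"
 shows "Lrq lam r U g'"
proof -
 obtain G where G: "G : borel_measurable borel" "AE z\<in>U in lborel. g z = G z"
  "(\<integral>\<^sup>+z. ennreal (\<bar>G z\<bar> powr r) * indicator (cell lam U) z \<partial>lborel) < \<infinity>" "AE z\<in>U in lborel. g (z + (lam, 0)) = g z"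
  using assms(1) by (auto simp: Lrq_def)
 have "AE z\<in>U in lborel. g' z = G z" using G(2) assms(2) by eventually_elim auto
 moreover have "AE z\<in>U in lborel. g' (z + (lam, 0)) = g' z"
  using G(4) assms(2) AE_shift[OF assms(2)] by eventually_elim auto
 ultimately show ?thesis using G(1,3) unfolding Lrq_def by blast
qed

lemma Lrq_add:
 assumes "Lrq lam r U g" "Lrq lam r U h"
 shows "Lrq lam r U (%z. g z + h z)"
proof -
 obtain G where G[measurable]: "G : borel_measurable borel" and G': "AE z\<in>U in lborel. g z = G z"
  "(\<integral>\<^sup>+z. ennreal (\<bar>G z\<bar> powr r) * indicator (cell lam U) z \<partial>lborel) < \<infinity>" "AE z\<in>U in lborel. g (z + (lam, 0)) = g z"
  using assms(1) by (auto simp: Lrq_def)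
 obtain H where H[measurable]: "H : borel_measurable borel" and H': "AE z\<in>U in lborel. h z = H z"
  "(\<integral>\<^sup>+z. ennreal (\<bar>H z\<bar> powr r) * indicator (cell lam U) z \<partial>lborel) < \<infinity>" "AE z\<in>U in lborel. h (z + (lam, 0)) = h z"
  using assms(2) by (auto simp: Lrq_def)
 have "(\<integral>\<^sup>+z. ennreal (\<bar>G z + H z\<bar> powr r) * indicator (cell lam U) z \<partial>lborel)
  <= (\<integral>\<^sup>+z. ennreal (2 powr r) * (ennreal (\<bar>G z\<bar> powr r) * indicator (cell lam U) z + ennreal (\<bar>H z\<bar> powr r) * indicator (cell lam U) z) \<partial>lborel)"
 proof (rule nn_integral_mono)
  fix z
  \<comment> \<open>Comparison with twice the larger summand replaces Minkowski's inequality, as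
    only finiteness matters.\<close>
  have "\<bar>G z + H z\<bar> powr r <= (2 * max \<bar>G z\<bar> \<bar>H z\<bar>) powr r" using r by (intro powr_mono2) auto
  also have "... = 2 powr r * (max \<bar>G z\<bar> \<bar>H z\<bar>) powr r" by (simp add: powr_mult)
  also have "... <= 2 powr r * (\<bar>G z\<bar> powr r + \<bar>H z\<bar> powr r)" by (intro mult_left_mono) (auto simp: max_def)
  finally have "ennreal (\<bar>G z + H z\<bar> powr r) <= ennreal (2 powr r * (\<bar>G z\<bar> powr r + \<bar>H z\<bar> powr r))" by (rule ennreal_leI)
  then show "ennreal (\<bar>G z + H z\<bar> powr r) * indicator (cell lam U) z <= ennreal (2 powr r) * (ennreal (\<bar>G z\<bar> powr r) * indicator (cell lam U) z + ennreal (\<bar>H z\<bar> powr r) * indicator (cell lam U) z)"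
   by (auto simp: indicator_def ennreal_mult ennreal_plus)
 qed
 also have "... = ennreal (2 powr r) * ((\<integral>\<^sup>+z. ennreal (\<bar>G z\<bar> powr r) * indicator (cell lam U) z \<partial>lborel) + (\<integral>\<^sup>+z. ennreal (\<bar>H z\<bar> powr r) * indicator (cell lam U) z \<partial>lborel))"
  by (subst nn_integral_cmult, measurable, subst nn_integral_add, measurable)
 also have "... < \<infinity>" using G'(2) H'(2) by (simp add: ennreal_mult_less_top)
 finally have "(\<integral>\<^sup>+z. ennreal (\<bar>G z + H z\<bar> powr r) * indicator (cell lam U) z \<partial>lborel) < \<infinity>" .
 moreover have "AE z\<in>U in lborel. g z + h z = G z + H z" using G'(1) H'(1) by eventually_elim auto
 moreover have "AE z\<in>U in lborel. g (z + (lam, 0)) + h (z + (lam, 0)) = g z + h z" using G'(3) H'(3) by eventually_elim auto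
 moreover have "(%z. G z + H z) : borel_measurable borel" by simp
 ultimately show ?thesis unfolding Lrq_def by blast
qed

lemma Lrq_mult:
 assumes g: "Lrq lam r U g" and c: "continuous_on U c" "!!z. z : U ==> \<bar>c z\<bar> <= B" "!!z. z : U ==> c (z + (lam, 0)) = c z"
 shows "Lrq lam r U (%z. c z * g z)"
proof -
 obtain G where G[measurable]: "G : borel_measurable borel" and G': "AE z\<in>U in lborel. g z = G z"
  "(\<integral>\<^sup>+z. ennreal (\<bar>G z\<bar> powr r) * indicator (cell lam U) z \<partial>lborel) < \<infinity>" "AE z\<in>U in lborel. g (z + (lam, 0)) = g z"
  using g by (auto simp: Lrq_def)
 have [measurable]: "(%z. indicator U z * c z) : borel_measurable borel"
  using L1loc_indicator_continuous[OF U c(1)] by (simp add: L1loc_def)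
 have "(\<integral>\<^sup>+z. ennreal (\<bar>indicator U z * c z * G z\<bar> powr r) * indicator (cell lam U) z \<partial>lborel)
  <= (\<integral>\<^sup>+z. ennreal (\<bar>B\<bar> powr r) * (ennreal (\<bar>G z\<bar> powr r) * indicator (cell lam U) z) \<partial>lborel)"
 proof (rule nn_integral_mono)
  fix z
  show "ennreal (\<bar>indicator U z * c z * G z\<bar> powr r) * indicator (cell lam U) z <= ennreal (\<bar>B\<bar> powr r) * (ennreal (\<bar>G z\<bar> powr r) * indicator (cell lam U) z)"
  proof (cases "z : cell lam U")
   case True
   then have z: "z : U" by (simp add: cell_def)
   have "\<bar>c z * G z\<bar> powr r <= (\<bar>B\<bar> * \<bar>G z\<bar>) powr r"
    using r c(2)[OF z] by (intro powr_mono2) (auto simp: abs_mult intro!: mult_right_mono)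
   also have "... = \<bar>B\<bar> powr r * \<bar>G z\<bar> powr r" by (simp add: powr_mult)
   finally have "ennreal (\<bar>c z * G z\<bar> powr r) <= ennreal (\<bar>B\<bar> powr r * \<bar>G z\<bar> powr r)" by (rule ennreal_leI)
   then show ?thesis using True z by (simp add: ennreal_mult)
  qed simp
 qed
 also have "... = ennreal (\<bar>B\<bar> powr r) * (\<integral>\<^sup>+z. ennreal (\<bar>G z\<bar> powr r) * indicator (cell lam U) z \<partial>lborel)"
  by (rule nn_integral_cmult) measurable
 also have "... < \<infinity>" using G'(2) by (simp add: ennreal_mult_less_top)
 finally have "(\<integral>\<^sup>+z. ennreal (\<bar>indicator U z * c z * G z\<bar> powr r) * indicator (cell lam U) z \<partial>lborel) < \<infinity>" .
 moreover have "AE z\<in>U in lborel. c z * g z = indicator U z * c z * G z" using G'(1) by eventually_elim auto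
 moreover have "AE z\<in>U in lborel. c (z + (lam, 0)) * g (z + (lam, 0)) = c z * g z"
  using G'(3) by eventually_elim (use c(3) in auto)
 moreover have "(%z. indicator U z * c z * G z) : borel_measurable borel" by measurable
 ultimately show ?thesis unfolding Lrq_def by blast
qed

lemma Lrq_const: "Lrq lam r U (%_. c)"
proof -
 have "(\<integral>\<^sup>+z. ennreal (\<bar>c\<bar> powr r) * indicator (cell lam U) z \<partial>lborel) = ennreal (\<bar>c\<bar> powr r) * emeasure lborel (cell lam U)"
  by (rule nn_integral_cmult_indicator) simp
 also have "... < \<infinity>" using cell_finite by (simp add: ennreal_mult_less_top)
 finally show ?thesis unfolding Lrq_def by (intro conjI exI[of _ "%_. c"]) auto
qed

lemma Lrq_continuous:
 assumes "continuous_on U c" "!!z. z : U ==> \<bar>c z\<bar> <= B" "!!z. z : U ==> c (z + (lam, 0)) = c z"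
 shows "Lrq lam r U c"
 using Lrq_mult[OF Lrq_const[of 1] assms] by simp

lemma nn_powr_rep:
 assumes G: "G : borel_measurable borel" and g: "g : borel_measurable (lebesgue_on (cell lam U))"
  and eq: "AE z\<in>U in lborel. g z = G z"
 shows "integrable (lebesgue_on (cell lam U)) (%z. \<bar>g z\<bar> powr r) \<longleftrightarrow>
  (\<integral>\<^sup>+z. ennreal (\<bar>G z\<bar> powr r) * indicator (cell lam U) z \<partial>lborel) < \<infinity>"
proof -
 have m: "(%z. \<bar>G z\<bar> powr r) : borel_measurable borel" using G by measurable
 have "integrable (lebesgue_on (cell lam U)) (%z. \<bar>g z\<bar> powr r) \<longleftrightarrow> integrable lborel (%z. indicator (cell lam U) z * \<bar>G z\<bar> powr r)"
 proof (rule lebesgue_on_rep(1)[OF m cell_sets])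
  show "(%z. \<bar>g z\<bar> powr r) : borel_measurable (lebesgue_on (cell lam U))" using g by measurable
  show "AE z in lborel. z : cell lam U --> \<bar>g z\<bar> powr r = \<bar>G z\<bar> powr r" using eq by eventually_elim (auto simp: cell_def)
 qed
 also have "... \<longleftrightarrow> (\<integral>\<^sup>+z. ennreal (norm (indicator (cell lam U) z * \<bar>G z\<bar> powr r)) \<partial>lborel) < \<infinity>"
  using m by (simp add: integrable_iff_bounded)
 also have "(%z. ennreal (norm (indicator (cell lam U) z * \<bar>G z\<bar> powr r))) = (%z. ennreal (\<bar>G z\<bar> powr r) * indicator (cell lam U) z)"
  by (auto simp: indicator_def fun_eq_iff)
 finally show ?thesis .
qed

lemma cell_sub: "cell lam U \<subseteq> U" by (auto simp: cell_def)

lemma Lrq_of_Lr_per: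
 assumes "Lr_per lam r U g"
 shows "Lrq lam r U g"
proof -
 have g: "g : borel_measurable (lebesgue_on U)" "AE z in lebesgue_on U. g (z + (lam, 0)) = g z"
  "integrable (lebesgue_on (cell lam U)) (%z. \<bar>g z\<bar> powr r)" "g : borel_measurable (lebesgue_on (cell lam U))"
  using assms by (auto simp: Lr_per_def Lr_on_def cell_def)
 obtain G where G: "G : borel_measurable borel" "AE z\<in>U in lborel. g z = G z"
  using borel_rep_exists[OF borel_open[OF U] g(1)] by blast
 show ?thesis using g nn_powr_rep[OF G(1) g(4) G(2)] G U unfolding Lrq_def by (auto simp: AE_lebesgue_on_iff)
qed

lemma Lr_per_of_Lrq:
 assumes "Lrq lam r U g" "g : borel_measurable (lebesgue_on U)"
 shows "Lr_per lam r U g"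
proof -
 obtain G where G: "G : borel_measurable borel" "AE z\<in>U in lborel. g z = G z"
  "(\<integral>\<^sup>+z. ennreal (\<bar>G z\<bar> powr r) * indicator (cell lam U) z \<partial>lborel) < \<infinity>" "AE z\<in>U in lborel. g (z + (lam, 0)) = g z"
  using assms(1) by (auto simp: Lrq_def)
 have m: "g : borel_measurable (lebesgue_on (cell lam U))"
  by (rule measurable_restrict_mono[OF assms(2) cell_sub])
 show ?thesis using nn_powr_rep[OF G(1) m G(2)] G(3,4) assms(2) m U
  unfolding Lr_per_def Lr_on_def by (simp add: AE_lebesgue_on_iff cell_def)
qed

text \<open>Working form of \<open>velocity_class\<close> with the weak derivatives named. The class
  is an algebra, closed under reciprocals and square roots away from 0; membership of the composed
  quantities follows from these rules.\<close>

definition vc :: "(real * real => real) => (real * real => real) => (real * real => real) => bool" where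
 "vc f g1 g2 \<longleftrightarrow> holder_on a (closure U) f & periodic_on lam (closure U) f & sobolev U f g1 g2 & Lrq lam r U g1 & Lrq lam r U g2"

lemma vcD:
 assumes "vc f g1 g2"
 shows "continuous_on U f" "z : U ==> f (z + (lam, 0)) = f z" "EX B. ALL z:U. \<bar>f z\<bar> <= B"
proof -
 have h: "holder_on a (closure U) f" using assms by (simp add: vc_def)
 obtain B where "ALL x:closure U. \<bar>f x\<bar> <= B" using holder_on_E[OF h] by blast
 then have "ALL z:U. \<bar>f z\<bar> <= B" using closure_subset[of U] by blast
 then show "EX B. ALL z:U. \<bar>f z\<bar> <= B" ..
 show "continuous_on U f" using assms by (auto simp: vc_def intro: sobolev_continuous)
 show "f (z + (lam, 0)) = f z" if "z : U"
  using assms that closure_subset[of U] unfolding vc_def periodic_on_def by blast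
qed

lemma closure_shift: "z : closure U ==> z + (lam, 0) : closure U"
proof -
 assume z: "z : closure U"
 have "(%z. z + (lam, 0)) ` closure U \<subseteq> closure U"
 proof (rule image_closure_subset)
  show "(%z. z + (lam, 0)) ` U \<subseteq> closure U" using shift closure_subset[of U] by auto
 qed (auto intro!: continuous_intros)
 then show ?thesis using z by auto
qed

lemma vc_cong:
 assumes "vc f g1 g2" "!!z. z : closure U ==> f z = f' z" "AE z\<in>U in lborel. g1 z = g1' z" "AE z\<in>U in lborel. g2 z = g2' z"
 shows "vc f' g1' g2'"
proof -
 show ?thesis unfolding vc_def
 proof (intro conjI)
  show "holder_on a (closure U) f'" by (rule holder_on_cong[of a "closure U" f]) (use assms in \<open>auto simp: vc_def\<close>)
  show "periodic_on lam (closure U) f'" using assms(1,2) closure_shift unfolding vc_def periodic_on_def by simp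
  show "sobolev U f' g1' g2'" 
  proof (rule sobolev_cong[OF _ _ assms(3,4)])
   show "sobolev U f g1 g2" using assms(1) by (simp add: vc_def)
   show "f z = f' z" if "z : U" for z using that closure_subset[of U] by (intro assms(2)) blast
  qed
  show "Lrq lam r U g1'" "Lrq lam r U g2'" using assms by (auto simp: vc_def intro: Lrq_cong)
 qed
qed

lemma vc_cong':
 assumes "vc f g1 g2" "!!z. z : closure U ==> f z = f' z" "!!z. z : U ==> g1 z = g1' z" "!!z. z : U ==> g2 z = g2' z"
 shows "vc f' g1' g2'"
 by (rule vc_cong[OF assms(1,2)]) (use assms(3,4) in auto)

lemma vc_const: "vc (%_. c) (%_. 0) (%_. 0)"
 by (simp add: vc_def holder_on_const periodic_on_def sobolev_const[OF U] Lrq_const)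

lemma vc_add:
 assumes "vc f f1 f2" "vc g g1 g2"
 shows "vc (%z. f z + g z) (%z. f1 z + g1 z) (%z. f2 z + g2 z)"
 using assms by (auto simp: vc_def periodic_on_def intro: holder_on_add sobolev_add Lrq_add)

lemma vc_mult:
 assumes f: "vc f f1 f2" and g: "vc g g1 g2"
 shows "vc (%z. f z * g z) (%z. f1 z * g z + f z * g1 z) (%z. f2 z * g z + f z * g2 z)"
proof -
 obtain B0 where B0: "ALL z:U. \<bar>f z\<bar> <= B0" using vcD(3)[OF f] ..
 note B = vcD(1)[OF f] bspec[OF B0] vcD(2)[OF f]
 obtain C0 where C0: "ALL z:U. \<bar>g z\<bar> <= C0" using vcD(3)[OF g] ..
 note C = vcD(1)[OF g] bspec[OF C0] vcD(2)[OF g]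
 have L: "Lrq lam r U (%z. g z * f1 z)" "Lrq lam r U (%z. f z * g1 z)" "Lrq lam r U (%z. g z * f2 z)" "Lrq lam r U (%z. f z * g2 z)"
  using f g by (auto simp: vc_def intro: Lrq_mult[OF _ B] Lrq_mult[OF _ C])
 show ?thesis
  using f g Lrq_add[OF L(1,2)] Lrq_add[OF L(3,4)]
  by (auto simp: vc_def periodic_on_def mult.commute[of _ "g _"] intro!: holder_on_mult sobolev_mult[of U f f1 f2 g g1 g2, unfolded mult.commute[of _ "g _"]])
qed

lemma vc_cmult: "vc f f1 f2 ==> vc (%z. c * f z) (%z. c * f1 z) (%z. c * f2 z)"
 using vc_mult[OF vc_const[of c]] by simp

lemma vc_minus: "vc f f1 f2 ==> vc (%z. - f z) (%z. - f1 z) (%z. - f2 z)"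
 using vc_cmult[of f f1 f2 "-1"] by simp

lemma vc_diff: "vc f f1 f2 ==> vc g g1 g2 ==> vc (%z. f z - g z) (%z. f1 z - g1 z) (%z. f2 z - g2 z)"
 using vc_add[OF _ vc_minus] by simp

lemma vc_inverse:
 assumes f: "vc f f1 f2" and m: "m > 0" "!!z. z : closure U ==> m <= \<bar>f z\<bar>"
 shows "vc (%z. inverse (f z)) (%z. - f1 z / (f z)\<^sup>2) (%z. - f2 z / (f z)\<^sup>2)"
proof -
 note B = vcD(1,2)[OF f]
 have mU: "m <= \<bar>f z\<bar>" "f z ~= 0" if "z : U" for z
 proof -
  show "m <= \<bar>f z\<bar>" using that closure_subset[of U] by (intro m(2)) blast
  then show "f z ~= 0" using m(1) by auto
 qed
 have c: "continuous_on U (%z. - (inverse (f z))\<^sup>2)" using B(1) mU by (auto intro!: continuous_intros)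
 have b: "\<bar>- (inverse (f z))\<^sup>2\<bar> <= (inverse m)\<^sup>2" if "z : U" for z
 proof -
  have "\<bar>inverse (f z)\<bar> <= inverse m" using mU[OF that] m by (simp add: le_imp_inverse_le)
  then have "\<bar>inverse (f z)\<bar>\<^sup>2 <= (inverse m)\<^sup>2" by (rule power_mono) simp
  then have "(inverse (f z))\<^sup>2 <= (inverse m)\<^sup>2" by (simp only: power2_abs)
  then show ?thesis by simp
 qed
 have p: "- (inverse (f (z + (lam, 0))))\<^sup>2 = - (inverse (f z))\<^sup>2" if "z : U" for z using B(2)[OF that] by simp
 have e: "- (inverse x)\<^sup>2 * y = - y / x\<^sup>2" for x y :: real by (simp add: power_inverse divide_inverse)
 have q: "Lrq lam r U f1" "Lrq lam r U f2" using f by (auto simp: vc_def)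
 have "Lrq lam r U (%z. - (inverse (f z))\<^sup>2 * f1 z)" by (rule Lrq_mult[OF q(1) c b p])
 moreover have "Lrq lam r U (%z. - (inverse (f z))\<^sup>2 * f2 z)" by (rule Lrq_mult[OF q(2) c b p])
 ultimately show ?thesis
  using f holder_on_inverse[OF _ m, of a] sobolev_inverse[of U f f1 f2] mU unfolding e
  by (auto simp: vc_def periodic_on_def)
qed

lemma vc_sqrt:
 assumes f: "vc f f1 f2" and m: "m > 0" "!!z. z : closure U ==> m <= f z"
 shows "vc (%z. sqrt (f z)) (%z. f1 z / (2 * sqrt (f z))) (%z. f2 z / (2 * sqrt (f z)))"
proof -
 note B = vcD(1,2)[OF f]
 have mU: "m <= f z" "f z > 0" if "z : U" for z
 proof -
  show "m <= f z" using that closure_subset[of U] by (intro m(2)) blast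
  then show "f z > 0" using m(1) by linarith
 qed
 have c: "continuous_on U (%z. inverse (2 * sqrt (f z)))" 
 proof (intro continuous_intros B(1) ballI)
  fix z assume "z : U"
  then show "2 * sqrt (f z) ~= 0" using mU(2)[of z] by simp
 qed
 have b: "\<bar>inverse (2 * sqrt (f z))\<bar> <= inverse (2 * sqrt m)" if "z : U" for z
  using mU[OF that] m by (simp add: le_imp_inverse_le)
 have p: "inverse (2 * sqrt (f (z + (lam, 0)))) = inverse (2 * sqrt (f z))" if "z : U" for z using B(2)[OF that] by simp
 have e: "inverse (2 * sqrt x) * y = y / (2 * sqrt x)" for x y :: real by (simp only: divide_inverse mult.commute)
 have q: "Lrq lam r U f1" "Lrq lam r U f2" using f by (auto simp: vc_def)
 have "Lrq lam r U (%z. inverse (2 * sqrt (f z)) * f1 z)" by (rule Lrq_mult[OF q(1) c b p])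
 moreover have "Lrq lam r U (%z. inverse (2 * sqrt (f z)) * f2 z)" by (rule Lrq_mult[OF q(2) c b p])
 ultimately show ?thesis
  using f holder_on_sqrt[OF _ m, of a] sobolev_sqrt[of U f f1 f2] mU unfolding e
  by (auto simp: vc_def periodic_on_def)
qed

lemma W1_perI:
 assumes "Lr_per lam r U f" "has_weak_deriv U (1, 0) f g1" "Lr_per lam r U g1" "has_weak_deriv U (0, 1) f g2" "Lr_per lam r U g2"
 shows "W1_per lam r U f"
 using assms unfolding W1_per_def ball_Basis_plane by blast

lemma vc_W1:
 assumes "vc f g1 g2"
 shows "Lr_per lam r U f" "W1_per lam r U f"
proof -
 obtain B0 where B0: "ALL z:U. \<bar>f z\<bar> <= B0" using vcD(3)[OF assms] ..
 note B = vcD(1)[OF assms] bspec[OF B0] vcD(2)[OF assms]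
 show L: "Lr_per lam r U f"
  by (rule Lr_per_of_Lrq[OF Lrq_continuous[OF B]])
   (simp_all add: locally_integrable_measurable[OF U locally_integrable_continuous[OF U B(1)]])
 have s: "sobolev U f g1 g2" and q: "Lrq lam r U g1" "Lrq lam r U g2" using assms by (auto simp: vc_def)
 note w = sobolev_wd[OF s]
 have e1: "AE z\<in>U in lborel. g1 z = wd1 U f z" using w(3) by eventually_elim auto
 have e2: "AE z\<in>U in lborel. g2 z = wd2 U f z" using w(4) by eventually_elim auto
 have m: "wd1 U f : borel_measurable (lebesgue_on U)" "wd2 U f : borel_measurable (lebesgue_on U)"
  using w(1,2) locally_integrable_measurable[OF U] by (auto simp: has_weak_deriv_def)
 show "W1_per lam r U f"
  by (rule W1_perI[OF L w(1) _ w(2)]) (intro Lr_per_of_Lrq m Lrq_cong[OF q(1) e1] Lrq_cong[OF q(2) e2])+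
qed

lemma velocity_class_iff: "velocity_class lam r a U f \<longleftrightarrow> (EX g1 g2. vc f g1 g2)"
proof
 assume A: "velocity_class lam r a U f"
 then obtain g1 g2 where g: "has_weak_deriv U (1, 0) f g1" "Lr_per lam r U g1" "has_weak_deriv U (0, 1) f g2" "Lr_per lam r U g2"
  unfolding velocity_class_def W1_per_def ball_Basis_plane by blast
 have h: "holder_on a (closure U) f" using A by (simp add: velocity_class_def)
 have "continuous_on U f" using holder_on_continuous[OF h] closure_subset by (rule continuous_on_subset)
 then have "sobolev U f g1 g2" by (rule sobolev_of_weak[OF U _ g(1,3)])
 then show "EX g1 g2. vc f g1 g2" using A g by (auto simp: vc_def velocity_class_def intro: Lrq_of_Lr_per)
next
 assume "EX g1 g2. vc f g1 g2"
 then show "velocity_class lam r a U f" using vc_W1(2) by (auto simp: velocity_class_def vc_def)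
qed

text \<open>Working form of \<open>potential_class\<close>: the first derivatives lie in the
  velocity class, and all second derivatives are named, the two mixed ones separately until their
  equality is proved.\<close>

definition pc :: "(real * real => real) => (real * real => real) => (real * real => real) =>
 (real * real => real) => (real * real => real) => (real * real => real) => (real * real => real) => bool" where
 "pc f f1 f2 f11 f12 f21 f22 \<longleftrightarrow> c1h a U f f1 f2 & periodic_on lam (closure U) f & vc f1 f11 f12 & vc f2 f21 f22"

lemma periodic_on_closureI:
 assumes c: "continuous_on (closure U) f" and p: "!!z. z : U ==> f (z + (lam, 0)) = f z"
 shows "periodic_on lam (closure U) f"
 unfolding periodic_on_def
proof
 fix z assume z: "z : closure U"
 have "continuous_on (closure U) (%z. f (z + (lam, 0)))"
 proof (rule continuous_on_compose2[OF c])
  show "continuous_on (closure U) (%z. z + (lam, 0))" by (intro continuous_intros)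
  show "(%z. z + (lam, 0)) ` closure U \<subseteq> closure U" using closure_shift by blast
 qed
 then have "continuous_on (closure U) (%z. f (z + (lam, 0)) - f z)" by (intro continuous_on_diff c)
 then have "f (z + (lam, 0)) - f z = 0"
  by (rule continuous_constant_on_closure[OF _ _ z]) (simp add: p)
 then show "f (z + (lam, 0)) = f z" by simp
qed

lemma C1_periodic:
 assumes C: "C1_on U f f1 f2" and p: "!!z. z : U ==> f (z + (lam, 0)) = f z" and z: "z : U"
 shows "f1 (z + (lam, 0)) = f1 z" "f2 (z + (lam, 0)) = f2 z"
proof -
 let ?w = "z + (lam, 0)"
 have w: "?w : U" using shift z by simp
 have D: "(f has_derivative (%h. f1 ?w * fst h + f2 ?w * snd h)) (at ?w)" using C w by (simp add: C1_on_def)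
 have "((%z. f (z + (lam, 0))) has_derivative (%h. f1 ?w * fst h + f2 ?w * snd h)) (at z)"
  by (rule has_derivative_compose[of "%z. z + (lam, 0)" "%h. h" z UNIV f, OF _ D]) (auto intro!: derivative_eq_intros)
 then have "(f has_derivative (%h. f1 ?w * fst h + f2 ?w * snd h)) (at z)"
  by (rule has_derivative_transform_within_open[OF _ U z]) (rule p)
 moreover have "(f has_derivative (%h. f1 z * fst h + f2 z * snd h)) (at z)" using C z by (simp add: C1_on_def)
 ultimately have e: "(%h. f1 ?w * fst h + f2 ?w * snd h) = (%h. f1 z * fst h + f2 z * snd h)" by (rule has_derivative_unique)
 show "f1 ?w = f1 z" using fun_cong[OF e, of "(1, 0)"] by simp
 show "f2 ?w = f2 z" using fun_cong[OF e, of "(0, 1)"] by simp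
qed

text \<open>The weak derivatives provided by \<open>W2_per\<close> agree almost everywhere with the
  classical ones, so the latter inherit the second derivatives. Periodicity of the derivatives comes
  from f, first inside and then by continuity on the closure.\<close>

lemma potential_class_iff: "potential_class lam r a U f \<longleftrightarrow> (EX f1 f2 f11 f12 f21 f22. pc f f1 f2 f11 f12 f21 f22)"
proof
 assume A: "potential_class lam r a U f"
 then obtain f1 f2 where c: "c1h a U f f1 f2" using C1_holder_closure_iff[OF U] by (auto simp: potential_class_def)
 have C: "C1_on U f f1 f2" and h: "holder_on a (closure U) f1" "holder_on a (closure U) f2" using c by (auto simp: c1h_def)
 have per: "periodic_on lam (closure U) f" using A by (simp add: potential_class_def)
 have p: "f (z + (lam, 0)) = f z" if "z : U" for z using per closure_subset[of U] that by (auto simp: periodic_on_def)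
 have P: "periodic_on lam (closure U) f1" "periodic_on lam (closure U) f2"
  using C1_periodic[OF C p] by (auto intro!: periodic_on_closureI holder_on_continuous h)
 obtain g1 g2 where g: "has_weak_deriv U (1, 0) f g1" "W1_per lam r U g1" "has_weak_deriv U (0, 1) f g2" "W1_per lam r U g2"
  using A unfolding potential_class_def W2_per_def ball_Basis_plane by blast
 note s = sobolev_C1[OF C]
 have e: "AE z\<in>U in lborel. g1 z = f1 z" "AE z\<in>U in lborel. g2 z = f2 z"
 proof -
  have "AE z in lebesgue_on U. g1 z = wd1 U f z" by (rule has_weak_deriv_unique[OF U Basis_plane(1) g(1) sobolev_wd(1)[OF s]]) simp
  then have "AE z\<in>U in lborel. g1 z = wd1 U f z" using U by (simp add: AE_lebesgue_on_iff)
  then show "AE z\<in>U in lborel. g1 z = f1 z" using sobolev_wd(3)[OF s] by eventually_elim auto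
  have "AE z in lebesgue_on U. g2 z = wd2 U f z" by (rule has_weak_deriv_unique[OF U Basis_plane(2) g(3) sobolev_wd(2)[OF s]]) simp
  then have "AE z\<in>U in lborel. g2 z = wd2 U f z" using U by (simp add: AE_lebesgue_on_iff)
  then show "AE z\<in>U in lborel. g2 z = f2 z" using sobolev_wd(4)[OF s] by eventually_elim auto
 qed
 have cf: "continuous_on U f1" "continuous_on U f2" using C by (auto simp: C1_on_def)
 have vc: "EX h1 h2. vc k h1 h2" if g: "W1_per lam r U g" and e: "AE z\<in>U in lborel. g z = k z" and k: "holder_on a (closure U) k" "periodic_on lam (closure U) k" for g k
 proof -
  obtain h1 h2 where h: "has_weak_deriv U (1, 0) g h1" "Lr_per lam r U h1" "has_weak_deriv U (0, 1) g h2" "Lr_per lam r U h2"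
   using g unfolding W1_per_def ball_Basis_plane by blast
  have ck: "continuous_on U k" using holder_on_continuous[OF k(1)] closure_subset by (rule continuous_on_subset)
  have l: "locally_integrable_on U h1" "locally_integrable_on U h2" using h by (auto simp: has_weak_deriv_def)
  have "has_weak_deriv U (1, 0) k h1"
   by (rule has_weak_deriv_cong[OF h(1) U Basis_plane(1) locally_integrable_continuous[OF U ck] e l(1)]) simp
  moreover have "has_weak_deriv U (0, 1) k h2"
   by (rule has_weak_deriv_cong[OF h(3) U Basis_plane(2) locally_integrable_continuous[OF U ck] e l(2)]) simp
  ultimately have "sobolev U k h1 h2" by (rule sobolev_of_weak[OF U ck])
  then show ?thesis using k h by (auto simp: vc_def intro: Lrq_of_Lr_per)
 qed
 show "EX f1 f2 f11 f12 f21 f22. pc f f1 f2 f11 f12 f21 f22"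
  using c per vc[OF g(2) e(1) h(1) P(1)] vc[OF g(4) e(2) h(2) P(2)] unfolding pc_def by blast
next
 assume "EX f1 f2 f11 f12 f21 f22. pc f f1 f2 f11 f12 f21 f22"
 then obtain f1 f2 f11 f12 f21 f22 where A: "c1h a U f f1 f2" "periodic_on lam (closure U) f" "vc f1 f11 f12" "vc f2 f21 f22"
  by (auto simp: pc_def)
 have C: "C1_on U f f1 f2" using A(1) by (simp add: c1h_def)
 have b: "bounded (f ` closure U)" using A(1) by (simp add: c1h_def)
 obtain B where B: "ALL y:f ` closure U. norm y <= B" using b unfolding bounded_iff ..
 have B': "\<bar>f z\<bar> <= B" if "z : U" for z
  using bspec[OF B imageI[OF subsetD[OF closure_subset that]]] by simp
 have p: "f (z + (lam, 0)) = f z" if "z : U" for z using A(2) closure_subset[of U] that by (auto simp: periodic_on_def)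
 have cf: "continuous_on U f" by (rule C1_on_continuous[OF C])
 have L: "Lr_per lam r U f"
  by (rule Lr_per_of_Lrq[OF Lrq_continuous[OF cf B' p]])
   (simp_all add: locally_integrable_measurable[OF U locally_integrable_continuous[OF U cf]])
 note s = sobolev_C1[OF C]
 have "continuous_on U f1" "continuous_on U f2" using C by (auto simp: C1_on_def)
 then have l: "locally_integrable_on U f1" "locally_integrable_on U f2" by (auto intro: locally_integrable_continuous[OF U])
 have "has_weak_deriv U (1, 0) f f1" "has_weak_deriv U (0, 1) f f2"
  using has_weak_deriv_cong[OF sobolev_wd(1)[OF s] U Basis_plane(1) locally_integrable_continuous[OF U cf] _ l(1)]
   has_weak_deriv_cong[OF sobolev_wd(2)[OF s] U Basis_plane(2) locally_integrable_continuous[OF U cf] _ l(2)]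
   sobolev_wd(3,4)[OF s] by auto
 then have "W2_per lam r U f" using L vc_W1(2)[OF A(3)] vc_W1(2)[OF A(4)] unfolding W2_per_def ball_Basis_plane by blast
 then show "potential_class lam r a U f" using A C1_holder_closure_iff[OF U] by (auto simp: potential_class_def)
qed

end

lemma periodic_int:
 fixes u :: "real => real"
 assumes "!!x. u (x + lam) = u x"
 shows "u (x + of_int n * lam) = u x"
proof -
 have nat: "u (x + real k * lam) = u x" for k x
 proof (induction k)
  case (Suc k)
  have "u (x + real (Suc k) * lam) = u ((x + real k * lam) + lam)" by (simp add: algebra_simps)
  also have "... = u x" by (simp only: assms Suc.IH)
  finally show ?case .
 qed simp
 show ?thesis
 proof (cases "n \<ge> 0")
  case True
  then show ?thesis using nat[of x "nat n"] by simp
 next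
  case False
  then show ?thesis using nat[of "x + of_int n * lam" "nat (- n)"] by (simp add: algebra_simps)
 qed
qed

lemma periodic_reduce:
 assumes "lam > (0::real)"
 obtains y n where "y : {0..lam}" "x = y + of_int n * lam"
proof (rule that[of "x - of_int \<lfloor>x / lam\<rfloor> * lam" "\<lfloor>x / lam\<rfloor>"])
 have "of_int \<lfloor>x / lam\<rfloor> * lam <= x" "x < (of_int \<lfloor>x / lam\<rfloor> + 1) * lam"
  by (rule floor_divide_lower[OF assms], rule floor_divide_upper[OF assms])
 then show "x - of_int \<lfloor>x / lam\<rfloor> * lam : {0..lam}" by (simp add: algebra_simps)
qed simp

text \<open>The first coordinate is unchanged, so one period of the source is mapped into one period
  of the target and the substitution inequality bounds the integral.\<close>

lemma Lrq_fibre: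
 assumes g: "Lrq lam r V g" and m: "m > 0" and C: "C1_on (subgraph l u) k k1 k2"
  and k2: "!!z. z : subgraph l u ==> m <= k2 z"
  and maps: "!!z. z : subgraph l u ==> fibre_map k z : V"
  and per: "!!z. z : subgraph l u ==> k (z + (lam, 0)) = k z" and V: "cell lam V : sets borel"
 shows "Lrq lam r (subgraph l u) (%z. g (fibre_map k z))"
proof -
 let ?U = "subgraph l u" and ?T = "fibre_map k"
 have U: "open ?U" using C by (simp add: C1_on_def)
 obtain G where G: "G : borel_measurable borel" "AE z\<in>V in lborel. g z = G z"
  "(\<integral>\<^sup>+z. ennreal (\<bar>G z\<bar> powr r) * indicator (cell lam V) z \<partial>lborel) < \<infinity>" "AE z\<in>V in lborel. g (z + (lam, 0)) = g z"
  using g by (auto simp: Lrq_def)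
 note [measurable] = G(1) V
 have cT: "continuous_on ?U ?T" unfolding fibre_map_def[abs_def] by (intro continuous_intros C1_on_continuous[OF C])
 have "(%z. indicator ?U z *\<^sub>R ?T z) : borel_measurable borel"
  by (rule borel_measurable_continuous_on_indicator) (use U cT in auto)
 then have Gm: "(%z. G (indicator ?U z *\<^sub>R ?T z)) : borel_measurable borel" by (rule measurable_compose[OF _ G(1)])
 let ?F = "%w. ennreal (\<bar>G w\<bar> powr r) * indicator (cell lam V) w"
 have "(\<integral>\<^sup>+z. ennreal (\<bar>G (indicator ?U z *\<^sub>R ?T z)\<bar> powr r) * indicator (cell lam ?U) z \<partial>lborel)
  <= (\<integral>\<^sup>+z. ?F (?T z) * indicator ?U z \<partial>lborel)"
 proof (rule nn_integral_mono)
  fix z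
  show "ennreal (\<bar>G (indicator ?U z *\<^sub>R ?T z)\<bar> powr r) * indicator (cell lam ?U) z <= ?F (?T z) * indicator ?U z"
  proof (cases "z : cell lam ?U")
   case True
   then have "z : ?U" "?T z : cell lam V" using maps[of z] by (auto simp: cell_def fibre_map_def)
   then show ?thesis using True by simp
  qed simp
 qed
 also have "... <= ennreal (1 / m) * (\<integral>\<^sup>+w. ?F w \<partial>lborel)"
  by (rule nn_integral_fibre_map_le(2)[OF _ m C k2]) measurable
 also have "... < \<infinity>" using G(3) by (simp add: ennreal_mult_less_top)
 finally have fin: "(\<integral>\<^sup>+z. ennreal (\<bar>G (indicator ?U z *\<^sub>R ?T z)\<bar> powr r) * indicator (cell lam ?U) z \<partial>lborel) < \<infinity>" .
 have A1: "AE z\<in>?U in lborel. g (?T z) = G (?T z)" by (rule AE_fibre_map[OF m C k2 maps G(2)])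
 have A2: "AE z\<in>?U in lborel. g (?T z + (lam, 0)) = g (?T z)" by (rule AE_fibre_map[OF m C k2 maps G(4)])
 have Tsh: "?T (z + (lam, 0)) = ?T z + (lam, 0)" if "z : ?U" for z using per[OF that] by (simp add: fibre_map_def prod_eq_iff)
 have "AE z\<in>?U in lborel. g (?T z) = G (indicator ?U z *\<^sub>R ?T z)" using A1 by eventually_elim auto
 moreover have "AE z\<in>?U in lborel. g (?T (z + (lam, 0))) = g (?T z)" using A2 by eventually_elim (use Tsh in auto)
 ultimately show ?thesis using Gm fin unfolding Lrq_def by blast
qed

section \<open>Domains below a periodic graph\<close>

locale wave_domain =
 fixes lam r a l :: real and u u' :: "real => real"
 assumes lam: "lam > 0" and r: "r \<ge> 1" and a: "a = (r - 1) / r"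
  and du: "!!x. (u has_real_derivative u' x) (at x)" and hu': "holder_on a UNIV u'"
  and pu: "!!x. u (x + lam) = u x" and lu: "!!x. l < u x"
begin

abbreviation "U \<equiv> subgraph l u"

lemma cont_u: "continuous_on UNIV u" using du by (auto intro!: continuous_at_imp_continuous_on DERIV_isCont)

lemma cont_u': "continuous_on UNIV u'" using hu' by (rule holder_on_continuous)

lemma open_U: "open U" using cont_u by (rule open_subgraph)

lemma closure_U: "closure U = {(x, y). l <= y & y <= u x}" using closure_subgraph[OF cont_u lu] .

lemma mem_closure_U [simp]: "(x, y) : closure U \<longleftrightarrow> l <= y & y <= u x" by (simp add: closure_U)

lemma u_bounds: "EX \<delta> M. 0 < \<delta> & (ALL x. l + \<delta> <= u x & u x <= M)"
proof -
 have c: "continuous_on {0..lam} u" by (rule continuous_on_subset[OF cont_u]) simp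
 obtain x0 where x0: "ALL y:{0..lam}. u x0 <= u y" using continuous_attains_inf[OF compact_Icc _ c] lam by auto
 obtain x1 where x1: "ALL y:{0..lam}. u y <= u x1" using continuous_attains_sup[OF compact_Icc _ c] lam by auto
 have "u x0 <= u x & u x <= u x1" for x
 proof -
  obtain y n where y: "y : {0..lam}" "x = y + of_int n * lam" using periodic_reduce[OF lam] by blast
  then have "u x = u y" using periodic_int[of u lam, OF pu] by simp
  then show ?thesis using x0 x1 y by simp
 qed
 then show ?thesis using lu[of x0] by (intro exI[of _ "u x0 - l"] exI[of _ "u x1"]) auto
qed

lemma cell_finite: "emeasure lborel (cell lam U) < \<infinity>"
proof -
 obtain M where M: "!!x. u x <= M" using u_bounds by blast
 have "cell lam U \<subseteq> cbox (0, l) (lam, M)"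
 proof
  fix z assume "z : cell lam U"
  then have "0 < fst z" "fst z < lam" "l < snd z" "snd z < u (fst z)" by (auto simp: cell_def subgraph_def)
  then show "z : cbox (0, l) (lam, M)" using M[of "fst z"] by (cases z) auto
 qed
 then have "bounded (cell lam U)" by (rule bounded_subset[OF bounded_cbox])
 then show ?thesis by (rule emeasure_bounded_finite)
qed

sublocale periodic_domain lam r a U
 by unfold_locales (use lam r a open_U cell_finite pu in \<open>auto simp: subgraph_def\<close>)

lemma u'_bound: "\<exists>L\<ge>0. ALL x. \<bar>u' x\<bar> <= L" using holder_on_E[OF hu'] by blast

lemma u_lipschitz: assumes "!!x. \<bar>u' x\<bar> <= L" shows "\<bar>u x - u y\<bar> <= L * \<bar>x - y\<bar>"
 using field_differentiable_bound[of UNIV u u' L x y] assms du by (auto intro: has_field_derivative_at_within)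

text \<open>These curves foliate the domain between bottom (s = 0) and top (s = 1). They replace
  horizontal segments, which may leave the domain.\<close>

definition level :: "real => real => real" where "level s x = l + s * (u x - l)"

lemma level_deriv: "(level s has_real_derivative s * u' x) (at x)"
 unfolding level_def[abs_def] by (auto intro!: derivative_eq_intros du)

lemma level_mem: "0 < s ==> s < 1 ==> (x, level s x) : U"
proof -
 assume s: "0 < s" "s < 1"
 have "s * (u x - l) < u x - l" using mult_strict_right_mono[of s 1 "u x - l"] s lu[of x] by simp
 then have "level s x < u x" unfolding level_def by linarith
 moreover have "l < level s x" using s lu[of x] by (simp add: level_def)
 ultimately show ?thesis by simp
qed

lemma level_mem_closure: "0 <= s ==> s <= 1 ==> (x, level s x) : closure U"
proof -
 assume s: "0 <= s" "s <= 1"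
 have "s * (u x - l) <= u x - l" using mult_right_mono[of s 1 "u x - l"] s lu[of x] by simp
 then have "level s x <= u x" unfolding level_def by linarith
 moreover have "l <= level s x" using s lu[of x] by (simp add: level_def)
 ultimately show ?thesis by simp
qed

lemma C1_along_curve:
 assumes C: "C1_on W f f1 f2" and \<gamma>: "(\<gamma> has_real_derivative \<gamma>') (at x)" and x: "(x, \<gamma> x) : W"
 shows "((%x. f (x, \<gamma> x)) has_real_derivative f1 (x, \<gamma> x) + f2 (x, \<gamma> x) * \<gamma>') (at x)"
proof -
 have D: "(f has_derivative (%h. f1 (x, \<gamma> x) * fst h + f2 (x, \<gamma> x) * snd h)) (at (x, \<gamma> x))"
  using C x by (simp add: C1_on_def)
 have "((%x. (x, \<gamma> x)) has_derivative (%h. (h, \<gamma>' * h))) (at x)"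
  using \<gamma> by (auto simp: has_field_derivative_def intro!: has_derivative_Pair)
 from has_derivative_compose[OF this D] show ?thesis
  unfolding has_field_derivative_def by (rule has_derivative_eq_rhs) (auto simp: algebra_simps)
qed

text \<open>For s = 0 or 1 the curve lies on the boundary, where f is not known to be
  differentiable. The fundamental theorem holds on interior levels and passes to the limit by
  uniform convergence of the integrands; differentiating the limit formula gives the claim.\<close>

lemma level_curve_deriv:
 assumes cf: "continuous_on (closure U) f" and C: "C1_on U f f1 f2"
  and c1: "continuous_on (closure U) f1" and c2: "continuous_on (closure U) f2" and s: "0 <= s" "s <= 1"
 shows "((%x. f (x, level s x)) has_real_derivative f1 (x, level s x) + f2 (x, level s x) * (s * u' x)) (at x)"
proof -
 define H where "H = (%(t, x). f1 (x, level t x) + f2 (x, level t x) * (t * u' x))"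
 have cl: "continuous_on ({0..1} \<times> UNIV) (%(t, x). (x, level t x))"
  unfolding level_def split_beta
  by (intro continuous_intros continuous_on_compose2[OF cont_u]) auto
 have cu': "continuous_on ({0..1::real} \<times> UNIV) (%p. u' (snd p))" by (intro continuous_on_compose2[OF cont_u'] continuous_intros) auto
 have cH: "continuous_on ({0..1} \<times> UNIV) H"
 proof -
  have "continuous_on ({0..1} \<times> UNIV) (%p. f1 (case p of (t, x) => (x, level t x)))"
   "continuous_on ({0..1} \<times> UNIV) (%p. f2 (case p of (t, x) => (x, level t x)))"
   by (rule continuous_on_compose2[OF c1 cl], use level_mem_closure in auto)
    (rule continuous_on_compose2[OF c2 cl], use level_mem_closure in auto)
  then have "continuous_on ({0..1} \<times> UNIV) (%p. f1 (case p of (t, x) => (x, level t x)) + f2 (case p of (t, x) => (x, level t x)) * (fst p * u' (snd p)))"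
   by (intro continuous_intros cu')
  then show ?thesis by (simp add: H_def split_beta)
 qed
 \<comment> \<open>A convex combination of s and 1/2, hence strictly between 0 and 1 even if s is an
   endpoint.\<close>
 define t where "t = (%n::nat. s + (1/2 - s) / real (n + 2))"
 have t: "0 < t n" "t n < 1" for n
 proof -
  define q where "q = 1 / real (n + 2)"
  have q: "0 < q" "q < 1" by (auto simp: q_def)
  have "t n = s + (1/2 - s) * q" by (simp add: t_def q_def)
  then have eq: "t n = (1 - q) * s + q / 2" by (simp add: algebra_simps)
  have b: "0 <= (1 - q) * s" "(1 - q) * s <= 1 - q" using q s mult_left_mono[of s 1 "1 - q"] by auto
  show "0 < t n" unfolding eq using q b by linarith
  show "t n < 1" unfolding eq using q b by linarith
 qed
 have tl: "t \<longlonglongrightarrow> s"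
 proof -
  have "(%n. (1/2 - s) / real (n + 2)) \<longlonglongrightarrow> 0" by (rule LIMSEQ_ignore_initial_segment[OF lim_const_over_n])
  from tendsto_add[OF tendsto_const[of s] this] show ?thesis by (simp add: t_def)
 qed
 \<comment> \<open>A bounded window around x, to have compactness for uniform continuity of the
   integrand.\<close>
 define b where "b = x - 1"
 define c where "c = x + 1"
 have bc: "b < x" "x < c" by (auto simp: b_def c_def)
 let ?K = "{0..1::real} \<times> {b..c}"
 have uc: "uniformly_continuous_on ?K H"
  by (intro compact_uniformly_continuous continuous_on_subset[OF cH] compact_Times compact_Icc) auto
 have u: "uniform_limit {b..c} (%n y. H (t n, y)) (%y. H (s, y)) sequentially"
  unfolding uniform_limit_iff
 proof (intro allI impI)
  fix e :: real assume "e > 0"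
  then obtain d where d: "d > 0" "!!p q. p : ?K ==> q : ?K ==> dist q p < d ==> dist (H q) (H p) < e"
   using uc unfolding uniformly_continuous_on_def by metis
  have "\<forall>\<^sub>F n in sequentially. dist (t n) s < d" using tl d(1) by (simp add: tendsto_iff)
  then show "\<forall>\<^sub>F n in sequentially. ALL y:{b..c}. dist (H (t n, y)) (H (s, y)) < e"
  proof eventually_elim
   case (elim n)
   show ?case
   proof
    fix y assume y: "y : {b..c}"
    show "dist (H (t n, y)) (H (s, y)) < e"
     by (rule d(2)) (use y s t[of n] elim in \<open>auto simp: dist_Pair_Pair\<close>)
   qed
  qed
 qed
 have cHs: "continuous_on {b..c} (%y. H (q, y))" if "0 <= q" "q <= 1" for q
  by (rule continuous_on_compose2[OF cH]) (use that in \<open>auto intro!: continuous_intros\<close>)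
 let ?g = "%y. f (y, level s y)"
 have FTC: "?g y = ?g b + integral {b..y} (%y. H (s, y))" if y: "y : {b..c}" for y
 proof -
  have int: "integral {b..y} (%y. H (t n, y)) = f (y, level (t n) y) - f (b, level (t n) b)" for n
  proof (rule integral_unique, rule fundamental_theorem_of_calculus)
   show "b <= y" using y by simp
   fix w
   have "((%x. f (x, level (t n) x)) has_real_derivative H (t n, w)) (at w)"
    unfolding H_def split by (rule C1_along_curve[OF C level_deriv level_mem[OF t]])
   then show "((%x. f (x, level (t n) x)) has_vector_derivative H (t n, w)) (at w within {b..y})"
    by (simp add: has_real_derivative_iff_has_vector_derivative has_vector_derivative_at_within)
  qed
  have "(%n. integral {b..y} (%y. H (t n, y))) \<longlonglongrightarrow> integral {b..y} (%y. H (s, y))"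
  proof (rule uniform_limit_integral_tendsto)
   show "uniform_limit {b..y} (%n y. H (t n, y)) (%y. H (s, y)) sequentially"
    by (rule uniform_limit_on_subset[OF u]) (use y in auto)
   show "continuous_on {b..y} (%y. H (t n, y))" for n
   proof (rule continuous_on_subset[OF cHs])
    show "0 <= t n" "t n <= 1" using t[of n] by auto
   qed (use y in auto)
  qed
  moreover have "(%n. f (w, level (t n) w)) \<longlonglongrightarrow> f (w, level s w)" for w
  proof (rule continuous_on_tendsto_compose[OF cf])
   show "(%n. (w, level (t n) w)) \<longlonglongrightarrow> (w, level s w)" unfolding level_def by (intro tendsto_intros tl)
   show "\<forall>\<^sub>F n in sequentially. (w, level (t n) w) : closure U"
    by (intro always_eventually allI level_mem_closure less_imp_le t)
   show "(w, level s w) : closure U" by (rule level_mem_closure[OF s])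
  qed
  ultimately have "integral {b..y} (%y. H (s, y)) = ?g y - ?g b"
   unfolding int by (intro LIMSEQ_unique[OF _ tendsto_diff])
  then show ?thesis by simp
 qed
 have "((%y. integral {b..y} (%y. H (s, y))) has_real_derivative H (s, x)) (at x within {b..c})"
  by (rule integral_has_real_derivative[OF cHs[OF s]]) (use bc in auto)
 then have "((%y. ?g b + integral {b..y} (%y. H (s, y))) has_real_derivative H (s, x)) (at x within {b..c})"
  by (auto intro!: derivative_eq_intros)
 then have "(?g has_real_derivative H (s, x)) (at x within {b..c})"
 proof (rule has_field_derivative_transform_within[where d=1])
  show "?g b + integral {b..y} (%y. H (s, y)) = ?g y" if "y : {b..c}" for y by (rule FTC[OF that, symmetric])
 qed (use bc in auto)
 then have "(?g has_real_derivative H (s, x)) (at x)" using bc by (simp add: at_within_Icc_at)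
 then show ?thesis by (simp add: H_def)
qed

lemma level_1: "level 1 x = u x" and level_0: "level 0 x = l" by (auto simp: level_def)

text \<open>The tangential derivatives that express the kinematic conditions at the surface and at
  the bed.\<close>

lemma top_deriv:
 assumes "c1h a U f f1 f2"
 shows "((%x. f (x, u x)) has_real_derivative f1 (x, u x) + f2 (x, u x) * u' x) (at x)"
  "((%x. f (x, l)) has_real_derivative f1 (x, l)) (at x)"
proof -
 have c: "continuous_on (closure U) f" "C1_on U f f1 f2" "continuous_on (closure U) f1" "continuous_on (closure U) f2"
  using assms by (auto simp: c1h_def intro: holder_on_continuous)
 show "((%x. f (x, u x)) has_real_derivative f1 (x, u x) + f2 (x, u x) * u' x) (at x)"
  using level_curve_deriv[OF c, of 1 x] by (simp add: level_1)
 show "((%x. f (x, l)) has_real_derivative f1 (x, l)) (at x)"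
  using level_curve_deriv[OF c, of 0 x] by (simp add: level_0)
qed

lemma level_exists:
 assumes "(x, y) : U"
 obtains s where "0 < s" "s < 1" "y = level s x"
proof (rule that[of "(y - l) / (u x - l)"])
 show "0 < (y - l) / (u x - l)" "(y - l) / (u x - l) < 1" "y = level ((y - l) / (u x - l)) x"
  using assms lu[of x] by (auto simp: level_def field_simps)
qed

lemma lipschitz_vertical:
 assumes C: "C1_on U f f1 f2" and M: "!!z. z : U ==> \<bar>f2 z\<bar> <= M" and y: "(x, y1) : U" "(x, y2) : U"
 shows "\<bar>f (x, y1) - f (x, y2)\<bar> <= M * \<bar>y1 - y2\<bar>"
proof -
 have "norm (f (x, y1) - f (x, y2)) <= M * norm (y1 - y2)"
 proof (rule field_differentiable_bound[of "{l<..<u x}" "%y. f (x, y)" "%y. f2 (x, y)"])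
  fix y assume "y : {l<..<u x}"
  then have m: "(x, y) : U" by simp
  show "((%y. f (x, y)) has_field_derivative f2 (x, y)) (at y within {l<..<u x})"
   using C1_on_slices(2)[OF C m] by (rule has_field_derivative_at_within)
  show "norm (f2 (x, y)) <= M" using M[OF m] by simp
 qed (use y in auto)
 then show ?thesis by simp
qed

text \<open>Mean value theorem on a fibre; continuity on the closure admits endpoints on the
  boundary.\<close>

lemma vertical_increase:
 assumes C: "C1_on U k k1 k2" and cont: "continuous_on (closure U) k" and k2: "!!z. z : U ==> c <= k2 z"
  and y: "l <= y1" "y1 <= y2" "y2 <= u x"
 shows "c * (y2 - y1) <= k (x, y2) - k (x, y1)"
proof (cases "y1 = y2")
 case False
 then have lt: "y1 < y2" using y by simp
 obtain \<xi> where xi: "y1 < \<xi>" "\<xi> < y2" "k (x, y2) - k (x, y1) = (y2 - y1) * k2 (x, \<xi>)"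
 proof (rule mvt[OF lt, of "%y. k (x, y)" "%y h. k2 (x, y) * h"])
  show "continuous_on {y1..y2} (%y. k (x, y))"
   by (rule continuous_on_compose2[OF cont]) (use y in \<open>auto intro!: continuous_intros\<close>)
  fix t assume "y1 < t" "t < y2"
  then have "(x, t) : U" using y by auto
  from C1_on_slices(2)[OF C this]
  show "((%y. k (x, y)) has_derivative (%h. k2 (x, t) * h)) (at t)" by (simp add: has_field_derivative_def)
 qed (auto simp: mult.commute)
 have "c <= k2 (x, \<xi>)" using xi y by (intro k2) auto
 then have "(y2 - y1) * c <= (y2 - y1) * k2 (x, \<xi>)" using lt by (intro mult_left_mono) auto
 then show ?thesis using xi(3) by (simp add: mult.commute)
qed simp

text \<open>Two points are joined by an arc of a level curve followed by a vertical segment; both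
  stay in the domain and their lengths are bounded by multiples of the distance.\<close>

lemma c1h_lipschitz:
 assumes c: "c1h a U f f1 f2"
 shows "\<exists>K\<ge>0. ALL z:closure U. ALL w:closure U. \<bar>f z - f w\<bar> <= K * dist z w"
proof -
 have C: "C1_on U f f1 f2" and h: "holder_on a (closure U) f1" "holder_on a (closure U) f2" using c by (auto simp: c1h_def)
 obtain M1 where M1: "M1 \<ge> 0" "ALL z:closure U. \<bar>f1 z\<bar> <= M1" using holder_on_E[OF h(1)] by blast
 obtain M2 where M2: "M2 \<ge> 0" "ALL z:closure U. \<bar>f2 z\<bar> <= M2" using holder_on_E[OF h(2)] by blast
 obtain L where L: "L \<ge> 0" "!!x. \<bar>u' x\<bar> <= L" using u'_bound by blast
 have M: "\<bar>f1 z\<bar> <= M1" "\<bar>f2 z\<bar> <= M2" if "z : U" for z using that M1 M2 closure_subset[of U] by blast+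
 \<comment> \<open>The first summand bounds the derivative along level curves; the second accounts
   for the vertical segment, whose length is at most (1 + L) times the distance.\<close>
 define K where "K = (M1 + M2 * L) + M2 * (1 + L)"
 have K: "K \<ge> 0" using M1 M2 L by (simp add: K_def)
 have main: "\<bar>f z - f w\<bar> <= K * dist z w" if zw: "z : U" "w : U" for z w
 proof -
  obtain x1 y1 x2 y2 where z: "z = (x1, y1)" and w: "w = (x2, y2)" by (cases z, cases w) blast
  obtain s where s: "0 < s" "s < 1" "y1 = level s x1" using level_exists zw z by blast
  let ?y = "level s x2"
  have "norm (f (x1, level s x1) - f (x2, level s x2)) <= (M1 + M2 * L) * norm (x1 - x2)"
  proof (rule field_differentiable_bound[of UNIV "%x. f (x, level s x)" "%x. f1 (x, level s x) + f2 (x, level s x) * (s * u' x)"])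
   fix x
   show "((%x. f (x, level s x)) has_field_derivative f1 (x, level s x) + f2 (x, level s x) * (s * u' x)) (at x within UNIV)"
    using C1_along_curve[OF C level_deriv level_mem[OF s(1,2)]] by simp
   have m: "(x, level s x) : U" by (rule level_mem[OF s(1,2)])
   have "\<bar>s * u' x\<bar> <= 1 * L" unfolding abs_mult using s L by (intro mult_mono) auto
   then have "\<bar>f2 (x, level s x) * (s * u' x)\<bar> <= M2 * L" unfolding abs_mult[of "f2 _"] using M(2)[OF m] M2 by (intro mult_mono) auto
   then show "norm (f1 (x, level s x) + f2 (x, level s x) * (s * u' x)) <= M1 + M2 * L" using M(1)[OF m] by simp
  qed auto
  then have A: "\<bar>f (x1, y1) - f (x2, ?y)\<bar> <= (M1 + M2 * L) * \<bar>x1 - x2\<bar>" using s by simp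
  have B: "\<bar>f (x2, ?y) - f (x2, y2)\<bar> <= M2 * \<bar>?y - y2\<bar>"
   by (rule lipschitz_vertical[OF C M(2)]) (use level_mem[OF s(1,2)] zw w in auto)
  have "?y - y1 = s * (u x2 - u x1)" using s(3) by (simp add: level_def algebra_simps)
  moreover have "\<bar>s\<bar> * \<bar>u x2 - u x1\<bar> <= 1 * (L * \<bar>x2 - x1\<bar>)" using s u_lipschitz[OF L(2), of x2 x1] by (intro mult_mono) auto
  ultimately have "\<bar>?y - y1\<bar> <= L * \<bar>x2 - x1\<bar>" by (simp add: abs_mult)
  then have "\<bar>?y - y2\<bar> <= L * \<bar>x1 - x2\<bar> + \<bar>y1 - y2\<bar>" by (simp add: abs_minus_commute)
  moreover have d: "\<bar>x1 - x2\<bar> <= dist z w" "\<bar>y1 - y2\<bar> <= dist z w"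
   using dist_fst_le[of z w] dist_snd_le[of z w] by (auto simp: z w dist_real_def)
  ultimately have "\<bar>?y - y2\<bar> <= (1 + L) * dist z w"
   using mult_left_mono[OF d(1) L(1)] by (simp add: algebra_simps)
  then have "M2 * \<bar>?y - y2\<bar> <= M2 * ((1 + L) * dist z w)" using M2 by (intro mult_left_mono) auto
  moreover have "(M1 + M2 * L) * \<bar>x1 - x2\<bar> <= (M1 + M2 * L) * dist z w" using d M1 M2 L by (intro mult_left_mono) auto
  ultimately have "\<bar>f (x1, y1) - f (x2, y2)\<bar> <= (M1 + M2 * L) * dist z w + M2 * ((1 + L) * dist z w)" using A B by linarith
  then show ?thesis by (simp add: z w K_def algebra_simps)
 qed
 have cf: "continuous_on (closure U) f" using c by (simp add: c1h_def)
 \<comment> \<open>The inequality is closed in the pair of points, so it extends from pairs in U to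
   pairs in the closure.\<close>
 have "0 <= K * dist (fst p) (snd p) - \<bar>f (fst p) - f (snd p)\<bar>" if p: "p : closure U \<times> closure U" for p
 proof (rule continuous_ge_on_closure[of "U \<times> U" "%p. K * dist (fst p) (snd p) - \<bar>f (fst p) - f (snd p)\<bar>"])
  show "continuous_on (closure (U \<times> U)) (%p. K * dist (fst p) (snd p) - \<bar>f (fst p) - f (snd p)\<bar>)"
   unfolding closure_Times by (intro continuous_intros continuous_on_compose2[OF cf]) auto
  show "p : closure (U \<times> U)" using p by (simp add: closure_Times)
 qed (use main in auto)
 then have "ALL z:closure U. ALL w:closure U. \<bar>f z - f w\<bar> <= K * dist z w" by force
 then show ?thesis using K by blast
qed

lemma c1h_vc:
 assumes c: "c1h a U f f1 f2" and p: "periodic_on lam (closure U) f"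
 shows "vc f f1 f2"
proof -
 have C: "C1_on U f f1 f2" and b: "bounded (f ` closure U)" and h: "holder_on a (closure U) f1" "holder_on a (closure U) f2"
  using c by (auto simp: c1h_def)
 obtain K where K: "ALL z:closure U. ALL w:closure U. \<bar>f z - f w\<bar> <= K * dist z w" using c1h_lipschitz[OF c] by blast
 have pU: "f (z + (lam, 0)) = f z" if "z : U" for z using p closure_subset[of U] that by (auto simp: periodic_on_def)
 note per = C1_periodic[OF C pU]
 have q: "Lrq lam r U g" if g: "holder_on a (closure U) g" "!!z. z : U ==> g (z + (lam, 0)) = g z" for g
 proof -
  obtain B where B: "ALL z:closure U. \<bar>g z\<bar> <= B" using holder_on_E[OF g(1)] by blast
  have cg: "continuous_on U g" using holder_on_continuous[OF g(1)] closure_subset by (rule continuous_on_subset)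
  have bB: "\<bar>g z\<bar> <= B" if "z : U" for z using B that closure_subset[of U] by blast
  show ?thesis by (rule Lrq_continuous[OF cg bB g(2)])
 qed
 show ?thesis unfolding vc_def
  using holder_onI_lipschitz[OF a_bounds b, of K] K p sobolev_C1[OF C] q[OF h(1) per(1)] q[OF h(2) per(2)] by blast
qed

end

text \<open>Used in two roles: k = -\<psi> maps the fluid domain to the strip, and k = h - d maps
  the strip to the fluid domain. The boundary conditions send bottom to bottom and top to top, and c
  > 0 expresses nondegeneracy.\<close>

locale fibre_inversion = D: wave_domain lam r a l u u' + E: wave_domain lam r a m v v'
 for lam r a l :: real and u u' :: "real => real" and m :: real and v v' :: "real => real" +
 fixes k k1 k2 k11 k12 k21 k22 :: "real \<times> real => real" and c :: real
 assumes k: "D.pc k k1 k2 k11 k12 k21 k22" and bot: "!!x. k (x, l) = m" and top: "!!x. k (x, u x) = v x"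
  and c: "c > 0" and k2c: "!!z. z : subgraph l u ==> c <= k2 z"
begin

abbreviation "U \<equiv> subgraph l u"
abbreviation "V \<equiv> subgraph m v"
abbreviation "T \<equiv> fibre_map k"

lemma c1h_k: "c1h a U k k1 k2" and per_k: "periodic_on lam (closure U) k"
 and vc_k1: "D.vc k1 k11 k12" and vc_k2: "D.vc k2 k21 k22"
 using k by (auto simp: D.pc_def)

lemma C_k: "C1_on U k k1 k2" and cont_k: "continuous_on (closure U) k"
 and cont_k1: "continuous_on (closure U) k1" and cont_k2: "continuous_on (closure U) k2"
 using c1h_k by (auto simp: c1h_def intro: holder_on_continuous)

lemma k2c_closure: "z : closure U ==> c <= k2 z"
 by (rule continuous_ge_on_closure[OF cont_k2]) (use k2c in auto)

lemma k_increase: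
 assumes "l <= y1" "y1 <= y2" "y2 <= u x"
 shows "c * (y2 - y1) <= k (x, y2) - k (x, y1)"
 by (rule D.vertical_increase[OF C_k cont_k k2c assms])

lemma k_increase_abs:
 assumes "(x, y1) : closure U" "(x, y2) : closure U"
 shows "c * \<bar>y1 - y2\<bar> <= \<bar>k (x, y1) - k (x, y2)\<bar>"
 using k_increase[of y1 y2 x] k_increase[of y2 y1 x] assms by (cases "y1 <= y2") auto

lemma k_inj: "(x, y1) : closure U ==> (x, y2) : closure U ==> k (x, y1) = k (x, y2) ==> y1 = y2"
 using k_increase_abs[of x y1 y2] c by (simp add: mult_le_0_iff)

lemma T_maps: "z : closure U ==> T z : closure V"
proof -
 assume z: "z : closure U"
 obtain x y where xy: "z = (x, y)" by (cases z)
 then have y: "l <= y" "y <= u x" using z by auto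
 have "0 <= c * (y - l)" "0 <= c * (u x - y)" using y c by auto
 then show ?thesis using k_increase[of l y x] k_increase[of y "u x" x] y bot[of x] top[of x]
  by (simp add: xy fibre_map_def)
qed

lemma k_surj: "(x, t) : closure V ==> EX y. (x, y) : closure U & k (x, y) = t"
proof -
 assume t: "(x, t) : closure V"
 have "\<exists>y\<ge>l. y <= u x & k (x, y) = t"
 proof (rule IVT'[of "%y. k (x, y)"])
  show "continuous_on {l..u x} (%y. k (x, y))"
   by (rule continuous_on_compose2[OF cont_k]) (auto intro!: continuous_intros)
 qed (use t bot top D.lu[of x] in auto)
 then show ?thesis by auto
qed

definition ki :: "real \<times> real => real" where
 "ki z = (THE y. (fst z, y) : closure U & k (fst z, y) = snd z)"

abbreviation "S \<equiv> fibre_map ki"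

lemma ki_eq: "(x, y) : closure U ==> ki (x, k (x, y)) = y"
 unfolding ki_def by (rule the_equality) (auto intro: k_inj simp del: D.mem_closure_U)

lemma ki_props:
 assumes "z : closure V"
 shows "S z : closure U" "T (S z) = z" "k (S z) = snd z"
proof -
 obtain x t where z: "z = (x, t)" by (cases z)
 obtain y where y: "(x, y) : closure U" "k (x, y) = t" using k_surj assms z by blast
 have "ki z = y" using ki_eq[OF y(1)] y(2) z by simp
 then show "S z : closure U" "T (S z) = z" "k (S z) = snd z" using y z by (auto simp: fibre_map_def)
qed

lemma S_T: "z : closure U ==> S (T z) = z"
 using ki_eq by (cases z) (simp add: fibre_map_def)

lemma S_maps: "z : V ==> S z : U"
proof -
 assume z: "z : V"
 obtain x t where xt: "z = (x, t)" by (cases z)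
 have m: "S z : closure U" "k (S z) = snd z" using ki_props[of z] z closure_subset[of V] by auto
 have "ki z ~= l" using m(2) bot z xt by (auto simp: fibre_map_def)
 moreover have "ki z ~= u x" using m(2) top z xt by (auto simp: fibre_map_def)
 ultimately show ?thesis using m(1) xt by (auto simp: fibre_map_def)
qed

lemma T_maps_open: "z : U ==> T z : V"
proof -
 assume z: "z : U"
 obtain x y where xy: "z = (x, y)" by (cases z)
 then have y: "l < y" "y < u x" using z by auto
 have "0 < c * (y - l)" "0 < c * (u x - y)" using y c by auto
 then show ?thesis using k_increase[of l y x] k_increase[of y "u x" x] y bot[of x] top[of x]
  by (simp add: xy fibre_map_def)
qed

lemma bij_T: "bij_betw T (closure U) (closure V)"
 by (rule bij_betw_byWitness[where f'=S]) (use S_T ki_props T_maps in auto)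

lemma the_inv_T: "z : closure V ==> the_inv_into (closure U) T z = S z"
 using the_inv_into_f_eq[OF bij_betw_imp_inj_on[OF bij_T], of "S z" z] ki_props by simp

text \<open>The height y1 need not be available over x2, so the comparison point over x2 is taken on
  the same level curve. Its image under k is close by Lipschitz continuity, and the growth of k
  along fibres turns closeness of images into closeness of heights.\<close>

lemma S_lipschitz: "\<exists>K\<ge>0. ALL z:closure V. ALL w:closure V. dist (S z) (S w) <= K * dist z w"
proof -
 obtain K where K: "K \<ge> 0" "ALL z:closure U. ALL w:closure U. \<bar>k z - k w\<bar> <= K * dist z w"
  using D.c1h_lipschitz[OF c1h_k] by blast
 obtain L where L: "L \<ge> 0" "!!x. \<bar>u' x\<bar> <= L" using D.u'_bound by blast
 have main: "\<bar>ki (x1, t1) - ki (x2, t2)\<bar> <= (L + K * (1 + L) / c + 1 / c) * dist (x1, t1) (x2, t2)"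
  if zw: "(x1, t1) : closure V" "(x2, t2) : closure V" for x1 t1 x2 t2
 proof -
  define y1 where "y1 = ki (x1, t1)"
  define y2 where "y2 = ki (x2, t2)"
  have y1: "(x1, y1) : closure U" "k (x1, y1) = t1" using ki_props[OF zw(1)] by (auto simp: fibre_map_def y1_def)
  have y2: "(x2, y2) : closure U" "k (x2, y2) = t2" using ki_props[OF zw(2)] by (auto simp: fibre_map_def y2_def)
  \<comment> \<open>Relative height of the first point in its fibre, the parameter of its level
    curve.\<close>
  define s where "s = (y1 - l) / (u x1 - l)"
  have s: "0 <= s" "s <= 1" "y1 = D.level s x1" using y1 D.lu[of x1] by (auto simp: s_def D.level_def field_simps)
  define y where "y = D.level s x2"
  have y: "(x2, y) : closure U" unfolding y_def by (rule D.level_mem_closure[OF s(1,2)])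
  let ?X = "\<bar>x1 - x2\<bar>"
  have "y - y1 = s * (u x2 - u x1)" using s(3) by (simp add: y_def D.level_def algebra_simps)
  moreover have "\<bar>s\<bar> * \<bar>u x2 - u x1\<bar> <= 1 * (L * \<bar>x2 - x1\<bar>)" using s D.u_lipschitz[OF L(2), of x2 x1] by (intro mult_mono) auto
  ultimately have "\<bar>y - y1\<bar> <= L * \<bar>x2 - x1\<bar>" by (simp add: abs_mult)
  then have yy1: "\<bar>y1 - y\<bar> <= L * ?X" by (simp add: abs_minus_commute)
  have "dist (x1, y1) (x2, y) <= ?X + \<bar>y1 - y\<bar>"
   using norm_Pair_le[of "x1 - x2" "y1 - y"] by (simp add: dist_norm)
  then have "dist (x1, y1) (x2, y) <= (1 + L) * ?X" using yy1 by (simp add: algebra_simps)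
  then have "K * dist (x1, y1) (x2, y) <= K * ((1 + L) * ?X)" using K(1) by (rule mult_left_mono)
  moreover have "\<bar>k (x1, y1) - k (x2, y)\<bar> <= K * dist (x1, y1) (x2, y)" using K(2) y1(1) y by blast
  ultimately have kk: "\<bar>k (x1, y1) - k (x2, y)\<bar> <= K * ((1 + L) * ?X)" by linarith
  have "c * \<bar>y - y2\<bar> <= \<bar>k (x2, y) - k (x2, y2)\<bar>" by (rule k_increase_abs[OF y y2(1)])
  then have "c * \<bar>y - y2\<bar> <= K * ((1 + L) * ?X) + \<bar>t1 - t2\<bar>" using kk y1(2) y2(2) by linarith
  then have "\<bar>y - y2\<bar> <= (K * ((1 + L) * ?X) + \<bar>t1 - t2\<bar>) / c" using c by (simp add: field_simps)
  then have "\<bar>y1 - y2\<bar> <= L * ?X + (K * ((1 + L) * ?X) + \<bar>t1 - t2\<bar>) / c" using yy1 by linarith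
  also have "... = (L + K * (1 + L) / c) * ?X + (1 / c) * \<bar>t1 - t2\<bar>" by (simp add: algebra_simps add_divide_distrib)
  also have "... <= (L + K * (1 + L) / c) * dist (x1, t1) (x2, t2) + (1 / c) * dist (x1, t1) (x2, t2)"
   using dist_fst_le[of "(x1, t1)" "(x2, t2)"] dist_snd_le[of "(x1, t1)" "(x2, t2)"] K L c
   by (intro add_mono mult_left_mono) (auto simp: dist_real_def)
  finally show ?thesis by (simp add: y1_def y2_def distrib_right)
 qed
 define M where "M = 1 + (L + K * (1 + L) / c + 1 / c)"
 have "M \<ge> 0" using K L c by (simp add: M_def)
 moreover have "dist (S z) (S w) <= M * dist z w" if zw: "z : closure V" "w : closure V" for z w
 proof -
  have "dist (S z) (S w) <= dist (fst z) (fst w) + dist (ki z) (ki w)"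
   using norm_Pair_le[of "fst z - fst w" "ki z - ki w"] by (simp add: fibre_map_def dist_norm)
  also have "... <= dist z w + (L + K * (1 + L) / c + 1 / c) * dist z w"
   using main[of "fst z" "snd z" "fst w" "snd w"] zw by (intro add_mono dist_fst_le) (simp add: dist_real_def)
  finally show ?thesis by (simp add: M_def distrib_right)
 qed
 ultimately show ?thesis by blast
qed

lemma cont_S: "continuous_on (closure V) S"
proof -
 obtain K where K: "K \<ge> 0" "ALL z:closure V. ALL w:closure V. dist (S z) (S w) <= K * dist z w" using S_lipschitz by blast
 then have "K-lipschitz_on (closure V) S" by (intro lipschitz_onI) auto
 then show ?thesis by (rule lipschitz_on_continuous_on)
qed

lemma cont_ki: "continuous_on (closure V) ki"
 using continuous_on_snd[OF cont_S] by (simp add: fibre_map_def)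

text \<open>Obtained by implicit differentiation of k(x, ki(x,t)) = t in t; differentiation in x
  gives the companion \<open>ki1\<close>.\<close>

definition "ki2 = (%z. inverse (k2 (S z)))"
definition "ki1 = (%z. - (k1 (S z) * inverse (k2 (S z))))"

text \<open>\<open>S\<close> is already known to be continuous, so the inverse function rule applies
  with the explicit inverse of the triangular derivative of \<open>T\<close>.\<close>

lemma C_ki: "C1_on V ki ki1 ki2"
 unfolding C1_on_def
proof (intro conjI ballI)
 show "open V" by (rule E.open_U)
 have cS: "continuous_on V S" using cont_S closure_subset by (rule continuous_on_subset)
 have nz: "k2 (S z) ~= 0" if "z : V" for z using k2c[OF S_maps[OF that]] c by auto
 have ck: "continuous_on V (%z. k1 (S z))" "continuous_on V (%z. k2 (S z))"
 proof -
  have cU: "continuous_on U k1" "continuous_on U k2" using C_k by (simp_all add: C1_on_def)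
  show "continuous_on V (%z. k1 (S z))" by (rule continuous_on_compose2[OF cU(1) cS]) (use S_maps in blast)
  show "continuous_on V (%z. k2 (S z))" by (rule continuous_on_compose2[OF cU(2) cS]) (use S_maps in blast)
 qed
 show "continuous_on V ki1" "continuous_on V ki2" unfolding ki1_def ki2_def by (intro continuous_intros ck; use nz in blast)+
 fix z assume z: "z : V"
 let ?A = "k1 (S z)" and ?B = "k2 (S z)"
 have dk: "(k has_derivative (%h. ?A * fst h + ?B * snd h)) (at (S z))"
  using C_k S_maps[OF z] by (simp only: C1_on_def)
 have dT: "(T has_derivative (%h. (fst h, ?A * fst h + ?B * snd h))) (at (S z))"
 proof -
  have eq: "T = (%z. (fst z, k z))" by (simp add: fibre_map_def fun_eq_iff)
  show ?thesis unfolding eq by (intro has_derivative_Pair dk bounded_linear_imp_has_derivative bounded_linear_fst)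
 qed
 have "(S has_derivative (%h. (fst h, (snd h - ?A * fst h) / ?B))) (at z)"
 proof (rule has_derivative_inverse_basic[where f=T and g=S and y=z and f'="%h. (fst h, ?A * fst h + ?B * snd h)" and T=V])
  show "(T has_derivative (%h. (fst h, ?A * fst h + ?B * snd h))) (at (S z))" by (rule dT)
  show "bounded_linear (%h. (fst h, (snd h - ?A * fst h) / ?B))"
   by (rule bounded_linear_Pair[OF bounded_linear_fst bounded_linear_compose[OF bounded_linear_divide
    bounded_linear_sub[OF bounded_linear_snd bounded_linear_const_mult[OF bounded_linear_fst]]]])
  show "(%h. (fst h, (snd h - ?A * fst h) / ?B)) \<circ> (%h. (fst h, ?A * fst h + ?B * snd h)) = id"
   using nz[OF z] by (simp add: fun_eq_iff)
  show "continuous (at z) S" using cS z E.open_U by (simp add: continuous_on_eq_continuous_at)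
  show "T (S w) = w" if "w : V" for w by (rule ki_props(2)) (use closure_subset[of V] that in blast)
 qed (use z E.open_U in auto)
 then have "((%z. snd (S z)) has_derivative (%h. snd (fst h, (snd h - ?A * fst h) / ?B))) (at z)"
  by (rule has_derivative_snd)
 then have "(ki has_derivative (%h. (snd h - ?A * fst h) / ?B)) (at z)" by (simp add: fibre_map_def)
 then show "(ki has_derivative (%h. ki1 z * fst h + ki2 z * snd h)) (at z)"
 proof (rule has_derivative_eq_rhs, intro ext)
  fix h show "(snd h - ?A * fst h) / ?B = ki1 z * fst h + ki2 z * snd h" unfolding ki1_def ki2_def divide_inverse by algebra
 qed
qed

lemma k2_bound: "\<exists>M>0. ALL z:closure U. \<bar>k2 z\<bar> <= M"
proof -
 have "holder_on a (closure U) k2" using c1h_k by (simp add: c1h_def)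
 then obtain M where "M \<ge> 0" "ALL z:closure U. \<bar>k2 z\<bar> <= M" using holder_on_E by blast
 then show ?thesis by (intro exI[of _ "M + 1"]) fastforce
qed

text \<open>An upper bound for k2 is a lower bound for the vertical derivative of the inverse, the
  nondegeneracy required to use \<open>S\<close> as a change of variables.\<close>

lemma ki2_lower: "\<exists>M>0. ALL z:closure V. M <= ki2 z"
proof -
 obtain M where M: "M > 0" "ALL z:closure U. \<bar>k2 z\<bar> <= M" using k2_bound by blast
 have "inverse M <= ki2 z" if "z : closure V" for z
 proof -
  have "S z : closure U" by (rule ki_props(1)[OF that])
  then have "c <= k2 (S z)" "\<bar>k2 (S z)\<bar> <= M" by (rule k2c_closure, rule M(2)[rule_format])
  then have "0 < k2 (S z)" "k2 (S z) <= M" using c by linarith+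
  then show ?thesis unfolding ki2_def by (rule le_imp_inverse_le[rotated])
 qed
 then show ?thesis using M(1) by (intro exI[of _ "inverse M"]) auto
qed

lemma ki_periodic: "z : closure V ==> ki (z + (lam, 0)) = ki z"
proof -
 assume z: "z : closure V"
 have m: "S z : closure U" "k (S z) = snd z" using ki_props[OF z] by auto
 have "k (S z + (lam, 0)) = k (S z)" using per_k m(1) by (simp add: periodic_on_def)
 then have eq: "k (fst z + lam, ki z) = snd z" using m(2) by (simp add: fibre_map_def)
 have "(fst z + lam, ki z) : closure U" using D.closure_shift[OF m(1)] by (simp add: fibre_map_def)
 from ki_eq[OF this] show ?thesis using eq plus_prod_def[of z "(lam, 0)"] by simp
qed

text \<open>\<open>S\<close> is itself the fibre map of \<open>ki\<close>, so the results on changes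
  of variables apply with the two domains exchanged.\<close>

lemma vc_S:
 assumes f: "D.vc f g1 g2"
 shows "E.vc (%z. f (S z)) (%z. g1 (S z) + ki1 z * g2 (S z)) (%z. ki2 z * g2 (S z))"
 unfolding E.vc_def
proof (intro conjI)
 obtain M where M: "M > 0" "ALL z:closure V. M <= ki2 z" using ki2_lower by blast
 have MV: "M <= ki2 z" if "z : V" for z using M(2) that closure_subset[of V] by blast
 obtain K where K: "K \<ge> 0" "ALL z:closure V. ALL w:closure V. dist (S z) (S w) <= K * dist z w" using S_lipschitz by blast
 have h: "holder_on a (closure U) f" "periodic_on lam (closure U) f" "sobolev U f g1 g2" "Lrq lam r U g1" "Lrq lam r U g2"
  using f by (auto simp: D.vc_def)
 have perV: "ki (z + (lam, 0)) = ki z" if "z : V" for z using ki_periodic that closure_subset[of V] by blast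
 show "holder_on a (closure V) (%z. f (S z))"
  by (rule holder_on_lipschitz_compose[OF h(1) D.a_bounds(1) _ K(1) _ cont_S]) (use K(2) ki_props(1) in auto)
 show "periodic_on lam (closure V) (%z. f (S z))"
  unfolding periodic_on_def
 proof
  fix z assume z: "z : closure V"
  have "S (z + (lam, 0)) = S z + (lam, 0)" using ki_periodic[OF z] by (simp add: fibre_map_def prod_eq_iff)
  then show "f (S (z + (lam, 0))) = f (S z)" using h(2) ki_props(1)[OF z] by (simp add: periodic_on_def)
 qed
 show "sobolev V (%z. f (S z)) (%z. g1 (S z) + ki1 z * g2 (S z)) (%z. ki2 z * g2 (S z))"
  by (rule sobolev_fibre_compose[OF h(3) M(1) C_ki MV S_maps])
 have q1: "Lrq lam r V (%z. g1 (S z))" by (rule Lrq_fibre[OF h(4) M(1) C_ki MV S_maps perV D.cell_sets])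
 have q2: "Lrq lam r V (%z. g2 (S z))" by (rule Lrq_fibre[OF h(5) M(1) C_ki MV S_maps perV D.cell_sets])
 note q = q1 q2
 have cki: "continuous_on V ki1" "continuous_on V ki2" using C_ki by (auto simp: C1_on_def)
 have pki: "ki1 (z + (lam, 0)) = ki1 z" "ki2 (z + (lam, 0)) = ki2 z" if "z : V" for z
  using E.C1_periodic[OF C_ki perV that] by auto
 have b: "\<bar>ki2 z\<bar> <= inverse c" "\<bar>k1 (S z)\<bar> <= B ==> \<bar>ki1 z\<bar> <= B * inverse c" if "z : V" for z B
 proof -
  have "c <= k2 (S z)" by (rule k2c[OF S_maps[OF that]])
  then have i: "0 < inverse (k2 (S z))" "inverse (k2 (S z)) <= inverse c" using c by (auto intro: le_imp_inverse_le)
  then show "\<bar>ki2 z\<bar> <= inverse c" by (simp add: ki2_def)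
  assume "\<bar>k1 (S z)\<bar> <= B"
  then show "\<bar>ki1 z\<bar> <= B * inverse c" unfolding ki1_def abs_minus_cancel abs_mult using i by (intro mult_mono) auto
 qed
 have "holder_on a (closure U) k1" using c1h_k by (simp add: c1h_def)
 then obtain B where B: "ALL z:closure U. \<bar>k1 z\<bar> <= B" using holder_on_E by blast
 have b1: "\<bar>ki1 z\<bar> <= B * inverse c" if "z : V" for z
  by (rule b(2)[OF that]) (use B S_maps[OF that] closure_subset[of U] in blast)
 show "Lrq lam r V (%z. ki2 z * g2 (S z))" by (rule E.Lrq_mult[OF q(2) cki(2) b(1) pki(2)])
 show "Lrq lam r V (%z. g1 (S z) + ki1 z * g2 (S z))"
  by (rule E.Lrq_add[OF q(1) E.Lrq_mult[OF q(2) cki(1) b1 pki(1)]])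
qed

text \<open>This and the next three are the weak partial derivatives of k1 and k2 composed with
  \<open>S\<close>, the ingredients of the second derivatives of the inverse.\<close>

definition "K1a = (%z. k11 (S z) + ki1 z * k12 (S z))"
definition "K1b = (%z. ki2 z * k12 (S z))"
definition "K2a = (%z. k21 (S z) + ki1 z * k22 (S z))"
definition "K2b = (%z. ki2 z * k22 (S z))"

lemma vc_ki2: "E.vc ki2 (%z. - K2a z / (k2 (S z))\<^sup>2) (%z. - K2b z / (k2 (S z))\<^sup>2)"
 unfolding ki2_def
proof (rule E.vc_inverse[OF _ c])
 show "E.vc (%z. k2 (S z)) K2a K2b" unfolding K2a_def K2b_def by (rule vc_S[OF vc_k2])
 show "c <= \<bar>k2 (S z)\<bar>" if "z : closure V" for z using k2c_closure[OF ki_props(1)[OF that]] by linarith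
qed

lemma vc_ki1: "E.vc ki1
 (%z. - (K1a z * ki2 z + k1 (S z) * (- K2a z / (k2 (S z))\<^sup>2)))
 (%z. - (K1b z * ki2 z + k1 (S z) * (- K2b z / (k2 (S z))\<^sup>2)))"
proof -
 have v1: "E.vc (%z. k1 (S z)) K1a K1b" unfolding K1a_def K1b_def by (rule vc_S[OF vc_k1])
 have "E.vc (%z. - (k1 (S z) * ki2 z)) (%z. - (K1a z * ki2 z + k1 (S z) * (- K2a z / (k2 (S z))\<^sup>2)))
  (%z. - (K1b z * ki2 z + k1 (S z) * (- K2b z / (k2 (S z))\<^sup>2)))"
  by (rule E.vc_minus[OF E.vc_mult[OF v1 vc_ki2]])
 then show ?thesis by (simp add: ki1_def ki2_def)
qed

text \<open>The first derivatives of the inverse are algebraic expressions in k1 and k2 composed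
  with \<open>S\<close>, and the velocity class is closed under these operations.\<close>

lemma pc_ki: "E.pc ki ki1 ki2
 (%z. - (K1a z * ki2 z + k1 (S z) * (- K2a z / (k2 (S z))\<^sup>2)))
 (%z. - (K1b z * ki2 z + k1 (S z) * (- K2b z / (k2 (S z))\<^sup>2)))
 (%z. - K2a z / (k2 (S z))\<^sup>2) (%z. - K2b z / (k2 (S z))\<^sup>2)"
 unfolding E.pc_def c1h_def
proof (intro conjI vc_ki1 vc_ki2 cont_ki C_ki)
 show "bounded (ki ` closure V)"
 proof -
  obtain M where M: "!!x. u x <= M" using D.u_bounds by blast
  have "\<bar>ki z\<bar> <= \<bar>l\<bar> + \<bar>M\<bar>" if "z : closure V" for z
   using ki_props(1)[OF that] M[of "fst z"] by (auto simp: fibre_map_def)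
  then show ?thesis by (intro boundedI[of _ "\<bar>l\<bar> + \<bar>M\<bar>"]) (erule imageE, simp)
 qed
 show "holder_on a (closure V) ki1" "holder_on a (closure V) ki2" using vc_ki1 vc_ki2 by (auto simp: E.vc_def)
 show "periodic_on lam (closure V) ki" using ki_periodic by (simp add: periodic_on_def)
qed

end

section \<open>Functions of the streamline variable\<close>

lemma AE_lborel_snd:
 "(AE z in (lborel :: (real \<times> real) measure). P (snd z)) \<longleftrightarrow> (AE p in (lborel :: real measure). P p)"
proof
 assume "AE z in (lborel :: (real \<times> real) measure). P (snd z)"
 then have "AE z in (lborel :: real measure) \<Otimes>\<^sub>M (lborel :: real measure). P (snd z)" unfolding lborel_prod .
 from lborel_pair.AE_pair[OF this] have A: "AE q in (lborel :: real measure). AE p in (lborel :: real measure). P p" by simp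
 show "AE p in (lborel :: real measure). P p"
 proof (rule ccontr)
  assume n: "\<not> (AE p in (lborel :: real measure). P p)"
  obtain N where N: "{q : space (lborel :: real measure). \<not> (AE p in (lborel :: real measure). P p)} \<subseteq> N" "emeasure (lborel :: real measure) N = 0" "N : sets (lborel :: real measure)"
   using A by (rule AE_E)
  then have "N = UNIV" using n by auto
  then show False using N(2) by simp
 qed
next
 assume "AE p in (lborel :: real measure). P p"
 then obtain N where N: "{p : space lborel. \<not> P p} \<subseteq> N" "emeasure lborel N = 0" "N : sets (lborel :: real measure)"
  by (rule AE_E)
 have "emeasure (lborel \<Otimes>\<^sub>M lborel) ((UNIV :: real set) \<times> N) = 0"
  by (subst lborel.emeasure_pair_measure_Times) (use N in auto)
 moreover have "(UNIV :: real set) \<times> N : sets (lborel \<Otimes>\<^sub>M lborel)" using N(3) by (intro pair_measureI) auto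
 ultimately have "(UNIV :: real set) \<times> N : null_sets lborel" unfolding lborel_prod by (simp only: null_sets_def mem_Collect_eq)
 then show "AE z in (lborel :: (real \<times> real) measure). P (snd z)"
  by (rule AE_I') (use N(1) in auto)
qed

text \<open>The indefinite integral is identically 0 near x, and its derivative there is h
  x.\<close>

lemma zero_if_integrals_zero:
 fixes h :: "real => real"
 assumes c: "continuous_on {c<..<d} h" and z: "!!s t. c < s ==> s <= t ==> t < d ==> integral {s..t} h = 0"
  and x: "c < x" "x < d"
 shows "h x = 0"
proof -
 obtain s where s: "c < s" "s < x" using dense[OF x(1)] by blast
 obtain t where t: "x < t" "t < d" using dense[OF x(2)] by blast
 have "continuous_on {s..t} h" by (rule continuous_on_subset[OF c]) (use s t in auto)
 then have "((%u. integral {s..u} h) has_real_derivative h x) (at x within {s..t})"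
  by (rule integral_has_real_derivative) (use s t in auto)
 then have "((%u. 0) has_real_derivative h x) (at x within {s..t})"
  by (rule has_field_derivative_transform_within[where d=1]) (use s t in \<open>auto intro!: z\<close>)
 then have "((%u. 0) has_real_derivative h x) (at x)" using s t by (simp add: at_within_Icc_at)
 from DERIV_unique[OF this DERIV_const] show ?thesis .
qed

text \<open>From s <= s^r + 1 with s = \<mu> |t|, divided by \<mu>. The free scale \<mu> takes the
  place of Hoelder's inequality and covers r = 1.\<close>

lemma powr_Young: assumes "r \<ge> 1" "\<mu> > 0" shows "\<bar>t\<bar> <= \<mu> powr (r - 1) * \<bar>t\<bar> powr r + 1 / (\<mu> :: real)"
proof -
 have A: "s <= s powr r + 1" if "s \<ge> 0" for s :: real
 proof (cases "s <= 1")
  case False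
  then have "s powr 1 <= s powr r" using assms(1) by (intro powr_mono) auto
  then show ?thesis using False by simp
 qed (use powr_ge_zero[of s r] in linarith)
 have "\<mu> * \<bar>t\<bar> <= (\<mu> * \<bar>t\<bar>) powr r + 1" by (rule A) (use assms in simp)
 then have "\<mu> * \<bar>t\<bar> <= \<mu> powr r * \<bar>t\<bar> powr r + 1" using assms by (simp add: powr_mult)
 also have "\<mu> powr r = \<mu> * \<mu> powr (r - 1)" using assms by (simp add: powr_diff)
 finally have "\<mu> * \<bar>t\<bar> <= \<mu> * (\<mu> powr (r - 1) * \<bar>t\<bar> powr r + 1 / \<mu>)" using assms by (simp add: distrib_left)
 then show ?thesis using assms(2) by (simp only: mult_le_cancel_left_pos)
qed

text \<open>On a bounded interval L_r is contained in L1, by \<open>powr_Young\<close> with scale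
  1.\<close>

lemma Lr_on_integrable_rep:
 fixes g G :: "real => real"
 assumes r: "r \<ge> 1" and L: "Lr_on r {c<..<d} g" and G: "G : borel_measurable borel" "AE p\<in>{c<..<d} in lborel. g p = G p"
 shows "integrable lborel (%p. indicator {c<..<d} p * \<bar>G p\<bar> powr r)" "integrable lborel (%p. indicator {c<..<d} p * G p)"
proof -
 note [measurable] = G(1)
 show A: "integrable lborel (%p. indicator {c<..<d} p * \<bar>G p\<bar> powr r)"
 proof (rule iffD1[OF lebesgue_on_rep(1)])
  show "(%p. \<bar>g p\<bar> powr r) : borel_measurable (lebesgue_on {c<..<d})" "integrable (lebesgue_on {c<..<d}) (%p. \<bar>g p\<bar> powr r)"
   using L by (auto simp: Lr_on_def)
  show "AE p\<in>{c<..<d} in lborel. \<bar>g p\<bar> powr r = \<bar>G p\<bar> powr r" using G(2) by eventually_elim auto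
 qed auto
 have I: "integrable lborel (%p. indicator {c<..<d} p :: real)"
  by (intro integrable_real_indicator) (auto intro!: emeasure_bounded_finite[unfolded infinity_ennreal_def] bounded_subset[OF bounded_closed_interval[of c d]])
 show "integrable lborel (%p. indicator {c<..<d} p * G p)"
 proof (rule Bochner_Integration.integrable_bound[OF Bochner_Integration.integrable_add[OF A I]])
  show "AE p in lborel. norm (indicator {c<..<d} p * G p) <= norm (indicator {c<..<d} p * \<bar>G p\<bar> powr r + indicator {c<..<d} p)"
   using powr_Young[OF r, of 1] by (auto simp: indicator_def)
 qed auto
qed

lemma test_function_1d:
 assumes \<phi>: "test_function {c<..<d::real} \<phi>"
 shows "(\<phi> has_real_derivative fd \<phi> x 1) (at x)"
  "continuous_on UNIV (%x. fd \<phi> x 1)" "x ~: {c<..<d} ==> \<phi> x = 0" "x ~: {c<..<d} ==> fd \<phi> x 1 = 0"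
proof -
 have C: "C_k (Suc 0) \<phi>" using \<phi> by (simp only: test_function_def)
 then have "\<phi> differentiable (at x)" by simp
 then have D: "(\<phi> has_derivative fd \<phi> x) (at x)" by (simp add: frechet_derivative_works)
 then have lin: "linear (fd \<phi> x)" by (rule has_derivative_linear)
 have "fd \<phi> x h = fd \<phi> x 1 * h" for h
  using linear_cmul[OF lin, of h 1] by (simp add: mult.commute)
 then have "fd \<phi> x = (%h. fd \<phi> x 1 * h)" by (rule ext)
 then show "(\<phi> has_real_derivative fd \<phi> x 1) (at x)" using D by (simp add: has_field_derivative_def)
 show "continuous_on UNIV (%x. fd \<phi> x 1)" using C by simp
 obtain S where "S \<subseteq> {c<..<d}" "!!z. z ~: S ==> \<phi> z = 0" "!!z b. z ~: S ==> fd \<phi> z b = 0"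
  using test_functionD[OF \<phi>] by metis
 then show "x ~: {c<..<d} ==> \<phi> x = 0" "x ~: {c<..<d} ==> fd \<phi> x 1 = 0" by blast+
qed

lemma test_functionI:
 assumes "!!k. C_k k \<phi>" "compact S" "S \<subseteq> U" "!!z. z ~: S ==> \<phi> z = 0"
 shows "test_function U \<phi>"
proof -
 have "closure {z. \<phi> z ~= 0} \<subseteq> S" by (rule closure_minimal) (use assms compact_imp_closed in auto)
 then show ?thesis using assms compact_closure[of "{z. \<phi> z ~= 0}"] bounded_subset[OF compact_imp_bounded[OF assms(2)]] closure_subset
  unfolding test_function_def by (metis subset_trans)
qed

lemma frechet_derivative_1: "(f has_real_derivative D) (at x) ==> fd f x 1 = D"
 using fun_cong[OF frechet_derivative_at[of f "(*) D" x], of 1] by (simp add: has_field_derivative_def)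

text \<open>The strip is treated as the domain below the constant graph 0, so that the results on
  fluid domains apply to it as well.\<close>

locale strip_domain =
 fixes lam r a p0 :: real
 assumes lam_pos: "lam > 0" and r_ge: "r \<ge> 1" and a_eq: "a = (r - 1) / r" and p0: "p0 < 0"
begin

sublocale wave_domain lam r a p0 "%_. 0" "%_. 0"
 by unfold_locales (use lam_pos r_ge a_eq p0 in \<open>auto intro: holder_on_const\<close>)

abbreviation "I \<equiv> {p0<..<0::real}"

lemma AE_I_iff: "(AE z\<in>U in lborel. P (snd z)) \<longleftrightarrow> (AE p\<in>I in lborel. P p)"
proof -
 have "z : U \<longleftrightarrow> snd z : I" for z by (cases z) auto
 then show ?thesis using AE_lborel_snd[of "%p. p : I --> P p"] by simp
qed

lemma cell_integral:
 assumes [measurable]: "h : borel_measurable (borel :: real measure)"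
 shows "(\<integral>\<^sup>+z. h (snd z) * indicator (cell lam U) z \<partial>lborel) = ennreal lam * (\<integral>\<^sup>+p. h p * indicator I p \<partial>lborel)"
proof -
 have i: "indicator (cell lam U) (q, p) = (indicator {0<..<lam} q * indicator I p :: ennreal)" for q p
  by (auto simp: cell_def indicator_def)
 have m: "(%z. h (snd z) * indicator (cell lam U) z) : borel_measurable ((lborel :: real measure) \<Otimes>\<^sub>M (lborel :: real measure))"
  by measurable (simp_all add: borel_prod)
 have "(\<integral>\<^sup>+z. h (snd z) * indicator (cell lam U) z \<partial>lborel) = (\<integral>\<^sup>+q. \<integral>\<^sup>+p. h p * indicator (cell lam U) (q, p) \<partial>lborel \<partial>lborel)"
  using lborel.nn_integral_fst[OF m] by (simp add: lborel_prod)
 also have "... = (\<integral>\<^sup>+q. indicator {0<..<lam} q * (\<integral>\<^sup>+p. h p * indicator I p \<partial>lborel) \<partial>lborel)"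
  by (intro nn_integral_cong, subst nn_integral_cmult[symmetric]) (auto simp: i mult_ac)
 also have "... = ennreal lam * (\<integral>\<^sup>+p. h p * indicator I p \<partial>lborel)"
  using lam_pos by (subst nn_integral_multc) auto
 finally show ?thesis .
qed

text \<open>A compact planar set lies in a bounded interval times its projection to the second
  coordinate, where Fubini applies.\<close>

lemma L1loc_snd:
 assumes g: "L1loc I g"
 shows "L1loc U (%z. g (snd z))"
 unfolding L1loc_def
proof (intro conjI allI impI)
 have [measurable]: "g : borel_measurable borel" using g by (simp add: L1loc_def)
 have gs: "(%z::real\<times>real. g (snd z)) : borel_measurable (borel \<Otimes>\<^sub>M borel)" by measurable
 then show "(%z::real\<times>real. g (snd z)) : borel_measurable borel" unfolding borel_prod .
 fix K :: "(real * real) set" assume K: "compact K & K \<subseteq> U"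
 let ?J = "snd ` K"
 have J: "compact ?J" "?J \<subseteq> I" using K by (auto intro!: compact_continuous_image continuous_intros)
 then have gi: "integrable lborel (%p. indicator ?J p * g p)" using g by (simp add: L1loc_def)
 have [measurable]: "?J : sets borel" "K : sets borel" using J K by (auto intro: borel_compact)
 have "bounded K" using K compact_imp_bounded by blast
 then obtain M where M: "!!z. z : K ==> norm z <= M" unfolding bounded_iff by blast
 let ?F = "%z::real\<times>real. indicator {-M..M} (fst z) * (indicator ?J (snd z) * g (snd z))"
 have "integrable ((lborel :: real measure) \<Otimes>\<^sub>M (lborel :: real measure)) ?F"
 proof (rule lborel_pair.Fubini_integrable)
  show "?F : borel_measurable (lborel \<Otimes>\<^sub>M lborel)" by measurable
  have "integrable lborel (%q::real. indicator {-M..M} q * (LINT p|lborel. \<bar>indicator ?J p * g p\<bar>))"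
   by (intro integrable_mult_left integrable_real_indicator)
    (auto intro!: emeasure_bounded_finite[unfolded infinity_ennreal_def] bounded_closed_interval)
  then show "integrable lborel (%q. LINT p|lborel. norm (?F (q, p)))" by (simp add: abs_mult)
  show "AE q in lborel. integrable lborel (%p. ?F (q, p))" using gi by (intro AE_I2) simp
 qed
 then have int: "integrable lborel (%z. indicator K z *\<^sub>R ?F z)" unfolding lborel_prod by (intro integrable_mult_indicator) auto
 have eq: "indicator K z *\<^sub>R ?F z = indicator K z * g (snd z)" for z
 proof (cases "z : K")
  case True
  then have "\<bar>fst z\<bar> <= M" using M[OF True] norm_fst_le[of "fst z" "snd z"] by simp
  then show ?thesis using True by (auto simp: indicator_def)
 qed simp
 show "integrable lborel (%z. indicator K z * g (snd z))" using int by (simp only: eq)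
qed

lemma open_I: "open I" by simp

text \<open>Fubini: vertical slices of a test function test R on the interval, while its horizontal
  derivative integrates to 0 along each horizontal line.\<close>

lemma sobolev_snd_compose:
 assumes w: "has_weak_deriv I 1 R f" and c: "continuous_on I R"
 shows "sobolev U (%z. R (snd z)) (%_. 0) (%z. f (snd z))"
proof -
 have loc: "locally_integrable_on I R" "locally_integrable_on I f" using w by (auto simp: has_weak_deriv_def)
 obtain R0 where R0: "L1loc I R0" "AE p\<in>I in lborel. R p = R0 p" using L1loc_rep_exists[OF open_I loc(1)] .
 obtain f0 where f0: "L1loc I f0" "AE p\<in>I in lborel. f p = f0 p" using L1loc_rep_exists[OF open_I loc(2)] .
 note LR = L1loc_snd[OF R0(1)] and Lf = L1loc_snd[OF f0(1)]
 have AR: "AE z\<in>U in lborel. R (snd z) = R0 (snd z)" by (rule iffD2[OF AE_I_iff R0(2)])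
 have Af: "AE z\<in>U in lborel. f (snd z) = f0 (snd z)" by (rule iffD2[OF AE_I_iff f0(2)])
 have cU: "continuous_on U (%z. R (snd z))" by (rule continuous_on_compose2[OF c]) (auto intro!: continuous_intros)
 have l1: "locally_integrable_on U (%z. R (snd z))" by (rule locally_integrable_continuous[OF open_U cU])
 have l2: "locally_integrable_on U (%z. R0 (snd z))" "locally_integrable_on U (%z. f0 (snd z))"
  using LR Lf by (auto intro: locally_integrable_of_L1loc)
 have l0: "locally_integrable_on U (%_. 0 :: real)" by (rule locally_integrable_continuous[OF open_U]) simp
 have m: "(%z::real\<times>real. R0 (snd z)) : borel_measurable borel" "(%z::real\<times>real. f0 (snd z)) : borel_measurable borel"
  using LR Lf by (auto simp: L1loc_def)
 have tested: "(LINT z|lborel. R0 (snd z) * fd \<phi> z (0, 1)) = - (LINT z|lborel. f0 (snd z) * \<phi> z) \<and>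
  (LINT z|lborel. R0 (snd z) * fd \<phi> z (1, 0)) = 0" if \<phi>: "test_function U \<phi>" for \<phi>
 proof -
  obtain S where S: "compact S" "S \<subseteq> U" "!!z. z ~: S ==> \<phi> z = 0" "!!z b. z ~: S ==> fd \<phi> z b = 0"
   "continuous_on UNIV \<phi>" "!!b. b : Basis ==> continuous_on UNIV (%z. fd \<phi> z b)"
   using test_functionD[OF \<phi>] by metis
  have C: "C_k k \<phi>" for k using \<phi> by (simp add: test_function_def)
  have diff: "\<phi> differentiable (at z)" for z using C[of "Suc 0"] by simp
  note int = L1loc_times_integrable[OF LR S(1,2) S(6)[OF Basis_plane(2)] S(4)] L1loc_times_integrable[OF Lf S(1,2,5,3)]
   L1loc_times_integrable[OF LR S(1,2) S(6)[OF Basis_plane(1)] S(4)]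
  note int' = int[folded lborel_prod]
  have slice: "test_function I (%p. \<phi> (q, p))" for q
  proof (rule test_functionI)
   show "C_k k (%p. \<phi> (q, p))" for k by (rule C_k_slice[OF C])
   show "compact (snd ` S)" "snd ` S \<subseteq> I" using S by (auto intro!: compact_continuous_image continuous_intros)
   show "\<phi> (q, p) = 0" if "p ~: snd ` S" for p using that by (intro S(3)) force
  qed
  have fd: "frechet_derivative (%p. \<phi> (q, p)) (at p) 1 = fd \<phi> (q, p) (0, 1)" for q p
   by (rule frechet_derivative_1[OF frechet_slice(1)[OF diff]])
  have one: "(LINT p|lborel. R0 p * fd \<phi> (q, p) (0, 1)) = - (LINT p|lborel. f0 p * \<phi> (q, p))" for q
   using weak_deriv_borel[OF w open_I _ _ R0(2) _ f0(2) slice[of q]] R0(1) f0(1) by (simp add: fd L1loc_def)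
  have A: "(LINT z|lborel. R0 (snd z) * fd \<phi> z (0, 1)) = - (LINT z|lborel. f0 (snd z) * \<phi> z)"
   using lborel_pair.integral_fst'[OF int'(1)] lborel_pair.integral_fst'[OF int'(2)] by (simp add: lborel_prod one)
  obtain M where M: "!!z. z : S ==> norm z <= M" using compact_imp_bounded[OF S(1)] unfolding bounded_iff by blast
  have out: "(q, p) ~: S" if "\<bar>q\<bar> > M" for q p using M[of "(q, p)"] norm_fst_le[of q p] that by fastforce
  have zero: "(LINT q|lborel. fd \<phi> (q, p) (1, 0)) = 0" for p
  proof (rule integral_deriv_zero_1d)
   show "((%q. \<phi> (q, p)) has_real_derivative fd \<phi> (q, p) (1, 0)) (at q)" for q
    by (rule frechet_slice(2)[OF diff])
   show "continuous_on UNIV (%q. fd \<phi> (q, p) (1, 0))"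
    by (rule continuous_on_compose2[OF S(6)[OF Basis_plane(1)]]) (auto intro!: continuous_intros)
  qed (use out S(3,4) in blast)+
  have B: "(LINT z|lborel. R0 (snd z) * fd \<phi> z (1, 0)) = 0"
   using lborel_pair.integral_snd[of "%q p. R0 p * fd \<phi> (q, p) (1, 0)"] int'(3)
   by (simp add: lborel_prod zero split_beta')
  show ?thesis using A B ..
 qed
 have "has_weak_deriv U (0, 1) (%z. R (snd z)) (%z. f0 (snd z))"
  by (rule iffD2[OF weak_deriv_borel_iff[OF open_U Basis_plane(2) l1 l2(2) m(1) AR m(2)]]) (use tested in auto)
 moreover have "has_weak_deriv U (1, 0) (%z. R (snd z)) (%_. 0)"
  by (rule iffD2[OF weak_deriv_borel_iff[OF open_U Basis_plane(1) l1 l0 m(1) AR, of "%_. 0"]]) (use tested in auto)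
 ultimately have "sobolev U (%z. R (snd z)) (%_. 0) (%z. f0 (snd z))" by (intro sobolev_of_weak[OF open_U cU])
 then show ?thesis by (rule sobolev_cong) (use Af in \<open>auto intro: AE_mp\<close>)
qed

text \<open>Reduced to uniqueness in the plane by composing with the second coordinate.\<close>

lemma weak_deriv_1d_unique:
 assumes w: "has_weak_deriv I 1 R f" "has_weak_deriv I 1 R' f'" and c: "continuous_on I R" and eq: "!!p. p : I ==> R p = R' p"
 shows "AE p\<in>I in lborel. f p = f' p"
proof -
 have s: "sobolev U (%z. R (snd z)) (%_. 0) (%z. f (snd z))" by (rule sobolev_snd_compose[OF w(1) c])
 have "continuous_on I R'" by (rule continuous_on_eq[OF c eq])
 then have "sobolev U (%z. R' (snd z)) (%_. 0) (%z. f' (snd z))" by (rule sobolev_snd_compose[OF w(2)])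
 then have s': "sobolev U (%z. R (snd z)) (%_. 0) (%z. f' (snd z))" by (rule sobolev_cong') (use eq in auto)
 have "AE z\<in>U in lborel. f (snd z) = f' (snd z)" using sobolev_wd(4)[OF s] sobolev_wd(4)[OF s'] by eventually_elim auto
 then show ?thesis by (rule iffD1[OF AE_I_iff])
qed

text \<open>The embedding of W^1_r of an interval into Hoelder functions, read off in the strip: the
  rectangle identity expresses an increment of F as an integral of g2, which
  \<open>powr_Young\<close> estimates.\<close>

lemma holder_snd:
 assumes s: "sobolev U f g1 g2" and F: "!!z. z : U ==> f z = F (snd z)" and q: "Lrq lam r U g2"
 shows "\<exists>C\<ge>0. ALL p1:I. ALL p2:I. \<bar>F p1 - F p2\<bar> <= C * \<bar>p1 - p2\<bar> powr a"
proof -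
 obtain G1 G2 where G: "sob U f G1 G2" "AE z\<in>U in lborel. g2 z = G2 z" using s by (auto simp: sobolev_def)
 obtain H where H: "H : borel_measurable borel" "AE z\<in>U in lborel. g2 z = H z"
  "(\<integral>\<^sup>+z. ennreal (\<bar>H z\<bar> powr r) * indicator (cell lam U) z \<partial>lborel) < \<infinity>"
  using q by (auto simp: Lrq_def)
 note [measurable] = H(1)
 have G2m: "L1loc U G2" using G(1) by (simp add: sob_def)
 define A where "A = enn2real (\<integral>\<^sup>+z. ennreal (\<bar>H z\<bar> powr r) * indicator (cell lam U) z \<partial>lborel)"
 have A: "A \<ge> 0" "(\<integral>\<^sup>+z. ennreal (\<bar>H z\<bar> powr r) * indicator (cell lam U) z \<partial>lborel) = ennreal A"
  using H(3) by (simp_all add: A_def)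
 have main: "\<bar>F p2 - F p1\<bar> <= (2 * A / lam + 1) * (p2 - p1) powr a" if p: "p0 < p1" "p1 < p2" "p2 < 0" for p1 p2
 proof -
  define L where "L = p2 - p1"
  have L: "L > 0" using p by (simp add: L_def)
  \<comment> \<open>This scale balances the two terms: \<mu>^(r-1) and L/\<mu> are both L^a, which
    is where the exponent (r-1)/r originates.\<close>
  define \<mu> where "\<mu> = L powr (1 / r)"
  have mu: "\<mu> > 0" using L by (simp add: \<mu>_def)
  \<comment> \<open>The middle half of a period, so that the closed rectangle fits into the open
    cell.\<close>
  let ?K = "cbox (lam / 4, p1) (3 * lam / 4, p2)"
  have KU: "?K \<subseteq> U" "?K \<subseteq> cell lam U" using p lam by (auto simp: cell_def)
  have int: "integrable lborel (%z. indicator ?K z * G2 z)" using G2m KU by (auto simp: L1loc_def)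
  have "(LINT z|lborel. indicator ?K z * G2 z) = integral {lam/4..3*lam/4} (%x. f (x, p2) - f (x, p1))"
   by (rule sob_rect(2)[OF G(1) KU(1)]) (use lam p in auto)
  also have "... = integral {lam/4..3*lam/4} (%x. F p2 - F p1)"
   by (rule integral_cong) (use p in \<open>simp add: F\<close>)
  also have "... = lam / 2 * (F p2 - F p1)" using lam by (simp add: field_simps)
  finally have e: "(LINT z|lborel. indicator ?K z * G2 z) = lam / 2 * (F p2 - F p1)" .
  have "lam / 2 * \<bar>F p2 - F p1\<bar> = \<bar>LINT z|lborel. indicator ?K z * G2 z\<bar>" unfolding e abs_mult using lam by simp
  then have "ennreal (lam / 2 * \<bar>F p2 - F p1\<bar>) <= (\<integral>\<^sup>+z. ennreal \<bar>indicator ?K z * G2 z\<bar> \<partial>lborel)"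
   using integral_norm_bound_ennreal[OF int] by simp
  also have "... <= (\<integral>\<^sup>+z. ennreal (\<mu> powr (r - 1)) * (ennreal (\<bar>H z\<bar> powr r) * indicator (cell lam U) z) + ennreal (1 / \<mu>) * indicator ?K z \<partial>lborel)"
  proof (rule nn_integral_mono_AE)
   show "AE z in lborel. ennreal \<bar>indicator ?K z * G2 z\<bar> <= ennreal (\<mu> powr (r - 1)) * (ennreal (\<bar>H z\<bar> powr r) * indicator (cell lam U) z) + ennreal (1 / \<mu>) * indicator ?K z"
    using G(2) H(2)
   proof eventually_elim
    case (elim z)
    show ?case
    proof (cases "z : ?K")
     case True
     then have z: "z : U" "z : cell lam U" using KU by auto
     then have "G2 z = H z" using elim by simp
     then have "ennreal \<bar>G2 z\<bar> <= ennreal (\<mu> powr (r - 1) * \<bar>H z\<bar> powr r + 1 / \<mu>)"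
      using powr_Young[OF r mu, of "H z"] by (intro ennreal_leI) simp
     also have "... = ennreal (\<mu> powr (r - 1)) * ennreal (\<bar>H z\<bar> powr r) + ennreal (1 / \<mu>)"
      using mu by (simp add: ennreal_mult ennreal_plus)
     finally show ?thesis using True z(2) by simp
    qed simp
   qed
  qed
  also have "... = ennreal (\<mu> powr (r - 1)) * ennreal A + ennreal (1 / \<mu>) * emeasure lborel ?K"
   by (subst nn_integral_add) (auto simp: nn_integral_cmult A(2))
  also have "emeasure lborel ?K = ennreal (lam / 2 * L)"
   using lam p by (subst emeasure_lborel_cbox_eq) (auto simp: Basis_prod_def L_def field_simps)
  also have "ennreal (\<mu> powr (r - 1)) * ennreal A + ennreal (1 / \<mu>) * ennreal (lam / 2 * L) = ennreal (\<mu> powr (r - 1) * A + 1 / \<mu> * (lam / 2 * L))"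
   using mu A lam L by (simp add: ennreal_mult[symmetric] ennreal_plus[symmetric] del: ennreal_plus)
  finally have "ennreal (lam / 2 * \<bar>F p2 - F p1\<bar>) <= ennreal (\<mu> powr (r - 1) * A + 1 / \<mu> * (lam / 2 * L))" .
  then have bd: "lam / 2 * \<bar>F p2 - F p1\<bar> <= \<mu> powr (r - 1) * A + 1 / \<mu> * (lam / 2 * L)"
   by (rule iffD1[OF ennreal_le_iff, rotated]) (use mu A lam L in simp)
  have m1: "\<mu> powr (r - 1) = L powr a" unfolding \<mu>_def powr_powr by (simp add: a)
  have m2: "1 / \<mu> * L = L powr a"
  proof -
   have "1 / \<mu> * L = L powr 1 / L powr (1 / r)" using L by (simp add: \<mu>_def)
   also have "... = L powr (1 - 1 / r)" by (rule powr_diff[symmetric])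
   also have "1 - 1 / r = a" using r by (simp add: a field_simps)
   finally show ?thesis .
  qed
  have "1 / \<mu> * (lam / 2 * L) = lam / 2 * (1 / \<mu> * L)" by simp
  then have "lam / 2 * \<bar>F p2 - F p1\<bar> <= L powr a * A + lam / 2 * L powr a" using bd unfolding m1 m2 by simp
  also have "... = lam / 2 * ((2 * A / lam + 1) * L powr a)" using lam by (simp add: field_simps)
  finally show ?thesis using lam by (simp add: L_def)
 qed
 have "\<bar>F p1 - F p2\<bar> <= (2 * A / lam + 1) * \<bar>p1 - p2\<bar> powr a" if "p1 : I" "p2 : I" for p1 p2
  using main[of p1 p2] main[of p2 p1] that by (cases p1 p2 rule: linorder_cases) (auto simp: abs_minus_commute)
 then show ?thesis using A lam by (intro exI[of _ "2 * A / lam + 1"]) auto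
qed

text \<open>Gives profiles in p, such as density and head, the full regularity of class (i);
  transported back by the hodograph map they become fields in the fluid domain.\<close>

lemma vc_snd_compose:
 assumes w: "has_weak_deriv I 1 R f" and c: "continuous_on {p0..0} R" and L: "Lr_on r I f"
 shows "vc (%z. R (snd z)) (%_. 0) (%z. f (snd z))"
proof -
 have cI: "continuous_on I R" by (rule continuous_on_subset[OF c]) auto
 have s: "sobolev U (%z. R (snd z)) (%_. 0) (%z. f (snd z))" by (rule sobolev_snd_compose[OF w cI])
 have fm: "f : borel_measurable (lebesgue_on I)" using L by (simp add: Lr_on_def)
 obtain f0 where f0: "f0 : borel_measurable borel" "AE p\<in>I in lborel. f p = f0 p"
  using borel_rep_exists[OF borel_open[OF open_I] fm] .
 note [measurable] = f0(1)
 have fin: "(\<integral>\<^sup>+p. ennreal (\<bar>f0 p\<bar> powr r) * indicator I p \<partial>lborel) < \<infinity>"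
 proof -
  have "(\<integral>\<^sup>+p. ennreal (\<bar>f0 p\<bar> powr r) * indicator I p \<partial>lborel) = (\<integral>\<^sup>+p. ennreal (norm (indicator I p * \<bar>f0 p\<bar> powr r)) \<partial>lborel)"
   by (intro nn_integral_cong) (auto simp: indicator_def)
  also have "... < \<infinity>" using Lr_on_integrable_rep(1)[OF r L f0] by (simp add: integrable_iff_bounded)
  finally show ?thesis .
 qed
 have q: "Lrq lam r U (%z. f (snd z))"
  unfolding Lrq_def
 proof (intro conjI exI[of _ "%z. f0 (snd z)"])
  have "(%z::real\<times>real. f0 (snd z)) : borel_measurable (borel \<Otimes>\<^sub>M borel)" by measurable
  then show "(%z::real\<times>real. f0 (snd z)) : borel_measurable borel" unfolding borel_prod .
  show "AE z\<in>U in lborel. f (snd z) = f0 (snd z)" by (rule iffD2[OF AE_I_iff f0(2)])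
  show "(\<integral>\<^sup>+z. ennreal (\<bar>f0 (snd z)\<bar> powr r) * indicator (cell lam U) z \<partial>lborel) < \<infinity>"
   using cell_integral[of "%p. ennreal (\<bar>f0 p\<bar> powr r)"] fin by (simp add: ennreal_mult_less_top)
 qed simp
 obtain C where C: "C \<ge> 0" "ALL p1:I. ALL p2:I. \<bar>R p1 - R p2\<bar> <= C * \<bar>p1 - p2\<bar> powr a"
  using holder_snd[OF s refl q] by blast
 have C': "\<bar>R p1 - R p2\<bar> <= C * \<bar>p1 - p2\<bar> powr a" if p: "p1 : {p0..0}" "p2 : {p0..0}" for p1 p2
 proof -
  define e where "e = (%n::nat. 1 / real (n + 2))"
  \<comment> \<open>Shrinking towards the midpoint p0/2 moves the endpoints into the open interval
    without increasing distances, so the bound extends to the closed interval by continuity.\<close>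
  define \<pi> where "\<pi> = (%n p. (1 - e n) * p + e n * (p0 / 2))"
  have e: "0 < e n" "e n < 1" for n by (auto simp: e_def)
  have e0: "e \<longlonglongrightarrow> 0" unfolding e_def by (rule LIMSEQ_ignore_initial_segment[OF lim_const_over_n])
  have m: "\<pi> n p : I" if "p : {p0..0}" for n p
  proof -
   have "(1 - e n) * p0 <= (1 - e n) * p" "(1 - e n) * p <= 0" using e[of n] that by (auto intro: mult_left_mono mult_nonneg_nonpos)
   moreover have "e n * p0 < e n * (p0 / 2)" "e n * (p0 / 2) < 0" using e[of n] p0 by (auto simp: mult_pos_neg)
   moreover have "(1 - e n) * p0 + e n * p0 = p0" by (simp add: algebra_simps)
   ultimately show ?thesis unfolding \<pi>_def by simp
  qed
  have lim: "(%n. R (\<pi> n p)) \<longlonglongrightarrow> R p" if "p : {p0..0}" for p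
  proof (rule continuous_on_tendsto_compose[OF c _ that])
   have "(%n. \<pi> n p) \<longlonglongrightarrow> (1 - 0) * p + 0 * (p0 / 2)" unfolding \<pi>_def by (intro tendsto_intros e0)
   then show "(%n. \<pi> n p) \<longlonglongrightarrow> p" by simp
   show "\<forall>\<^sub>F n in sequentially. \<pi> n p : {p0..0}" using m[OF that] by (intro always_eventually) (auto simp: less_imp_le)
  qed
  have "(%n. \<bar>R (\<pi> n p1) - R (\<pi> n p2)\<bar>) \<longlonglongrightarrow> \<bar>R p1 - R p2\<bar>" by (intro tendsto_intros lim p)
  then show ?thesis
  proof (rule LIMSEQ_le_const2, intro exI allI impI)
   fix n
   have "\<pi> n p1 - \<pi> n p2 = (1 - e n) * (p1 - p2)" by (simp add: \<pi>_def algebra_simps)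
   then have "\<bar>\<pi> n p1 - \<pi> n p2\<bar> <= 1 * \<bar>p1 - p2\<bar>" unfolding abs_mult using e[of n] by (simp only: abs_mult, intro mult_right_mono) auto
   then have "\<bar>\<pi> n p1 - \<pi> n p2\<bar> powr a <= \<bar>p1 - p2\<bar> powr a" using a_bounds by (intro powr_mono2) auto
   then have "C * \<bar>\<pi> n p1 - \<pi> n p2\<bar> powr a <= C * \<bar>p1 - p2\<bar> powr a" using C(1) by (rule mult_left_mono)
   then show "\<bar>R (\<pi> n p1) - R (\<pi> n p2)\<bar> <= C * \<bar>p1 - p2\<bar> powr a"
    using bspec[OF bspec[OF C(2) m[OF p(1)]] m[OF p(2)]] by (rule order_trans[rotated])
  qed
 qed
 have "bounded (R ` {p0..0})" by (intro compact_imp_bounded compact_continuous_image c) auto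
 then obtain B where "ALL x:R ` {p0..0}. norm x <= B" unfolding bounded_iff by blast
 then have B: "!!p. p : {p0..0} ==> \<bar>R p\<bar> <= B" by simp
 have sn: "snd z : {p0..0}" if "z : closure U" for z using that by (cases z) simp
 have "holder_on a (closure U) (%z. R (snd z))"
 proof (rule holder_onI)
  show "continuous_on (closure U) (%z. R (snd z))" by (rule continuous_on_compose2[OF c]) (use sn in \<open>auto intro!: continuous_intros\<close>)
  show "\<bar>R (snd z)\<bar> <= B" if "z : closure U" for z by (rule B[OF sn[OF that]])
  show "\<bar>R (snd z) - R (snd w)\<bar> <= C * dist z w powr a" if "z : closure U" "w : closure U" for z w
  proof -
   have "\<bar>snd z - snd w\<bar> powr a <= dist z w powr a" using dist_snd_le[of z w] a_bounds by (intro powr_mono2) (auto simp: dist_real_def)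
   then show ?thesis using C'[OF sn[OF that(1)] sn[OF that(2)]] mult_left_mono[OF _ C(1)] by (meson order_trans)
  qed
 qed
 then show ?thesis using s q Lrq_const[of 0] by (simp add: vc_def periodic_on_def)
qed

end

section \<open>Antiderivatives in p and functions independent of q\<close>

context strip_domain begin

lemma Lr_on_continuous:
 assumes c: "continuous_on {p0..0} F"
 shows "Lr_on r I F"
proof -
 have cI: "continuous_on I F" by (rule continuous_on_subset[OF c]) auto
 have m: "F : borel_measurable (lebesgue_on I)" by (rule continuous_imp_measurable_on_sets_lebesgue[OF cI]) simp
 have "bounded (F ` {p0..0})" by (intro compact_imp_bounded compact_continuous_image c compact_Icc)
 then obtain B where "ALL x:F ` {p0..0}. norm x <= B" unfolding bounded_iff by blast
 then have B: "\<bar>F p\<bar> <= B" if "p : I" for p using that by simp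
 have "I : lmeasurable" by (rule bounded_set_imp_lmeasurable) (auto intro: bounded_subset[OF bounded_closed_interval[of p0 0]])
 then interpret finite_measure "lebesgue_on I" by (rule finite_measure_lebesgue_on)
 have "integrable (lebesgue_on I) (%p. \<bar>F p\<bar> powr r)"
 proof (rule integrable_const_bound[of _ "B powr r"])
  show "AE p in lebesgue_on I. norm (\<bar>F p\<bar> powr r) <= B powr r"
   by (rule AE_I2) (use r B in \<open>auto simp: space_restrict_space intro!: powr_mono2\<close>)
  show "(%p. \<bar>F p\<bar> powr r) : borel_measurable (lebesgue_on I)" using m by measurable
 qed
 then show ?thesis using m by (simp add: Lr_on_def)
qed

text \<open>Take K plus the integral of \<beta> from p to 0; Fubini on a triangle verifies the weak
  derivative for merely integrable \<beta>. The free value K will normalise the pressure at the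
  surface.\<close>

lemma antiderivative_exists:
 assumes L: "Lr_on r I \<beta>"
 shows "EX B. continuous_on {p0..0} B & B 0 = K & has_weak_deriv I 1 B (%p. - \<beta> p)"
proof -
 have bm: "\<beta> : borel_measurable (lebesgue_on I)" using L by (simp add: Lr_on_def)
 obtain \<beta>0 where \<beta>0: "\<beta>0 : borel_measurable borel" "AE p\<in>I in lborel. \<beta> p = \<beta>0 p"
  using borel_rep_exists[OF borel_open[OF open_I] bm] .
 define b where "b = (%p. indicator I p * \<beta>0 p)"
 have ib: "integrable lborel b" unfolding b_def by (rule Lr_on_integrable_rep(2)[OF r L \<beta>0])
 have [measurable]: "b : borel_measurable borel" using ib by simp
 have b0: "b p = 0" if "p ~: I" for p using that by (simp add: b_def)
 have bset: "set_integrable lborel {p..q} b" for p q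
  unfolding set_integrable_def by (rule integrable_mult_indicator[OF _ ib]) simp
 define B where "B = (%p. K + integral {p..0} b)"
 have Bp: "B p = K + (LINT s|lborel. indicator {p..0} s * b s)" for p
  using set_borel_integral_eq_integral(2)[OF bset[of p 0]] by (simp add: B_def set_lebesgue_integral_def)
 have cB: "continuous_on {p0..0} B"
  unfolding B_def by (intro continuous_intros indefinite_integral_continuous_1' set_borel_integral_eq_integral(1) bset)
 have cBI: "continuous_on I B" by (rule continuous_on_subset[OF cB]) auto
 have B0: "B 0 = K" using integral_refl[of 0 b] by (simp add: B_def)
 have loc1: "locally_integrable_on I B" by (rule locally_integrable_continuous[OF open_I cBI])
 have Lb: "L1loc I (%p. - b p)"
  unfolding L1loc_def
 proof (intro conjI allI impI)
  fix K :: "real set" assume "compact K & K \<subseteq> I"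
  then have "integrable lborel (%z. indicator K z *\<^sub>R (- b z))" by (intro integrable_mult_indicator integrable_minus ib) (auto intro: borel_compact)
  then show "integrable lborel (%z. indicator K z * - b z)" by simp
 qed measurable
 have Ab: "AE p\<in>I in lborel. - b p = - \<beta> p" using \<beta>0(2) by eventually_elim (auto simp: b_def)
 have loc\<beta>: "locally_integrable_on I (%p. - \<beta> p)"
  unfolding locally_integrable_on_def
 proof (intro allI impI)
  fix K :: "real set" assume K: "compact K & K \<subseteq> I"
  have bK: "\<beta> : borel_measurable (lebesgue_on K)" by (rule measurable_restrict_mono[OF bm]) (use K in simp)
  show "integrable (lebesgue_on K) (%p. - \<beta> p)"
  proof (rule iffD2[OF lebesgue_on_rep(1)])
   show "(%p. - b p) : borel_measurable borel" by measurable
   show "K : sets borel" using K by (simp add: borel_compact)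
   show "(%p. - \<beta> p) : borel_measurable (lebesgue_on K)" using bK by measurable
   show "AE p\<in>K in lborel. - \<beta> p = - b p" using Ab by eventually_elim (use K in auto)
   show "integrable lborel (%p. indicator K p * - b p)" using Lb K by (simp add: L1loc_def)
  qed
 qed
 have m1: "(%p. indicator I p * B p) : borel_measurable borel"
  using borel_measurable_continuous_on_indicator[OF _ cBI] by simp
 have tested: "(LINT p|lborel. (indicator I p * B p) * fd \<phi> p 1) = - (LINT p|lborel. - b p * \<phi> p)"
  if \<phi>: "test_function I \<phi>" for \<phi>
 proof -
  define \<phi>' where "\<phi>' = (%p. fd \<phi> p 1)"
  have D: "(\<phi> has_real_derivative \<phi>' p) (at p)" and c': "continuous_on UNIV \<phi>'" and z: "p ~: I ==> \<phi> p = 0" and z': "p ~: I ==> \<phi>' p = 0" for p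
   using test_function_1d[OF \<phi>] by (simp_all add: \<phi>'_def)
  have [measurable]: "\<phi>' : borel_measurable borel" by (rule borel_measurable_continuous_onI[OF c'])
  have out: "p ~: I" if "\<bar>p\<bar> > - p0" for p using that by auto
  have i': "integrable lborel \<phi>'" by (rule integrable_compact_support[OF c', of "- p0"], rule z', rule out) (simp add: dist_real_def)
  have i0: "(LINT p|lborel. \<phi>' p) = 0" by (rule integral_deriv_zero_1d[OF D c', of "- p0"]) (use out z z' in blast)+
  \<comment> \<open>The triangle p <= s <= 0, with s as first coordinate: integrating in p first
    gives b \<phi>, integrating in s first gives the integral that defines B.\<close>
  let ?D = "{w::real\<times>real. snd w <= fst w & fst w <= 0}"
  let ?F = "%w. indicator ?D w * (b (fst w) * \<phi>' (snd w))"
  have Dm: "?D : sets ((lborel :: real measure) \<Otimes>\<^sub>M (lborel :: real measure))"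
   unfolding lborel_prod by (simp, intro borel_closed closed_Collect_conj closed_Collect_le continuous_intros)
  have "integrable ((lborel :: real measure) \<Otimes>\<^sub>M (lborel :: real measure)) (%w. b (fst w) * \<phi>' (snd w))"
  proof (rule lborel_pair.Fubini_integrable)
   show "(%w. b (fst w) * \<phi>' (snd w)) : borel_measurable (lborel \<Otimes>\<^sub>M lborel)" by measurable
   show "integrable lborel (%q. LINT p|lborel. norm (b (fst (q, p)) * \<phi>' (snd (q, p))))" using ib by (simp add: abs_mult)
   show "AE q in lborel. integrable lborel (%p. b (fst (q, p)) * \<phi>' (snd (q, p)))" using i' by (intro AE_I2) simp
  qed
  from integrable_mult_indicator[OF Dm this]
  have iF: "integrable ((lborel :: real measure) \<Otimes>\<^sub>M (lborel :: real measure)) ?F" by simp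
  have one: "(LINT s|lborel. ?F (s, p)) = (LINT s|lborel. indicator {p..0} s * b s) * \<phi>' p" for p
  proof -
   have e: "?F (s, p) = (indicator {p..0} s * b s) * \<phi>' p" for s by (simp add: indicator_def)
   show ?thesis by (simp only: e integral_mult_left_zero)
  qed
  have two: "(LINT p|lborel. ?F (s, p)) = b s * \<phi> s" for s
  proof (cases "s : I")
   case True
   have e: "?F (s, p) = b s * (\<phi>' p * indicator {p0..s} p)" for p
    using True z'[of p] by (cases "p0 <= p") (auto simp: indicator_def)
   have "(LINT p|lborel. ?F (s, p)) = b s * (LINT p|lborel. \<phi>' p * indicator {p0..s} p)"
    by (simp only: e integral_mult_right_zero)
   also have "(LINT p|lborel. \<phi>' p * indicator {p0..s} p) = \<phi> s - \<phi> p0"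
    by (rule integral_FTC_Icc_real) (use True D c' in \<open>auto simp: continuous_on_eq_continuous_at\<close>)
   finally show ?thesis using z[of p0] by simp
  qed (simp add: b0)
  have "(LINT s|lborel. b s * \<phi> s) = (LINT w|(lborel \<Otimes>\<^sub>M lborel). ?F w)"
   using lborel_pair.integral_fst'[OF iF] by (simp only: two)
  also have "... = (LINT p|lborel. LINT s|lborel. ?F (s, p))"
   using lborel_pair.integral_snd[of "%s p. ?F (s, p)"] iF by (simp add: split_beta')
  also have "... = (LINT p|lborel. (LINT s|lborel. indicator {p..0} s * b s) * \<phi>' p)" by (simp only: one)
  finally have dbl: "(LINT s|lborel. b s * \<phi> s) = (LINT p|lborel. (LINT s|lborel. indicator {p..0} s * b s) * \<phi>' p)" .
  have iG: "integrable lborel (%p. (LINT s|lborel. indicator {p..0} s * b s) * \<phi>' p)"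
   using lborel_pair.integrable_snd[of "%s p. ?F (s, p)"] iF by (simp only: split_beta' prod.collapse one)
  have "(indicator I p * B p) * \<phi>' p = K * \<phi>' p + (LINT s|lborel. indicator {p..0} s * b s) * \<phi>' p" for p
   using z'[of p] by (cases "p : I") (simp_all add: Bp distrib_right)
  then have "(LINT p|lborel. (indicator I p * B p) * \<phi>' p) = (LINT p|lborel. K * \<phi>' p + (LINT s|lborel. indicator {p..0} s * b s) * \<phi>' p)" by simp
  also have "... = (LINT s|lborel. b s * \<phi> s)"
   using i' iG by (subst Bochner_Integration.integral_add) (simp_all add: i0 dbl)
  finally show ?thesis by (simp add: \<phi>'_def)
 qed
 have "has_weak_deriv I 1 B (%p. - \<beta> p)"
 proof (rule iffD2[OF weak_deriv_borel_iff[OF open_I _ loc1 loc\<beta> m1 _ _ _]])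
  show "AE p\<in>I in lborel. B p = indicator I p * B p" by simp
  show "(%p. - b p) : borel_measurable borel" by measurable
  show "AE p\<in>I in lborel. - \<beta> p = - b p" using Ab by eventually_elim auto
 qed (use tested in auto)
 then show ?thesis using cB B0 by blast
qed

text \<open>On rectangles the divergence theorem leaves only the difference of the values on the two
  vertical edges, whose integral vanishes over every subinterval; continuity gives equality at each
  p.\<close>

lemma flat_const:
 assumes v: "vc f g1 g2" and z: "AE z\<in>U in lborel. g1 z = 0" and w: "w : closure U"
 shows "f w = f (0, snd w)"
proof -
 have h: "continuous_on (closure U) f" using v by (auto simp: vc_def intro: holder_on_continuous)
 obtain G1 G2 where G: "sob U f G1 G2" "AE z\<in>U in lborel. g1 z = G1 z" using v by (auto simp: vc_def sobolev_def)
 have G1: "AE z\<in>U in lborel. G1 z = 0" using z G(2) by eventually_elim auto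
 have inU: "f (q1, p) = f (q2, p)" if q: "q1 <= q2" and p: "p0 < p" "p < 0" for q1 q2 p
 proof -
  have "f (q2, p) - f (q1, p) = 0"
  proof (rule zero_if_integrals_zero[OF _ _ p])
   show "continuous_on {p0<..<0} (%p. f (q2, p) - f (q1, p))"
    by (intro continuous_intros continuous_on_compose2[OF h]) auto
   fix s t assume st: "p0 < s" "s <= t" "t < (0::real)"
   have K: "cbox (q1, s) (q2, t) \<subseteq> U" using st by auto
   have "AE z in lborel. indicator (cbox (q1, s) (q2, t)) z * G1 z = 0" using G1 by eventually_elim (use K in \<open>auto simp: indicator_def\<close>)
   then have "(LINT z|lborel. indicator (cbox (q1, s) (q2, t)) z * G1 z) = 0" by (rule integral_eq_zero_AE)
   then show "integral {s..t} (%p. f (q2, p) - f (q1, p)) = 0" using sob_rect(1)[OF G(1) K q st(2)] by simp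
  qed
  then show ?thesis by simp
 qed
 have "f w - f (0, snd w) = 0"
 proof (rule continuous_constant_on_closure[where S=U and f="%w. f w - f (0, snd w)"])
  show "continuous_on (closure U) (%w. f w - f (0, snd w))"
   by (intro continuous_intros h continuous_on_compose2[OF h]) auto
  fix w assume "w : U"
  then show "f w - f (0, snd w) = 0" using inU[of "fst w" 0 "snd w"] inU[of 0 "fst w" "snd w"]
   by (cases w; cases "fst w <= 0") auto
 qed (rule w)
 then show ?thesis by simp
qed

text \<open>The candidate is the average of g2 in q against a bump of mass one; testing f with
  products b(q) \<phi>(p) shows that it is the weak derivative. Uniqueness then makes g2 equal to it
  almost everywhere, which transfers integrability over a cell to the interval.\<close>

lemma flat_weak_deriv:
 assumes v: "vc f g1 g2" and z: "AE z\<in>U in lborel. g1 z = 0"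
 shows "EX G. has_weak_deriv I 1 (%p. f (0, p)) G & Lr_on r I G & (AE z\<in>U in lborel. g2 z = G (snd z))"
proof -
 have h: "continuous_on (closure U) f" and s: "sobolev U f g1 g2" and q: "Lrq lam r U g2"
  using v by (auto simp: vc_def intro: holder_on_continuous)
 define F where "F = (%p. f (0, p))"
 have fF: "f z = F (snd z)" if "z : U" for z using flat_const[OF v z, of z] that closure_subset[of U] by (auto simp: F_def)
 obtain G1 G2 where G: "sob U f G1 G2" "AE z\<in>U in lborel. g2 z = G2 z" using s by (auto simp: sobolev_def)
 have LG2: "L1loc U G2" and cfU: "continuous_on U f" using G(1) by (auto simp: sob_def)
 have cF: "continuous_on I F" unfolding F_def by (rule continuous_on_compose2[OF h]) (auto intro!: continuous_intros)
 obtain b :: "real => real" where b: "!!k. smooth_upto k b" "!!t. 0 <= b t" "!!t. 1 <= \<bar>t\<bar> ==> b t = 0" "integrable lborel b" "integral\<^sup>L lborel b = 1"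
  by (rule bump_exists, rule that)
 have cb: "continuous_on UNIV b" using b(1)[of 0] by simp
 define h where "h = (%z. indicator U z * (b (fst z) * G2 z))"
 have Lh: "L1loc U h" unfolding h_def
  by (rule L1loc_mult_continuous[OF LG2 _ open_U]) (rule continuous_on_compose2[OF cb], auto intro!: continuous_intros)
 have hm: "h : borel_measurable borel" using Lh by (simp add: L1loc_def)
 have hm'[measurable]: "h : borel_measurable ((lborel :: real measure) \<Otimes>\<^sub>M (lborel :: real measure))"
  unfolding lborel_prod using hm by simp
 have h0: "h (q, p) = 0" if "q ~: {-1..1} \<or> p ~: I" for q p using that b(3)[of q] by (auto simp: h_def)
 define G where "G = (%p. LINT q|lborel. h (q, p))"
 have LG: "L1loc I G"
  unfolding L1loc_def
 proof (intro conjI allI impI)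
  have "(%(p, q). h (q, p)) : borel_measurable ((lborel :: real measure) \<Otimes>\<^sub>M (lborel :: real measure))" by measurable
  from lborel.borel_measurable_lebesgue_integral[OF this] show "G : borel_measurable borel" by (simp add: G_def)
  fix J :: "real set" assume J: "compact J & J \<subseteq> I"
  let ?K = "{-1..1::real} \<times> J"
  have K: "compact ?K" "?K \<subseteq> U" using J compact_Times[OF compact_Icc[of "-1" "1::real"]] by auto
  have "integrable ((lborel :: real measure) \<Otimes>\<^sub>M (lborel :: real measure)) (%z. indicator ?K z * h z)"
   unfolding lborel_prod using Lh K unfolding L1loc_def by blast
  then have "integrable lborel (%p. LINT q|lborel. indicator ?K (q, p) * h (q, p))"
   using lborel_pair.integrable_snd[of "%q p. indicator ?K (q, p) * h (q, p)"] by (simp add: split_beta')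
  moreover have "(LINT q|lborel. indicator ?K (q, p) * h (q, p)) = indicator J p * G p" for p
  proof -
   have e: "indicator ?K (q, p) * h (q, p) = indicator J p * h (q, p)" for q using h0[of q p] by (auto simp: indicator_def)
   show ?thesis by (simp only: e integral_mult_right_zero G_def)
  qed
  ultimately show "integrable lborel (%p. indicator J p * G p)" by simp
 qed
 have Gm: "G : borel_measurable borel" using LG by (simp add: L1loc_def)
 have tested: "(LINT p|lborel. (indicator I p * F p) * fd \<phi> p 1) = - (LINT p|lborel. G p * \<phi> p)"
  if \<phi>: "test_function I \<phi>" for \<phi>
 proof -
  define \<phi>' where "\<phi>' = (%p. fd \<phi> p 1)"
  have D: "(\<phi> has_real_derivative \<phi>' p) (at p)" and z: "p ~: I ==> \<phi> p = 0" and z': "p ~: I ==> \<phi>' p = 0" for p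
   using test_function_1d[OF \<phi>] by (simp_all add: \<phi>'_def)
  define \<Phi> where "\<Phi> = (%z. b (fst z) * \<phi> (snd z))"
  have sm: "smooth_upto k \<phi>" for k using \<phi> by (intro smooth_upto_of_C_k) (simp add: test_function_def)
  obtain S where S: "compact S" "S \<subseteq> I" "!!p. p ~: S ==> \<phi> p = 0" using test_functionD[OF \<phi>] by metis
  have KS: "compact ({-1..1::real} \<times> S)" "{-1..1} \<times> S \<subseteq> U"
   using S compact_Times[OF compact_Icc[of "-1" "1::real"] S(1)] by auto
  have \<Phi>0: "\<Phi> w = 0" if "w ~: {-1..1} \<times> S" for w
   using that b(3)[of "fst w"] S(3)[of "snd w"] by (cases w) (auto simp: \<Phi>_def)
  have CkP: "C_k k \<Phi>" for k unfolding \<Phi>_def by (rule C_k_tensor[OF b(1) sm])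
  have t\<Phi>: "test_function U \<Phi>" by (rule test_functionI[OF CkP KS \<Phi>0])
  obtain S' where S': "compact S'" "S' \<subseteq> U" "!!z. z ~: S' ==> \<Phi> z = 0" "!!z b. z ~: S' ==> fd \<Phi> z b = 0"
   "continuous_on UNIV \<Phi>" "!!b. b : Basis ==> continuous_on UNIV (%z. fd \<Phi> z b)"
   using test_functionD[OF t\<Phi>] by metis
  have diff: "\<Phi> differentiable (at w)" for w using CkP[of "Suc 0"] by simp
  have d2: "fd \<Phi> (q, p) (0, 1) = b q * \<phi>' p" for q p
  proof (rule DERIV_unique[OF frechet_slice(1)[OF diff]])
   show "((%p. \<Phi> (q, p)) has_real_derivative b q * \<phi>' p) (at p)" unfolding \<Phi>_def by (auto intro!: derivative_eq_intros D)
  qed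
  have Lf: "L1loc U (%z. indicator U z * f z)" by (rule L1loc_indicator_continuous[OF open_U cfU])
  have i1: "integrable (lborel \<Otimes>\<^sub>M lborel) (%w. (indicator U w * f w) * fd \<Phi> w (0, 1))"
   unfolding lborel_prod by (rule L1loc_times_integrable[OF Lf S'(1,2) S'(6)[OF Basis_plane(2)] S'(4)])
  have i2: "integrable (lborel \<Otimes>\<^sub>M lborel) (%w. G2 w * \<Phi> w)"
   unfolding lborel_prod by (rule L1loc_times_integrable[OF LG2 S'(1,2,5,3)])
  have e1: "(LINT q|lborel. (indicator U (q, p) * f (q, p)) * fd \<Phi> (q, p) (0, 1)) = (indicator I p * F p) * \<phi>' p" for p
  proof -
   have "(indicator U (q, p) * f (q, p)) * fd \<Phi> (q, p) (0, 1) = ((indicator I p * F p) * \<phi>' p) * b q" for q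
    using fF[of "(q, p)"] by (auto simp: d2 indicator_def)
   then show ?thesis using b(5) by simp
  qed
  have e2: "(LINT q|lborel. G2 (q, p) * \<Phi> (q, p)) = G p * \<phi> p" for p
  proof -
   have "G2 (q, p) * \<Phi> (q, p) = h (q, p) * \<phi> p" for q using z[of p] by (auto simp: \<Phi>_def h_def indicator_def)
   then show ?thesis by (simp add: G_def)
  qed
  have "(LINT p|lborel. (indicator I p * F p) * \<phi>' p) = (LINT w|(lborel \<Otimes>\<^sub>M lborel). (indicator U w * f w) * fd \<Phi> w (0, 1))"
   using lborel_pair.integral_snd[of "%q p. (indicator U (q, p) * f (q, p)) * fd \<Phi> (q, p) (0, 1)"] i1
   by (simp only: e1 split_beta' prod.collapse)
  also have "... = - (LINT w|(lborel \<Otimes>\<^sub>M lborel). G2 w * \<Phi> w)" unfolding lborel_prod by (rule sob_tested(2)[OF G(1) t\<Phi>])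
  also have "(LINT w|(lborel \<Otimes>\<^sub>M lborel). G2 w * \<Phi> w) = (LINT p|lborel. G p * \<phi> p)"
   using lborel_pair.integral_snd[of "%q p. G2 (q, p) * \<Phi> (q, p)"] i2 by (simp only: e2 split_beta' prod.collapse)
  finally show ?thesis by (simp add: \<phi>'_def)
 qed
 have m1: "(%p. indicator I p * F p) : borel_measurable borel"
  using borel_measurable_continuous_on_indicator[OF _ cF] by simp
 have w: "has_weak_deriv I 1 F G"
  by (rule iffD2[OF weak_deriv_borel_iff[OF open_I _ locally_integrable_continuous[OF open_I cF] locally_integrable_of_L1loc[OF LG] m1 _ Gm]])
   (use tested in auto)
 have s2: "sobolev U f (%_. 0) (%z. G (snd z))"
  by (rule sobolev_cong'[OF sobolev_snd_compose[OF w cF]]) (use fF in auto)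
 have eq: "AE z\<in>U in lborel. g2 z = G (snd z)" using sobolev_wd(4)[OF s] sobolev_wd(4)[OF s2] by eventually_elim auto
 obtain H where H: "H : borel_measurable borel" "AE z\<in>U in lborel. g2 z = H z"
  "(\<integral>\<^sup>+z. ennreal (\<bar>H z\<bar> powr r) * indicator (cell lam U) z \<partial>lborel) < \<infinity>"
  using q by (auto simp: Lrq_def)
 have "(\<integral>\<^sup>+z. ennreal (\<bar>G (snd z)\<bar> powr r) * indicator (cell lam U) z \<partial>lborel) = (\<integral>\<^sup>+z. ennreal (\<bar>H z\<bar> powr r) * indicator (cell lam U) z \<partial>lborel)"
 proof (rule nn_integral_cong_AE)
  show "AE z in lborel. ennreal (\<bar>G (snd z)\<bar> powr r) * indicator (cell lam U) z = ennreal (\<bar>H z\<bar> powr r) * indicator (cell lam U) z"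
   using eq H(2) by eventually_elim (use cell_sub in \<open>auto simp: indicator_def\<close>)
 qed
 then have "ennreal lam * (\<integral>\<^sup>+p. ennreal (\<bar>G p\<bar> powr r) * indicator I p \<partial>lborel) < \<infinity>"
  using cell_integral[of "%p. ennreal (\<bar>G p\<bar> powr r)"] Gm H(3) by simp
 then have fin: "(\<integral>\<^sup>+p. ennreal (\<bar>G p\<bar> powr r) * indicator I p \<partial>lborel) < \<infinity>"
  using lam_pos by (auto simp: ennreal_mult_less_top)
 have "integrable lborel (%p. indicator I p * \<bar>G p\<bar> powr r)"
 proof (rule integrableI_bounded)
  show "(%p. indicator I p * \<bar>G p\<bar> powr r) : borel_measurable lborel" using Gm by measurable
  have "(\<integral>\<^sup>+p. ennreal (norm (indicator I p * \<bar>G p\<bar> powr r)) \<partial>lborel) = (\<integral>\<^sup>+p. ennreal (\<bar>G p\<bar> powr r) * indicator I p \<partial>lborel)"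
   by (intro nn_integral_cong) (auto simp: indicator_def)
  then show "(\<integral>\<^sup>+p. ennreal (norm (indicator I p * \<bar>G p\<bar> powr r)) \<partial>lborel) < \<infinity>" using fin by simp
 qed
 then have "integrable (lebesgue_on I) (%p. \<bar>G p\<bar> powr r)"
  using lebesgue_on_borel(1)[of "%p. \<bar>G p\<bar> powr r" I] Gm by simp
 then have "Lr_on r I G" using borel_measurable_lebesgue_onI[OF Gm] by (simp add: Lr_on_def)
 then show ?thesis using w eq by (auto simp: F_def)
qed

end

section \<open>Symmetry of second weak derivatives\<close>

lemma test_function_deriv:
 assumes "test_function U \<phi>" "b : Basis"
 shows "test_function U (%z. fd \<phi> z b)"
proof -
 obtain S where S: "compact S" "S \<subseteq> U" "!!z b. z ~: S ==> fd \<phi> z b = 0"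
  using test_functionD[OF assms(1)] by metis
 have "C_k k (%z. fd \<phi> z b)" for k
 proof -
  have "C_k (Suc k) \<phi>" using assms(1) unfolding test_function_def by blast
  then show ?thesis using assms(2) by simp
 qed
 then show ?thesis by (rule test_functionI[OF _ S])
qed

text \<open>Schwarz's theorem: integrated over vertical segments, the two mixed derivatives agree by
  the fundamental theorem and differentiation under the integral, so they agree pointwise by
  continuity.\<close>

lemma mixed_partials_test_function:
 fixes \<phi> :: "real \<times> real => real"
 assumes \<phi>: "test_function U \<phi>"
 shows "frechet_derivative (%z :: real \<times> real. fd \<phi> z (0, 1)) (at w) (1, 0) = frechet_derivative (%z. fd \<phi> z (1, 0)) (at w) (0, 1)"
proof -
 define \<phi>1 where "\<phi>1 = (%z. fd \<phi> z (1, 0))"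
 define \<phi>2 where "\<phi>2 = (%z. fd \<phi> z (0, 1))"
 define \<phi>12 where "\<phi>12 = (%z. fd \<phi>1 z (0, 1))"
 define \<phi>21 where "\<phi>21 = (%z. fd \<phi>2 z (1, 0))"
 have C: "C1_on UNIV \<phi> \<phi>1 \<phi>2" unfolding \<phi>1_def \<phi>2_def by (rule test_function_C1_on[OF \<phi>])
 have C1: "C1_on UNIV \<phi>1 (%z. fd \<phi>1 z (1, 0)) \<phi>12"
  unfolding \<phi>12_def by (rule test_function_C1_on) (use test_function_deriv[OF \<phi> Basis_plane(1)] in \<open>simp add: \<phi>1_def\<close>)
 have C2: "C1_on UNIV \<phi>2 \<phi>21 (%z. fd \<phi>2 z (0, 1))"
  unfolding \<phi>21_def by (rule test_function_C1_on) (use test_function_deriv[OF \<phi> Basis_plane(2)] in \<open>simp add: \<phi>2_def\<close>)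
 have cont: "continuous_on UNIV \<phi>12" "continuous_on UNIV \<phi>21" "continuous_on UNIV \<phi>2" using C1 C2 C by (auto simp: C1_on_def)
 have cs: "continuous_on S (%t. g (x, t))" if "continuous_on UNIV g" for g :: "real \<times> real => real" and x S
  by (rule continuous_on_compose2[OF that]) (auto intro!: continuous_intros)
 obtain x y where w: "w = (x, y)" by (cases w)
 have FTC: "integral {s..t} (%v. g2 (x, v)) = g (x, t) - g (x, s)" if "C1_on UNIV g g1 g2" "s <= t" for g g1 g2 x and s t :: real
 proof (rule integral_unique, rule fundamental_theorem_of_calculus[OF that(2)])
  fix v
  show "((%v. g (x, v)) has_vector_derivative g2 (x, v)) (at v within {s..t})"
   using C1_on_slices(2)[OF that(1), of x v] by (simp add: has_real_derivative_iff_has_vector_derivative has_vector_derivative_at_within)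
 qed
 have "\<phi>12 (x, y) - \<phi>21 (x, y) = 0"
 proof (rule zero_if_integrals_zero[of "y - 1" "y + 1" "%y. \<phi>12 (x, y) - \<phi>21 (x, y)"])
  show "continuous_on {y - 1<..<y + 1} (%y. \<phi>12 (x, y) - \<phi>21 (x, y))" by (intro continuous_intros cs cont)
  fix s t :: real assume st: "s <= t"
  have D1: "((%u. \<phi> (u, t) - \<phi> (u, s)) has_real_derivative \<phi>1 (x, t) - \<phi>1 (x, s)) (at x)"
   by (intro DERIV_diff C1_on_slices(1)[OF C]) auto
  have "((%u. integral (cbox s t) (%v. \<phi>2 (u, v))) has_field_derivative integral (cbox s t) (%v. \<phi>21 (x, v))) (at x within UNIV)"
  proof (rule leibniz_rule_field_derivative)
   show "((%u. \<phi>2 (u, v)) has_field_derivative \<phi>21 (u, v)) (at u within UNIV)" for u v using C1_on_slices(1)[OF C2] by simp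
   show "(%v. \<phi>2 (u, v)) integrable_on cbox s t" for u by (intro integrable_continuous cs cont)
   show "continuous_on (UNIV \<times> cbox s t) (%(u, v). \<phi>21 (u, v))" using cont(2) continuous_on_subset by auto
  qed auto
  then have "((%u. \<phi> (u, t) - \<phi> (u, s)) has_real_derivative integral {s..t} (%v. \<phi>21 (x, v))) (at x)"
   using FTC[OF C st] by simp
  from DERIV_unique[OF this D1] have "integral {s..t} (%v. \<phi>21 (x, v)) = integral {s..t} (%v. \<phi>12 (x, v))"
   using FTC[OF C1 st] by simp
  then show "integral {s..t} (%v. \<phi>12 (x, v) - \<phi>21 (x, v)) = 0"
   by (subst Henstock_Kurzweil_Integration.integral_diff) (auto intro!: integrable_continuous_interval cs cont)
 qed auto
 then show ?thesis by (simp add: w \<phi>12_def \<phi>21_def \<phi>1_def \<phi>2_def)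
qed

text \<open>Either mixed derivative, tested with \<phi>, leads to f paired with a mixed second
  derivative of \<phi>; symmetry is inherited from \<phi>.\<close>

lemma sobolev_mixed_partials:
 assumes C: "C1_on U f f1 f2" and s: "sobolev U f1 f11 f12" "sobolev U f2 f21 f22"
 shows "AE z\<in>U in lborel. f12 z = f21 z"
proof -
 have U: "open U" using C by (simp add: C1_on_def)
 obtain G11 G12 where G1: "sob U f1 G11 G12" "AE z\<in>U in lborel. f12 z = G12 z" using s(1) by (auto simp: sobolev_def)
 obtain G21 G22 where G2: "sob U f2 G21 G22" "AE z\<in>U in lborel. f21 z = G21 z" using s(2) by (auto simp: sobolev_def)
 have L: "L1loc U G12" "L1loc U G21" using G1 G2 by (auto simp: sob_def)
 have "AE z\<in>U in lborel. G12 z - G21 z = 0"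
 proof (rule AE_zero_if_tested_zero[OF U L1loc_diff[OF L]])
  fix \<phi> assume \<phi>: "test_function U \<phi>"
  note t = test_function_deriv[OF \<phi> Basis_plane(1)] test_function_deriv[OF \<phi> Basis_plane(2)]
  obtain S where S: "compact S" "S \<subseteq> U" "!!z. z ~: S ==> \<phi> z = 0" "continuous_on UNIV \<phi>"
   using test_functionD[OF \<phi>] by metis
  note i = L1loc_times_integrable[OF L(1) S(1,2,4,3)] L1loc_times_integrable[OF L(2) S(1,2,4,3)]
  have "(LINT z|lborel. G12 z * \<phi> z) = (LINT z|lborel. G21 z * \<phi> z)"
   using sob_tested(2)[OF G1(1) \<phi>] sob_tested(1)[OF G2(1) \<phi>] sob_tested(1)[OF sob_C1[OF C] t(2)] sob_tested(2)[OF sob_C1[OF C] t(1)]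
   by (simp add: mixed_partials_test_function[OF \<phi>])
  then show "(LINT z|lborel. (G12 z - G21 z) * \<phi> z) = 0" using i by (simp add: left_diff_distrib)
 qed
 then show ?thesis using G1(2) G2(2) by eventually_elim auto
qed

context periodic_domain begin

lemma vc_wd: "vc f g1 g2 ==> AE z\<in>U in lborel. wd1 U f z = g1 z & wd2 U f z = g2 z"
proof -
 assume "vc f g1 g2"
 then have s: "sobolev U f g1 g2" by (simp add: vc_def)
 show ?thesis using sobolev_wd(3)[OF s] sobolev_wd(4)[OF s] by eventually_elim auto
qed

text \<open>Replaces the iterated choices \<open>wd1\<close> and \<open>wd2\<close> in the equations
  by the named derivatives, simultaneously at almost every point.\<close>

lemma pc_wd:
 assumes p: "pc f f1 f2 f11 f12 f21 f22"
 shows "AE z\<in>U in lborel. wd1 U f z = f1 z & wd2 U f z = f2 z & wd1 U (wd1 U f) z = f11 z & wd2 U (wd1 U f) z = f12 z \<and>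
  wd2 U (wd2 U f) z = f22 z & f12 z = f21 z"
proof -
 have C: "C1_on U f f1 f2" and s: "sobolev U f1 f11 f12" "sobolev U f2 f21 f22" using p by (auto simp: pc_def c1h_def vc_def)
 note w = sobolev_wd[OF sobolev_C1[OF C]]
 have l: "locally_integrable_on U (wd1 U f)" "locally_integrable_on U (wd2 U f)" using w(1,2) by (auto simp: has_weak_deriv_def)
 have e: "AE z\<in>U in lborel. f1 z = wd1 U f z" using w(3) by eventually_elim auto
 have e': "AE z\<in>U in lborel. f2 z = wd2 U f z" using w(4) by eventually_elim auto
 show ?thesis
  using w(3,4) sobolev_weak_deriv(3,4)[OF s(1) l(1) e] sobolev_weak_deriv(4)[OF s(2) l(2) e'] sobolev_mixed_partials[OF C s]
  by eventually_elim auto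
qed

end

context fibre_inversion begin

lemma AE_S: assumes "AE z\<in>U in lborel. P z" shows "AE z\<in>V in lborel. P (S z)"
proof -
 obtain M where M: "M > 0" "ALL z:closure V. M <= ki2 z" using ki2_lower by blast
 have MV: "M <= ki2 z" if "z : V" for z using M(2) that closure_subset[of V] by blast
 show ?thesis by (rule AE_fibre_map[OF M(1) C_ki MV S_maps assms])
qed

lemma AE_T: assumes "AE z\<in>V in lborel. P z" shows "AE z\<in>U in lborel. P (T z)"
 by (rule AE_fibre_map[OF c C_k k2c T_maps_open assms])

text \<open>\<open>T\<close> is the inverse of \<open>S\<close>, so the result for \<open>S\<close>
  is applied to the inverted configuration; its derivative formulas return k1 and k2.\<close>

lemma vc_T:
 assumes f: "E.vc f g1 g2"
 shows "D.vc (%z. f (T z)) (%z. g1 (T z) + k1 z * g2 (T z)) (%z. k2 z * g2 (T z))"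
proof -
 obtain M where M: "M > 0" "ALL z:closure V. M <= ki2 z" using ki2_lower by blast
 have MV: "M <= ki2 z" if "z : V" for z using M(2) that closure_subset[of V] by blast
 have b: "ki (x, m) = l" "ki (x, v x) = u x" for x
  using ki_eq[of x l] ki_eq[of x "u x"] D.lu[of x] by (simp_all add: bot top)
 interpret F: fibre_inversion lam r a m v v' l u u' ki ki1 ki2 "%z. - (K1a z * ki2 z + k1 (S z) * (- K2a z / (k2 (S z))\<^sup>2))"
 "%z. - (K1b z * ki2 z + k1 (S z) * (- K2b z / (k2 (S z))\<^sup>2))" "%z. - K2a z / (k2 (S z))\<^sup>2" "%z. - K2b z / (k2 (S z))\<^sup>2" M
  by unfold_locales (use pc_ki b M(1) MV in auto)
 have FS: "fibre_map F.ki z = T z" if z: "z : closure U" for z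
 proof -
  have "T z : closure V" by (rule T_maps[OF z])
  moreover have "ki (T z) = snd z" using S_T[OF z] by (metis fibre_map_def snd_conv)
  ultimately show ?thesis using F.ki_eq[of "fst z" "k z"] by (simp add: fibre_map_def)
 qed
 have FSU: "fibre_map F.ki z = T z" and ST: "S (T z) = z" and nz: "k2 z ~= 0" if "z : U" for z
  using FS[of z] S_T[of z] k2c[of z] c that closure_subset[of U] by auto
 show ?thesis
 proof (rule D.vc_cong'[OF F.vc_S[OF f]])
  show "f (fibre_map F.ki z) = f (T z)" if "z : closure U" for z by (simp only: FS[OF that])
  show "g1 (fibre_map F.ki z) + F.ki1 z * g2 (fibre_map F.ki z) = g1 (T z) + k1 z * g2 (T z)" if "z : U" for z
   unfolding F.ki1_def FSU[OF that] unfolding ki1_def ki2_def ST[OF that] using nz[OF that] by simp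
  show "F.ki2 z * g2 (fibre_map F.ki z) = k2 z * g2 (T z)" if "z : U" for z
   unfolding F.ki2_def FSU[OF that] unfolding ki2_def ST[OF that] by simp
 qed
qed

end

section \<open>Domains and surface profiles of the three formulations\<close>

lemma fluid_domain_subgraph: "fluid_domain d \<eta> = subgraph (- d) \<eta>"
 by (simp add: fluid_domain_def subgraph_def)

lemma strip_subgraph: "strip p0 = subgraph p0 (%_. 0)"
 by (auto simp: strip_def subgraph_def)

lemma surface_wave_domain:
 assumes "lam > 0" "r \<ge> 1" "a = (r - 1) / r" and s: "surface_profile d lam a \<eta>"
 shows "wave_domain lam r a (- d) \<eta> (deriv \<eta>)"
proof
 have C: "C1_holder_closure a UNIV \<eta>" using s by (simp add: surface_profile_def)
 then have "\<eta> differentiable (at x)" for x by (simp add: C1_holder_closure_def)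
 then show D: "(\<eta> has_real_derivative deriv \<eta> x) (at x)" for x by (simp add: DERIV_deriv_iff_real_differentiable)
 obtain g where g: "holder_on a UNIV g" "!!x. g x = fd \<eta> x 1"
  using C by (auto simp: C1_holder_closure_def)
 have "g = deriv \<eta>" using g(2) frechet_derivative_1[OF D] by (simp add: fun_eq_iff)
 then show "holder_on a UNIV (deriv \<eta>)" using g(1) by simp
qed (use assms in \<open>auto simp: surface_profile_def\<close>)

lemma (in wave_domain) surface_profile: "surface_profile (- l) lam a u"
 unfolding surface_profile_def C1_holder_closure_def
proof (intro conjI allI ballI)
 show "continuous_on (closure UNIV) u" using cont_u by simp
 obtain \<delta> M where M: "ALL x. l + \<delta> <= u x & u x <= M" using u_bounds by blast
 have "\<bar>u x\<bar> <= \<bar>l + \<delta>\<bar> + \<bar>M\<bar>" for x using M[rule_format, of x] by linarith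
 then show "bounded (u ` closure UNIV)" by (intro boundedI[of _ "\<bar>l + \<delta>\<bar> + \<bar>M\<bar>"]) auto
 show "u differentiable (at x)" for x using du[of x] by (auto simp: real_differentiable_def)
 fix b :: real assume "b : Basis"
 then have "b = 1" by simp
 then show "EX g. holder_on a (closure UNIV) g & (ALL z:UNIV. g z = fd u z b)"
  using hu' frechet_derivative_1[OF du] by (intro exI[of _ u']) auto
qed (use pu lu in auto)

lemma C1_on_minus: "C1_on V f f1 f2 ==> C1_on V (%z. - f z) (%z. - f1 z) (%z. - f2 z)"
 unfolding C1_on_def by (auto intro!: continuous_intros has_derivative_eq_rhs[OF has_derivative_minus])

lemma (in periodic_domain) pc_minus:
 assumes "pc f f1 f2 f11 f12 f21 f22"
 shows "pc (%z. - f z) (%z. - f1 z) (%z. - f2 z) (%z. - f11 z) (%z. - f12 z) (%z. - f21 z) (%z. - f22 z)"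
proof -
 have m: "vc (%z. - f1 z) (%z. - f11 z) (%z. - f12 z)" "vc (%z. - f2 z) (%z. - f21 z) (%z. - f22 z)"
  using assms by (auto simp: pc_def intro: vc_minus)
 then have h: "holder_on a (closure U) (%z. - f1 z)" "holder_on a (closure U) (%z. - f2 z)" by (auto simp: vc_def)
 have c: "continuous_on (closure U) f" "C1_on U f f1 f2" "periodic_on lam (closure U) f" and b: "bounded (f ` closure U)"
  using assms by (auto simp: pc_def c1h_def)
 have "bounded ((%z. - f z) ` closure U)" using b unfolding bounded_iff by auto
 then show ?thesis using m h c unfolding pc_def c1h_def
  by (auto intro!: C1_on_minus continuous_intros simp: periodic_on_def)
qed

section \<open>Potentials of curl-free fields\<close>

context wave_domain begin

lemma U_nonempty: "U ~= {}"
proof -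
 have "(0, level (1/2) 0) : U" by (rule level_mem) simp_all
 then show ?thesis by blast
qed

text \<open>The height y occurs as a factor in head and pressure, so it has to belong to the
  algebra.\<close>

lemma vc_snd: "vc snd (%_. 0) (%_. 1)"
proof (rule c1h_vc)
 obtain \<delta> M where M: "0 < \<delta>" "!!x. l + \<delta> <= u x & u x <= M" using u_bounds by blast
 have "norm (snd z) <= \<bar>l\<bar> + \<bar>M\<bar>" if "z : closure U" for z using M(2)[of "fst z"] that by (cases z) auto
 then have "bounded (snd ` closure U)" by (intro boundedI[of _ "\<bar>l\<bar> + \<bar>M\<bar>"]) (erule imageE, simp)
 moreover have "C1_on U snd (%_. 0) (%_. 1)"
  unfolding C1_on_def using open_U by (auto intro!: bounded_linear_imp_has_derivative bounded_linear_snd)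
 ultimately show "c1h a U snd (%_. 0) (%_. 1)" by (auto simp: c1h_def intro!: continuous_intros holder_on_const)
qed (simp add: periodic_on_def)

text \<open>The potential is the integral of B along vertical fibres from the bottom, so its
  y-derivative is immediate. The x-derivative comes from the rectangle identities for A and B,
  linked by the weak curl condition; A = 0 at the bottom removes the lower edge. The condition at
  the top makes the potential constant along the surface.\<close>

lemma potential_exists:
 assumes A: "vc A A1 A2" and B: "vc B B1 B2" and curl: "AE z\<in>U in lborel. A2 z = B1 z"
  and bot: "!!x. A (x, l) = 0" and top: "!!x. A (x, u x) + B (x, u x) * u' x = 0"
 shows "EX \<psi>. pc \<psi> A B A1 A2 B1 B2 & (ALL x. \<psi> (x, u x) = 0) & (EX k. ALL x. \<psi> (x, l) = k)"
proof -
 have hA: "holder_on a (closure U) A" and hB: "holder_on a (closure U) B" and perB: "periodic_on lam (closure U) B"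
  using A B by (auto simp: vc_def)
 have cA: "continuous_on (closure U) A" and cB: "continuous_on (closure U) B" using hA hB by (auto intro: holder_on_continuous)
 have cAU: "continuous_on U A" and cBU: "continuous_on U B" using cA cB closure_subset by (blast intro: continuous_on_subset)+
 obtain G1 G2 where G: "sob U A G1 G2" "AE z\<in>U in lborel. A2 z = G2 z" using A by (auto simp: vc_def sobolev_def)
 obtain H1 H2 where H: "sob U B H1 H2" "AE z\<in>U in lborel. B1 z = H1 z" using B by (auto simp: vc_def sobolev_def)
 have GH: "AE z\<in>U in lborel. G2 z = H1 z" using curl G(2) H(2) by eventually_elim auto
 \<comment> \<open>Normalises the potential to 0 at one surface point, hence along the whole
   surface.\<close>
 define K where "K = integral {l..u 0} (%t. B (0, t))"
 define \<psi> where "\<psi> = (%z. integral {l..snd z} (%t. B (fst z, t)) - K)"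
 have psi: "\<psi> (x, y) = integral {l..y} (%t. B (x, t)) - K" for x y by (simp add: \<psi>_def)
 have cBx: "continuous_on {l..y} (%t. B (x, t))" if "y <= u x" for x y
  by (rule continuous_on_compose2[OF cB]) (use that in \<open>auto intro!: continuous_intros\<close>)
 have dyw: "((%y. \<psi> (x, y)) has_real_derivative B (x, y)) (at y within {l..u x})" if "l <= y" "y <= u x" for x y
  unfolding psi using DERIV_diff[OF integral_has_real_derivative[OF cBx[OF order_refl]] DERIV_const, of y x K] that by simp
 have dy: "((%y. \<psi> (x, y)) has_real_derivative B (x, y)) (at y)" if "(x, y) : U" for x y
  using dyw[of y x] that by (simp add: at_within_Icc_at)
 have key: "\<psi> (x2, y) - \<psi> (x1, y) = integral {x1..x2} (%s. A (s, y))"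
  if x: "x1 <= x2" and y: "l < y" "!!s. s : {x1..x2} ==> y < u s" for x1 x2 y
 proof -
  \<comment> \<open>Defect of the rectangle identity with lower edge e. It is 0 for e > l, where the
    closed rectangle lies in the open domain; by continuity the lower edge can then be moved to the
    bottom.\<close>
  define \<Phi> where "\<Phi> = (%e. integral {e..y} (%t. B (x2, t) - B (x1, t)) - integral (cbox x1 x2) (%s. A (s, y) - A (s, e)))"
  have x12: "y < u x1" "y < u x2" using y(2) x by auto
  have "\<Phi> l = 0"
  proof (rule continuous_constant_on_closure[where S="{l<..y}" and f=\<Phi>])
   have cl: "closure {l<..y} = {l..y}" using y(1) by simp
   show "continuous_on (closure {l<..y}) \<Phi>"
    unfolding \<Phi>_def cl
   proof (rule continuous_on_diff)
    show "continuous_on {l..y} (%e. integral {e..y} (%t. B (x2, t) - B (x1, t)))"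
     by (intro indefinite_integral_continuous_1' integrable_continuous_interval continuous_intros cBx) (use x12 in auto)
    show "continuous_on {l..y} (%e. integral (cbox x1 x2) (%s. A (s, y) - A (s, e)))"
    proof (rule integral_continuous_on_param)
     have m: "l <= e & e <= u s" if "e : {l..y}" "s : cbox x1 x2" for e s using that y(2)[of s] by auto
     have "continuous_on ({l..y} \<times> cbox x1 x2) (%p. A (snd p, y) - A (snd p, fst p))"
     proof (rule continuous_on_diff)
      show "continuous_on ({l..y} \<times> cbox x1 x2) (%p. A (snd p, y))"
       by (rule continuous_on_compose2[OF cA]) (use y m in \<open>auto intro!: continuous_intros simp: less_imp_le\<close>)
      show "continuous_on ({l..y} \<times> cbox x1 x2) (%p. A (snd p, fst p))"
       by (rule continuous_on_compose2[OF cA]) (use m in \<open>auto intro!: continuous_intros\<close>)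
     qed
     then show "continuous_on ({l..y} \<times> cbox x1 x2) (%(e, s). A (s, y) - A (s, e))" by (simp add: split_beta')
    qed
   qed
   fix e assume e: "e : {l<..y}"
   have R: "cbox (x1, e) (x2, y) \<subseteq> U"
   proof
    fix z assume "z : cbox (x1, e) (x2, y)"
    then show "z : U" using e y(2)[of "fst z"] by (cases z) auto
   qed
   have "(LINT z|lborel. indicator (cbox (x1, e) (x2, y)) z * H1 z) = (LINT z|lborel. indicator (cbox (x1, e) (x2, y)) z * G2 z)"
   proof (rule integral_cong_AE)
    show "(%z. indicator (cbox (x1, e) (x2, y)) z * H1 z) : borel_measurable lborel"
     using H(1) by (auto simp: sob_def L1loc_def)
    show "(%z. indicator (cbox (x1, e) (x2, y)) z * G2 z) : borel_measurable lborel"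
     using G(1) by (auto simp: sob_def L1loc_def)
    show "AE z in lborel. indicator (cbox (x1, e) (x2, y)) z * H1 z = indicator (cbox (x1, e) (x2, y)) z * G2 z"
     using GH by eventually_elim (use R in \<open>auto simp: indicator_def\<close>)
   qed
   then show "\<Phi> e = 0" using sob_rect(1)[OF H(1) R x] sob_rect(2)[OF G(1) R x] e by (simp add: \<Phi>_def)
  qed (use y(1) in simp)
  moreover have "integral {l..y} (%t. B (x2, t) - B (x1, t)) = \<psi> (x2, y) - \<psi> (x1, y)"
   unfolding psi by (subst Henstock_Kurzweil_Integration.integral_diff) (use x12 in \<open>auto intro!: integrable_continuous_interval cBx\<close>)
  ultimately show ?thesis by (simp add: \<Phi>_def bot)
 qed
 have dx: "((%x. \<psi> (x, y)) has_real_derivative A (x, y)) (at x)" if xy: "(x, y) : U" for x y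
 proof -
  \<comment> \<open>Horizontal segments stay in the domain only locally, so \<open>key\<close> is
    applied near x.\<close>
  have "open {s. y < u s}" by (intro open_Collect_less continuous_intros cont_u)
  moreover have "x : {s. y < u s}" using xy by simp
  ultimately obtain e where e: "e > 0" "cball x e \<subseteq> {s. y < u s}" using open_contains_cball by blast
  have e': "y < u s" if "s : {x - e..x + e}" for s using e(2) that by (auto simp: subset_iff dist_real_def)
  have cAx: "continuous_on {x - e..x + e} (%s. A (s, y))"
   by (rule continuous_on_compose2[OF cA]) (use e' xy in \<open>auto intro!: continuous_intros simp: less_imp_le\<close>)
  have "((%x'. \<psi> (x - e, y) + integral {x - e..x'} (%s. A (s, y))) has_real_derivative 0 + A (x, y)) (at x within {x - e..x + e})"
   by (intro DERIV_add DERIV_const integral_has_real_derivative[OF cAx]) (use e in auto)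
  then have "((%x'. \<psi> (x', y)) has_real_derivative 0 + A (x, y)) (at x within {x - e..x + e})"
  proof (rule has_field_derivative_transform_within[where d=1])
   fix x' assume x': "x' : {x - e..x + e}"
   show "\<psi> (x - e, y) + integral {x - e..x'} (%s. A (s, y)) = \<psi> (x', y)"
    using key[of "x - e" x' y] x' e' xy by auto
  qed (use e in auto)
  then show ?thesis using e by (simp add: at_within_Icc_at)
 qed
 have C: "C1_on U \<psi> A B"
  unfolding C1_on_def
 proof (intro conjI ballI open_U cAU cBU)
  fix z assume z: "z : U"
  obtain x y where xy: "z = (x, y)" by (cases z)
  obtain X Y where XY: "open X" "open Y" "(x, y) : X \<times> Y" "X \<times> Y \<subseteq> U"
   using open_prod_elim[OF open_U] z xy by metis
  obtain e where e: "e > 0" "ball y e \<subseteq> Y" using XY(2,3) open_contains_ball by blast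
  have sub: "X \<times> ball y e \<subseteq> U" using XY(4) e by auto
  have op: "open (X \<times> ball y e)" by (intro open_Times XY open_ball)
  have m: "(x, y) : X \<times> ball y e" using XY e by auto
  \<comment> \<open>The existence of both partial derivatives is upgraded to differentiability by
    continuity of one of them, B, on a small product neighbourhood.\<close>
  have "((%(x, y). \<psi> (x, y)) has_derivative (%(tx, ty). A (x, y) * tx + blinfun_apply (B (x, y) *\<^sub>R id_blinfun) ty)) (at (x, y) within X \<times> ball y e)"
  proof (rule has_derivative_partialsI[where f="%x y. \<psi> (x, y)" and fy="%x y. B (x, y) *\<^sub>R id_blinfun"])
   show "((%x. \<psi> (x, y)) has_derivative (*) (A (x, y))) (at x within X)"
    using has_field_derivative_at_within[OF dx[of x y]] z xy by (simp add: has_field_derivative_def)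
   show "((%y. \<psi> (x', y)) has_derivative blinfun_apply (B (x', y') *\<^sub>R id_blinfun)) (at y' within ball y e)"
    if "x' : X" "y' : ball y e" for x' y'
   proof -
    have U': "(x', y') : U" using sub that by blast
    have "blinfun_apply (B (x', y') *\<^sub>R id_blinfun) = (*) (B (x', y'))" by (simp add: fun_eq_iff blinfun.scaleR_left)
    then show ?thesis using has_field_derivative_at_within[OF dy[OF U']] by (simp add: has_field_derivative_def)
   qed
   have "continuous_on (X \<times> ball y e) (%z. B z *\<^sub>R (id_blinfun :: real \<Rightarrow>\<^sub>L real))"
    by (intro continuous_intros continuous_on_subset[OF cBU sub])
   then show "continuous (at (x, y) within X \<times> ball y e) (%(x, y). B (x, y) *\<^sub>R (id_blinfun :: real \<Rightarrow>\<^sub>L real))"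
    using m by (simp add: continuous_on_eq_continuous_within split_beta')
  qed (use m sub in auto)
  then have "(\<psi> has_derivative (%(tx, ty). A (x, y) * tx + B (x, y) * ty)) (at (x, y))"
   using at_within_open[OF m op] by (simp add: blinfun.scaleR_left)
  then show "(\<psi> has_derivative (%h. A z * fst h + B z * snd h)) (at z)" by (simp add: xy split_beta')
 qed
 \<comment> \<open>Rescaling the fibre to [0,1] removes the variable endpoint, so continuity on the
   closure becomes continuity of a parameter integral.\<close>
 have rep: "\<psi> (x, y) = integral (cbox 0 1) (%s. B (x, l + s * (y - l)) * (y - l)) - K" if y: "l <= y" "y <= u x" for x y
 proof -
  let ?g = "%s. l + s * (y - l)"
  have m: "?g s : {l..u x}" if "s : {0..1}" for s
  proof -
   have "0 <= s * (y - l)" using that y by simp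
   moreover have "s * (y - l) <= 1 * (y - l)" by (rule mult_right_mono) (use that y in auto)
   ultimately show ?thesis using y by auto
  qed
  have "((%s. B (x, ?g s) * (y - l)) has_integral (%y. \<psi> (x, y)) (?g 1) - (%y. \<psi> (x, y)) (?g 0)) {0..1}"
  proof (rule fundamental_theorem_of_calculus)
   fix s :: real assume s: "s : {0..1}"
   have dg: "(?g has_real_derivative (y - l)) (at s within {0..1})" by (rule derivative_eq_intros refl | simp)+
   have df: "((%y. \<psi> (x, y)) has_real_derivative B (x, ?g s)) (at (?g s) within (?g ` {0..1}))"
   proof (rule DERIV_subset)
    show "((%y. \<psi> (x, y)) has_real_derivative B (x, ?g s)) (at (?g s) within {l..u x})"
     by (rule dyw) (use m[OF s] in simp_all)
    show "?g ` {0..1} \<subseteq> {l..u x}" by (rule image_subsetI) (rule m)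
   qed
   have "((%s. \<psi> (x, ?g s)) has_real_derivative B (x, ?g s) * (y - l)) (at s within {0..1})"
    using DERIV_image_chain[OF df dg] by (simp only: o_def)
   then show "((%s. \<psi> (x, ?g s)) has_vector_derivative B (x, ?g s) * (y - l)) (at s within {0..1})"
    by (simp only: has_real_derivative_iff_has_vector_derivative)
  qed simp
  then have "((%s. B (x, ?g s) * (y - l)) has_integral \<psi> (x, y) - \<psi> (x, l)) {0..1}" by simp
  then have "integral {0..1} (%s. B (x, ?g s) * (y - l)) = \<psi> (x, y) - \<psi> (x, l)" by (rule integral_unique)
  moreover have "\<psi> (x, l) = - K" using integral_refl[of l "%t. B (x, t)"] by (simp add: psi)
  ultimately show ?thesis by simp
 qed
 have seg: "l <= l + s * (y - l) & l + s * (y - l) <= u x" if "l <= y" "y <= u x" "s : {0..1}" for x y s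
 proof -
  have "0 <= s * (y - l)" using that by simp
  moreover have "s * (y - l) <= 1 * (y - l)" by (rule mult_right_mono) (use that in auto)
  ultimately show ?thesis using that by auto
 qed
 have c\<psi>: "continuous_on (closure U) \<psi>"
 proof (rule continuous_on_eq)
  show "continuous_on (closure U) (%z. integral (cbox 0 1) (%s. B (fst z, l + s * (snd z - l)) * (snd z - l)) - K)"
  proof (intro continuous_on_diff continuous_on_const integral_continuous_on_param)
   have "continuous_on (closure U \<times> cbox 0 1) (%p. B (fst (fst p), l + snd p * (snd (fst p) - l)) * (snd (fst p) - l))"
    by (intro continuous_on_mult continuous_on_compose2[OF cB] continuous_intros) (use seg in \<open>auto simp: closure_U\<close>)
   then show "continuous_on (closure U \<times> cbox 0 1) (%(z, s). B (fst z, l + s * (snd z - l)) * (snd z - l))" by (simp add: split_beta')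
  qed
  fix z assume "z : closure U"
  then show "integral (cbox 0 1) (%s. B (fst z, l + s * (snd z - l)) * (snd z - l)) - K = \<psi> z"
   using rep[of "snd z" "fst z"] by (cases z) simp
 qed
 obtain M where M: "M \<ge> 0" "ALL z:closure U. \<bar>B z\<bar> <= M" using holder_on_E[OF hB] by blast
 obtain N where N: "!!x. u x <= N" using u_bounds by blast
 have "norm (\<psi> z) <= M * (N - l) + \<bar>K\<bar>" if t: "z : closure U" for z
 proof -
  obtain x y where z: "z = (x, y)" by (cases z)
  have y: "l <= y" "y <= u x" using t z by auto
  have "norm (integral {l..y} (%t. B (x, t))) <= M * (y - l)"
   by (rule integral_bound[OF y(1) cBx[OF y(2)]]) (use M y in auto)
  also have "... <= M * (N - l)" using M N[of x] y by (intro mult_left_mono) auto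
  finally show ?thesis by (simp add: z psi)
 qed
 then have b\<psi>: "bounded (\<psi> ` closure U)" by (intro boundedI[of _ "M * (N - l) + \<bar>K\<bar>"]) (erule imageE, simp)
 have per: "periodic_on lam (closure U) \<psi>"
  unfolding periodic_on_def
 proof
  fix z assume z: "z : closure U"
  have "integral {l..snd z} (%t. B (fst z + lam, t)) = integral {l..snd z} (%t. B (fst z, t))"
  proof (rule integral_cong)
   fix t assume "t : {l..snd z}"
   then have "(fst z, t) : closure U" using z by (cases z) auto
   then have "B ((fst z, t) + (lam, 0)) = B (fst z, t)" using perB unfolding periodic_on_def by blast
   then show "B (fst z + lam, t) = B (fst z, t)" by simp
  qed
  then show "\<psi> (z + (lam, 0)) = \<psi> z" by (simp add: \<psi>_def)
 qed
 have c1: "c1h a U \<psi> A B" using c\<psi> b\<psi> C hA hB by (simp add: c1h_def)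
 have "((%x. \<psi> (x, u x)) has_real_derivative 0) (at x)" for x using top_deriv(1)[OF c1, of x] top by simp
 then have "\<psi> (x, u x) = \<psi> (0, u 0)" for x using DERIV_isconst_all[of "%x. \<psi> (x, u x)" x 0] by blast
 moreover have "\<psi> (0, u 0) = 0" by (simp add: psi K_def)
 moreover have "\<psi> (x, l) = - K" for x using integral_refl[of l "%t. B (x, t)"] by (simp add: psi)
 ultimately show ?thesis using c1 per A B by (intro exI[of _ \<psi>]) (auto simp: pc_def)
qed

end

lemma (in strip_domain) flat_continuous: "vc f g1 g2 ==> continuous_on {p0..0} (%p. f (0, p))"
proof -
 assume "vc f g1 g2"
 then have "continuous_on (closure U) f" by (auto simp: vc_def intro: holder_on_continuous)
 then show ?thesis by (rule continuous_on_compose2) (auto intro!: continuous_intros)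
qed

lemma (in wave_domain) pc_add_const:
 assumes "pc f f1 f2 f11 f12 f21 f22"
 shows "pc (%z. f z + c) f1 f2 f11 f12 f21 f22"
proof -
 have c: "continuous_on (closure U) f" "C1_on U f f1 f2" "periodic_on lam (closure U) f" and b: "bounded (f ` closure U)"
  using assms by (auto simp: pc_def c1h_def)
 obtain B where B: "ALL x:f ` closure U. norm x <= B" using b unfolding bounded_iff by blast
 have "norm (f z + c) <= B + \<bar>c\<bar>" if "z : closure U" for z
 proof -
  have "norm (f z) <= B" using B that by blast
  then show ?thesis by simp
 qed
 then have "bounded ((%z. f z + c) ` closure U)" by (intro boundedI[of _ "B + \<bar>c\<bar>"]) (erule imageE, simp)
 moreover have "C1_on U (%z. f z + c) f1 f2"
  using c(2) unfolding C1_on_def by (simp add: has_derivative_add_const)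
 moreover have "continuous_on (closure U) (%z. f z + c)" by (intro continuous_intros c)
 ultimately show ?thesis using assms by (simp add: pc_def c1h_def periodic_on_def)
qed

text \<open>The derivative chosen by \<open>weak_deriv\<close> agrees almost everywhere with an L_r
  derivative, so the one appearing in the equations has the right integrability.\<close>

lemma (in strip_domain) data_vc:
 assumes D: "data_class \<rho>0 r p0 R \<beta>"
 shows "vc (%z. R (snd z)) (%_. 0) (%z. weak_deriv I 1 R (snd z))"
proof -
 have c: "continuous_on {p0..0} R" using D by (simp add: data_class_def W1_interval_def)
 have cI: "continuous_on I R" by (rule continuous_on_subset[OF c]) auto
 obtain f where f: "has_weak_deriv I 1 R f" "Lr_on r I f" using D by (auto simp: data_class_def W1_interval_def)
 have "AE p\<in>I in lborel. f p = weak_deriv I 1 R p"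
  by (rule weak_deriv_1d_unique[OF f(1) weak_deriv_works[OF f(1)] cI refl])
 then have "AE z\<in>U in lborel. f (snd z) = weak_deriv I 1 R (snd z)" by (rule iffD2[OF AE_I_iff])
 then show ?thesis by (intro vc_cong[OF vc_snd_compose[OF f(1) c f(2)]]) auto
qed

section \<open>The correspondences\<close>

text \<open>Incompressibility and transport of density make sqrt(\<rho>) times the velocity
  divergence free, which is the curl condition for the gradient of \<psi>. Here s stands for
  sqrt(\<rho>), with derivatives r1/(2s) and r2/(2s).\<close>

lemma curl_identity:
 fixes w :: real
 assumes "w * r1 + v * r2 = 0" "w1 + v2 = 0"
 shows "- (r2 / (2 * s) * v + s * v2) = r1 / (2 * s) * w + s * w1"
proof -
 have v2: "v2 = - w1" and e: "r2 * v = - (r1 * w)" using assms by (auto simp: algebra_simps)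
 have "r2 / (2 * s) * v = - (r1 * w) / (2 * s)" unfolding e[symmetric] by simp
 then show ?thesis unfolding v2 by simp
qed

text \<open>Bernoulli's law: the head is constant along streamlines, by the momentum equations and
  transport of density. The terms are left in the form in which the product rules for
  \<open>vc\<close> deliver them.\<close>

lemma head_identity:
 fixes w :: real
 assumes "\<rho> * w * w1 + \<rho> * v * w2 = - P1" "\<rho> * w * v1 + \<rho> * v * v2 = - P2 - g * \<rho>" "w * r1 + v * r2 = 0"
 shows "w * (P1 + (1/2) * (r1 * (w * w + v * v) + \<rho> * ((w1 * w + w * w1) + (v1 * v + v * v1))) + g * (r1 * y + \<rho> * 0)) +
  v * (P2 + (1/2) * (r2 * (w * w + v * v) + \<rho> * ((w2 * w + w * w2) + (v2 * v + v * v2))) + g * (r2 * y + \<rho> * 1)) = 0"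
proof -
 have P: "P1 = - (\<rho> * w * w1 + \<rho> * v * w2)" "P2 = - (\<rho> * w * v1 + \<rho> * v * v2) - g * \<rho>" using assms by auto
 have "w * (P1 + (1/2) * (r1 * (w * w + v * v) + \<rho> * ((w1 * w + w * w1) + (v1 * v + v * v1))) + g * (r1 * y + \<rho> * 0)) +
  v * (P2 + (1/2) * (r2 * (w * w + v * v) + \<rho> * ((w2 * w + w * w2) + (v2 * v + v * v2))) + g * (r2 * y + \<rho> * 1)) =
  (w * r1 + v * r2) * ((w * w + v * v) / 2 + g * y)"
  unfolding P by (simp add: field_simps)
 then show ?thesis using assms(3) by simp
qed

text \<open>The Long-Yih equation at one point. The vertical derivatives of head and density are
  those of functions of -\<psi>, with s w as the vertical derivative of \<psi>; the vertical
  momentum equation eliminates the pressure, and the nonzero factor s w is cancelled.\<close>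

lemma stream_identity:
 fixes w :: real
 assumes s: "s > 0" "s * s = \<rho>" and w: "w ~= 0"
  and e: "\<rho> * w * v1 + \<rho> * v * v2 = - P2 - g * \<rho>" "w * r1 + v * r2 = 0"
  and b: "P2 + (1/2) * (r2 * (w * w + v * v) + \<rho> * ((w2 * w + w * w2) + (v2 * v + v * v2))) + g * (r2 * y + \<rho> * 1) = \<beta> * (s * w)"
  and r2: "r2 = - (G * (s * w))"
 shows "- (r1 / (2 * s) * v + s * v1) + (r2 / (2 * s) * w + s * w2) = g * y * G + \<beta>"
proof -
 have P2: "P2 = - (\<rho> * w * v1 + \<rho> * v * v2) - g * \<rho>" using e(1) by simp
 have r1: "r1 * w = - (v * r2)" using e(2) by (simp add: algebra_simps)
 have "(- (r1 / (2 * s) * v + s * v1) + (r2 / (2 * s) * w + s * w2)) * (s * w) = - ((r1 * w) * v) / 2 - (s * s) * v1 * w + r2 * w * w / 2 + (s * s) * w2 * w"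
  using s(1) by (simp add: field_simps)
 also have "... = P2 + (1/2) * (r2 * (w * w + v * v) + \<rho> * ((w2 * w + w * w2) + (v2 * v + v * v2))) + g * (r2 * y + \<rho> * 1) + g * y * (- r2)"
  unfolding r1 s(2) P2 by (simp add: field_simps)
 also have "... = (g * y * G + \<beta>) * (s * w)" unfolding b by (simp add: r2 algebra_simps)
 finally show ?thesis using s(1) w by simp
qed

text \<open>Two potentials with the same gradient and the value 0 on the surface agree on every
  vertical fibre. Hence the inverse hodographs coincide, and with them density and head; the head,
  continuous by assumption, determines \<beta> almost everywhere.\<close>

lemma velocity_to_stream_unique:
 fixes lam r a p0 p0' d :: real
 assumes par: "lam > 0" "r \<ge> 1" "a = (r - 1) / r" and p0: "p0 < 0" and cl: "!!x. - d < \<eta> x" "continuous_on UNIV \<eta>"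
  and s: "velocity_to_stream g d w v P \<rho> \<eta> p0 R \<beta> \<psi>" and s': "velocity_to_stream g d w v P \<rho> \<eta> p0' R' \<beta>' \<psi>'"
  and c: "continuous_on {p0<..<0} (%p. head g w v P \<rho> (inv_hodograph d \<eta> \<psi> (0, p)))"
 shows "p0' = p0 & (ALL z:closure (fluid_domain d \<eta>). \<psi>' z = \<psi> z) & (ALL p:{p0..0}. R' p = R p) & (AE p in lebesgue_on {p0<..<0}. \<beta>' p = \<beta> p)"
proof -
 interpret strip_domain lam r a p0 by unfold_locales (use par p0 in auto)
 let ?U = "subgraph (- d) \<eta>"
 have mem: "(x, y) : closure ?U \<longleftrightarrow> - d <= y & y <= \<eta> x" for x y using closure_subgraph[OF cl(2,1)] by auto
 note f = s[unfolded velocity_to_stream_def Let_def fluid_domain_subgraph]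
 note f' = s'[unfolded velocity_to_stream_def Let_def fluid_domain_subgraph]
 let ?L = "%z k. - sqrt (\<rho> z) * v z * fst k + sqrt (\<rho> z) * w z * snd k"
 have p: "continuous_on (closure ?U) \<psi>" "!!z. z : ?U ==> (\<psi> has_derivative ?L z) (at z)" "!!x. \<psi> (x, \<eta> x) = 0" "p0 = - \<psi> (0, - d)"
  using f by blast+
 have p': "continuous_on (closure ?U) \<psi>'" "!!z. z : ?U ==> (\<psi>' has_derivative ?L z) (at z)" "!!x. \<psi>' (x, \<eta> x) = 0" "p0' = - \<psi>' (0, - d)"
  using f' by blast+
 have "((%z. \<psi>' z - \<psi> z) has_derivative (%k. 0 * fst k + 0 * snd k)) (at z)" if "z : ?U" for z
  by (rule has_derivative_eq_rhs[OF has_derivative_diff[OF p'(2)[OF that] p(2)[OF that]]]) auto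
 then have C: "C1_on ?U (%z. \<psi>' z - \<psi> z) (%_. 0) (%_. 0)"
  using open_subgraph[OF cl(2)] by (simp add: C1_on_def)
 have eq: "\<psi>' z = \<psi> z" if z: "z : closure ?U" for z
 proof -
  obtain x y where xy: "z = (x, y)" by (cases z)
  then have y: "- d <= y" "y <= \<eta> x" using z mem by auto
  show ?thesis
  proof (cases "y = \<eta> x")
   case False
   then have lt: "y < \<eta> x" using y by simp
   have "(%t. \<psi>' (x, t) - \<psi> (x, t)) (\<eta> x) = (%t. \<psi>' (x, t) - \<psi> (x, t)) y"
   proof (rule DERIV_isconst_end[OF lt])
    show "continuous_on {y..\<eta> x} (%t. \<psi>' (x, t) - \<psi> (x, t))"
     by (intro continuous_on_diff continuous_on_compose2[OF p(1)] continuous_on_compose2[OF p'(1)]) (use y in \<open>auto simp: mem intro!: continuous_intros\<close>)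
    show "DERIV (%t. \<psi>' (x, t) - \<psi> (x, t)) t :> 0" if "y < t" "t < \<eta> x" for t
     by (rule C1_on_slices(2)[OF C]) (use that y in simp)
   qed
   then show ?thesis using p(3) p'(3) by (simp add: xy)
  qed (use p(3) p'(3) xy in simp)
 qed
 have p00: "p0' = p0" using p(4) p'(4) eq[of "(0, - d)"] cl(1)[of 0] by (simp add: mem)
 have inv: "inv_hodograph d \<eta> \<psi>' z = inv_hodograph d \<eta> \<psi> z" for z
 proof -
  have "(y : closure ?U & hodograph \<psi>' y = z) = (y : closure ?U & hodograph \<psi> y = z)" for y
   using eq[of y] by (auto simp: hodograph_def)
  then show ?thesis by (simp add: inv_hodograph_def the_inv_into_def fluid_domain_subgraph)
 qed
 have R: "R' p = R p" if "p : {p0..0}" for p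
 proof -
  have "\<rho> (inv_hodograph d \<eta> \<psi> (0, p)) = R p" "\<rho> (inv_hodograph d \<eta> \<psi>' (0, p)) = R' p" using f f' that p00 by blast+
  then show ?thesis by (simp add: inv)
 qed
 obtain B where B: "ALL q. ALL p:{p0..0}. head g w v P \<rho> (inv_hodograph d \<eta> \<psi> (q, p)) = B p" "has_weak_deriv {p0<..<0} 1 B (%p. - \<beta> p)"
  using f by blast
 obtain B' where B': "ALL q. ALL p:{p0'..0}. head g w v P \<rho> (inv_hodograph d \<eta> \<psi>' (q, p)) = B' p" "has_weak_deriv {p0'<..<0} 1 B' (%p. - \<beta>' p)"
  using f' by blast
 have "head g w v P \<rho> (inv_hodograph d \<eta> \<psi> (0, p)) = B p" if "p : I" for p using B(1) that by (simp add: less_imp_le)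
 then have cB: "continuous_on I B" using continuous_on_eq[OF c] by blast
 have BB: "B p = B' p" if "p : I" for p
 proof -
  have "p : {p0..0}" using that by auto
  then have "head g w v P \<rho> (inv_hodograph d \<eta> \<psi> (0, p)) = B p" "head g w v P \<rho> (inv_hodograph d \<eta> \<psi>' (0, p)) = B' p" using B(1) B'(1) p00 by blast+
  then show ?thesis by (simp add: inv)
 qed
 have "AE p\<in>I in lborel. - \<beta> p = - \<beta>' p"
  by (rule weak_deriv_1d_unique[OF B(2) B'(2)[unfolded p00] cB BB])
 then have "AE p in lebesgue_on I. \<beta>' p = \<beta> p" unfolding AE_lebesgue_on_iff[OF borel_open[OF open_I]] by eventually_elim auto
 then show ?thesis using p00 eq R by (simp add: fluid_domain_subgraph)
qed

lemma velocity_to_stream_exists: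
 assumes par: "g > 0" "\<rho>0 > 0" "lam > 0" "r \<ge> 1" "a = (r - 1) / r"
  and vs: "velocity_solution g d \<rho>0 lam r a w v P \<rho> \<eta>"
 shows "\<exists>p0 R \<beta> \<psi>. p0 < 0 & velocity_to_stream g d w v P \<rho> \<eta> p0 R \<beta> \<psi> & stream_solution g d \<rho>0 lam r a p0 R \<beta> \<psi> \<eta> \<and>
  (\<forall>p0' R' \<beta>' \<psi>'. velocity_to_stream g d w v P \<rho> \<eta> p0' R' \<beta>' \<psi>' -->
   p0' = p0 & (ALL z:closure (fluid_domain d \<eta>). \<psi>' z = \<psi> z) & (ALL p:{p0..0}. R' p = R p) & (AE p in lebesgue_on {p0<..<0}. \<beta>' p = \<beta> p))"
proof -
 let ?U = "subgraph (- d) \<eta>"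
 note f = vs[unfolded velocity_solution_def Let_def fluid_domain_subgraph]
 have sp: "surface_profile d lam a \<eta>" using f by blast
 interpret W: wave_domain lam r a "- d" \<eta> "deriv \<eta>" by (rule surface_wave_domain[OF par(3-5) sp])
 have "velocity_class lam r a ?U w" using f by blast
 then obtain w1 w2 where vw: "W.vc w w1 w2" unfolding W.velocity_class_iff by blast
 have "velocity_class lam r a ?U v" using f by blast
 then obtain v1 v2 where vv: "W.vc v v1 v2" unfolding W.velocity_class_iff by blast
 have "velocity_class lam r a ?U P" using f by blast
 then obtain P1 P2 where vP: "W.vc P P1 P2" unfolding W.velocity_class_iff by blast
 have "velocity_class lam r a ?U \<rho>" using f by blast
 then obtain r1 r2 where vr: "W.vc \<rho> r1 r2" unfolding W.velocity_class_iff by blast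
 have "AE z in lebesgue_on ?U. \<rho> z * w z * wd1 ?U w z + \<rho> z * v z * wd2 ?U w z = - wd1 ?U P z"
  "AE z in lebesgue_on ?U. \<rho> z * w z * wd1 ?U v z + \<rho> z * v z * wd2 ?U v z = - wd2 ?U P z - g * \<rho> z"
  "AE z in lebesgue_on ?U. w z * wd1 ?U \<rho> z + v z * wd2 ?U \<rho> z = 0" "AE z in lebesgue_on ?U. wd1 ?U w z + wd2 ?U v z = 0"
  using f by blast+
 note e = this[unfolded AE_lebesgue_on_iff[OF borel_open[OF W.open_U]]]
 have bc: "!!x. P (x, \<eta> x) = 0" "!!x. v (x, \<eta> x) = w (x, \<eta> x) * deriv \<eta> x" "!!x. v (x, - d) = 0" "integral {0..lam} \<eta> = 0"
  "(SUP z\<in>?U. w z) < 0" "!!z. z : ?U ==> \<rho>0 <= \<rho> z"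
  using f by blast+
 have pt: "AE z\<in>?U in lborel. \<rho> z * w z * w1 z + \<rho> z * v z * w2 z = - P1 z \<and>
   \<rho> z * w z * v1 z + \<rho> z * v z * v2 z = - P2 z - g * \<rho> z & w z * r1 z + v z * r2 z = 0 & w1 z + v2 z = 0"
  using e W.vc_wd[OF vw] W.vc_wd[OF vv] W.vc_wd[OF vP] W.vc_wd[OF vr] by eventually_elim auto
 have cont: "continuous_on (closure ?U) \<rho>" "continuous_on (closure ?U) w" using vr vw by (auto simp: W.vc_def intro: holder_on_continuous)
 have \<rho>0c: "\<rho>0 <= \<rho> z" if "z : closure ?U" for z by (rule continuous_ge_on_closure[OF cont(1) that]) (rule bc(6))
 define s where "s = (%z. sqrt (\<rho> z))"
 have s: "s z > 0" "s z * s z = \<rho> z" "sqrt \<rho>0 <= s z" if "z : closure ?U" for z using \<rho>0c[OF that] par(2) by (auto simp: s_def)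
 have vs': "W.vc s (%z. r1 z / (2 * s z)) (%z. r2 z / (2 * s z))" unfolding s_def by (rule W.vc_sqrt[OF vr par(2) \<rho>0c])
 define A where "A = (%z. - (s z * v z))"
 define B where "B = (%z. s z * w z)"
 define A1 where "A1 = (%z. - (r1 z / (2 * s z) * v z + s z * v1 z))"
 define A2 where "A2 = (%z. - (r2 z / (2 * s z) * v z + s z * v2 z))"
 define B1 where "B1 = (%z. r1 z / (2 * s z) * w z + s z * w1 z)"
 define B2 where "B2 = (%z. r2 z / (2 * s z) * w z + s z * w2 z)"
 have vA: "W.vc A A1 A2" unfolding A_def A1_def A2_def by (rule W.vc_minus[OF W.vc_mult[OF vs' vv]])
 have vB: "W.vc B B1 B2" unfolding B_def B1_def B2_def by (rule W.vc_mult[OF vs' vw])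
 have "AE z\<in>?U in lborel. A2 z = B1 z"
  unfolding A2_def B1_def using pt by eventually_elim (blast intro: curl_identity)
 moreover have "A (x, - d) = 0" for x by (simp add: A_def bc(3))
 moreover have "A (x, \<eta> x) + B (x, \<eta> x) * deriv \<eta> x = 0" for x by (simp add: A_def B_def bc(2))
 ultimately obtain \<psi> k where psi: "W.pc \<psi> A B A1 A2 B1 B2" "!!x. \<psi> (x, \<eta> x) = 0" "!!x. \<psi> (x, - d) = k"
  using W.potential_exists[OF vA vB] by blast
 define M where "M = - (SUP z\<in>?U. w z)"
 have M: "M > 0" using bc(5) by (simp add: M_def)
 obtain Bw where Bw: "ALL z:?U. \<bar>w z\<bar> <= Bw" using W.vcD(3)[OF vw] by blast
 \<comment> \<open>A real supremum bounds its set only if the set is bounded above, hence the detour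
   through boundedness of w.\<close>
 have "bdd_above (w ` ?U)" by (rule bdd_aboveI2[of _ _ Bw]) (use Bw abs_le_D1 in blast)
 then have wU: "w z <= - M" if "z : ?U" for z using cSUP_upper[OF that] by (simp add: M_def)
 have wc: "w z <= - M" if "z : closure ?U" for z by (rule continuous_le_on_closure[OF cont(2) that]) (rule wU)
 \<comment> \<open>Lower bound for - sqrt(\<rho>) w, from the lower bounds of the two
   factors.\<close>
 define c where "c = sqrt \<rho>0 * M"
 have c: "c > 0" using M par(2) by (simp add: c_def)
 have Bc: "c <= - B z" if "z : closure ?U" for z
 proof -
  have "sqrt \<rho>0 * M <= s z * (- w z)" using s[OF that] wc[OF that] M par(2) by (intro mult_mono) auto
  then show ?thesis by (simp add: c_def B_def)
 qed
 have BcU: "c <= - B z" and sU: "s z > 0" "s z * s z = \<rho> z" and wneg: "w z < 0" if "z : ?U" for z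
  using Bc[of z] s[of z] wU[of z] M that closure_subset[of ?U] by auto
 note mpc = W.pc_minus[OF psi(1)]
 \<comment> \<open>k is the value of \<psi> at the bed; it is positive since -\<psi> increases
   strictly from the bed to its value 0 at the surface.\<close>
 define p0 where "p0 = - k"
 have p0: "p0 < 0"
 proof -
  have "c * (\<eta> 0 - - d) <= - \<psi> (0, \<eta> 0) - - \<psi> (0, - d)"
   by (rule W.vertical_increase[of "%z. - \<psi> z" "%z. - A z" "%z. - B z"]) (use mpc BcU W.lu[of 0] in \<open>auto simp: W.pc_def c1h_def\<close>)
  moreover have "0 < c * (\<eta> 0 - - d)" using c W.lu[of 0] by simp
  ultimately show ?thesis by (simp add: psi p0_def)
 qed
 interpret Sd: strip_domain lam r a p0 by unfold_locales (use par p0 in auto)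
 interpret H: fibre_inversion lam r a "- d" \<eta> "deriv \<eta>" p0 "%_. 0" "%_. 0" "%z. - \<psi> z" "%z. - A z" "%z. - B z"
  "%z. - A1 z" "%z. - A2 z" "%z. - B1 z" "%z. - B2 z" c
  by unfold_locales (use mpc psi c BcU in \<open>auto simp: p0_def\<close>)
 let ?V = "subgraph p0 (%_. 0)"
 have hod: "hodograph \<psi> = H.T" by (simp add: hodograph_def fibre_map_def fun_eq_iff)
 have inv: "inv_hodograph d \<eta> \<psi> z = H.S z" if "z : closure ?V" for z
  unfolding inv_hodograph_def hod fluid_domain_subgraph by (rule H.the_inv_T[OF that])
 \<comment> \<open>In the strip the q-derivative is the derivative along streamlines: their slope is
   v/w, so transport equations become vanishing q-derivatives.\<close>
 have flat: "AE z\<in>?V in lborel. x1 (H.S z) + H.ki1 z * x2 (H.S z) = 0"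
  if "AE z\<in>?U in lborel. w z * x1 z + v z * x2 z = 0" for x1 x2
  using H.AE_S[OF that]
 proof eventually_elim
  case (elim z)
  show ?case
  proof
   assume z: "z : ?V"
   let ?z = "H.S z"
   have zU: "?z : ?U" by (rule H.S_maps[OF z])
   have "H.ki1 z = v ?z / w ?z" unfolding H.ki1_def unfolding A_def B_def using sU[OF zU] wneg[OF zU] by (simp add: field_simps)
   then have "x1 ?z + H.ki1 z * x2 ?z = (w ?z * x1 ?z + v ?z * x2 ?z) / w ?z" using wneg[OF zU] by (simp add: field_simps)
   then show "x1 ?z + H.ki1 z * x2 ?z = 0" using elim z by simp
  qed
 qed
 define hd where "hd = head g w v P \<rho>"
 define h1 where "h1 = (%z. P1 z + (1/2) * (r1 z * (w z * w z + v z * v z) + \<rho> z * ((w1 z * w z + w z * w1 z) + (v1 z * v z + v z * v1 z))) + g * (r1 z * snd z + \<rho> z * 0))"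
 define h2 where "h2 = (%z. P2 z + (1/2) * (r2 z * (w z * w z + v z * v z) + \<rho> z * ((w2 z * w z + w z * w2 z) + (v2 z * v z + v z * v2 z))) + g * (r2 z * snd z + \<rho> z * 1))"
 have vh: "W.vc hd h1 h2"
  unfolding h1_def h2_def
  by (rule W.vc_cong'[OF W.vc_add[OF W.vc_add[OF vP W.vc_cmult[of _ _ _ "1/2", OF W.vc_mult[OF vr W.vc_add[OF W.vc_mult[OF vw vw] W.vc_mult[OF vv vv]]]]] W.vc_cmult[of _ _ _ g, OF W.vc_mult[OF vr W.vc_snd]]]])
   (auto simp: hd_def head_def power2_eq_square)
 have f1: "AE z\<in>?V in lborel. r1 (H.S z) + H.ki1 z * r2 (H.S z) = 0"
  by (rule flat) (use pt in \<open>eventually_elim, auto\<close>)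
 have f2: "AE z\<in>?V in lborel. h1 (H.S z) + H.ki1 z * h2 (H.S z) = 0"
 proof (rule flat)
  show "AE z\<in>?U in lborel. w z * h1 z + v z * h2 z = 0"
   using pt unfolding h1_def h2_def by eventually_elim (blast intro: head_identity)
 qed
 note vR = H.vc_S[OF vr] and vH = H.vc_S[OF vh]
 define R where "R = (%p. \<rho> (H.S (0, p)))"
 define Bh where "Bh = (%p. hd (H.S (0, p)))"
 have R: "\<rho> (H.S z) = R (snd z)" and Bh: "hd (H.S z) = Bh (snd z)" if "z : closure ?V" for z
  using Sd.flat_const[OF vR f1 that] Sd.flat_const[OF vH f2 that] by (simp_all add: R_def Bh_def)
 obtain GR where GR: "has_weak_deriv Sd.I 1 R GR" "Lr_on r Sd.I GR" "AE z\<in>?V in lborel. H.ki2 z * r2 (H.S z) = GR (snd z)"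
  using Sd.flat_weak_deriv[OF vR f1] unfolding R_def by blast
 obtain GB where GB: "has_weak_deriv Sd.I 1 Bh GB" "Lr_on r Sd.I GB" "AE z\<in>?V in lborel. H.ki2 z * h2 (H.S z) = GB (snd z)"
  using Sd.flat_weak_deriv[OF vH f2] unfolding Bh_def by blast
 define \<beta> where "\<beta> = (%p. - GB p)"
 have cR: "continuous_on {p0..0} R" and cBh: "continuous_on {p0..0} Bh"
  using Sd.flat_continuous[OF vR] Sd.flat_continuous[OF vH] by (simp_all add: R_def Bh_def)
 have cI: "continuous_on Sd.I R" "continuous_on Sd.I Bh" using cR cBh by (auto intro: continuous_on_subset)
 have L\<beta>: "Lr_on r Sd.I \<beta>" using GB(2) by (auto simp: Lr_on_def \<beta>_def)
 have cl0: "(0, p) : closure ?V" if "p : {p0..0}" for p using that by simp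
 have data: "data_class \<rho>0 r p0 R \<beta>"
  unfolding data_class_def W1_interval_def
 proof (intro conjI ballI)
  show "EX f'. has_weak_deriv Sd.I 1 R f' & Lr_on r Sd.I f'" using GR by blast
  show "\<rho>0 <= R p" if "p : {p0..0}" for p unfolding R_def by (rule \<rho>0c[OF H.ki_props(1)[OF cl0[OF that]]])
 qed (rule cR Sd.Lr_on_continuous[OF cR] L\<beta>)+
 have v2s: "velocity_to_stream g d w v P \<rho> \<eta> p0 R \<beta> \<psi>"
  unfolding velocity_to_stream_def Let_def fluid_domain_subgraph strip_subgraph
 proof (intro conjI ballI allI exI[of _ Bh])
  show "continuous_on (closure ?U) \<psi>" using psi(1) by (simp add: W.pc_def c1h_def)
  have C: "C1_on ?U \<psi> A B" using psi(1) by (simp add: W.pc_def c1h_def)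
  show "(\<psi> has_derivative (%k. - sqrt (\<rho> z) * v z * fst k + sqrt (\<rho> z) * w z * snd k)) (at z)" if "z : ?U" for z
   using C that by (simp add: C1_on_def A_def B_def s_def)
  show "bij_betw (hodograph \<psi>) (closure ?U) (closure ?V)" unfolding hod by (rule H.bij_T)
  fix q p assume p: "p : {p0..0}"
  then have m: "(q, p) : closure ?V" by simp
  show "\<rho> (inv_hodograph d \<eta> \<psi> (q, p)) = R p" unfolding inv[OF m] R[OF m] by simp
  show "head g w v P \<rho> (inv_hodograph d \<eta> \<psi> (q, p)) = Bh p" using Bh[OF m] unfolding inv[OF m] by (simp add: hd_def)
 next
  show "has_weak_deriv {p0<..<0} 1 Bh (%p. - \<beta> p)" using GB(1) by (simp add: \<beta>_def)
 qed (simp_all add: psi p0_def)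
 \<comment> \<open>The surface corresponds to p = 0.\<close>
 have topS: "\<rho> (x, \<eta> x) = R 0" "hd (x, \<eta> x) = Bh 0" for x
 proof -
  have m: "(x, \<eta> x) : closure ?U" using W.lu[of x] by simp
  have "H.S (x, 0) = (x, \<eta> x)" using H.S_T[OF m] by (simp add: fibre_map_def psi(2))
  then show "\<rho> (x, \<eta> x) = R 0" "hd (x, \<eta> x) = Bh 0" using R[of "(x, 0)"] Bh[of "(x, 0)"] p0 by simp_all
 qed
 have C: "C1_on ?U \<psi> A B" and cA: "continuous_on (closure ?U) A" "continuous_on (closure ?U) B"
  using psi(1) by (auto simp: W.pc_def c1h_def intro: holder_on_continuous)
 have cd: "cd1 ?U \<psi> z = A z" "cd2 ?U \<psi> z = B z" if "z : closure ?U" for z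
  by (rule ext_deriv_eq(1)[OF C that cA(1)], rule ext_deriv_eq(2)[OF C that cA(2)])
 define G2 where "G2 = (%x. (cd1 ?U \<psi> (x, \<eta> x))\<^sup>2 + (cd2 ?U \<psi> (x, \<eta> x))\<^sup>2)"
 \<comment> \<open>Bernoulli's law on the surface, where P = 0.\<close>
 have G2: "G2 x = 2 * Bh 0 - 2 * g * R 0 * \<eta> x" for x
 proof -
  have m: "(x, \<eta> x) : closure ?U" using W.lu[of x] by simp
  have "G2 x = (s (x, \<eta> x) * s (x, \<eta> x)) * ((w (x, \<eta> x))\<^sup>2 + (v (x, \<eta> x))\<^sup>2)"
   unfolding G2_def cd[OF m] by (simp add: A_def B_def power2_eq_square algebra_simps)
  also have "s (x, \<eta> x) * s (x, \<eta> x) = \<rho> (x, \<eta> x)" by (rule s(2)[OF m])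
  finally have "G2 x = R 0 * ((w (x, \<eta> x))\<^sup>2 + (v (x, \<eta> x))\<^sup>2)" by (simp add: topS)
  moreover have "Bh 0 = R 0 * ((w (x, \<eta> x))\<^sup>2 + (v (x, \<eta> x))\<^sup>2) / 2 + g * R 0 * \<eta> x"
   using topS(2)[of x] by (simp add: hd_def head_def bc(1) topS(1))
  ultimately show ?thesis by simp
 qed
 have ci: "\<eta> integrable_on {0..lam}" by (intro integrable_continuous_interval continuous_on_subset[OF W.cont_u]) auto
 \<comment> \<open>The zero mean of \<eta> removes the gravity term, which identifies Q as twice the
   head at p = 0.\<close>
 have "integral {0..lam} G2 = lam * (2 * Bh 0)"
 proof -
  have "((%x. 2 * Bh 0 - 2 * g * R 0 * \<eta> x) has_integral (lam - 0) *\<^sub>R (2 * Bh 0) - 2 * g * R 0 * integral {0..lam} \<eta>) {0..lam}"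
   by (intro has_integral_diff has_integral_mult_right integrable_integral[OF ci]) (use has_integral_const_real[of "2 * Bh 0" 0 lam] par in simp)
  then show ?thesis using bc(4) by (simp add: G2[abs_def] integral_unique)
 qed
 then have Q: "(1 / lam) * integral {0..lam} G2 = 2 * Bh 0" using par(3) by simp
 have wR: "AE z\<in>?V in lborel. weak_deriv Sd.I 1 R (snd z) = GR (snd z)"
  by (rule iffD2[OF Sd.AE_I_iff], rule Sd.weak_deriv_1d_unique[OF weak_deriv_works[OF GR(1)] GR(1) cI(1) refl])
 have T: "H.S (H.T z) = z" "snd (H.T z) = - \<psi> z" if "z : ?U" for z
  using H.S_T[of z] that closure_subset[of ?U] by (auto simp: fibre_map_def)
 \<comment> \<open>The p-derivatives of density and head are known almost everywhere in the strip;
   \<open>AE_T\<close> carries these statements back to the fluid domain.\<close>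
 have pde: "AE z\<in>?U in lborel. A1 z + B2 z = g * snd z * weak_deriv Sd.I 1 R (- \<psi> z) + \<beta> (- \<psi> z)"
  using pt H.AE_T[OF GR(3)] H.AE_T[OF GB(3)] H.AE_T[OF wR]
 proof eventually_elim
  case (elim z)
  show ?case
  proof
   assume z: "z : ?U"
   have ki2: "H.ki2 (H.T z) = inverse (- B z)" unfolding H.ki2_def T(1)[OF z] ..
   have nz: "s z * w z ~= 0" using sU[OF z] wneg[OF z] by simp
   have i1: "inverse (- B z) * r2 z = GR (- \<psi> z)" and i2: "inverse (- B z) * h2 z = GB (- \<psi> z)" and i3: "weak_deriv Sd.I 1 R (- \<psi> z) = GR (- \<psi> z)"
    using elim(2,3,4) z unfolding ki2 T(1)[OF z] T(2)[OF z] by auto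
   have "r2 z = - (GR (- \<psi> z) * (s z * w z))" unfolding i1[symmetric] using nz by (simp add: B_def field_simps)
   moreover have "h2 z = \<beta> (- \<psi> z) * (s z * w z)" unfolding \<beta>_def i2[symmetric] using nz by (simp add: B_def field_simps)
   ultimately show "A1 z + B2 z = g * snd z * weak_deriv Sd.I 1 R (- \<psi> z) + \<beta> (- \<psi> z)"
    unfolding A1_def B2_def i3 using elim(1) z sU[OF z] wneg[OF z]
    by (intro stream_identity[of "s z" "\<rho> z" "w z" "v1 z" "v z" "v2 z" "P2 z" g "r1 z" "r2 z" "w2 z" "snd z"]) (auto simp: h2_def)
  qed
 qed
 have st: "stream_solution g d \<rho>0 lam r a p0 R \<beta> \<psi> \<eta>"
  unfolding stream_solution_def Let_def fluid_domain_subgraph AE_lebesgue_on_iff[OF borel_open[OF W.open_U]]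
 proof (intro conjI allI data sp)
  show "potential_class lam r a ?U \<psi>" unfolding W.potential_class_iff using psi(1) by blast
  show "AE z\<in>?U in lborel. wd1 ?U (wd1 ?U \<psi>) z + wd2 ?U (wd2 ?U \<psi>) z = g * snd z * weak_deriv {p0<..<0} 1 R (- \<psi> z) + \<beta> (- \<psi> z)"
   using pde W.pc_wd[OF psi(1)] by eventually_elim auto
  show "(cd1 ?U \<psi> (x, \<eta> x))\<^sup>2 + (cd2 ?U \<psi> (x, \<eta> x))\<^sup>2 + 2 * g * R 0 * \<eta> x =
   1 / lam * integral {0..lam} (%x. (cd1 ?U \<psi> (x, \<eta> x))\<^sup>2 + (cd2 ?U \<psi> (x, \<eta> x))\<^sup>2)" for x
   using Q G2[of x] by (simp add: G2_def)
  have "(SUP z\<in>?U. cd2 ?U \<psi> z) <= - c"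
  proof (rule cSUP_least[OF W.U_nonempty])
   fix z assume z: "z : ?U"
   then show "cd2 ?U \<psi> z <= - c" using cd(2)[of z] BcU[OF z] closure_subset[of ?U] by auto
  qed
  then show "(SUP z\<in>?U. cd2 ?U \<psi> z) < 0" using c by linarith
 qed (simp_all add: psi p0_def)
 have "continuous_on {p0<..<0} (%p. head g w v P \<rho> (inv_hodograph d \<eta> \<psi> (0, p)))"
  by (rule continuous_on_eq[OF cI(2)]) (simp add: inv Bh_def hd_def)
 then show ?thesis using p0 v2s st velocity_to_stream_unique[OF par(3-5) p0 W.lu W.cont_u v2s] by blast
qed

text \<open>Translates a solution of (S) into named derivatives and an invertible fibre map with k =
  -\<psi>; both the passage to (D) and the return to (V) start from it.\<close>

lemma stream_solution_inversion:
 assumes par: "lam > 0" "r \<ge> 1" "a = (r - 1) / r" "p0 < 0"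
  and st: "stream_solution g d \<rho>0 lam r a p0 R \<beta> \<psi> \<eta>"
 shows "EX A B A1 A2 B1 B2 c. wave_domain lam r a (- d) \<eta> (deriv \<eta>) \<and>
  periodic_domain.pc lam r a (subgraph (- d) \<eta>) \<psi> A B A1 A2 B1 B2 \<and>
  fibre_inversion lam r a (- d) \<eta> (deriv \<eta>) p0 (%_. 0) (%_. 0) (%z. - \<psi> z) (%z. - A z) (%z. - B z)
   (%z. - A1 z) (%z. - A2 z) (%z. - B1 z) (%z. - B2 z) c \<and>
  (AE z in lborel. z : subgraph (- d) \<eta> --> A1 z + B2 z = g * snd z * weak_deriv {p0<..<0} 1 R (- \<psi> z) + \<beta> (- \<psi> z) & A2 z = B1 z) \<and>
  (ALL x. (A (x, \<eta> x))\<^sup>2 + (B (x, \<eta> x))\<^sup>2 + 2 * g * R 0 * \<eta> x = (1 / lam) * integral {0..lam} (%x. (A (x, \<eta> x))\<^sup>2 + (B (x, \<eta> x))\<^sup>2))"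
proof -
 let ?U = "subgraph (- d) \<eta>"
 note f = st[unfolded stream_solution_def Let_def fluid_domain_subgraph]
 have sp: "surface_profile d lam a \<eta>" using f by blast
 interpret W: wave_domain lam r a "- d" \<eta> "deriv \<eta>" by (rule surface_wave_domain[OF par(1-3) sp])
 interpret Sd: strip_domain lam r a p0 by unfold_locales (use par in auto)
 have "potential_class lam r a ?U \<psi>" using f by blast
 then obtain A B A1 A2 B1 B2 where psi: "W.pc \<psi> A B A1 A2 B1 B2" unfolding W.potential_class_iff by blast
 have C: "C1_on ?U \<psi> A B" and cA: "continuous_on (closure ?U) A" "continuous_on (closure ?U) B" and hB: "holder_on a (closure ?U) B"
  using psi by (auto simp: W.pc_def c1h_def intro: holder_on_continuous)
 have cd: "cd1 ?U \<psi> z = A z" "cd2 ?U \<psi> z = B z" if "z : closure ?U" for z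
  by (rule ext_deriv_eq(1)[OF C that cA(1)], rule ext_deriv_eq(2)[OF C that cA(2)])
 have top: "(x, \<eta> x) : closure ?U" for x using W.lu[of x] by simp
 have "AE z in lebesgue_on ?U. wd1 ?U (wd1 ?U \<psi>) z + wd2 ?U (wd2 ?U \<psi>) z = g * snd z * weak_deriv {p0<..<0} 1 R (- \<psi> z) + \<beta> (- \<psi> z)"
  using f by blast
 then have pde: "AE z\<in>?U in lborel. A1 z + B2 z = g * snd z * weak_deriv {p0<..<0} 1 R (- \<psi> z) + \<beta> (- \<psi> z) & A2 z = B1 z"
  unfolding AE_lebesgue_on_iff[OF borel_open[OF W.open_U]] using W.pc_wd[OF psi] by eventually_elim auto
 have bc: "!!x. \<psi> (x, \<eta> x) = 0" "!!x. \<psi> (x, - d) = - p0" "(SUP z\<in>?U. cd2 ?U \<psi> z) < 0" using f by blast+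
 have Q0: "ALL x. (cd1 ?U \<psi> (x, \<eta> x))\<^sup>2 + (cd2 ?U \<psi> (x, \<eta> x))\<^sup>2 + 2 * g * R 0 * \<eta> x =
   1 / lam * integral {0..lam} (%x. (cd1 ?U \<psi> (x, \<eta> x))\<^sup>2 + (cd2 ?U \<psi> (x, \<eta> x))\<^sup>2)" using f by blast
 note Q = Q0[unfolded cd[OF top]]
 define c where "c = - (SUP z\<in>?U. B z)"
 have "(SUP z\<in>?U. cd2 ?U \<psi> z) = (SUP z\<in>?U. B z)"
  by (intro SUP_cong refl cd(2)) (use closure_subset in blast)
 then have c: "c > 0" using bc(3) by (simp add: c_def)
 obtain N where N: "ALL z:closure ?U. \<bar>B z\<bar> <= N" using holder_on_E[OF hB] by blast
 have "bdd_above (B ` ?U)" by (rule bdd_aboveI2[of _ _ N]) (use N abs_le_D1 closure_subset in blast)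
 then have Bc: "c <= - B z" if "z : ?U" for z using cSUP_upper[OF that] by (simp add: c_def)
 have "fibre_inversion lam r a (- d) \<eta> (deriv \<eta>) p0 (%_. 0) (%_. 0) (%z. - \<psi> z) (%z. - A z) (%z. - B z)
   (%z. - A1 z) (%z. - A2 z) (%z. - B1 z) (%z. - B2 z) c"
  by unfold_locales (use W.pc_minus[OF psi] bc c Bc in auto)
 then show ?thesis using W.wave_domain_axioms psi pde Q by blast
qed

text \<open>With k = -\<psi> inverted, h_p = i = 1/b and h_q = -a/b. The quasilinear operator
  applied to the inverse collapses to minus the Laplacian of k times h_p^3, the mixed derivatives
  cancelling by symmetry.\<close>

lemma height_identity:
 fixes b :: real
 assumes "i = inverse b" "k21 = k12" "hq = - (a * i)"
 shows "(1 + hq\<^sup>2) * (- (i * k22) / b\<^sup>2) - 2 * hq * i * (- (i * k12 * i + a * (- (i * k22) / b\<^sup>2))) +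
  i\<^sup>2 * (- ((k11 + hq * k12) * i + a * (- (k21 + hq * k22) / b\<^sup>2))) = - (k11 + k22) * i ^ 3"
proof -
 have d: "x / b\<^sup>2 = x * (i * i)" for x unfolding assms(1) by (simp add: divide_inverse power2_eq_square)
 show ?thesis unfolding d assms(2,3) by (simp add: power2_eq_square power3_eq_cube algebra_simps)
qed

lemma stream_to_height_exists:
 assumes par: "lam > 0" "r \<ge> 1" "a = (r - 1) / r" "p0 < 0"
  and st: "stream_solution g d \<rho>0 lam r a p0 R \<beta> \<psi> \<eta>"
 shows "EX h. stream_to_height d p0 \<psi> \<eta> h & height_solution g d \<rho>0 lam r a p0 R \<beta> h \<and>
  (ALL h'. stream_to_height d p0 \<psi> \<eta> h' --> (ALL z:closure (strip p0). h' z = h z))"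
proof -
 obtain A B A1 A2 B1 B2 c where
  W: "wave_domain lam r a (- d) \<eta> (deriv \<eta>)" and psi: "periodic_domain.pc lam r a (subgraph (- d) \<eta>) \<psi> A B A1 A2 B1 B2" and
  H: "fibre_inversion lam r a (- d) \<eta> (deriv \<eta>) p0 (%_. 0) (%_. 0) (%z. - \<psi> z) (%z. - A z) (%z. - B z)
   (%z. - A1 z) (%z. - A2 z) (%z. - B1 z) (%z. - B2 z) c" and
  pde: "AE z in lborel. z : subgraph (- d) \<eta> --> A1 z + B2 z = g * snd z * weak_deriv {p0<..<0} 1 R (- \<psi> z) + \<beta> (- \<psi> z) & A2 z = B1 z" and
  Q: "ALL x. (A (x, \<eta> x))\<^sup>2 + (B (x, \<eta> x))\<^sup>2 + 2 * g * R 0 * \<eta> x = (1 / lam) * integral {0..lam} (%x. (A (x, \<eta> x))\<^sup>2 + (B (x, \<eta> x))\<^sup>2)"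
  using stream_solution_inversion[OF par st] by blast
 let ?U = "subgraph (- d) \<eta>" and ?V = "subgraph p0 (%_. 0)"
 interpret W: wave_domain lam r a "- d" \<eta> "deriv \<eta>" by (rule W)
 interpret Sd: strip_domain lam r a p0 by unfold_locales (use par in auto)
 interpret H: fibre_inversion lam r a "- d" \<eta> "deriv \<eta>" p0 "%_. 0" "%_. 0" "%z. - \<psi> z" "%z. - A z" "%z. - B z"
  "%z. - A1 z" "%z. - A2 z" "%z. - B1 z" "%z. - B2 z" c by (rule H)
 have data: "data_class \<rho>0 r p0 R \<beta>" using st by (simp add: stream_solution_def Let_def)
 define h where "h = (%z. H.ki z + d)"
 note pch = Sd.pc_add_const[OF H.pc_ki, of d, folded h_def]
 have hod: "hodograph \<psi> = H.T" by (simp add: hodograph_def fibre_map_def fun_eq_iff)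
 have inv: "inv_hodograph d \<eta> \<psi> z = H.S z" if "z : closure ?V" for z
  unfolding inv_hodograph_def hod fluid_domain_subgraph by (rule H.the_inv_T[OF that])
 have s2h: "stream_to_height d p0 \<psi> \<eta> h"
  unfolding stream_to_height_def fluid_domain_subgraph strip_subgraph hod
  using H.bij_T inv by (simp add: h_def fibre_map_def)
 have C: "C1_on ?V h H.ki1 H.ki2" and ck: "continuous_on (closure ?V) H.ki1" "continuous_on (closure ?V) H.ki2"
  using pch by (auto simp: Sd.pc_def c1h_def intro: holder_on_continuous)
 have cd: "cd1 ?V h z = H.ki1 z" "cd2 ?V h z = H.ki2 z" if "z : closure ?V" for z
  by (rule ext_deriv_eq(1)[OF C that ck(1)], rule ext_deriv_eq(2)[OF C that ck(2)])
 have top: "(q, 0) : closure ?V" for q using par by simp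
 have S0: "H.S (q, 0) = (q, \<eta> q)" for q
  using H.ki_eq[of q "\<eta> q"] W.lu[of q] H.top[of q] by (simp add: fibre_map_def)
 have nzB: "B z ~= 0" if "z : closure ?U" for z using H.k2c_closure[OF that] H.c by auto
 have nz: "B (q, \<eta> q) ~= 0" for q using nzB[of "(q, \<eta> q)"] W.lu[of q] by simp
 \<comment> \<open>On the surface 1 + h_q^2 = h_p^2 |grad \<psi>|^2; this turns the boundary
   condition of (S) into that of (D), mean value included.\<close>
 have e1: "1 + (H.ki1 (q, 0))\<^sup>2 = (H.ki2 (q, 0))\<^sup>2 * ((A (q, \<eta> q))\<^sup>2 + (B (q, \<eta> q))\<^sup>2)" for q
  unfolding H.ki1_def H.ki2_def S0 using nz[of q] by (simp add: field_simps power2_eq_square)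
 have k2nz: "H.ki2 (q, 0) ~= 0" for q unfolding H.ki2_def S0 using nz[of q] by simp
 have e2: "(1 + (H.ki1 (q, 0))\<^sup>2) / (H.ki2 (q, 0))\<^sup>2 = (A (q, \<eta> q))\<^sup>2 + (B (q, \<eta> q))\<^sup>2" for q
  unfolding e1 using k2nz[of q] by simp
 \<comment> \<open>The infimum of h_p is positive because the vertical derivative of \<psi> is
   bounded.\<close>
 obtain M where M: "M > 0" "ALL z:closure ?V. M <= H.ki2 z" using H.ki2_lower by blast
 have "height_solution g d \<rho>0 lam r a p0 R \<beta> h"
  unfolding height_solution_def Let_def strip_subgraph AE_lebesgue_on_iff[OF borel_open[OF Sd.open_U]]
 proof (intro conjI allI data)
  show "potential_class lam r a ?V h" unfolding Sd.potential_class_iff using pch by blast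
  show "AE z\<in>?V in lborel. (1 + (wd1 ?V h z)\<^sup>2) * wd2 ?V (wd2 ?V h) z - 2 * wd1 ?V h z * wd2 ?V h z * wd2 ?V (wd1 ?V h) z +
   (wd2 ?V h z)\<^sup>2 * wd1 ?V (wd1 ?V h) z - (g * weak_deriv {p0<..<0} 1 R (snd z) * (h z - d) + \<beta> (snd z)) * wd2 ?V h z ^ 3 = 0"
   using Sd.pc_wd[OF pch] H.AE_S[OF pde]
  proof eventually_elim
   case (elim z)
   show ?case
   proof
    assume z: "z : ?V"
    let ?z = "H.S z"
    have zc: "z : closure ?V" using z closure_subset by blast
    have k: "- \<psi> ?z = snd z" by (rule H.ki_props(3)[OF zc])
    have y: "snd ?z = h z - d" by (simp add: h_def fibre_map_def)
    have P: "A1 ?z + B2 ?z = g * (h z - d) * weak_deriv {p0<..<0} 1 R (snd z) + \<beta> (snd z)" and sym: "A2 ?z = B1 ?z"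
     using elim(2) z unfolding k y by auto
    have w: "wd1 ?V h z = H.ki1 z" "wd2 ?V h z = H.ki2 z"
     "wd1 ?V (wd1 ?V h) z = - (H.K1a z * H.ki2 z + (- A ?z) * (- H.K2a z / (- B ?z)\<^sup>2))"
     "wd2 ?V (wd1 ?V h) z = - (H.K1b z * H.ki2 z + (- A ?z) * (- H.K2b z / (- B ?z)\<^sup>2))"
     "wd2 ?V (wd2 ?V h) z = - H.K2b z / (- B ?z)\<^sup>2" using elim(1) z by auto
    have I: "(1 + (H.ki1 z)\<^sup>2) * (- H.K2b z / (- B ?z)\<^sup>2) - 2 * H.ki1 z * H.ki2 z * (- (H.K1b z * H.ki2 z + (- A ?z) * (- H.K2b z / (- B ?z)\<^sup>2))) +
     (H.ki2 z)\<^sup>2 * (- (H.K1a z * H.ki2 z + (- A ?z) * (- H.K2a z / (- B ?z)\<^sup>2))) = - (- A1 ?z + - B2 ?z) * H.ki2 z ^ 3"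
     unfolding H.K1a_def H.K1b_def H.K2a_def H.K2b_def
     by (rule height_identity) (simp_all add: H.ki1_def H.ki2_def sym)
    have "- (- A1 ?z + - B2 ?z) = g * weak_deriv {p0<..<0} 1 R (snd z) * (h z - d) + \<beta> (snd z)" using P by (simp add: mult_ac)
    then show "(1 + (wd1 ?V h z)\<^sup>2) * wd2 ?V (wd2 ?V h) z - 2 * wd1 ?V h z * wd2 ?V h z * wd2 ?V (wd1 ?V h) z +
     (wd2 ?V h z)\<^sup>2 * wd1 ?V (wd1 ?V h) z - (g * weak_deriv {p0<..<0} 1 R (snd z) * (h z - d) + \<beta> (snd z)) * wd2 ?V h z ^ 3 = 0"
     unfolding w I by simp
   qed
  qed
  show "h (q, p0) = 0" for q using H.ki_eq[of q "- d"] W.lu[of q] H.bot[of q] by (simp add: h_def)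
  show "1 + (cd1 ?V h (q, 0))\<^sup>2 + (cd2 ?V h (q, 0))\<^sup>2 * (2 * g * R 0 * (h (q, 0) - d) -
   1 / lam * integral {0..lam} (%s. (1 + (cd1 ?V h (s, 0))\<^sup>2) / (cd2 ?V h (s, 0))\<^sup>2)) = 0" for q
  proof -
   have y: "h (q, 0) - d = \<eta> q" using S0[of q] by (simp add: h_def fibre_map_def)
   have "(A (q, \<eta> q))\<^sup>2 + (B (q, \<eta> q))\<^sup>2 + (2 * g * R 0 * \<eta> q - 1 / lam * integral {0..lam} (%x. (A (x, \<eta> x))\<^sup>2 + (B (x, \<eta> x))\<^sup>2)) = 0"
    using Q[rule_format, of q] by simp
   then show ?thesis unfolding cd[OF top] e2 y unfolding e1 distrib_left[symmetric] by simp
  qed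
  have "M <= (INF z\<in>?V. cd2 ?V h z)"
  proof (rule cINF_greatest[OF Sd.U_nonempty])
   fix z assume "z : ?V"
   then have "z : closure ?V" using closure_subset by blast
   then show "M <= cd2 ?V h z" using cd(2) M(2) by simp
  qed
  then show "(INF z\<in>?V. cd2 ?V h z) > 0" using M(1) by linarith
 qed
 then show ?thesis using s2h by (intro exI[of _ h]) (simp add: stream_to_height_def)
qed

text \<open>Now k = h - d is inverted, so a = h_q, b = h_p and the inverse is -\<psi>. Multiplying
  the Laplacian of \<psi> by b^3 recovers the height operator, and b^3 can be cancelled.\<close>

lemma inverse_height_identity:
 fixes b :: real
 assumes nz: "b ~= 0" and i: "i = inverse b" and k: "k21 = k12" and hq: "hq = - (a * i)"
  and e: "(1 + a\<^sup>2) * k22 - 2 * a * b * k12 + b\<^sup>2 * k11 - F * b ^ 3 = 0"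
 shows "- (- ((k11 + hq * k12) * i + a * (- (k21 + hq * k22) / b\<^sup>2))) + - (- (i * k22) / b\<^sup>2) = F"
proof -
 have "(- (- ((k11 + hq * k12) * i + a * (- (k21 + hq * k22) / b\<^sup>2))) + - (- (i * k22) / b\<^sup>2)) * b ^ 3 =
  (1 + a\<^sup>2) * k22 - 2 * a * b * k12 + b\<^sup>2 * k11"
  unfolding hq i k using nz by (simp add: field_simps power2_eq_square power3_eq_cube)
 also have "... = F * b ^ 3" using e by simp
 finally show ?thesis using nz by simp
qed

lemma height_to_stream_exists:
 assumes par: "lam > 0" "r \<ge> 1" "a = (r - 1) / r" "p0 < 0"
  and hs: "height_solution g d \<rho>0 lam r a p0 R \<beta> h"
 shows "EX \<psi> \<eta>. stream_solution g d \<rho>0 lam r a p0 R \<beta> \<psi> \<eta> & stream_to_height d p0 \<psi> \<eta> h"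
proof -
 let ?V = "subgraph p0 (%_. 0)"
 interpret Sd: strip_domain lam r a p0 by unfold_locales (use par in auto)
 note f = hs[unfolded height_solution_def Let_def strip_subgraph]
 have data: "data_class \<rho>0 r p0 R \<beta>" and pot: "potential_class lam r a ?V h" using f by blast+
 obtain hq hp hqq hqp hpq hpp where pch: "Sd.pc h hq hp hqq hqp hpq hpp" using pot unfolding Sd.potential_class_iff by blast
 have C: "C1_on ?V h hq hp" and hh: "holder_on a (closure ?V) hq" "holder_on a (closure ?V) hp" and per: "periodic_on lam (closure ?V) h"
  using pch by (auto simp: Sd.pc_def c1h_def)
 note ch = hh[THEN holder_on_continuous]
 have cd: "cd1 ?V h z = hq z" "cd2 ?V h z = hp z" if "z : closure ?V" for z
  by (rule ext_deriv_eq(1)[OF C that ch(1)], rule ext_deriv_eq(2)[OF C that ch(2)])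
 have top: "(q, 0) : closure ?V" for q using par by simp
 have "AE z in lebesgue_on ?V. (1 + (wd1 ?V h z)\<^sup>2) * wd2 ?V (wd2 ?V h) z - 2 * wd1 ?V h z * wd2 ?V h z * wd2 ?V (wd1 ?V h) z +
   (wd2 ?V h z)\<^sup>2 * wd1 ?V (wd1 ?V h) z - (g * weak_deriv {p0<..<0} 1 R (snd z) * (h z - d) + \<beta> (snd z)) * wd2 ?V h z ^ 3 = 0"
  using f by blast
 then have pde: "AE z\<in>?V in lborel. (1 + (hq z)\<^sup>2) * hpp z - 2 * hq z * hp z * hqp z + (hp z)\<^sup>2 * hqq z -
   (g * weak_deriv {p0<..<0} 1 R (snd z) * (h z - d) + \<beta> (snd z)) * hp z ^ 3 = 0 & hqp z = hpq z"
  unfolding AE_lebesgue_on_iff[OF borel_open[OF Sd.open_U]] using Sd.pc_wd[OF pch] by eventually_elim auto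
 have bc: "!!q. h (q, p0) = 0" "(INF z\<in>?V. cd2 ?V h z) > 0" using f by blast+
 have "ALL q. 1 + (cd1 ?V h (q, 0))\<^sup>2 + (cd2 ?V h (q, 0))\<^sup>2 * (2 * g * R 0 * (h (q, 0) - d) -
   1 / lam * integral {0..lam} (%s. (1 + (cd1 ?V h (s, 0))\<^sup>2) / (cd2 ?V h (s, 0))\<^sup>2)) = 0" using f by blast
 note bt = this[unfolded cd[OF top]]
 define c where "c = (INF z\<in>?V. hp z)"
 have "(INF z\<in>?V. cd2 ?V h z) = (INF z\<in>?V. hp z)" by (intro INF_cong refl cd(2)) (use closure_subset in blast)
 then have c: "c > 0" using bc(2) by (simp add: c_def)
 obtain N where N: "ALL z:closure ?V. \<bar>hp z\<bar> <= N" using holder_on_E[OF hh(2)] by blast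
 have "- N <= hp z" if "z : ?V" for z
 proof -
  have "\<bar>hp z\<bar> <= N" using N that closure_subset by blast
  then show ?thesis by simp
 qed
 then have "bdd_below (hp ` ?V)" by (rule bdd_belowI2)
 then have hpc: "c <= hp z" if "z : ?V" for z using cINF_lower[OF _ that] by (simp add: c_def)
 define k where "k = (%z. h z + - d)"
 note pck = Sd.pc_add_const[OF pch, of "- d", folded k_def]
 have c1k: "c1h a ?V k hq hp" using pck by (simp add: Sd.pc_def)
 \<comment> \<open>The surface is the image of p = 0; its slope is the tangential derivative of h
   along the top of the strip, whence the regularity of \<eta>.\<close>
 define \<eta> where "\<eta> = (%x. k (x, 0))"
 define \<eta>' where "\<eta>' = (%x. hq (x, 0))"
 have d\<eta>: "(\<eta> has_real_derivative \<eta>' x) (at x)" for x using Sd.top_deriv(1)[OF c1k, of x] by (simp add: \<eta>_def \<eta>'_def)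
 have h\<eta>: "holder_on a UNIV \<eta>'" unfolding \<eta>'_def
  by (rule holder_on_lipschitz_compose[OF hh(1) Sd.a_bounds(1), of _ _ 1]) (use top in \<open>auto simp: dist_Pair_Pair intro!: continuous_intros\<close>)
 have p\<eta>: "\<eta> (x + lam) = \<eta> x" for x
 proof -
  have "h ((x, 0) + (lam, 0)) = h (x, 0)" using per top[of x] unfolding periodic_on_def by blast
  then show ?thesis by (simp add: \<eta>_def k_def)
 qed
 \<comment> \<open>h grows at rate at least c from its value 0 at p = p0, so the surface stays above
   the bed.\<close>
 have l\<eta>: "- d < \<eta> x" for x
 proof -
  have "c * (0 - p0) <= k (x, 0) - k (x, p0)"
   by (rule Sd.vertical_increase[of k hq hp]) (use c1k hpc par in \<open>auto simp: c1h_def\<close>)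
  moreover have "0 < c * (0 - p0)" using c par by (simp add: mult_pos_neg)
  ultimately show ?thesis by (simp add: \<eta>_def k_def bc(1))
 qed
 interpret W: wave_domain lam r a "- d" \<eta> \<eta>' by unfold_locales (use par d\<eta> h\<eta> p\<eta> l\<eta> in auto)
 interpret H: fibre_inversion lam r a p0 "%_. 0" "%_. 0" "- d" \<eta> \<eta>' k hq hp hqq hqp hpq hpp c
  by unfold_locales (use pck c hpc bc(1) in \<open>auto simp: \<eta>_def k_def\<close>)
 let ?U = "subgraph (- d) \<eta>"
 \<comment> \<open>The inverse fibre map has second component p = -\<psi>.\<close>
 define \<psi> where "\<psi> = (%z. - H.ki z)"
 note pc\<psi> = W.pc_minus[OF H.pc_ki, folded \<psi>_def]
 have C\<psi>: "C1_on ?U \<psi> (%z. - H.ki1 z) (%z. - H.ki2 z)" and c\<psi>: "continuous_on (closure ?U) (%z. - H.ki1 z)" "continuous_on (closure ?U) (%z. - H.ki2 z)"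
  using pc\<psi> by (auto simp: W.pc_def c1h_def intro: holder_on_continuous)
 have cd\<psi>: "cd1 ?U \<psi> z = - H.ki1 z" "cd2 ?U \<psi> z = - H.ki2 z" if "z : closure ?U" for z
  by (rule ext_deriv_eq(1)[OF C\<psi> that c\<psi>(1)], rule ext_deriv_eq(2)[OF C\<psi> that c\<psi>(2)])
 have topU: "(x, \<eta> x) : closure ?U" for x using l\<eta>[of x] by simp
 have ki0: "H.ki (x, \<eta> x) = 0" for x using H.ki_eq[of x 0] par by (simp add: \<eta>_def)
 have S0: "H.S (x, \<eta> x) = (x, 0)" for x by (simp add: fibre_map_def ki0)
 have nz: "hp (x, 0) ~= 0" for x using H.k2c_closure[OF top[of x]] c by auto
 have g2: "(cd1 ?U \<psi> (x, \<eta> x))\<^sup>2 + (cd2 ?U \<psi> (x, \<eta> x))\<^sup>2 = (1 + (hq (x, 0))\<^sup>2) / (hp (x, 0))\<^sup>2" for x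
  unfolding cd\<psi>[OF topU] H.ki1_def H.ki2_def S0 using nz[of x] by (simp add: field_simps power2_eq_square)
 obtain M where M: "M > 0" "ALL z:closure ?U. M <= H.ki2 z" using H.ki2_lower by blast
 have "stream_solution g d \<rho>0 lam r a p0 R \<beta> \<psi> \<eta>"
  unfolding stream_solution_def Let_def fluid_domain_subgraph AE_lebesgue_on_iff[OF borel_open[OF W.open_U]]
 proof (intro conjI allI data)
  show "surface_profile d lam a \<eta>" using W.surface_profile by simp
  show "potential_class lam r a ?U \<psi>" unfolding W.potential_class_iff using pc\<psi> by blast
  show "AE z\<in>?U in lborel. wd1 ?U (wd1 ?U \<psi>) z + wd2 ?U (wd2 ?U \<psi>) z = g * snd z * weak_deriv {p0<..<0} 1 R (- \<psi> z) + \<beta> (- \<psi> z)"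
   using W.pc_wd[OF pc\<psi>] H.AE_S[OF pde]
  proof eventually_elim
   case (elim z)
   show ?case
   proof
    assume z: "z : ?U"
    let ?z = "H.S z"
    have zc: "z : closure ?U" using z closure_subset by blast
    have kz: "h ?z - d = snd z" using H.ki_props(3)[OF zc] by (simp add: k_def)
    have pz: "snd ?z = - \<psi> z" by (simp add: \<psi>_def fibre_map_def)
    have E: "(1 + (hq ?z)\<^sup>2) * hpp ?z - 2 * hq ?z * hp ?z * hqp ?z + (hp ?z)\<^sup>2 * hqq ?z -
     (g * weak_deriv {p0<..<0} 1 R (- \<psi> z) * snd z + \<beta> (- \<psi> z)) * hp ?z ^ 3 = 0" and sym: "hpq ?z = hqp ?z"
     using elim(2) z unfolding kz pz by auto
    have nzz: "hp ?z ~= 0" using H.k2c_closure[OF H.ki_props(1)[OF zc]] c by auto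
    have w: "wd1 ?U (wd1 ?U \<psi>) z = - (- (H.K1a z * H.ki2 z + hq ?z * (- H.K2a z / (hp ?z)\<^sup>2)))"
     "wd2 ?U (wd2 ?U \<psi>) z = - (- H.K2b z / (hp ?z)\<^sup>2)" using elim(1) z by auto
    have "wd1 ?U (wd1 ?U \<psi>) z + wd2 ?U (wd2 ?U \<psi>) z = g * weak_deriv {p0<..<0} 1 R (- \<psi> z) * snd z + \<beta> (- \<psi> z)"
     unfolding w H.K1a_def H.K2a_def H.K2b_def
     by (rule inverse_height_identity[OF nzz _ sym _ E]) (simp_all add: H.ki1_def H.ki2_def)
    then show "wd1 ?U (wd1 ?U \<psi>) z + wd2 ?U (wd2 ?U \<psi>) z = g * snd z * weak_deriv {p0<..<0} 1 R (- \<psi> z) + \<beta> (- \<psi> z)"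
     by (simp add: mult_ac)
   qed
  qed
  show "\<psi> (x, \<eta> x) = 0" for x by (simp add: \<psi>_def ki0)
  show "\<psi> (x, - d) = - p0" for x using H.ki_eq[of x p0] par by (simp add: \<psi>_def k_def bc(1))
  show "(cd1 ?U \<psi> (x, \<eta> x))\<^sup>2 + (cd2 ?U \<psi> (x, \<eta> x))\<^sup>2 + 2 * g * R 0 * \<eta> x =
   1 / lam * integral {0..lam} (%x. (cd1 ?U \<psi> (x, \<eta> x))\<^sup>2 + (cd2 ?U \<psi> (x, \<eta> x))\<^sup>2)" for x
  proof -
   let ?m = "1 / lam * integral {0..lam} (%s. (1 + (hq (s, 0))\<^sup>2) / (hp (s, 0))\<^sup>2)"
   have "1 + (hq (x, 0))\<^sup>2 + (hp (x, 0))\<^sup>2 * (2 * g * R 0 * \<eta> x - ?m) = 0"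
    using bt[rule_format, of x] by (simp add: \<eta>_def k_def)
   then have "1 + (hq (x, 0))\<^sup>2 = (?m - 2 * g * R 0 * \<eta> x) * (hp (x, 0))\<^sup>2" by (simp add: algebra_simps)
   then have "(1 + (hq (x, 0))\<^sup>2) / (hp (x, 0))\<^sup>2 = ?m - 2 * g * R 0 * \<eta> x" using nz[of x] by simp
   then show ?thesis unfolding g2 by simp
  qed
  have "(SUP z\<in>?U. cd2 ?U \<psi> z) <= - M"
  proof (rule cSUP_least[OF W.U_nonempty])
   fix z assume "z : ?U"
   then have "z : closure ?U" using closure_subset by blast
   then show "cd2 ?U \<psi> z <= - M" using cd\<psi>(2) M(2) by simp
  qed
  then show "(SUP z\<in>?U. cd2 ?U \<psi> z) < 0" using M(1) by linarith
 qed
 moreover have "stream_to_height d p0 \<psi> \<eta> h"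
 proof -
  have hod: "hodograph \<psi> = H.S" by (simp add: hodograph_def fibre_map_def \<psi>_def fun_eq_iff)
  have bij: "bij_betw H.S (closure ?U) (closure ?V)"
   by (rule bij_betw_byWitness[where f'=H.T]) (use H.S_T H.ki_props H.T_maps in auto)
  have "the_inv_into (closure ?U) H.S z = H.T z" if "z : closure ?V" for z
   by (rule the_inv_into_f_eq[OF bij_betw_imp_inj_on[OF bij] H.S_T[OF that] H.T_maps[OF that]])
  then show ?thesis
   unfolding stream_to_height_def fluid_domain_subgraph strip_subgraph inv_hodograph_def hod using bij
   by (simp add: fibre_map_def k_def)
 qed
 ultimately show ?thesis by blast
qed

text \<open>Here w = B i and v = - A i with i = 1/sqrt(\<rho>). The gradients of \<rho> and i are
  multiples of grad \<psi> = (A, B), as \<rho> depends on \<psi> alone, so their contributions along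
  (w, v) cancel. The four identities are the momentum equations, transport of density and
  incompressibility.\<close>

lemma velocity_identities:
 fixes A :: real
 assumes i: "\<rho> * (i * i) = 1" and sym: "A2 = B1" and pde: "A1 + B2 = g * y * G + \<beta>"
 shows "\<rho> * (B * i) * (B1 * i + B * (A * H)) + \<rho> * (- (A * i)) * (B2 * i + B * (B * H)) =
   - (A * \<beta> - (1/2) * ((A1 * A + A * A1) + (B1 * B + B * B1)) - g * (- A * G * y + \<rho> * 0))"
  "\<rho> * (B * i) * (- (A1 * i + A * (A * H))) + \<rho> * (- (A * i)) * (- (A2 * i + A * (B * H))) =
   - (B * \<beta> - (1/2) * ((A2 * A + A * A2) + (B2 * B + B * B2)) - g * (- B * G * y + \<rho> * 1)) - g * \<rho>"
  "(B * i) * (- A * G) + (- (A * i)) * (- B * G) = 0"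
  "(B1 * i + B * (A * H)) + - (A2 * i + A * (B * H)) = 0"
proof -
 have b: "\<beta> = A1 + B2 - g * y * G" using pde by simp
 have "\<rho> * (B * i) * (B1 * i + B * (A * H)) + \<rho> * (- (A * i)) * (B2 * i + B * (B * H)) = (\<rho> * (i * i)) * (B * B1 - A * B2)"
  by (simp add: algebra_simps)
 then show "\<rho> * (B * i) * (B1 * i + B * (A * H)) + \<rho> * (- (A * i)) * (B2 * i + B * (B * H)) =
   - (A * \<beta> - (1/2) * ((A1 * A + A * A1) + (B1 * B + B * B1)) - g * (- A * G * y + \<rho> * 0))"
  unfolding i b by (simp add: algebra_simps)
 have "\<rho> * (B * i) * (- (A1 * i + A * (A * H))) + \<rho> * (- (A * i)) * (- (A2 * i + A * (B * H))) = (\<rho> * (i * i)) * (A * A2 - B * A1)"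
  by (simp add: algebra_simps)
 then show "\<rho> * (B * i) * (- (A1 * i + A * (A * H))) + \<rho> * (- (A * i)) * (- (A2 * i + A * (B * H))) =
   - (B * \<beta> - (1/2) * ((A2 * A + A * A2) + (B2 * B + B * B2)) - g * (- B * G * y + \<rho> * 1)) - g * \<rho>"
  unfolding i b by (simp add: algebra_simps)
qed (simp_all add: sym algebra_simps)

text \<open>The velocity is recovered by dividing grad \<psi> by sqrt(\<rho>), and the pressure from
  the head, an antiderivative of -\<beta> composed with -\<psi>.\<close>

lemma stream_to_velocity_exists:
 assumes par: "lam > 0" "r \<ge> 1" "a = (r - 1) / r" "p0 < 0" and pos: "g > 0" "\<rho>0 > 0"
  and st: "stream_solution g d \<rho>0 lam r a p0 R \<beta> \<psi> \<eta>"
 shows "\<exists>w v P \<rho>. velocity_solution g d \<rho>0 lam r a w v P \<rho> \<eta> & velocity_to_stream g d w v P \<rho> \<eta> p0 R \<beta> \<psi>"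
proof -
 obtain A B A1 A2 B1 B2 c where
  W: "wave_domain lam r a (- d) \<eta> (deriv \<eta>)" and psi: "periodic_domain.pc lam r a (subgraph (- d) \<eta>) \<psi> A B A1 A2 B1 B2" and
  H: "fibre_inversion lam r a (- d) \<eta> (deriv \<eta>) p0 (%_. 0) (%_. 0) (%z. - \<psi> z) (%z. - A z) (%z. - B z)
   (%z. - A1 z) (%z. - A2 z) (%z. - B1 z) (%z. - B2 z) c" and
  pde: "AE z in lborel. z : subgraph (- d) \<eta> --> A1 z + B2 z = g * snd z * weak_deriv {p0<..<0} 1 R (- \<psi> z) + \<beta> (- \<psi> z) & A2 z = B1 z" and
  Q: "ALL x. (A (x, \<eta> x))\<^sup>2 + (B (x, \<eta> x))\<^sup>2 + 2 * g * R 0 * \<eta> x = (1 / lam) * integral {0..lam} (%x. (A (x, \<eta> x))\<^sup>2 + (B (x, \<eta> x))\<^sup>2)"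
  using stream_solution_inversion[OF par st] by blast
 let ?U = "subgraph (- d) \<eta>" and ?V = "subgraph p0 (%_. 0)"
 interpret W: wave_domain lam r a "- d" \<eta> "deriv \<eta>" by (rule W)
 interpret Sd: strip_domain lam r a p0 by unfold_locales (use par in auto)
 interpret H: fibre_inversion lam r a "- d" \<eta> "deriv \<eta>" p0 "%_. 0" "%_. 0" "%z. - \<psi> z" "%z. - A z" "%z. - B z"
  "%z. - A1 z" "%z. - A2 z" "%z. - B1 z" "%z. - B2 z" c by (rule H)
 note f = st[unfolded stream_solution_def Let_def fluid_domain_subgraph]
 have data: "data_class \<rho>0 r p0 R \<beta>" and sp: "surface_profile d lam a \<eta>" using f by blast+
 have bc: "!!x. \<psi> (x, \<eta> x) = 0" "!!x. \<psi> (x, - d) = - p0" using f by blast+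
 have \<rho>0R: "\<rho>0 <= R p" if "p : {p0..0}" for p using data that by (auto simp: data_class_def)
 have L\<beta>: "Lr_on r Sd.I \<beta>" using data by (simp add: data_class_def)
 have L\<beta>': "Lr_on r Sd.I (%p. - \<beta> p)" using L\<beta> by (auto simp: Lr_on_def)
 define Qc where "Qc = (1 / lam) * integral {0..lam} (%x. (A (x, \<eta> x))\<^sup>2 + (B (x, \<eta> x))\<^sup>2)"
 \<comment> \<open>The value Q/2 at p = 0 is forced by P = 0 on the surface.\<close>
 obtain Bh where Bh: "continuous_on {p0..0} Bh" "Bh 0 = Qc / 2" "has_weak_deriv Sd.I 1 Bh (%p. - \<beta> p)"
  using Sd.antiderivative_exists[OF L\<beta>] by blast
 define G where "G = (%z. weak_deriv {p0<..<0} 1 R (- \<psi> z))"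
 define \<rho> where "\<rho> = (%z. R (- \<psi> z))"
 have sT: "snd (H.T z) = - \<psi> z" for z by (simp add: fibre_map_def)
 have v\<rho>: "W.vc \<rho> (%z. - A z * G z) (%z. - B z * G z)"
  by (rule W.vc_cong'[OF H.vc_T[OF Sd.data_vc[OF data]]]) (simp_all add: \<rho>_def G_def fibre_map_def)
 define h where "h = (%z. Bh (- \<psi> z))"
 have vh: "W.vc h (%z. A z * \<beta> (- \<psi> z)) (%z. B z * \<beta> (- \<psi> z))"
  by (rule W.vc_cong'[OF H.vc_T[OF Sd.vc_snd_compose[OF Bh(3,1) L\<beta>']]]) (simp_all add: h_def fibre_map_def)
 have \<rho>0c: "\<rho>0 <= \<rho> z" if z: "z : closure ?U" for z
 proof -
  have "H.T z : closure ?V" by (rule H.T_maps[OF z])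
  then have "- \<psi> z : {p0..0}" by (simp add: fibre_map_def)
  then show ?thesis unfolding \<rho>_def by (rule \<rho>0R)
 qed
 define s where "s = (%z. sqrt (\<rho> z))"
 have s: "s z > 0" "s z * s z = \<rho> z" "sqrt \<rho>0 <= s z" if "z : closure ?U" for z using \<rho>0c[OF that] pos(2) by (auto simp: s_def)
 have vs: "W.vc s (%z. (- A z * G z) / (2 * s z)) (%z. (- B z * G z) / (2 * s z))" unfolding s_def by (rule W.vc_sqrt[OF v\<rho> pos(2) \<rho>0c])
 define i where "i = (%z. inverse (s z))"
 \<comment> \<open>The factor in grad i = - grad s / s^2 = K grad \<psi>, where grad s = grad \<rho>
   / (2 s).\<close>
 define K where "K = (%z. G z / (2 * s z) / (s z)\<^sup>2)"
 have vi: "W.vc i (%z. A z * K z) (%z. B z * K z)"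
 proof -
  have s0: "sqrt \<rho>0 > 0" using pos by simp
  have sa: "sqrt \<rho>0 <= \<bar>s z\<bar>" if "z : closure ?U" for z using s[OF that] by simp
  show ?thesis by (rule W.vc_cong'[OF W.vc_inverse[OF vs s0 sa]]) (simp_all add: i_def K_def)
 qed
 have i: "i z > 0" "s z * i z = 1" "\<rho> z * (i z * i z) = 1" if z: "z : closure ?U" for z
 proof -
  show "i z > 0" and one: "s z * i z = 1" using s(1)[OF z] by (auto simp: i_def)
  have "\<rho> z * (i z * i z) = (s z * i z) * (s z * i z)" unfolding s(2)[OF z, symmetric] by (simp only: mult_ac)
  then show "\<rho> z * (i z * i z) = 1" unfolding one by simp
 qed
 have vA: "W.vc A A1 A2" and vB: "W.vc B B1 B2" and c1: "c1h a ?U \<psi> A B" using psi by (auto simp: W.pc_def)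
 define w where "w = (%z. B z * i z)"
 define v where "v = (%z. - (A z * i z))"
 define P where "P = (%z. h z - (1/2) * (A z * A z + B z * B z) - g * (\<rho> z * snd z))"
 have vw: "W.vc w (%z. B1 z * i z + B z * (A z * K z)) (%z. B2 z * i z + B z * (B z * K z))"
  unfolding w_def by (rule W.vc_mult[OF vB vi])
 have vv: "W.vc v (%z. - (A1 z * i z + A z * (A z * K z))) (%z. - (A2 z * i z + A z * (B z * K z)))"
  unfolding v_def by (rule W.vc_minus[OF W.vc_mult[OF vA vi]])
 have vP: "W.vc P (%z. A z * \<beta> (- \<psi> z) - (1/2) * ((A1 z * A z + A z * A1 z) + (B1 z * B z + B z * B1 z)) - g * (- A z * G z * snd z + \<rho> z * 0))
  (%z. B z * \<beta> (- \<psi> z) - (1/2) * ((A2 z * A z + A z * A2 z) + (B2 z * B z + B z * B2 z)) - g * (- B z * G z * snd z + \<rho> z * 1))"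
  unfolding P_def
  by (rule W.vc_diff[OF W.vc_diff[OF vh W.vc_cmult[OF W.vc_add[OF W.vc_mult[OF vA vA] W.vc_mult[OF vB vB]]]] W.vc_cmult[OF W.vc_mult[OF v\<rho> W.vc_snd]]])
 have top: "(x, \<eta> x) : closure ?U" and bot: "(x, - d) : closure ?U" for x using W.lu[of x] by simp_all
 \<comment> \<open>\<psi> is constant along the surface, so its tangential derivative vanishes; up
   to the factor 1/sqrt(\<rho>) this is the kinematic condition.\<close>
 have Atop: "A (x, \<eta> x) = - (B (x, \<eta> x) * deriv \<eta> x)" for x
 proof -
  have "((%x. 0) has_real_derivative A (x, \<eta> x) + B (x, \<eta> x) * deriv \<eta> x) (at x)" using W.top_deriv(1)[OF c1, of x] by (simp add: bc)
  from DERIV_unique[OF this DERIV_const] show ?thesis by simp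
 qed
 have Abot: "A (x, - d) = 0" for x
 proof -
  have "((%x. - p0) has_real_derivative A (x, - d)) (at x)" using W.top_deriv(2)[OF c1, of x] by (simp add: bc)
  from DERIV_unique[OF this DERIV_const] show ?thesis .
 qed
 have G2: "(A (x, \<eta> x))\<^sup>2 + (B (x, \<eta> x))\<^sup>2 = Qc - 2 * g * R 0 * \<eta> x" for x
 proof -
  have "(A (x, \<eta> x))\<^sup>2 + (B (x, \<eta> x))\<^sup>2 + 2 * g * R 0 * \<eta> x = Qc" unfolding Qc_def using Q by blast
  then show ?thesis by linarith
 qed
 have ci: "\<eta> integrable_on {0..lam}" by (intro integrable_continuous_interval continuous_on_subset[OF W.cont_u]) auto
 \<comment> \<open>Average the surface condition over a period: Q is the mean of |grad \<psi>|^2, so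
   only 2 g R(0) times the integral of \<eta> remains, and g R(0) > 0.\<close>
 have int0: "integral {0..lam} \<eta> = 0"
 proof -
  have "((%x. Qc - 2 * g * R 0 * \<eta> x) has_integral (lam - 0) *\<^sub>R Qc - 2 * g * R 0 * integral {0..lam} \<eta>) {0..lam}"
   by (intro has_integral_diff has_integral_mult_right integrable_integral[OF ci]) (use has_integral_const_real[of Qc 0 lam] par in simp)
  then have "integral {0..lam} (%x. Qc - 2 * g * R 0 * \<eta> x) = lam * Qc - 2 * g * R 0 * integral {0..lam} \<eta>"
   by (simp only: integral_unique) simp
  moreover have "lam * Qc = integral {0..lam} (%x. Qc - 2 * g * R 0 * \<eta> x)"
   by (rule trans[OF arg_cong[OF Qc_def[unfolded G2], of "(*) lam"]]) (use par(1) in simp)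
  ultimately have "2 * g * R 0 * integral {0..lam} \<eta> = 0" by linarith
  moreover have "R 0 > 0" using \<rho>0R[of 0] pos par by simp
  ultimately show ?thesis using pos by simp
 qed
 have "velocity_solution g d \<rho>0 lam r a w v P \<rho> \<eta>"
  unfolding velocity_solution_def Let_def fluid_domain_subgraph AE_lebesgue_on_iff[OF borel_open[OF W.open_U]]
 proof (intro conjI allI ballI sp int0)
  show "velocity_class lam r a ?U w" "velocity_class lam r a ?U v" "velocity_class lam r a ?U P" "velocity_class lam r a ?U \<rho>"
   unfolding W.velocity_class_iff using vw vv vP v\<rho> by blast+
  have iU: "\<rho> z * (i z * i z) = 1" if "z : ?U" for z using i(3)[of z] that closure_subset[of ?U] by blast
  show "AE z\<in>?U in lborel. \<rho> z * w z * wd1 ?U w z + \<rho> z * v z * wd2 ?U w z = - wd1 ?U P z"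
   using pde W.vc_wd[OF vw] W.vc_wd[OF vP]
  proof eventually_elim
   case (elim z)
   show ?case
   proof
    assume z: "z : ?U"
    have e: "A2 z = B1 z" "A1 z + B2 z = g * snd z * G z + \<beta> (- \<psi> z)" using elim(1) z by (auto simp: G_def)
    show "\<rho> z * w z * wd1 ?U w z + \<rho> z * v z * wd2 ?U w z = - wd1 ?U P z"
     using velocity_identities(1)[OF iU[OF z] e, of "B z" "A z" "K z"] elim(2,3) z by (simp only: w_def v_def simp_thms)
   qed
  qed
  show "AE z\<in>?U in lborel. \<rho> z * w z * wd1 ?U v z + \<rho> z * v z * wd2 ?U v z = - wd2 ?U P z - g * \<rho> z"
   using pde W.vc_wd[OF vv] W.vc_wd[OF vP]
  proof eventually_elim
   case (elim z)
   show ?case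
   proof
    assume z: "z : ?U"
    have e: "A2 z = B1 z" "A1 z + B2 z = g * snd z * G z + \<beta> (- \<psi> z)" using elim(1) z by (auto simp: G_def)
    show "\<rho> z * w z * wd1 ?U v z + \<rho> z * v z * wd2 ?U v z = - wd2 ?U P z - g * \<rho> z"
     using velocity_identities(2)[OF iU[OF z] e, of "B z" "A z" "K z"] elim(2,3) z by (simp only: w_def v_def simp_thms)
   qed
  qed
  show "AE z\<in>?U in lborel. w z * wd1 ?U \<rho> z + v z * wd2 ?U \<rho> z = 0"
   using W.vc_wd[OF v\<rho>] by eventually_elim (auto simp: w_def v_def)
  show "AE z\<in>?U in lborel. wd1 ?U w z + wd2 ?U v z = 0"
   using pde W.vc_wd[OF vw] W.vc_wd[OF vv] by eventually_elim auto
  show "P (x, \<eta> x) = 0" for x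
  proof -
   have "A (x, \<eta> x) * A (x, \<eta> x) + B (x, \<eta> x) * B (x, \<eta> x) = Qc - 2 * g * R 0 * \<eta> x" using G2[of x] by (simp add: power2_eq_square)
   then show ?thesis unfolding P_def h_def \<rho>_def by (simp add: bc Bh(2) diff_divide_distrib)
  qed
  show "v (x, \<eta> x) = w (x, \<eta> x) * deriv \<eta> x" for x by (simp add: v_def w_def Atop)
  show "v (x, - d) = 0" for x by (simp add: v_def Abot)
  have "holder_on a (closure ?U) s" using vs by (simp add: W.vc_def)
  \<comment> \<open>An upper bound for sqrt(\<rho>) keeps w = B / sqrt(\<rho>) away from 0.\<close>
  then obtain N where N: "ALL z:closure ?U. \<bar>s z\<bar> <= N" using holder_on_E by blast
  have Np: "N > 0" using bspec[OF N top[of 0]] s(1)[OF top[of 0]] by simp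
  have "(SUP z\<in>?U. w z) <= - (c * inverse N)"
  proof (rule cSUP_least[OF W.U_nonempty])
   fix z assume "z : ?U"
   then have z: "z : closure ?U" using closure_subset by blast
   have "s z <= N" using bspec[OF N z] by simp
   then have "inverse N <= i z" unfolding i_def using s(1)[OF z] by (intro le_imp_inverse_le)
   then have "c * inverse N <= (- B z) * i z" using H.k2c_closure[OF z] H.c Np by (intro mult_mono) auto
   then show "w z <= - (c * inverse N)" by (simp add: w_def)
  qed
  moreover have "0 < c * inverse N" using H.c Np by simp
  ultimately show "(SUP z\<in>?U. w z) < 0" by linarith
  show "\<rho>0 <= \<rho> z" if "z : ?U" for z using \<rho>0c[of z] that closure_subset by blast
 qed
 moreover have "velocity_to_stream g d w v P \<rho> \<eta> p0 R \<beta> \<psi>"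
  unfolding velocity_to_stream_def Let_def fluid_domain_subgraph strip_subgraph
 proof (intro conjI ballI allI exI[of _ Bh])
  have hod: "hodograph \<psi> = H.T" by (simp add: hodograph_def fibre_map_def fun_eq_iff)
  have inv: "inv_hodograph d \<eta> \<psi> z = H.S z" if "z : closure ?V" for z
   unfolding inv_hodograph_def hod fluid_domain_subgraph by (rule H.the_inv_T[OF that])
  show "continuous_on (closure ?U) \<psi>" using c1 by (simp add: c1h_def)
  show "(\<psi> has_derivative (%k. - sqrt (\<rho> z) * v z * fst k + sqrt (\<rho> z) * w z * snd k)) (at z)" if z: "z : ?U" for z
  proof -
   have si: "sqrt (\<rho> z) * i z = 1" using i(2)[of z] z closure_subset[of ?U] by (auto simp: s_def)
   have "- sqrt (\<rho> z) * v z = (sqrt (\<rho> z) * i z) * A z" "sqrt (\<rho> z) * w z = (sqrt (\<rho> z) * i z) * B z" by (simp_all add: v_def w_def)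
   then have e: "- sqrt (\<rho> z) * v z = A z" "sqrt (\<rho> z) * w z = B z" unfolding si by simp_all
   show ?thesis unfolding e using c1 z by (simp only: c1h_def C1_on_def)
  qed
  show "bij_betw (hodograph \<psi>) (closure ?U) (closure ?V)" unfolding hod by (rule H.bij_T)
  fix q p assume p: "p : {p0..0}"
  then have m: "(q, p) : closure ?V" by simp
  have k: "- \<psi> (H.S (q, p)) = p" using H.ki_props(3)[OF m] by simp
  show "\<rho> (inv_hodograph d \<eta> \<psi> (q, p)) = R p" unfolding inv[OF m] \<rho>_def k ..
  let ?z = "H.S (q, p)"
  have "\<rho> ?z * (i ?z * i ?z) = 1" by (rule i(3)[OF H.ki_props(1)[OF m]])
  moreover have "\<rho> ?z * ((w ?z)\<^sup>2 + (v ?z)\<^sup>2) = (\<rho> ?z * (i ?z * i ?z)) * (A ?z * A ?z + B ?z * B ?z)"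
   by (simp add: w_def v_def power2_eq_square algebra_simps)
  ultimately have "\<rho> ?z * ((w ?z)\<^sup>2 + (v ?z)\<^sup>2) = A ?z * A ?z + B ?z * B ?z" by simp
  then have "head g w v P \<rho> ?z = h ?z" unfolding head_def P_def by simp
  then show "head g w v P \<rho> (inv_hodograph d \<eta> \<psi> (q, p)) = Bh p" unfolding inv[OF m] h_def k .
 next
  show "has_weak_deriv {p0<..<0} 1 Bh (%p. - \<beta> p)" by (rule Bh(3))
 qed (simp_all add: bc)
 ultimately show ?thesis by blast
qed

theorem theorem2p5:
  fixes g d \<rho>0 lam r a :: real
  assumes "g > 0" and "d > 0" and "\<rho>0 > 0" and "lam > 0" and "r \<ge> 1" and "a = (r - 1) / r"
  shows
    "(\<forall>w v P \<rho> \<eta>. velocity_solution g d \<rho>0 lam r a w v P \<rho> \<eta> \<longrightarrow>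
        (\<exists>p0 R \<beta> \<psi>. p0 < 0 \<and> velocity_to_stream g d w v P \<rho> \<eta> p0 R \<beta> \<psi> \<and>
           stream_solution g d \<rho>0 lam r a p0 R \<beta> \<psi> \<eta> \<and>
           (\<forall>p0' R' \<beta>' \<psi>'. velocity_to_stream g d w v P \<rho> \<eta> p0' R' \<beta>' \<psi>' \<longrightarrow>
              p0' = p0 \<and> (\<forall>z\<in>closure (fluid_domain d \<eta>). \<psi>' z = \<psi> z) \<and>
              (\<forall>p\<in>{p0..0}. R' p = R p) \<and> (AE p in lebesgue_on {p0<..<0}. \<beta>' p = \<beta> p))))
     \<and>
     (\<forall>p0 R \<beta> \<psi> \<eta>. p0 < 0 \<and> stream_solution g d \<rho>0 lam r a p0 R \<beta> \<psi> \<eta> \<longrightarrow>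
        (\<exists>h. stream_to_height d p0 \<psi> \<eta> h \<and> height_solution g d \<rho>0 lam r a p0 R \<beta> h \<and>
           (\<forall>h'. stream_to_height d p0 \<psi> \<eta> h' \<longrightarrow> (\<forall>z\<in>closure (strip p0). h' z = h z))))
     \<and>
     (\<forall>p0 R \<beta> h. p0 < 0 \<and> height_solution g d \<rho>0 lam r a p0 R \<beta> h \<longrightarrow>
        (\<exists>w v P \<rho> \<eta> \<psi>. velocity_solution g d \<rho>0 lam r a w v P \<rho> \<eta> \<and>
           velocity_to_stream g d w v P \<rho> \<eta> p0 R \<beta> \<psi> \<and>
           stream_to_height d p0 \<psi> \<eta> h))"
proof (intro conjI allI impI)
 fix w v P \<rho> \<eta>
 assume "velocity_solution g d \<rho>0 lam r a w v P \<rho> \<eta>"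
 then show "\<exists>p0 R \<beta> \<psi>. p0 < 0 & velocity_to_stream g d w v P \<rho> \<eta> p0 R \<beta> \<psi> \<and>
     stream_solution g d \<rho>0 lam r a p0 R \<beta> \<psi> \<eta> \<and>
     (\<forall>p0' R' \<beta>' \<psi>'. velocity_to_stream g d w v P \<rho> \<eta> p0' R' \<beta>' \<psi>' -->
       p0' = p0 & (ALL z:closure (fluid_domain d \<eta>). \<psi>' z = \<psi> z) \<and>
       (ALL p:{p0..0}. R' p = R p) & (AE p in lebesgue_on {p0<..<0}. \<beta>' p = \<beta> p))"
  by (rule velocity_to_stream_exists[OF assms(1,3-6)])
next
 fix p0 R \<beta> \<psi> \<eta>
 assume "p0 < 0 & stream_solution g d \<rho>0 lam r a p0 R \<beta> \<psi> \<eta>"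
 then show "EX h. stream_to_height d p0 \<psi> \<eta> h & height_solution g d \<rho>0 lam r a p0 R \<beta> h \<and>
     (ALL h'. stream_to_height d p0 \<psi> \<eta> h' --> (ALL z:closure (strip p0). h' z = h z))"
  by (intro stream_to_height_exists[OF assms(4-6)]) auto
next
 fix p0 R \<beta> h
 assume h: "p0 < 0 & height_solution g d \<rho>0 lam r a p0 R \<beta> h"
 \<comment> \<open>The way back passes through (S), so that the same \<psi> and \<eta> serve both
   correspondences.\<close>
 obtain \<psi> \<eta> where s: "stream_solution g d \<rho>0 lam r a p0 R \<beta> \<psi> \<eta>" "stream_to_height d p0 \<psi> \<eta> h"
  using height_to_stream_exists[OF assms(4-6)] h by blast
 show "\<exists>w v P \<rho> \<eta> \<psi>. velocity_solution g d \<rho>0 lam r a w v P \<rho> \<eta> \<and>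
     velocity_to_stream g d w v P \<rho> \<eta> p0 R \<beta> \<psi> & stream_to_height d p0 \<psi> \<eta> h"
  using stream_to_velocity_exists[OF assms(4-6) conjunct1[OF h] assms(1,3) s(1)] s(2) by blast
qed

end
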